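(* Let $\Omega\subset\mathbb{R}^d$ be a bounded Lipschitz domain and $s\in(0,1)$. Consider the discretization of the homogeneous Dirichlet problem for the integral fractional Laplacian, $(-\Delta)^s u=f$ in $\Omega$, $u=0$ in $\Omega^c$, by continuous piecewise linear Lagrangian finite elements on the quasi-uniform grids $\{\overline{\mathcal{T}}_k\}_{k=0}^{\bar J}$ described in the context, with associated operator $\overline A:\overline V\to\overline V$. Then the preconditioner $$\overline{B}=\overline{I}_{\bar J}\,\bar h_{\bar J}^{2s}\,\overline{Q}_{\bar J}+(1-\widetilde\gamma^{\,s})\sum_{k=0}^{\bar J-1}\overline I_k\,\bar h_k^{2s}\,\overline Q_k:\overline V\to\overline V$$ satisfies $\mathrm{cond}(\overline B\,\overline A)\lesssim 1$, where the hidden constant is uniform with respect to both $\bar J$ and $s$.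
   Context: $(\cdot,\cdot)$ and $\|\cdot\|_0$ denote the inner product and norm of $L^2(\Omega)$. For $s\in(0,1)$, $\widetilde H^s(\Omega)$ is the closure of $C_0^\infty(\Omega)$ in $H^s(\mathbb{R}^d)$ (functions extended by zero outside $\Omega$), with inner product $$a(u,v)=(u,v)_s:=\frac{C(d,s)}{2}\iint_{\mathbb{R}^d\times\mathbb{R}^d}\frac{(u(x)-u(y))(v(x)-v(y))}{|x-y|^{d+2s}}\,dx\,dy,\qquad C(d,s)=\frac{2^{2s}s\,\Gamma(s+\frac d2)}{\pi^{d/2}\Gamma(1-s)}.$$ The weak form of the Dirichlet problem is: find $u\in\widetilde H^s(\Omega)$ with $a(u,v)=\langle f,v\rangle$ for all $v\in\widetilde H^s(\Omega)$. $\{\overline{\mathcal{T}}_k\}_{k=0}^{\bar J}$ is a family of conforming shape-regular simplicial triangulations of $\Omega$ obtained by successive uniform refinement of a quasi-uniform initial triangulation $\overline{\mathcal T}_0$; the grid size of $\overline{\mathcal T}_k$ is $\bar h_k\simeq\gamma^k$ with $\gamma\in(0,1)$ a fixed constant (e.g. $\gamma=\frac12$ if each simplex is refined into $2^d$ children). $\overline V_k$ is the space of continuous functions on $\overline\Omega$ that are piecewise linear over $\overline{\mathcal T}_k$ and vanish on $\partial\Omega$; these spaces are nested, and $\overline V:=\overline V_{\bar J}$. $\overline A:\overline V\to\overline V$ is defined by $(\overline A v,w)=a(v,w)$ for all $v,w\in\overline V$. $\overline Q_k:\overline V\to\overline V_k$ is the $L^2$-orthogonal projection and $\overline I_k:\overline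 V_k\to\overline V$ the inclusion. $\widetilde\gamma\in(0,1)$ is an arbitrary fixed constant. $\mathrm{cond}(\overline B\,\overline A)=\lambda_{\max}(\overline B\,\overline A)/\lambda_{\min}(\overline B\,\overline A)$. $X\lesssim Y$ means $X\le CY$ with a constant $C$ independent of $\bar J$ and $s$ (it may depend on $\Omega,d$, the shape regularity and quasi-uniformity constants, $\gamma$ and $\widetilde\gamma$); $X\simeq Y$ means $X\lesssim Y$ and $Y\lesssim X$. *)

theory Defs
  imports "HOL-Analysis.Analysis"
begin

text \<open>
  Near each boundary point, \<Omega> is the part of a ball lying strictly above the graph of a Lipschitz
  function over the hyperplane orthogonal to some unit vector n.
\<close>

definition bounded_lipschitz_domain :: "'a::euclidean_space set \<Rightarrow> bool" where
  "bounded_lipschitz_domain \<Omega> \<longleftrightarrow>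
     open \<Omega> \<and> connected \<Omega> \<and> bounded \<Omega> \<and> \<Omega> \<noteq> {} \<and>
     (\<forall>x0\<in>frontier \<Omega>. \<exists>r>0. \<exists>n L \<phi>. norm n = 1 \<and> L-lipschitz_on {y. y \<bullet> n = 0} \<phi> \<and>
        \<Omega> \<inter> ball x0 r = {x \<in> ball x0 r. \<phi> (x - (x \<bullet> n) *\<^sub>R n) < x \<bullet> n})"

definition simplicial_mesh :: "'a::euclidean_space set \<Rightarrow> 'a set set \<Rightarrow> bool" where
  "simplicial_mesh \<Omega> \<T> \<longleftrightarrow>
     triangulation \<T> \<and> (\<forall>K\<in>\<T>. int DIM('a) simplex K) \<and> \<Union>\<T> = closure \<Omega>"

definition mesh_size :: "'a::euclidean_space set set \<Rightarrow> real" where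
  "mesh_size \<T> = Max (diameter ` \<T>)"

definition inball_diameter :: "'a::euclidean_space set \<Rightarrow> real" where
  "inball_diameter K = Sup {2 * r |r x. 0 \<le> r \<and> cball x r \<subseteq> K}"

definition shape_regular :: "real \<Rightarrow> 'a::euclidean_space set set \<Rightarrow> bool" where
  "shape_regular \<kappa> \<T> \<longleftrightarrow> (\<forall>K\<in>\<T>. diameter K \<le> \<kappa> * inball_diameter K)"

definition quasi_uniform :: "real \<Rightarrow> 'a::euclidean_space set set \<Rightarrow> bool" where
  "quasi_uniform q \<T> \<longleftrightarrow> (\<forall>K\<in>\<T>. mesh_size \<T> \<le> q * diameter K)"

definition mesh_refines :: "'a::euclidean_space set set \<Rightarrow> 'a set set \<Rightarrow> bool" where
  "mesh_refines \<T>' \<T> \<longleftrightarrow> (\<forall>K'\<in>\<T>'. \<exists>K\<in>\<T>. K' \<subseteq> K)"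

text \<open>
  The levels are \<T> 0, ..., \<T> J; values of \<T> beyond J are irrelevant. That the refinement is uniform
  is expressed by quasi-uniformity of every level together with mesh sizes comparable to
  \<gamma> ^ k, all with level-independent constants.
\<close>

definition grid_hierarchy ::
    "'a::euclidean_space set \<Rightarrow> real \<Rightarrow> real \<Rightarrow> real \<Rightarrow> real \<Rightarrow> nat \<Rightarrow> (nat \<Rightarrow> 'a set set) \<Rightarrow> bool" where
  "grid_hierarchy \<Omega> \<kappa> q c \<gamma> J \<T> \<longleftrightarrow>
     (\<forall>k\<le>J. simplicial_mesh \<Omega> (\<T> k) \<and> shape_regular \<kappa> (\<T> k) \<and> quasi_uniform q (\<T> k) \<and>
             mesh_size (\<T> k) \<le> c * \<gamma> ^ k \<and> \<gamma> ^ k \<le> c * mesh_size (\<T> k)) \<and>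
     (\<forall>k<J. mesh_refines (\<T> (Suc k)) (\<T> k))"

text \<open>
  Finite element functions are represented by their extension by zero to the whole space, so that
  the fractional form applies to them directly and the inclusions between the nested spaces are the
  identity.
\<close>

definition fe_space :: "'a::euclidean_space set \<Rightarrow> 'a set set \<Rightarrow> ('a \<Rightarrow> real) set" where
  "fe_space \<Omega> \<T> =
     {v. continuous_on (closure \<Omega>) v \<and> (\<forall>x. x \<notin> \<Omega> \<longrightarrow> v x = 0) \<and>
         (\<forall>K\<in>\<T>. \<exists>g b. \<forall>x\<in>K. v x = g \<bullet> x + b)}"

definition l2_inner :: "'a::euclidean_space set \<Rightarrow> ('a \<Rightarrow> real) \<Rightarrow> ('a \<Rightarrow> real) \<Rightarrow> real" where
  "l2_inner \<Omega> u v = (LINT x:\<Omega>|lborel. u x * v x)"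

definition frac_const :: "nat \<Rightarrow> real \<Rightarrow> real" where
  "frac_const d s = 2 powr (2 * s) * s * Gamma (s + real d / 2) / (pi powr (real d / 2) * Gamma (1 - s))"

text \<open>The integrand is 0 on the diagonal, where it has the form 0 / 0.\<close>

definition frac_form :: "real \<Rightarrow> ('a::euclidean_space \<Rightarrow> real) \<Rightarrow> ('a \<Rightarrow> real) \<Rightarrow> real" where
  "frac_form s u v = frac_const DIM('a) s / 2 *
     (LINT (x, y)|(lborel \<Otimes>\<^sub>M lborel).
        (u x - u y) * (v x - v y) / norm (x - y) powr (real DIM('a) + 2 * s))"

definition l2_projection ::
    "'a::euclidean_space set \<Rightarrow> ('a \<Rightarrow> real) set \<Rightarrow> ('a \<Rightarrow> real) \<Rightarrow> ('a \<Rightarrow> real)" where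
  "l2_projection \<Omega> W v = (THE z. z \<in> W \<and> (\<forall>w\<in>W. l2_inner \<Omega> z w = l2_inner \<Omega> v w))"

definition frac_operator ::
    "real \<Rightarrow> 'a::euclidean_space set \<Rightarrow> ('a \<Rightarrow> real) set \<Rightarrow> ('a \<Rightarrow> real) \<Rightarrow> ('a \<Rightarrow> real)" where
  "frac_operator s \<Omega> V v = (THE z. z \<in> V \<and> (\<forall>w\<in>V. l2_inner \<Omega> z w = frac_form s v w))"

definition bpx_preconditioner ::
    "real \<Rightarrow> real \<Rightarrow> 'a::euclidean_space set \<Rightarrow> nat \<Rightarrow> (nat \<Rightarrow> 'a set set) \<Rightarrow> ('a \<Rightarrow> real) \<Rightarrow> ('a \<Rightarrow> real)"
  where
  "bpx_preconditioner s \<gamma>' \<Omega> J \<T> v = (\<lambda>x.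
     mesh_size (\<T> J) powr (2 * s) * l2_projection \<Omega> (fe_space \<Omega> (\<T> J)) v x +
     (1 - \<gamma>' powr s) *
       (\<Sum>k<J. mesh_size (\<T> k) powr (2 * s) * l2_projection \<Omega> (fe_space \<Omega> (\<T> k)) v x))"

definition eigenvalues_on :: "('a \<Rightarrow> real) set \<Rightarrow> (('a \<Rightarrow> real) \<Rightarrow> ('a \<Rightarrow> real)) \<Rightarrow> real set" where
  "eigenvalues_on V F = {\<mu>. \<exists>v\<in>V. v \<noteq> (\<lambda>x. 0) \<and> F v = (\<lambda>x. \<mu> * v x)}"

definition cond_on :: "('a \<Rightarrow> real) set \<Rightarrow> (('a \<Rightarrow> real) \<Rightarrow> ('a \<Rightarrow> real)) \<Rightarrow> real" where
  "cond_on V F = Max (eigenvalues_on V F) / Min (eigenvalues_on V F)"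

end

theory Submission
  imports Defs
begin

text \<open>
  Let \<open>R j = Q j - Q (j - 1)\<close> be the differences of the \<open>L\<^sup>2\<close> projections onto the nested spaces. Abel
  summation, together with the fact that \<open>1 - \<gamma> powr s\<close> is comparable to \<open>s\<close> for every fixed \<open>\<gamma>\<close>,
  identifies \<open>(B w, w)\<close> up to constants with the sum of \<open>\<gamma> powr (2 s j) \<parallel>R j w\<parallel>\<^sup>2\<close>. The eigenvalues are
  therefore controlled by comparing the form with the sum of \<open>\<gamma> powr (- 2 s j) \<parallel>R j v\<parallel>\<^sup>2\<close>. In both
  directions the constant is \<open>frac_const d s / (s (1 - s))\<close> up to a bounded factor, so its dependence on
  \<open>s\<close> cancels in the condition number.

  The form is bounded by the level sum through a strengthened Cauchy-Schwarz inequality between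
  increments of finite element functions on different levels. Conversely, the distance from \<open>v\<close> to
  level \<open>k\<close> is bounded by second differences of \<open>v\<close> averaged over steps of length at most a multiple
  of \<open>\<gamma> ^ k\<close>, and the parallelogram identity turns second differences into first ones at the gain of a
  factor \<open>4 - 4 powr s\<close>.
\<close>

section \<open>Inner products on function spaces\<close>

text \<open>The two comparisons of the form with the level sum may degenerate as s tends to 0 or 1,
  provided that they degenerate alike. The upper one grows like 1 / (s (1 - s)): the kernel integral
  inside a ball costs 1 / (1 - s), the one outside 1 / s. The lower one must gain s (1 - s): second
  differences supply 1 - s, while s comes from the mass of the kernel far out, of order 1 / s, and
  from the Abel weight \<gamma> powr (- 2 s) - 1. The obstacle on the upper side is that gradients
  of finite element functions jump across faces. Only a layer around the faces sees a jump, and the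
  measure of that layer provides half an order of smoothness beyond the gradient, hence a decay like
  sqrt \<gamma> to the power of the distance between two levels, which is summable. On the lower
  side it is the Lipschitz boundary: symmetric averages reach outside \<Omega>, so nodal values near
  the complement are reset to zero and v has to be recovered there from second differences alone.
  The spectrum is bounded through a single eigenvector v and w = A v: one comparison enters by
  duality of weighted level sums, the other by testing with the sum of \<gamma> powr (2 s j) R j
  w.\<close>

locale semi_ip =
  fixes V :: "('b \<Rightarrow> real) set" and B :: "('b \<Rightarrow> real) \<Rightarrow> ('b \<Rightarrow> real) \<Rightarrow> real"
  assumes zero_mem: "(\<lambda>x. 0) \<in> V"
    and lin_mem: "\<And>u v r. u \<in> V \<Longrightarrow> v \<in> V \<Longrightarrow> (\<lambda>x. u x + r * v x) \<in> V"
    and sym: "\<And>u v. u \<in> V \<Longrightarrow> v \<in> V \<Longrightarrow> B u v = B v u"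
    and lin: "\<And>u v w r. u \<in> V \<Longrightarrow> v \<in> V \<Longrightarrow> w \<in> V \<Longrightarrow>
      B (\<lambda>x. u x + r * v x) w = B u w + r * B v w"
    and nonneg: "\<And>u. u \<in> V \<Longrightarrow> 0 \<le> B u u"
begin

definition nm :: "('b \<Rightarrow> real) \<Rightarrow> real" where "nm u = sqrt (B u u)"

lemma add_mem: "u \<in> V \<Longrightarrow> v \<in> V \<Longrightarrow> (\<lambda>x. u x + v x) \<in> V"
  using lin_mem[of u v 1] by simp

lemma scale_mem: "v \<in> V \<Longrightarrow> (\<lambda>x. r * v x) \<in> V"
  using lin_mem[OF zero_mem, of v r] by simp

lemma diff_mem: "u \<in> V \<Longrightarrow> v \<in> V \<Longrightarrow> (\<lambda>x. u x - v x) \<in> V"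
  using lin_mem[of u v "-1"] by simp

lemma sum_mem: "finite I \<Longrightarrow> (\<And>i. i \<in> I \<Longrightarrow> f i \<in> V) \<Longrightarrow> (\<lambda>x. \<Sum>i\<in>I. f i x) \<in> V"
  by (induction I rule: finite_induct) (auto simp: zero_mem intro: add_mem)

lemma B_add: "u \<in> V \<Longrightarrow> v \<in> V \<Longrightarrow> w \<in> V \<Longrightarrow> B (\<lambda>x. u x + v x) w = B u w + B v w"
  using lin[of u v w 1] by simp

lemma B_diff: "u \<in> V \<Longrightarrow> v \<in> V \<Longrightarrow> w \<in> V \<Longrightarrow> B (\<lambda>x. u x - v x) w = B u w - B v w"
  using lin[of u v w "-1"] by simp

lemma B_zero: "w \<in> V \<Longrightarrow> B (\<lambda>x. 0) w = 0"
  using B_add[OF zero_mem zero_mem, of w] by simp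

lemma B_scale: "v \<in> V \<Longrightarrow> w \<in> V \<Longrightarrow> B (\<lambda>x. r * v x) w = r * B v w"
  using lin[OF zero_mem, of v w r] B_zero by simp

lemma B_sum: "finite I \<Longrightarrow> (\<And>i. i \<in> I \<Longrightarrow> f i \<in> V) \<Longrightarrow> w \<in> V \<Longrightarrow>
    B (\<lambda>x. \<Sum>i\<in>I. f i x) w = (\<Sum>i\<in>I. B (f i) w)"
  by (induction I rule: finite_induct) (auto simp: B_zero B_add sum_mem)

lemma B_add_right: "u \<in> V \<Longrightarrow> v \<in> V \<Longrightarrow> w \<in> V \<Longrightarrow> B w (\<lambda>x. u x + v x) = B w u + B w v"
  using sym[OF _ add_mem[of u v], of w] by (simp add: B_add sym[of w])

lemma B_diff_right: "u \<in> V \<Longrightarrow> v \<in> V \<Longrightarrow> w \<in> V \<Longrightarrow> B w (\<lambda>x. u x - v x) = B w u - B w v"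
  using sym[OF _ diff_mem[of u v], of w] by (simp add: B_diff sym[of w])

lemma B_scale_right: "v \<in> V \<Longrightarrow> w \<in> V \<Longrightarrow> B w (\<lambda>x. r * v x) = r * B w v"
  using sym[OF _ scale_mem[of v r], of w] by (simp add: B_scale sym[of w])

lemma B_sum_right: "finite I \<Longrightarrow> (\<And>i. i \<in> I \<Longrightarrow> f i \<in> V) \<Longrightarrow> w \<in> V \<Longrightarrow>
    B w (\<lambda>x. \<Sum>i\<in>I. f i x) = (\<Sum>i\<in>I. B w (f i))"
  using sym[OF _ sum_mem[of I f], of w] by (simp add: B_sum sym[of w])

lemma nm_nonneg: "u \<in> V \<Longrightarrow> 0 \<le> nm u"
  by (simp add: nm_def nonneg)

lemma nm_sq: "u \<in> V \<Longrightarrow> (nm u)\<^sup>2 = B u u"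
  by (simp add: nm_def nonneg)

lemma B_diff_sq: "u \<in> V \<Longrightarrow> v \<in> V \<Longrightarrow> B (\<lambda>x. u x - v x) (\<lambda>x. u x - v x) = B u u - 2 * B u v + B v v"
  using sym[of u v] by (simp add: B_diff B_diff_right diff_mem)

lemma B_add_sq: "u \<in> V \<Longrightarrow> v \<in> V \<Longrightarrow> B (\<lambda>x. u x + v x) (\<lambda>x. u x + v x) = B u u + 2 * B u v + B v v"
  using sym[of u v] by (simp add: B_add B_add_right add_mem)

lemma Cauchy_Schwarz_sq:
  assumes "u \<in> V" "v \<in> V"
  shows "(B u v)\<^sup>2 \<le> B u u * B v v"
proof -
  have *: "0 \<le> B u u - 2 * r * B u v + r\<^sup>2 * B v v" for r
    using nonneg[OF diff_mem[OF assms(1) scale_mem[OF assms(2), of r]]]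
    by (simp add: B_diff_sq scale_mem assms B_scale B_scale_right power2_eq_square mult.assoc)
  show ?thesis
  proof (cases "B v v = 0")
    case True
    have "B u v = 0"
    proof (rule ccontr)
      assume "B u v \<noteq> 0"
      \<comment> \<open>For this r the quadratic expression equals -1.\<close>
      with *[of "(B u u + 1) / (2 * B u v)"] True show False by (simp add: field_simps)
    qed
    with True show ?thesis by simp
  next
    case False
    with nonneg[OF assms(2)] have "0 < B v v" by simp
    with *[of "B u v / B v v"] show ?thesis
      by (simp add: field_simps power2_eq_square)
  qed
qed

lemma Cauchy_Schwarz:
  assumes "u \<in> V" "v \<in> V"
  shows "\<bar>B u v\<bar> \<le> nm u * nm v"
  using real_sqrt_le_mono[OF Cauchy_Schwarz_sq[OF assms]] by (simp add: nm_def real_sqrt_mult)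

lemma nm_triangle:
  assumes "u \<in> V" "v \<in> V"
  shows "nm (\<lambda>x. u x + v x) \<le> nm u + nm v"
proof (rule power2_le_imp_le)
  show "(nm (\<lambda>x. u x + v x))\<^sup>2 \<le> (nm u + nm v)\<^sup>2"
    using Cauchy_Schwarz[OF assms] assms
    by (simp add: nm_sq add_mem B_add_sq power2_sum)
qed (simp add: nm_nonneg assms)

lemma nm_scale: "v \<in> V \<Longrightarrow> nm (\<lambda>x. r * v x) = \<bar>r\<bar> * nm v"
  by (simp add: nm_def B_scale B_scale_right scale_mem real_sqrt_mult)

lemma nm_zero: "nm (\<lambda>x. 0) = 0"
  by (simp add: nm_def B_zero zero_mem)

lemma nm_minus_commute: "u \<in> V \<Longrightarrow> v \<in> V \<Longrightarrow> nm (\<lambda>x. u x - v x) = nm (\<lambda>x. v x - u x)"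
  using sym[of u v] by (simp add: nm_def B_diff_sq)

lemma nm_triangle_diff:
  assumes "u \<in> V" "v \<in> V"
  shows "nm (\<lambda>x. u x - v x) \<le> nm u + nm v"
  using nm_triangle[OF assms(1) scale_mem[OF assms(2), of "-1"]] nm_scale[OF assms(2), of "-1"] by simp

lemma nm_sum: "finite I \<Longrightarrow> (\<And>i. i \<in> I \<Longrightarrow> f i \<in> V) \<Longrightarrow> nm (\<lambda>x. \<Sum>i\<in>I. f i x) \<le> (\<Sum>i\<in>I. nm (f i))"
proof (induction I rule: finite_induct)
  case (insert a I)
  then show ?case
    using nm_triangle[of "f a" "\<lambda>x. \<Sum>i\<in>I. f i x"] by (simp add: sum_mem)
qed (simp add: nm_zero)

lemma nm_sq_add_le:
  assumes "u \<in> V" "v \<in> V"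
  shows "B (\<lambda>x. u x + v x) (\<lambda>x. u x + v x) \<le> 2 * B u u + 2 * B v v"
  using nonneg[OF diff_mem[OF assms]] assms by (simp add: B_diff_sq B_add_sq)

end

text \<open>Finite dimension is expressed by a finite set of points whose values determine every
  member of \<open>V\<close>. For finite elements these are the mesh vertices, so no basis of hat
  functions has to be built.\<close>

locale fin_ip = semi_ip +
  assumes posdef: "\<And>u. u \<in> V \<Longrightarrow> B u u = 0 \<Longrightarrow> u = (\<lambda>x. 0)"
    and separating: "\<exists>P. finite P \<and> (\<forall>v\<in>V. (\<forall>p\<in>P. v p = 0) \<longrightarrow> v = (\<lambda>x. 0))"

text \<open>Induction on the separating set, over all subspaces \<open>W\<close>: the members
  vanishing at \<open>p\<close> form a subspace separated by the remaining points, of codimension at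
  most one in \<open>W\<close>. If it is smaller than \<open>W\<close>, some \<open>u\<close>
  outside it, made orthogonal to its basis and normalized, completes the basis.\<close>

lemma (in fin_ip) orthonormal_basis:
  "\<exists>E. finite E \<and> E \<subseteq> V \<and> (\<forall>e\<in>E. \<forall>f\<in>E. B e f = (if e = f then 1 else 0)) \<and>
     (\<forall>v\<in>V. v = (\<lambda>x. \<Sum>e\<in>E. B v e * e x))"
proof -
  have "\<exists>E. finite E \<and> E \<subseteq> W \<and> (\<forall>e\<in>E. \<forall>f\<in>E. B e f = (if e = f then 1 else 0)) \<and>
     (\<forall>v\<in>W. v = (\<lambda>x. \<Sum>e\<in>E. B v e * e x))"
    if "finite P" "W \<subseteq> V" "(\<lambda>x. 0) \<in> W" "\<And>u v r. u \<in> W \<Longrightarrow> v \<in> W \<Longrightarrow> (\<lambda>x. u x + r * v x) \<in> W"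
      "\<And>v. v \<in> W \<Longrightarrow> (\<forall>p\<in>P. v p = 0) \<Longrightarrow> v = (\<lambda>x. 0)" for P W
    using that
  proof (induction P arbitrary: W rule: finite_induct)
    case empty
    have "v = (\<lambda>x. 0)" if "v \<in> W" for v using empty.prems(4)[OF that] by simp
    then show ?case by (intro exI[of _ "{}"]) simp
  next
    case (insert p P)
    interpret W: semi_ip W B
    proof
      have WV: "u \<in> W \<Longrightarrow> u \<in> V" for u using insert.prems(1) by auto
      show "(\<lambda>x. 0) \<in> W" by fact
      show "(\<lambda>x. u x + r * v x) \<in> W" if "u \<in> W" "v \<in> W" for u v r by (rule insert.prems(3)[OF that])
      show "B u v = B v u" if "u \<in> W" "v \<in> W" for u v by (intro sym WV that)
      show "B (\<lambda>x. u x + r * v x) w = B u w + r * B v w" if "u \<in> W" "v \<in> W" "w \<in> W" for u v w r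
        by (intro lin WV that)
      show "0 \<le> B u u" if "u \<in> W" for u by (intro nonneg WV that)
    qed
    let ?W = "{v\<in>W. v p = 0}"
    have "\<exists>E. finite E \<and> E \<subseteq> ?W \<and> (\<forall>e\<in>E. \<forall>f\<in>E. B e f = (if e = f then 1 else 0)) \<and>
       (\<forall>v\<in>?W. v = (\<lambda>x. \<Sum>e\<in>E. B v e * e x))"
      proof (rule insert.IH)
      show "?W \<subseteq> V" using insert.prems(1) by auto
      show "(\<lambda>x. 0) \<in> ?W" using W.zero_mem by simp
      show "(\<lambda>x. u x + r * v x) \<in> ?W" if "u \<in> ?W" "v \<in> ?W" for u v r
        using that W.lin_mem[of u v r] by simp
      show "v = (\<lambda>x. 0)" if "v \<in> ?W" "\<forall>p\<in>P. v p = 0" for v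
        using that by (intro insert.prems(4)) auto
    qed
    then obtain E where E: "finite E" "E \<subseteq> ?W" "\<And>e f. e \<in> E \<Longrightarrow> f \<in> E \<Longrightarrow> B e f = (if e = f then 1 else 0)"
      "\<And>v. v \<in> ?W \<Longrightarrow> v = (\<lambda>x. \<Sum>e\<in>E. B v e * e x)" by blast
    show ?case
    proof (cases "?W = W")
      case True
      with E show ?thesis by (intro exI[of _ E]) auto
    next
      case False
      then obtain u where u: "u \<in> W" "u p \<noteq> 0" by blast
      define pr where "pr = (\<lambda>x. \<Sum>e\<in>E. B u e * e x)"
      have EW: "\<And>e. e \<in> E \<Longrightarrow> e \<in> W" "\<And>e. e \<in> E \<Longrightarrow> e p = 0" using E(2) by auto
      have prW: "pr \<in> W" unfolding pr_def
        by (rule W.sum_mem[OF E(1)]) (rule W.scale_mem, rule EW)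
      have prp: "pr p = 0" unfolding pr_def by (intro sum.neutral ballI) (simp only: EW(2) mult_zero_right)
      have Bpr: "B pr e = B u e" if "e \<in> E" for e
      proof -
        have "B pr e = (\<Sum>f\<in>E. B (\<lambda>x. B u f * f x) e)" unfolding pr_def
          by (rule W.B_sum) (use E(1) EW that W.scale_mem in auto)
        also have "\<dots> = (\<Sum>f\<in>E. if f = e then B u e else 0)"
          using E(3) that EW by (intro sum.cong) (auto simp: W.B_scale)
        finally show ?thesis using E(1) that by simp
      qed
      define w where "w = (\<lambda>x. u x - pr x)"
      have w: "w \<in> W" "w p \<noteq> 0" using u prW prp by (auto simp: w_def W.diff_mem)
      have wE: "B w e = 0" if "e \<in> E" for e
        using Bpr that EW u prW by (simp add: w_def W.B_diff)
      have "B w w \<noteq> 0" using posdef[of w] w insert.prems(1) by auto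
      with W.nonneg[OF w(1)] have Bw: "0 < B w w" by simp
      define r where "r = 1 / sqrt (B w w)"
      define g where "g = (\<lambda>x. r * w x)"
      have r: "r \<noteq> 0" "r * r * B w w = 1" using Bw by (auto simp: r_def)
      have g: "g \<in> W" "g p \<noteq> 0" using w r by (auto simp: g_def W.scale_mem)
      have gg: "B g g = 1" unfolding g_def using w(1) r(2) by (simp add: W.B_scale W.B_scale_right W.scale_mem)
      have gE: "B g e = 0" "B e g = 0" if "e \<in> E" for e
        using wE[OF that] that EW w W.sym[of g e] g by (auto simp: g_def W.B_scale)
      have gnE: "g \<notin> E" using g EW by auto
      have "v = (\<lambda>x. \<Sum>e\<in>insert g E. B v e * e x)" if v: "v \<in> W" for v
      proof -
        define a where "a = v p / g p"
        define v0 where "v0 = (\<lambda>x. v x - a * g x)"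
        have v0W: "v0 \<in> W" unfolding v0_def by (rule W.diff_mem[OF v W.scale_mem[OF g(1)]])
        moreover have "v0 p = 0" using g by (simp add: v0_def a_def)
        ultimately have v0: "v0 = (\<lambda>x. \<Sum>e\<in>E. B v0 e * e x)" using E(4) by blast
        have v0e: "B v0 e = B v e" if "e \<in> E" for e
          unfolding v0_def using that v g gE EW by (simp add: W.B_diff W.B_scale W.scale_mem)
        have "B v0 g = B (\<lambda>x. \<Sum>e\<in>E. B v0 e * e x) g" using v0 by simp
        also have "\<dots> = (\<Sum>e\<in>E. B (\<lambda>x. B v0 e * e x) g)"
          by (rule W.B_sum) (use E(1) EW g W.scale_mem in auto)
        also have "\<dots> = 0" using EW g gE by (intro sum.neutral) (simp add: W.B_scale)
        finally have "B v g = a" unfolding v0_def using v g gg by (simp add: W.B_diff W.B_scale W.scale_mem)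
        moreover have "v x = a * g x + v0 x" for x by (simp add: v0_def)
        ultimately show ?thesis
          using fun_cong[OF v0] v0e E(1) gnE by (intro ext) simp
      qed
      moreover have "\<forall>e\<in>insert g E. \<forall>f\<in>insert g E. B e f = (if e = f then 1 else 0)"
        using E(3) gE gg gnE by auto
      ultimately show ?thesis using E(1) EW g by (intro exI[of _ "insert g E"]) auto
    qed
  qed
  note * = this
  obtain P where "finite P" "\<And>v. v \<in> V \<Longrightarrow> (\<forall>p\<in>P. v p = 0) \<Longrightarrow> v = (\<lambda>x. 0)" using separating by blast
  from *[OF this(1) subset_refl zero_mem lin_mem this(2)] show ?thesis by blast
qed

context fin_ip begin

text \<open>The coefficients of \<open>z\<close> in an orthonormal basis are the values of
  \<open>l\<close>. Unique existence is what the definite descriptions of the projections and of the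
  operator ask for.\<close>

lemma riesz:
  assumes "\<And>u v r. u \<in> V \<Longrightarrow> v \<in> V \<Longrightarrow> l (\<lambda>x. u x + r * v x) = l u + r * l v"
  shows "\<exists>!z. z \<in> V \<and> (\<forall>w\<in>V. B z w = l w)"
proof -
  obtain E where E: "finite E" "E \<subseteq> V" "\<And>e f. e \<in> E \<Longrightarrow> f \<in> E \<Longrightarrow> B e f = (if e = f then 1 else 0)"
      "\<And>v. v \<in> V \<Longrightarrow> v = (\<lambda>x. \<Sum>e\<in>E. B v e * e x)" using orthonormal_basis by blast
  have l0: "l (\<lambda>x. 0) = 0" using assms[OF zero_mem zero_mem, of 1] by simp
  have ls: "l (\<lambda>x. \<Sum>e\<in>F. a e * e x) = (\<Sum>e\<in>F. a e * l e)" if "finite F" "F \<subseteq> V" for F a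
    using that
  proof (induction F rule: finite_induct)
    case (insert e F)
    then have "l (\<lambda>x. (\<Sum>e\<in>F. a e * e x) + a e * e x) = l (\<lambda>x. \<Sum>e\<in>F. a e * e x) + a e * l e"
      by (intro assms sum_mem scale_mem) auto
    with insert show ?case by (simp add: add.commute)
  qed (simp add: l0)
  define z where "z = (\<lambda>x. \<Sum>e\<in>E. l e * e x)"
  have zV: "z \<in> V" unfolding z_def using E by (intro sum_mem scale_mem) auto
  have zw: "B z w = l w" if "w \<in> V" for w
  proof -
    have "B z w = (\<Sum>e\<in>E. B (\<lambda>x. l e * e x) w)" unfolding z_def
      using E that by (intro B_sum scale_mem) auto
    also have "\<dots> = (\<Sum>e\<in>E. B w e * l e)"
      using E(2) that by (intro sum.cong) (auto simp: B_scale sym)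
    also have "\<dots> = l (\<lambda>x. \<Sum>e\<in>E. B w e * e x)" using ls[OF E(1,2)] by simp
    also have "\<dots> = l w" using E(4)[OF that] by simp
    finally show ?thesis .
  qed
  show ?thesis
  proof (rule ex1I[of _ z])
    fix y assume y: "y \<in> V \<and> (\<forall>w\<in>V. B y w = l w)"
    let ?d = "\<lambda>x. y x - z x"
    have "B ?d ?d = 0" using y zV zw diff_mem[of y z] by (simp add: B_diff)
    then have "?d = (\<lambda>x. 0)" using y zV by (intro posdef diff_mem) auto
    then show "y = z" by (intro ext) (metis eq_iff_diff_eq_0)
  qed (use zV zw in auto)
qed

text \<open>A double count of the normalized squares of \<open>B (f i) e\<close> over
  \<open>F\<close> and \<open>E\<close>: Parseval makes each row sum 1, Bessel bounds each column
  sum by 1, hence \<open>card F \<le> card E\<close>. It will show that the spectrum is finite, so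
  that its \<open>Max\<close> and \<open>Min\<close> are meaningful.\<close>

lemma finite_orthogonal_family:
  assumes "\<And>i. i \<in> I \<Longrightarrow> f i \<in> V" "\<And>i. i \<in> I \<Longrightarrow> f i \<noteq> (\<lambda>x. 0)"
    "\<And>i j. i \<in> I \<Longrightarrow> j \<in> I \<Longrightarrow> i \<noteq> j \<Longrightarrow> B (f i) (f j) = 0"
  shows "finite I"
proof -
  obtain E where E: "finite E" "E \<subseteq> V" "\<And>e f. e \<in> E \<Longrightarrow> f \<in> E \<Longrightarrow> B e f = (if e = f then 1 else 0)"
      "\<And>v. v \<in> V \<Longrightarrow> v = (\<lambda>x. \<Sum>e\<in>E. B v e * e x)" using orthonormal_basis by blast
  have pos: "0 < B (f i) (f i)" if "i \<in> I" for i
    using assms(1,2)[OF that] posdef nonneg by (metis less_eq_real_def)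
  have "card F \<le> card E" if F: "finite F" "F \<subseteq> I" for F
  proof -
    have one: "1 = (\<Sum>e\<in>E. (B (f i) e)\<^sup>2 / B (f i) (f i))" if "i \<in> F" for i
    proof -
      have fi: "f i \<in> V" using that F assms by auto
      have "B (f i) (f i) = B (\<lambda>x. \<Sum>e\<in>E. B (f i) e * e x) (f i)" using E(4)[OF fi] by simp
      also have "\<dots> = (\<Sum>e\<in>E. B (\<lambda>x. B (f i) e * e x) (f i))"
        using E fi by (intro B_sum scale_mem) auto
      also have "\<dots> = (\<Sum>e\<in>E. (B (f i) e)\<^sup>2)"
        using E fi by (intro sum.cong) (auto simp: B_scale power2_eq_square sym)
      finally show ?thesis using pos[of i] that F by (simp add: sum_divide_distrib[symmetric] subset_iff)
    qed
    have bessel: "(\<Sum>i\<in>F. (B (f i) e)\<^sup>2 / B (f i) (f i)) \<le> 1" if e: "e \<in> E" for e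
    proof -
      have eV: "e \<in> V" using e E by auto
      define b where "b = (\<lambda>i. B (f i) e / B (f i) (f i))"
      define p where "p = (\<lambda>x. \<Sum>i\<in>F. b i * f i x)"
      have fV: "f i \<in> V" if "i \<in> F" for i using that F assms by auto
      have pV: "p \<in> V" unfolding p_def using F fV by (intro sum_mem scale_mem) auto
      have pe: "B p e = (\<Sum>i\<in>F. (B (f i) e)\<^sup>2 / B (f i) (f i))"
      proof -
        have "B p e = (\<Sum>i\<in>F. B (\<lambda>x. b i * f i x) e)" unfolding p_def
          using F fV eV by (intro B_sum scale_mem) auto
        also have "\<dots> = (\<Sum>i\<in>F. b i * B (f i) e)" using fV eV by (simp add: B_scale)
        finally show ?thesis by (simp add: b_def power2_eq_square)
      qed
      have pf: "B p (f j) = B (f j) e" if j: "j \<in> F" for j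
      proof -
        have "B p (f j) = (\<Sum>i\<in>F. B (\<lambda>x. b i * f i x) (f j))" unfolding p_def
          using F fV j by (intro B_sum scale_mem) auto
        also have "\<dots> = (\<Sum>i\<in>F. b i * B (f i) (f j))" using fV j by (simp add: B_scale)
        also have "\<dots> = (\<Sum>i\<in>F. if i = j then b j * B (f j) (f j) else 0)"
          using j assms(3) F(2) by (intro sum.cong) (auto simp: subset_iff)
        also have "\<dots> = (\<Sum>i\<in>F. if i = j then B (f j) e else 0)"
          using pos[of j] j F(2) by (intro sum.cong) (auto simp: b_def)
        finally show ?thesis using F j by simp
      qed
      have pp: "B p p = B p e"
      proof -
        have "B p p = (\<Sum>i\<in>F. B p (\<lambda>x. b i * f i x))"
          using B_sum_right[OF F(1), of "\<lambda>i x. b i * f i x" p, folded p_def] fV pV scale_mem by simp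
        also have "\<dots> = (\<Sum>i\<in>F. b i * B (f i) e)" using fV pV pf by (simp add: B_scale_right)
        finally show ?thesis using pe by (simp add: b_def power2_eq_square)
      qed
      have "0 \<le> B (\<lambda>x. e x - p x) (\<lambda>x. e x - p x)" by (intro nonneg diff_mem eV pV)
      then show ?thesis using pp pe E(3)[OF e e] eV pV sym[of e p] by (simp add: B_diff_sq)
    qed
    have "real (card F) = (\<Sum>i\<in>F. \<Sum>e\<in>E. (B (f i) e)\<^sup>2 / B (f i) (f i))"
      using one by simp
    also have "\<dots> = (\<Sum>e\<in>E. \<Sum>i\<in>F. (B (f i) e)\<^sup>2 / B (f i) (f i))" by (rule sum.swap)
    also have "\<dots> \<le> (\<Sum>e\<in>E. 1)" by (intro sum_mono bessel)
    finally show ?thesis by simp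
  qed
  then show "finite I"
    by (metis finite_subset infinite_arbitrarily_large not_less_eq_eq)
qed

end

section \<open>Square-integrable functions\<close>

definition L2 :: "'b measure \<Rightarrow> ('b \<Rightarrow> real) set" where
  "L2 M = {f \<in> borel_measurable M. integrable M (\<lambda>x. (f x)\<^sup>2)}"

definition ip :: "'b measure \<Rightarrow> ('b \<Rightarrow> real) \<Rightarrow> ('b \<Rightarrow> real) \<Rightarrow> real" where
  "ip M f g = (LINT x|M. f x * g x)"

lemma L2_mult_integrable:
  assumes "f \<in> L2 M" "g \<in> L2 M"
  shows "integrable M (\<lambda>x. f x * g x)"
proof (rule Bochner_Integration.integrable_bound)
  show "integrable M (\<lambda>x. (f x)\<^sup>2 + (g x)\<^sup>2)" using assms by (simp add: L2_def)
  have "norm (a * b) \<le> norm (a\<^sup>2 + b\<^sup>2)" for a b :: real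
  proof -
    have "0 \<le> (\<bar>a\<bar> - \<bar>b\<bar>)\<^sup>2" "0 \<le> \<bar>a\<bar> * \<bar>b\<bar>" by auto
    then have "\<bar>a\<bar> * \<bar>b\<bar> \<le> a\<^sup>2 + b\<^sup>2" unfolding power2_diff power2_abs by linarith
    then show ?thesis by (simp add: abs_mult)
  qed
  then show "AE x in M. norm (f x * g x) \<le> norm ((f x)\<^sup>2 + (g x)\<^sup>2)" by auto
  have "f \<in> borel_measurable M" "g \<in> borel_measurable M" using assms by (auto simp: L2_def)
  then show "(\<lambda>x. f x * g x) \<in> borel_measurable M" by simp
qed

lemma L2_lin:
  assumes "f \<in> L2 M" "g \<in> L2 M"
  shows "(\<lambda>x. f x + r * g x) \<in> L2 M"
proof -
  have "integrable M (\<lambda>x. (f x)\<^sup>2 + (2 * r) * (f x * g x) + r\<^sup>2 * (g x)\<^sup>2)"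
    using assms L2_mult_integrable[OF assms] by (auto simp: L2_def)
  moreover have "(\<lambda>x. (f x)\<^sup>2 + (2 * r) * (f x * g x) + r\<^sup>2 * (g x)\<^sup>2) = (\<lambda>x. (f x + r * g x)\<^sup>2)"
    by (auto simp: power2_eq_square algebra_simps)
  moreover have "f \<in> borel_measurable M" "g \<in> borel_measurable M" using assms by (auto simp: L2_def)
  ultimately show ?thesis by (simp add: L2_def)
qed

text \<open>Functions are not identified up to null sets, so the form is only semidefinite. Lebesgue
  measure and its product with itself are the instances used.\<close>

interpretation L2: semi_ip "L2 M" "ip M" for M :: "'b measure"
proof
  show "(\<lambda>x. 0) \<in> L2 M" by (simp add: L2_def)
  show "ip M u v = ip M v u" for u v by (simp add: ip_def mult.commute)
  show "ip M (\<lambda>x. u x + r * v x) w = ip M u w + r * ip M v w"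
    if "u \<in> L2 M" "v \<in> L2 M" "w \<in> L2 M" for u v w r
  proof -
    have "ip M (\<lambda>x. u x + r * v x) w = (LINT x|M. u x * w x + r * (v x * w x))"
      by (simp add: ip_def algebra_simps)
    then show ?thesis
      using L2_mult_integrable[OF that(1,3)] L2_mult_integrable[OF that(2,3)] by (simp add: ip_def)
  qed
  show "0 \<le> ip M u u" for u by (simp add: ip_def)
qed (rule L2_lin)

section \<open>Kernel integrals and the Gagliardo energy\<close>

text \<open>Young's inequality for \<open>a powr s * 1 powr (1 - s)\<close>. With the next lemma it
  makes 1 - a powr s comparable to s uniformly on (0, 1); the factors s and 1 - s of the later
  constants are extracted by these two bounds.\<close>

lemma one_minus_powr_ge:
  fixes a s :: real
  assumes "0 < a" "0 \<le> s" "s \<le> 1"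
  shows "s * (1 - a) \<le> 1 - a powr s"
  using Youngs_inequality_0[of s "1 - s" a 1] assms by (simp add: algebra_simps)

lemma one_minus_powr_le:
  fixes a s :: real
  assumes "0 < a"
  shows "1 - a powr s \<le> - ln a * s"
proof -
  have "1 + s * ln a \<le> a powr s" using exp_ge_add_one_self[of "s * ln a"] assms by (simp add: powr_def)
  then show ?thesis by (simp add: algebra_simps)
qed

section \<open>Invariance of Lebesgue integrals under translation, scaling and reflection\<close>

lemma nn_integral_translate:
  fixes f :: "'a::euclidean_space \<Rightarrow> ennreal"
  assumes [measurable]: "f \<in> borel_measurable borel"
  shows "(\<integral>\<^sup>+x. f (x + a) \<partial>lborel) = (\<integral>\<^sup>+x. f x \<partial>lborel)"
proof -
  have "(\<integral>\<^sup>+x. f x \<partial>lborel) = (\<integral>\<^sup>+x. f x \<partial>distr lborel borel ((+) a))" by (simp add: lborel_distr_plus)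
  also have "\<dots> = (\<integral>\<^sup>+x. f (a + x) \<partial>lborel)" by (subst nn_integral_distr) auto
  finally show ?thesis by (simp add: add.commute)
qed

lemma nn_integral_scale:
  fixes f :: "'a::euclidean_space \<Rightarrow> ennreal"
  assumes [measurable]: "f \<in> borel_measurable borel" and c: "c \<noteq> 0"
  shows "(\<integral>\<^sup>+x. f x \<partial>lborel) = ennreal (\<bar>c\<bar> ^ DIM('a)) * (\<integral>\<^sup>+x. f (c *\<^sub>R x) \<partial>lborel)"
proof -
  have "(\<integral>\<^sup>+x. f x \<partial>lborel) = (\<integral>\<^sup>+x. f x \<partial>density (distr lborel borel (\<lambda>x. 0 + c *\<^sub>R x)) (\<lambda>_. ennreal (\<bar>c\<bar> ^ DIM('a))))"
    using lborel_affine[OF c, of "0::'a"] by simp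
  also have "\<dots> = ennreal (\<bar>c\<bar> ^ DIM('a)) * (\<integral>\<^sup>+x. f (c *\<^sub>R x) \<partial>lborel)"
    by (simp add: nn_integral_density nn_integral_distr nn_integral_cmult)
  finally show ?thesis .
qed

lemma integral_translate:
  fixes f :: "'a::euclidean_space \<Rightarrow> real"
  assumes [measurable]: "f \<in> borel_measurable borel"
  shows "(LINT x|lborel. f (x + a)) = (LINT x|lborel. f x)"
proof -
  have "(LINT x|lborel. f x) = (LINT x|distr lborel borel ((+) a). f x)" by (simp add: lborel_distr_plus)
  also have "\<dots> = (LINT x|lborel. f (a + x))" by (subst integral_distr) auto
  finally show ?thesis by (simp add: add.commute)
qed

lemma integrable_translate:
  fixes f :: "'a::euclidean_space \<Rightarrow> real"
  assumes "integrable lborel f"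
  shows "integrable lborel (\<lambda>x. f (x + a))"
proof -
  have [measurable]: "f \<in> borel_measurable borel" using assms borel_measurable_integrable by force
  have "integrable (distr lborel borel ((+) a)) f" using assms by (simp add: lborel_distr_plus)
  then have "integrable lborel (\<lambda>x. f (a + x))" by (subst (asm) integrable_distr_eq) auto
  then show ?thesis by (simp add: add.commute)
qed

lemma integral_reflect:
  fixes f :: "'a::euclidean_space \<Rightarrow> real"
  assumes [measurable]: "f \<in> borel_measurable borel"
  shows "(LINT x|lborel. f (- x)) = (LINT x|lborel. f x)"
proof -
  have "lborel = distr lborel borel (\<lambda>x::'a. - x)"
    using lborel_affine[of "-1" "0::'a"] by (simp add: density_1)
  then have "(LINT x|lborel. f x) = (LINT x|distr lborel borel (\<lambda>x::'a. - x). f x)" by simp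
  also have "\<dots> = (LINT x|lborel. f (- x))" by (subst integral_distr) auto
  finally show ?thesis by simp
qed

lemma integrable_reflect:
  fixes f :: "'a::euclidean_space \<Rightarrow> real"
  assumes "integrable lborel f"
  shows "integrable lborel (\<lambda>x. f (- x))"
proof -
  have [measurable]: "f \<in> borel_measurable borel" using assms borel_measurable_integrable by force
  have "lborel = distr lborel borel (\<lambda>x::'a. - x)"
    using lborel_affine[of "-1" "0::'a"] by (simp add: density_1)
  with assms have "integrable (distr lborel borel (\<lambda>x::'a. - x)) f" by simp
  then show ?thesis by (subst (asm) integrable_distr_eq) auto
qed

lemma L2_translate:
  fixes f :: "'a::euclidean_space \<Rightarrow> real"
  assumes "f \<in> L2 lborel"
  shows "(\<lambda>x. f (x + a)) \<in> L2 lborel"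
proof -
  have [measurable]: "f \<in> borel_measurable borel" using assms by (simp add: L2_def)
  show ?thesis using assms integrable_translate[of "\<lambda>x. (f x)\<^sup>2"] by (simp add: L2_def)
qed

lemma ip_translate:
  fixes f g :: "'a::euclidean_space \<Rightarrow> real"
  assumes "f \<in> L2 lborel" "g \<in> L2 lborel"
  shows "ip lborel (\<lambda>x. f (x + a)) (\<lambda>x. g (x + a)) = ip lborel f g"
proof -
  have [measurable]: "f \<in> borel_measurable borel" "g \<in> borel_measurable borel" using assms by (auto simp: L2_def)
  show ?thesis unfolding ip_def using integral_translate[of "\<lambda>x. f x * g x" a] by simp
qed

text \<open>Listed from the largest exponent \<open>m\<close> down, the terms decay geometrically,
  so the sum is at most \<open>1 / (1 - q)\<close> times its largest term \<open>1 / q ^ m\<close>,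
  and that term is at most \<open>1 / \<rho>\<close>. The bound does not see the size of
  \<open>A\<close>; it later turns a sum over levels into the fractional kernel.\<close>

lemma geometric_sum_inverse_le:
  fixes q \<rho> :: real
  assumes "0 < q" "q < 1" "finite A" "\<And>k. k \<in> A \<Longrightarrow> \<rho> \<le> q ^ k" "0 < \<rho>"
  shows "(\<Sum>k\<in>A. 1 / q ^ k) \<le> 1 / (\<rho> * (1 - q))"
proof (cases "A = {}")
  case True
  with assms show ?thesis by simp
next
  case False
  define m where "m = Max A"
  have m: "m \<in> A" "\<And>k. k \<in> A \<Longrightarrow> k \<le> m" using assms(3) False by (auto simp: m_def)
  have "(\<Sum>k\<in>A. 1 / q ^ k) \<le> (\<Sum>k\<le>m. 1 / q ^ k)"
    using m(2) assms(1) by (intro sum_mono2) auto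
  also have "\<dots> = (\<Sum>k\<le>m. 1 / q ^ (m - k))"
    by (rule sum.reindex_bij_witness[of _ "\<lambda>k. m - k" "\<lambda>k. m - k"]) auto
  also have "\<dots> = (\<Sum>k\<le>m. q ^ k) / q ^ m"
    using assms(1) by (simp add: sum_divide_distrib power_diff)
  also have "(\<Sum>k\<le>m. q ^ k) \<le> 1 / (1 - q)"
  proof -
    have "0 \<le> q * q ^ m" using assms by simp
    moreover have "(1 - q) * (\<Sum>k\<le>m. q ^ k) = 1 - q * q ^ m" using sum_gp_basic[of q m] by simp
    ultimately have "(1 - q) * (\<Sum>k\<le>m. q ^ k) \<le> 1" by linarith
    then show ?thesis using assms(1,2) by (simp add: pos_le_divide_eq mult.commute)
  qed
  also have "1 / (1 - q) / q ^ m \<le> 1 / (1 - q) / \<rho>"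
    using assms m by (intro divide_left_mono) auto
  finally show ?thesis using assms by (simp add: divide_right_mono mult.commute)
qed

section \<open>Integrals of the fractional kernel inside and outside a ball\<close>

lemma emeasure_cball_le:
  "0 \<le> r \<Longrightarrow> emeasure lborel (cball (c::'a::euclidean_space) r) = ennreal (unit_ball_vol DIM('a) * r ^ DIM('a))"
  by (rule emeasure_cball)

lemma ennreal_le_suminf: "f j \<le> (\<Sum>i. f i)" for f :: "nat \<Rightarrow> ennreal"
  using sum_le_suminf[of f "{j}"] by simp

lemma nn_integral_cball_series:
  fixes a b :: "nat \<Rightarrow> real"
  assumes "\<And>i. 0 \<le> a i" "\<And>i. 0 \<le> b i"
  shows "(\<integral>\<^sup>+z. (\<Sum>i. ennreal (a i) * indicator (cball 0 (b i)) z) \<partial>(lborel :: 'a::euclidean_space measure))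
    = (\<Sum>i. ennreal (a i * (unit_ball_vol DIM('a) * b i ^ DIM('a))))"
proof -
  have "(\<integral>\<^sup>+z. (\<Sum>i. ennreal (a i) * indicator (cball 0 (b i)) z) \<partial>(lborel :: 'a measure))
    = (\<Sum>i. \<integral>\<^sup>+z. ennreal (a i) * indicator (cball 0 (b i)) z \<partial>(lborel :: 'a measure))"
    by (intro nn_integral_suminf borel_measurable_times_ennreal borel_measurable_const borel_measurable_indicator) simp
  also have "\<dots> = (\<Sum>i. ennreal (a i * (unit_ball_vol DIM('a) * b i ^ DIM('a))))"
  proof (rule suminf_cong)
    fix i
    have "(\<integral>\<^sup>+z. ennreal (a i) * indicator (cball 0 (b i)) z \<partial>(lborel :: 'a measure)) = ennreal (a i) * emeasure lborel (cball (0::'a) (b i))"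
      by (rule nn_integral_cmult_indicator) simp
    then show "(\<integral>\<^sup>+z. ennreal (a i) * indicator (cball 0 (b i)) z \<partial>(lborel :: 'a measure)) = ennreal (a i * (unit_ball_vol DIM('a) * b i ^ DIM('a)))"
      using assms by (simp add: emeasure_cball_le ennreal_mult')
  qed
  finally show ?thesis .
qed

lemma quarter_powr: "(1/4) powr s = (4::real) powr - s"
  by (simp add: powr_divide powr_minus inverse_eq_divide)

text \<open>Both kernel bounds cover the region by the dyadic balls of radius \<open>t * 2 ^ i\<close>.\<close>

lemma kernel_outer_le:
  fixes s t :: real
  assumes s: "0 < s" "s < 1" and t: "0 < t"
  shows "(\<integral>\<^sup>+z. indicator {z. t < norm z} z * ennreal (norm z powr - (real DIM('a) + 2 * s)) \<partial>(lborel :: 'a::euclidean_space measure))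
    \<le> ennreal (unit_ball_vol DIM('a) * 2 ^ (DIM('a) + 1) * t powr (- 2 * s) / s)"
proof -
  let ?d = "DIM('a)" and ?p = "real DIM('a) + 2 * s"
  let ?T = "\<lambda>i::nat. t * 2 ^ i"
  have T0: "0 < ?T i" for i using t by simp
  have "(\<integral>\<^sup>+z. indicator {z. t < norm z} z * ennreal (norm z powr - ?p) \<partial>(lborel :: 'a measure))
    \<le> (\<integral>\<^sup>+z. (\<Sum>i. ennreal (?T i powr - ?p) * indicator (cball 0 (?T (Suc i))) z) \<partial>(lborel :: 'a measure))"
  proof (rule nn_integral_mono)
    fix z :: 'a
    show "indicator {z. t < norm z} z * ennreal (norm z powr - ?p)
      \<le> (\<Sum>i. ennreal (?T i powr - ?p) * indicator (cball 0 (?T (Suc i))) z)"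
    proof (cases "t < norm z")
      case True
      define j where "j = (LEAST i. norm z \<le> ?T (Suc i))"
      have ex: "\<exists>i. norm z \<le> ?T (Suc i)"
      proof -
        obtain n where "norm z / t < 2 ^ n" using real_arch_pow[of 2 "norm z / t"] by auto
        then have "norm z < t * 2 ^ n" using t by (simp add: field_simps)
        also have "\<dots> \<le> ?T (Suc n)" using t by simp
        finally have "norm z \<le> ?T (Suc n)" by simp
        then show ?thesis by blast
      qed
      have j: "norm z \<le> ?T (Suc j)" unfolding j_def by (rule LeastI_ex[OF ex])
      have j': "?T j < norm z"
      proof (cases j)
        case 0
        with True show ?thesis by simp
      next
        case (Suc i)
        then have "i < j" by simp
        then have "\<not> norm z \<le> ?T (Suc i)" unfolding j_def by (rule not_less_Least)
        with Suc show ?thesis by simp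
      qed
      have "norm z powr - ?p \<le> ?T j powr - ?p" using j' T0[of j] s by (intro powr_mono2') auto
      then have "ennreal (norm z powr - ?p) \<le> ennreal (?T j powr - ?p) * indicator (cball 0 (?T (Suc j))) z"
        using j by (simp add: ennreal_leI)
      also have "\<dots> \<le> (\<Sum>i. ennreal (?T i powr - ?p) * indicator (cball 0 (?T (Suc i))) z)"
        by (rule ennreal_le_suminf[of "\<lambda>i. ennreal (?T i powr - ?p) * indicator (cball 0 (?T (Suc i))) z"])
      finally show ?thesis using True by simp
    qed simp
  qed
  also have "\<dots> = (\<Sum>i. ennreal (?T i powr - ?p * (unit_ball_vol ?d * ?T (Suc i) ^ ?d)))"
    by (rule nn_integral_cball_series) (use t in auto)
  also have "\<dots> = (\<Sum>i. ennreal (unit_ball_vol ?d * 2 ^ ?d * t powr (- 2 * s) * (4 powr - s) ^ i))"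
  proof (intro suminf_cong)
    fix i
    have "?T i powr - ?p * (unit_ball_vol ?d * ?T (Suc i) ^ ?d)
      = unit_ball_vol ?d * 2 ^ ?d * (?T i powr - ?p * ?T i ^ ?d)"
      by (simp add: power_mult_distrib mult_ac)
    also have "?T i powr - ?p * ?T i ^ ?d = ?T i powr (- 2 * s)"
      using T0[of i] by (subst powr_realpow[symmetric]) (auto simp: powr_add[symmetric])
    also have "?T i powr (- 2 * s) = t powr (- 2 * s) * (4 powr - s) ^ i"
    proof -
      have "(2 ^ i) powr (- 2 * s) = ((2::real) powr (- 2 * s)) ^ i"
        by (simp add: powr_realpow[symmetric] powr_powr mult_ac)
      also have "(2::real) powr (- 2 * s) = (2 powr 2) powr (- s)" by (subst powr_powr) simp
      finally show ?thesis using t by (simp add: powr_mult)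
    qed
    finally show "ennreal (?T i powr - ?p * (unit_ball_vol ?d * ?T (Suc i) ^ ?d))
      = ennreal (unit_ball_vol ?d * 2 ^ ?d * t powr (- 2 * s) * (4 powr - s) ^ i)" by (simp only: mult.assoc)
  qed
  also have "\<dots> = ennreal (unit_ball_vol ?d * 2 ^ ?d * t powr (- 2 * s) * (1 / (1 - 4 powr - s)))"
  proof (rule suminf_ennreal_eq)
    have "4 powr - s < (1::real)" using s by (simp add: powr_less_one)
    then show "(\<lambda>i. unit_ball_vol ?d * 2 ^ ?d * t powr (- 2 * s) * (4 powr - s) ^ i) sums
      (unit_ball_vol ?d * 2 ^ ?d * t powr (- 2 * s) * (1 / (1 - 4 powr - s)))"
      by (intro sums_mult geometric_sums) simp
  qed auto
  also have "\<dots> \<le> ennreal (unit_ball_vol ?d * 2 ^ ?d * t powr (- 2 * s) * (2 / s))"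
  proof (intro ennreal_leI mult_left_mono)
    \<comment> \<open>The geometric series has ratio 4 powr (- s), which tends to 1 as s tends to 0;
      this inequality converts its sum into the factor 1 / s.\<close>
    have "s * (1 - 1/4) \<le> 1 - (1/4) powr s" using s by (intro one_minus_powr_ge) auto
    then have "s / 2 \<le> 1 - 4 powr - s" unfolding quarter_powr using s by simp
    then show "1 / (1 - 4 powr - s) \<le> 2 / s"
      using s frac_le[of 1 1 "s / 2" "1 - 4 powr - s"] by simp
  qed auto
  finally show ?thesis by (simp add: mult_ac)
qed

lemma kernel_inner_le:
  fixes s t :: real
  assumes s: "0 < s" "s < 1" and t: "0 < t"
  shows "(\<integral>\<^sup>+z. indicator {z. norm z \<le> t} z * ennreal ((norm z)\<^sup>2 * norm z powr - (real DIM('a) + 2 * s)) \<partial>(lborel :: 'a::euclidean_space measure))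
    \<le> ennreal (unit_ball_vol DIM('a) * 2 ^ (DIM('a) + 3) * t powr (2 - 2 * s) / (1 - s))"
proof -
  let ?d = "DIM('a)" and ?p = "real DIM('a) + 2 * s"
  let ?T = "\<lambda>i::nat. t / 2 ^ i"
  have T0: "0 < ?T i" for i using t by simp
  have "(\<integral>\<^sup>+z. indicator {z. norm z \<le> t} z * ennreal ((norm z)\<^sup>2 * norm z powr - ?p) \<partial>(lborel :: 'a measure))
    \<le> (\<integral>\<^sup>+z. (\<Sum>i. ennreal ((?T i)\<^sup>2 * ?T (Suc i) powr - ?p) * indicator (cball 0 (?T i)) z) \<partial>(lborel :: 'a measure))"
  proof (rule nn_integral_mono)
    fix z :: 'a
    show "indicator {z. norm z \<le> t} z * ennreal ((norm z)\<^sup>2 * norm z powr - ?p)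
      \<le> (\<Sum>i. ennreal ((?T i)\<^sup>2 * ?T (Suc i) powr - ?p) * indicator (cball 0 (?T i)) z)"
    \<comment> \<open>The origin lies in no shell, and the integrand is zero there.\<close>
    proof (cases "norm z \<le> t \<and> z \<noteq> 0")
      case True
      define j where "j = (LEAST i. ?T (Suc i) < norm z)"
      have ex: "\<exists>i. ?T (Suc i) < norm z"
      proof -
        obtain n where "t / norm z < 2 ^ n" using real_arch_pow[of 2 "t / norm z"] by auto
        then have "t < 2 ^ n * norm z" using True by (simp add: field_simps)
        also have "\<dots> \<le> 2 ^ Suc n * norm z" by (intro mult_right_mono) auto
        finally have "?T (Suc n) < norm z" by (simp add: field_simps)
        then show ?thesis by blast
      qed
      have j: "?T (Suc j) < norm z" unfolding j_def by (rule LeastI_ex[OF ex])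
      have j': "norm z \<le> ?T j"
      proof (cases j)
        case 0
        with True show ?thesis by simp
      next
        case (Suc i)
        then have "i < j" by simp
        then have "\<not> ?T (Suc i) < norm z" unfolding j_def by (rule not_less_Least)
        with Suc show ?thesis by simp
      qed
      have "(norm z)\<^sup>2 * norm z powr - ?p \<le> (?T j)\<^sup>2 * ?T (Suc j) powr - ?p"
        using j j' T0[of "Suc j"] s by (intro mult_mono powr_mono2' power_mono) auto
      then have "ennreal ((norm z)\<^sup>2 * norm z powr - ?p) \<le> ennreal ((?T j)\<^sup>2 * ?T (Suc j) powr - ?p) * indicator (cball 0 (?T j)) z"
        using j' by (simp add: ennreal_leI)
      also have "\<dots> \<le> (\<Sum>i. ennreal ((?T i)\<^sup>2 * ?T (Suc i) powr - ?p) * indicator (cball 0 (?T i)) z)"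
        by (rule ennreal_le_suminf[of "\<lambda>i. ennreal ((?T i)\<^sup>2 * ?T (Suc i) powr - ?p) * indicator (cball 0 (?T i)) z"])
      finally show ?thesis using True by simp
    qed auto
  qed
  also have "\<dots> = (\<Sum>i. ennreal ((?T i)\<^sup>2 * ?T (Suc i) powr - ?p * (unit_ball_vol ?d * ?T i ^ ?d)))"
    by (rule nn_integral_cball_series) (use t in auto)
  also have "\<dots> = (\<Sum>i. ennreal (unit_ball_vol ?d * 2 powr ?p * t powr (2 - 2 * s) * ((1/4) powr (1 - s)) ^ i))"
  proof (intro suminf_cong)
    fix i
    have T: "?T (Suc i) powr - ?p = ?T i powr - ?p * 2 powr ?p"
    proof -
      have "?T (Suc i) powr - ?p = (?T i / 2) powr - ?p" by (simp add: mult.commute)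
      also have "\<dots> = ?T i powr - ?p / 2 powr - ?p" by (rule powr_divide)
      also have "\<dots> = ?T i powr - ?p * 2 powr ?p" by (simp only: powr_minus[of 2] divide_inverse inverse_inverse_eq)
      finally show ?thesis .
    qed
    have "(?T i)\<^sup>2 * ?T (Suc i) powr - ?p * (unit_ball_vol ?d * ?T i ^ ?d)
      = (?T i)\<^sup>2 * (?T i powr - ?p * 2 powr ?p) * (unit_ball_vol ?d * ?T i ^ ?d)" unfolding T ..
    also have "(?T i)\<^sup>2 * (?T i powr - ?p * 2 powr ?p) * (unit_ball_vol ?d * ?T i ^ ?d)
      = unit_ball_vol ?d * 2 powr ?p * (?T i ^ 2 * (?T i powr - ?p * ?T i ^ ?d))"
      by (simp add: mult_ac)
    also have "?T i ^ 2 * (?T i powr - ?p * ?T i ^ ?d) = ?T i powr (2 - 2 * s)"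
    proof -
      have "?T i ^ 2 * (?T i powr - ?p * ?T i ^ ?d) = ?T i powr real 2 * (?T i powr - ?p * ?T i powr real ?d)"
        using T0[of i] by (simp only: powr_realpow)
      also have "\<dots> = ?T i powr (2 - 2 * s)" by (simp add: powr_add[symmetric] del: powr_numeral)
      finally show ?thesis .
    qed
    also have "?T i powr (2 - 2 * s) = t powr (2 - 2 * s) * ((1/4) powr (1 - s)) ^ i"
    proof -
      have "(2 ^ i) powr (2 - 2 * s) = ((2::real) powr (2 - 2 * s)) ^ i"
        by (simp add: powr_realpow[symmetric] powr_powr mult_ac)
      also have "(2::real) powr (2 - 2 * s) = (2 powr 2) powr (1 - s)" by (subst powr_powr) (simp add: algebra_simps)
      finally have "(2 ^ i) powr (2 - 2 * s) = ((4::real) powr (1 - s)) ^ i" by simp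
      then show ?thesis using t by (simp add: powr_divide power_divide)
    qed
    finally show "ennreal ((?T i)\<^sup>2 * ?T (Suc i) powr - ?p * (unit_ball_vol ?d * ?T i ^ ?d))
      = ennreal (unit_ball_vol ?d * 2 powr ?p * t powr (2 - 2 * s) * ((1/4) powr (1 - s)) ^ i)" by (simp only: mult.assoc)
  qed
  also have "\<dots> = ennreal (unit_ball_vol ?d * 2 powr ?p * t powr (2 - 2 * s) * (1 / (1 - (1/4) powr (1 - s))))"
  proof (rule suminf_ennreal_eq)
    have "(1/4) powr (1 - s) < (1::real)" using one_minus_powr_ge[of "1/4" "1 - s"] s by simp
    then show "(\<lambda>i. unit_ball_vol ?d * 2 powr ?p * t powr (2 - 2 * s) * ((1/4) powr (1 - s)) ^ i) sums
      (unit_ball_vol ?d * 2 powr ?p * t powr (2 - 2 * s) * (1 / (1 - (1/4) powr (1 - s))))"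
      by (intro sums_mult geometric_sums) simp
  qed auto
  also have "\<dots> \<le> ennreal (unit_ball_vol ?d * 2 ^ (?d + 2) * t powr (2 - 2 * s) * (2 / (1 - s)))"
  proof (intro ennreal_leI mult_mono)
    \<comment> \<open>Here the ratio is (1/4) powr (1 - s), so the factor 1 / (1 - s) appears
      instead.\<close>
    have "(1 - s) * (1 - 1/4) \<le> 1 - (1/4) powr (1 - s)" using s by (intro one_minus_powr_ge) auto
    then have *: "(1 - s) / 2 \<le> 1 - (1/4) powr (1 - s)" using s by simp
    then show "1 / (1 - (1/4) powr (1 - s)) \<le> 2 / (1 - s)"
      using s frac_le[of 1 1 "(1-s)/2" "1 - (1/4) powr (1 - s)"] by simp
    show "0 \<le> 1 / (1 - (1/4) powr (1 - s))" using * s by simp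
    have "2 powr ?p \<le> (2::real) powr real (?d + 2)" using s by (intro powr_mono) auto
    then show "2 powr ?p \<le> (2::real) ^ (?d + 2)" by (simp only: powr_realpow)
  qed auto
  finally show ?thesis by (simp add: mult_ac power_add)
qed

text \<open>Self-similarity replaces polar coordinates. Scaling by 2 shows that the tail beyond
  \<open>2 * D\<close> is \<open>4 powr - s\<close> times the tail \<open>X\<close> beyond
  \<open>D\<close>. Hence \<open>(1 - 4 powr - s) * X\<close> is the integral over the shell
  between, and \<open>1 - 4 powr - s \<le> ln 4 * s\<close> yields the factor 1 / s.\<close>

lemma kernel_outer_ge:
  fixes s D :: real
  assumes s: "0 < s" "s < 1" and D: "0 < D"
  shows "ennreal (unit_ball_vol DIM('a) * D powr (- 2 * s) / (2 ^ (2 * DIM('a) + 2) * ln 4 * s))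
    \<le> (\<integral>\<^sup>+z. indicator {z. D < norm z} z * ennreal (norm z powr - (real DIM('a) + 2 * s)) \<partial>(lborel :: 'a::euclidean_space measure))"
proof -
  let ?d = "DIM('a)" and ?p = "real DIM('a) + 2 * s" and ?M = "lborel :: 'a measure"
  define X where "X = (\<integral>\<^sup>+z. indicator {z. D < norm z} z * ennreal (norm z powr - ?p) \<partial>?M)"
  have "X < \<infinity>" unfolding X_def
    by (rule le_less_trans[OF kernel_outer_le[OF s D]]) simp
  then obtain x where x: "X = ennreal x" "0 \<le> x" by (cases X) auto
  have split: "X = (\<integral>\<^sup>+z. indicator {z. D < norm z \<and> norm z \<le> 2 * D} z * ennreal (norm z powr - ?p) \<partial>?M)
      + (\<integral>\<^sup>+z. indicator {z. 2 * D < norm z} z * ennreal (norm z powr - ?p) \<partial>?M)"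
    unfolding X_def by (subst nn_integral_add[symmetric]) (use D in \<open>auto intro!: nn_integral_cong simp: indicator_def\<close>)
  have "(\<integral>\<^sup>+z. indicator {z. 2 * D < norm z} z * ennreal (norm z powr - ?p) \<partial>?M)
    = ennreal (\<bar>2\<bar> ^ ?d) * (\<integral>\<^sup>+z. indicator {z. 2 * D < norm z} (2 *\<^sub>R z) * ennreal (norm (2 *\<^sub>R z) powr - ?p) \<partial>?M)"
    by (rule nn_integral_scale) auto
  also have "(\<integral>\<^sup>+z. indicator {z. 2 * D < norm z} (2 *\<^sub>R z) * ennreal (norm (2 *\<^sub>R z) powr - ?p) \<partial>?M)
    = (\<integral>\<^sup>+z. ennreal (2 powr - ?p) * (indicator {z. D < norm z} z * ennreal (norm z powr - ?p)) \<partial>?M)"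
    by (intro nn_integral_cong) (auto simp: indicator_def powr_mult ennreal_mult')
  also have "\<dots> = ennreal (2 powr - ?p) * X" unfolding X_def by (intro nn_integral_cmult) auto
  also have "ennreal (\<bar>2\<bar> ^ ?d) * (ennreal (2 powr - ?p) * X) = ennreal (4 powr - s * x)"
  proof -
    have "(2::real) ^ ?d * 2 powr - ?p = 4 powr - s"
    proof -
      have "(2::real) ^ ?d * 2 powr - ?p = 2 powr (- 2 * s)"
        by (subst powr_realpow[symmetric]) (auto simp: powr_add[symmetric])
      also have "\<dots> = (2 powr 2) powr (- s)" by (subst powr_powr) simp
      finally show ?thesis by simp
    qed
    then show ?thesis using x by (simp add: ennreal_mult'[symmetric] mult.assoc[symmetric])
  qed
  finally have tail: "(\<integral>\<^sup>+z. indicator {z. 2 * D < norm z} z * ennreal (norm z powr - ?p) \<partial>?M) = ennreal (4 powr - s * x)" .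
  define w where "w = unit_ball_vol ?d * D powr (- 2 * s) / 2 ^ (2 * ?d + 2)"
  have w: "0 \<le> w" by (simp add: w_def)
  have shell: "ennreal w \<le> (\<integral>\<^sup>+z. indicator {z. D < norm z \<and> norm z \<le> 2 * D} z * ennreal (norm z powr - ?p) \<partial>?M)"
  proof -
    obtain b :: 'a where b: "b \<in> Basis" using nonempty_Basis by blast
    \<comment> \<open>A ball inside the shell, so that the volume of balls suffices to bound the
      shell integral from below.\<close>
    let ?B = "ball ((3/2 * D) *\<^sub>R b) (D / 2)"
    have sub: "D < norm z \<and> norm z \<le> 2 * D" if "z \<in> ?B" for z
    proof -
      have n: "norm ((3/2 * D) *\<^sub>R b) = 3/2 * D" using b D by simp
      have "dist ((3/2 * D) *\<^sub>R b) z < D / 2" using that by simp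
      then show ?thesis
        using norm_triangle_ineq2[of "(3/2 * D) *\<^sub>R b" z] norm_triangle_ineq2[of z "(3/2 * D) *\<^sub>R b"] n
          norm_minus_commute[of z "(3/2 * D) *\<^sub>R b"]
        unfolding dist_norm by linarith
    qed
    have wle: "w \<le> (2 * D) powr - ?p * (unit_ball_vol ?d * (D / 2) ^ ?d)"
    proof -
      have "(2 * D) powr - ?p = 2 powr - ?p * D powr - ?p" using D by (simp add: powr_mult)
      moreover have "D powr - ?p * D ^ ?d = D powr (- 2 * s)"
        using D by (subst powr_realpow[symmetric]) (auto simp: powr_add[symmetric])
      ultimately have *: "(2 * D) powr - ?p * (unit_ball_vol ?d * (D / 2) ^ ?d)
        = unit_ball_vol ?d * D powr (- 2 * s) * (2 powr - ?p / 2 ^ ?d)" by (simp add: power_divide field_simps)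
      have "2 powr - real (?d + 2) \<le> (2::real) powr - ?p" using s by (intro powr_mono) auto
      then have "1 / 2 ^ (?d + 2) \<le> (2::real) powr - ?p" by (simp only: powr_minus_divide powr_realpow)
      then have "1 / 2 ^ (?d + 2) / 2 ^ ?d \<le> (2::real) powr - ?p / 2 ^ ?d" by (intro divide_right_mono) auto
      moreover have "2 * ?d + 2 = (?d + 2) + ?d" by simp
      then have "(1::real) / 2 ^ (2 * ?d + 2) = 1 / 2 ^ (?d + 2) / 2 ^ ?d"
        by (simp only: power_add divide_divide_eq_left)
      ultimately have "1 / 2 ^ (2 * ?d + 2) \<le> (2::real) powr - ?p / 2 ^ ?d" by (simp only:)
      then have "unit_ball_vol ?d * D powr (- 2 * s) * (1 / 2 ^ (2 * ?d + 2)) \<le>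
          unit_ball_vol ?d * D powr (- 2 * s) * (2 powr - ?p / 2 ^ ?d)"
        by (intro mult_left_mono) auto
      then show ?thesis unfolding * w_def by simp
    qed
    have "ennreal w \<le> ennreal ((2 * D) powr - ?p) * emeasure lborel ?B"
      using wle D by (simp add: emeasure_ball ennreal_mult'[symmetric] ennreal_leI)
    also have "\<dots> = (\<integral>\<^sup>+z. ennreal ((2 * D) powr - ?p) * indicator ?B z \<partial>?M)"
      by (rule nn_integral_cmult_indicator[symmetric]) simp
    also have "\<dots> \<le> (\<integral>\<^sup>+z. indicator {z. D < norm z \<and> norm z \<le> 2 * D} z * ennreal (norm z powr - ?p) \<partial>?M)"
    proof (rule nn_integral_mono)
      fix z
      show "ennreal ((2 * D) powr - ?p) * indicator ?B z \<le> indicator {z. D < norm z \<and> norm z \<le> 2 * D} z * ennreal (norm z powr - ?p)"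
      proof (cases "z \<in> ?B")
        case True
        have "(2 * D) powr - ?p \<le> norm z powr - ?p" using sub[OF True] D s by (intro powr_mono2') auto
        then show ?thesis using True sub[OF True] by (simp add: ennreal_leI)
      qed simp
    qed
    finally show ?thesis .
  qed
  have "ennreal w + ennreal (4 powr - s * x) \<le> X"
    unfolding split tail by (rule add_right_mono[OF shell])
  then have "w + 4 powr - s * x \<le> x" unfolding x(1) using w x(2) by (simp add: ennreal_plus[symmetric] del: ennreal_plus)
  then have "w \<le> (1 - 4 powr - s) * x" by (simp add: algebra_simps)
  also have "\<dots> \<le> (ln 4 * s) * x"
    using one_minus_powr_le[of "1/4" s] x(2) unfolding quarter_powr by (intro mult_right_mono) (auto simp: ln_div)
  finally have "w / (ln 4 * s) \<le> x" using s by (simp add: field_simps)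
  then have "ennreal (w / (ln 4 * s)) \<le> X" using x by (simp add: ennreal_leI)
  then show ?thesis by (simp add: X_def w_def field_simps)
qed

section \<open>Difference energies and the Gagliardo energy\<close>

definition increment_energy :: "('a::euclidean_space \<Rightarrow> real) \<Rightarrow> 'a \<Rightarrow> ennreal" where
  "increment_energy u z = (\<integral>\<^sup>+x. ennreal ((u (x + z) - u x)\<^sup>2) \<partial>lborel)"

definition second_diff_energy :: "('a::euclidean_space \<Rightarrow> real) \<Rightarrow> 'a \<Rightarrow> ennreal" where
  "second_diff_energy u z = (\<integral>\<^sup>+x. ennreal ((u (x + z) - 2 * u x + u (x - z))\<^sup>2) \<partial>lborel)"

definition frac_kernel :: "real \<Rightarrow> 'a::euclidean_space \<Rightarrow> real" where
  "frac_kernel s z = norm z powr - (real DIM('a) + 2 * s)"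

text \<open>The squared Gagliardo seminorm in the variables x and z = y - x. Its values are extended
  reals, so that finiteness on the finite element space is a theorem rather than a convention of the
  integral.\<close>

definition gagliardo :: "real \<Rightarrow> ('a::euclidean_space \<Rightarrow> real) \<Rightarrow> ennreal" where
  "gagliardo s u = (\<integral>\<^sup>+z. increment_energy u z * ennreal (frac_kernel s z) \<partial>lborel)"

lemma increment_energy_measurable [measurable]:
  fixes u :: "'a::euclidean_space \<Rightarrow> real"
  assumes [measurable]: "u \<in> borel_measurable borel"
  shows "increment_energy u \<in> borel_measurable borel" "second_diff_energy u \<in> borel_measurable borel"
  unfolding increment_energy_def[abs_def] second_diff_energy_def[abs_def] by measurable

lemma frac_kernel_measurable [measurable]: "frac_kernel s \<in> borel_measurable borel"
  unfolding frac_kernel_def[abs_def] by measurable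

lemma frac_kernel_nonneg [simp]: "0 \<le> frac_kernel s z" by (simp add: frac_kernel_def)

text \<open>The parallelogram identity for the values at x + z, x and x - z, integrated over x;
  translation invariance identifies the energies of the two first differences of step z.\<close>

lemma increment_energy_parallelogram:
  fixes u :: "'a::euclidean_space \<Rightarrow> real"
  assumes [measurable]: "u \<in> borel_measurable borel"
  shows "increment_energy u (2 *\<^sub>R z) + second_diff_energy u z = 4 * increment_energy u z"
proof -
  have A: "increment_energy u z = (\<integral>\<^sup>+x. ennreal ((u x - u (x - z))\<^sup>2) \<partial>lborel)"
    using nn_integral_translate[of "\<lambda>x. ennreal ((u (x + z) - u x)\<^sup>2)" "- z"] by (simp add: increment_energy_def)
  have B: "increment_energy u (2 *\<^sub>R z) = (\<integral>\<^sup>+x. ennreal ((u (x + z) - u (x - z))\<^sup>2) \<partial>lborel)"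
    using nn_integral_translate[of "\<lambda>x. ennreal ((u (x + 2 *\<^sub>R z) - u x)\<^sup>2)" "- z"]
    by (simp add: increment_energy_def scaleR_2 algebra_simps)
  have "increment_energy u (2 *\<^sub>R z) + second_diff_energy u z = (\<integral>\<^sup>+x. ennreal ((u (x + z) - u (x - z))\<^sup>2) + ennreal ((u (x + z) - 2 * u x + u (x - z))\<^sup>2) \<partial>lborel)"
    unfolding B second_diff_energy_def by (rule nn_integral_add[symmetric]) auto
  also have "\<dots> = (\<integral>\<^sup>+x. 2 * ennreal ((u (x + z) - u x)\<^sup>2) + 2 * ennreal ((u x - u (x - z))\<^sup>2) \<partial>lborel)"
  proof (rule nn_integral_cong)
    fix x
    have *: "(a - b)\<^sup>2 + (a - 2 * c + b)\<^sup>2 = 2 * (a - c)\<^sup>2 + 2 * (c - b)\<^sup>2" for a b c :: real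
      by (simp add: power2_eq_square algebra_simps)
    have "ennreal ((u (x + z) - u (x - z))\<^sup>2) + ennreal ((u (x + z) - 2 * u x + u (x - z))\<^sup>2)
      = ennreal (2 * (u (x + z) - u x)\<^sup>2 + 2 * (u x - u (x - z))\<^sup>2)"
      by (simp add: ennreal_plus[symmetric] * del: ennreal_plus)
    then show "ennreal ((u (x + z) - u (x - z))\<^sup>2) + ennreal ((u (x + z) - 2 * u x + u (x - z))\<^sup>2)
      = 2 * ennreal ((u (x + z) - u x)\<^sup>2) + 2 * ennreal ((u x - u (x - z))\<^sup>2)"
      by (simp add: ennreal_mult')
  qed
  also have "\<dots> = 2 * increment_energy u z + 2 * increment_energy u z"
    by (subst nn_integral_add) (auto simp: nn_integral_cmult increment_energy_def A[symmetric, unfolded increment_energy_def])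
  also have "\<dots> = 4 * increment_energy u z" by (simp add: distrib_right[symmetric])
  finally show ?thesis .
qed

text \<open>The factor \<open>4 - 4 powr s\<close>, of order \<open>1 - s\<close>, is what makes the lower bound uniform as \<open>s\<close> tends to 1.\<close>

lemma gagliardo_second_difference:
  fixes u :: "'a::euclidean_space \<Rightarrow> real"
  assumes [measurable]: "u \<in> borel_measurable borel" and w: "gagliardo s u = ennreal w" "0 \<le> w" and s: "0 < s" "s < 1"
  shows "(\<integral>\<^sup>+z. second_diff_energy u z * ennreal (frac_kernel s z) \<partial>lborel) = ennreal ((4 - 4 powr s) * w)"
proof -
  let ?p = "real DIM('a) + 2 * s"
  \<comment> \<open>Substituting 2 z shows that doubling the step multiplies the weighted energy by
    \<open>4 powr s\<close>; against the 4 of the parallelogram identity this leaves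
    \<open>4 - 4 powr s\<close>.\<close>
  have "gagliardo s u = ennreal (\<bar>2\<bar> ^ DIM('a)) * (\<integral>\<^sup>+z. increment_energy u (2 *\<^sub>R z) * ennreal (frac_kernel s (2 *\<^sub>R z)) \<partial>lborel)"
    unfolding gagliardo_def by (rule nn_integral_scale) auto
  also have "(\<integral>\<^sup>+z. increment_energy u (2 *\<^sub>R z) * ennreal (frac_kernel s (2 *\<^sub>R z)) \<partial>lborel)
    = (\<integral>\<^sup>+z. ennreal (2 powr - ?p) * (increment_energy u (2 *\<^sub>R z) * ennreal (frac_kernel s z)) \<partial>lborel)"
    by (intro nn_integral_cong) (simp add: frac_kernel_def powr_mult ennreal_mult' mult_ac)
  also have "\<dots> = ennreal (2 powr - ?p) * (\<integral>\<^sup>+z. increment_energy u (2 *\<^sub>R z) * ennreal (frac_kernel s z) \<partial>lborel)"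
    by (rule nn_integral_cmult) auto
  also have "ennreal (\<bar>2\<bar> ^ DIM('a)) * (ennreal (2 powr - ?p) * (\<integral>\<^sup>+z. increment_energy u (2 *\<^sub>R z) * ennreal (frac_kernel s z) \<partial>lborel))
    = ennreal (4 powr - s) * (\<integral>\<^sup>+z. increment_energy u (2 *\<^sub>R z) * ennreal (frac_kernel s z) \<partial>lborel)"
  proof -
    have "(2::real) ^ DIM('a) * 2 powr - ?p = 2 powr (- 2 * s)"
      by (subst powr_realpow[symmetric]) (auto simp: powr_add[symmetric])
    also have "\<dots> = (2 powr 2) powr (- s)" by (subst powr_powr) simp
    finally have "(2::real) ^ DIM('a) * 2 powr - ?p = 4 powr - s" by simp
    then show ?thesis by (simp add: ennreal_mult'[symmetric] mult.assoc[symmetric])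
  qed
  finally have "ennreal (4 powr s) * gagliardo s u = ennreal (4 powr s) * (ennreal (4 powr - s) * (\<integral>\<^sup>+z. increment_energy u (2 *\<^sub>R z) * ennreal (frac_kernel s z) \<partial>lborel))"
    by simp
  also have "\<dots> = (\<integral>\<^sup>+z. increment_energy u (2 *\<^sub>R z) * ennreal (frac_kernel s z) \<partial>lborel)"
    by (simp add: mult.assoc[symmetric] ennreal_mult'[symmetric] powr_add[symmetric])
  finally have dbl: "(\<integral>\<^sup>+z. increment_energy u (2 *\<^sub>R z) * ennreal (frac_kernel s z) \<partial>lborel) = ennreal (4 powr s * w)"
    using w by (simp add: ennreal_mult')
  have "(\<integral>\<^sup>+z. increment_energy u (2 *\<^sub>R z) * ennreal (frac_kernel s z) \<partial>lborel) + (\<integral>\<^sup>+z. second_diff_energy u z * ennreal (frac_kernel s z) \<partial>lborel)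
    = (\<integral>\<^sup>+z. increment_energy u (2 *\<^sub>R z) * ennreal (frac_kernel s z) + second_diff_energy u z * ennreal (frac_kernel s z) \<partial>lborel)"
    by (rule nn_integral_add[symmetric]) auto
  also have "\<dots> = (\<integral>\<^sup>+z. 4 * (increment_energy u z * ennreal (frac_kernel s z)) \<partial>lborel)"
    by (intro nn_integral_cong) (simp add: distrib_right[symmetric] increment_energy_parallelogram mult.assoc)
  also have "\<dots> = 4 * gagliardo s u" unfolding gagliardo_def by (rule nn_integral_cmult) auto
  also have "\<dots> = ennreal (4 * w)" using w by (simp add: ennreal_mult')
  finally have sum: "ennreal (4 powr s * w) + (\<integral>\<^sup>+z. second_diff_energy u z * ennreal (frac_kernel s z) \<partial>lborel) = ennreal (4 * w)"
    unfolding dbl .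
  \<comment> \<open>Finiteness has to be known before \<open>4 powr s * w\<close> can be cancelled
    in \<open>ennreal\<close>.\<close>
  then have "(\<integral>\<^sup>+z. second_diff_energy u z * ennreal (frac_kernel s z) \<partial>lborel) < \<infinity>"
    by (metis ennreal_add_eq_top ennreal_neq_top infinity_ennreal_def top.not_eq_extremum)
  then obtain y where y: "(\<integral>\<^sup>+z. second_diff_energy u z * ennreal (frac_kernel s z) \<partial>lborel) = ennreal y" "0 \<le> y"
    by (cases "(\<integral>\<^sup>+z. second_diff_energy u z * ennreal (frac_kernel s z) \<partial>lborel)") auto
  have "4 powr s * w + y = 4 * w"
    using sum w y by (simp add: ennreal_plus[symmetric] del: ennreal_plus)
  then show ?thesis using y by (simp add: algebra_simps)
qed

text \<open>Splitting the kernel into two square roots turns the form into an \<open>L2\<close>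
  inner product on the product space, from which symmetry, bilinearity and nonnegativity are
  inherited.\<close>

definition frac_diff :: "real \<Rightarrow> ('a::euclidean_space \<Rightarrow> real) \<Rightarrow> 'a \<times> 'a \<Rightarrow> real" where
  "frac_diff s u = (\<lambda>(x, y). (u x - u y) * norm (x - y) powr (- (real DIM('a) + 2 * s) / 2))"

lemma frac_diff_nn_integral:
  fixes u :: "'a::euclidean_space \<Rightarrow> real"
  assumes [measurable]: "u \<in> borel_measurable borel"
  shows "(\<integral>\<^sup>+xy. ennreal ((frac_diff s u xy)\<^sup>2) \<partial>(lborel \<Otimes>\<^sub>M lborel)) = gagliardo s u"
proof -
  have meas [measurable]: "frac_diff s u \<in> borel_measurable (borel \<Otimes>\<^sub>M borel)"
    unfolding frac_diff_def by measurable
  have "(\<integral>\<^sup>+xy. ennreal ((frac_diff s u xy)\<^sup>2) \<partial>(lborel \<Otimes>\<^sub>M lborel))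
    = (\<integral>\<^sup>+x. \<integral>\<^sup>+y. ennreal ((frac_diff s u (x, y))\<^sup>2) \<partial>lborel \<partial>lborel)"
    by (rule lborel.nn_integral_fst[symmetric]) auto
  also have "\<dots> = (\<integral>\<^sup>+x. \<integral>\<^sup>+z. ennreal ((frac_diff s u (x, z + x))\<^sup>2) \<partial>lborel \<partial>lborel)"
    by (intro nn_integral_cong nn_integral_translate[symmetric]) measurable
  also have "\<dots> = (\<integral>\<^sup>+z. \<integral>\<^sup>+x. ennreal ((frac_diff s u (x, z + x))\<^sup>2) \<partial>lborel \<partial>lborel)"
    by (rule lborel_pair.Fubini'[symmetric]) measurable
  also have "\<dots> = (\<integral>\<^sup>+z. \<integral>\<^sup>+x. ennreal ((u (x + z) - u x)\<^sup>2) * ennreal (frac_kernel s z) \<partial>lborel \<partial>lborel)"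
  proof (intro nn_integral_cong)
    fix x z :: 'a
    have "(norm z powr (- (real DIM('a) + 2 * s) / 2))\<^sup>2 = frac_kernel s z"
      by (simp add: power2_eq_square powr_add[symmetric] frac_kernel_def)
    then show "ennreal ((frac_diff s u (x, z + x))\<^sup>2) = ennreal ((u (x + z) - u x)\<^sup>2) * ennreal (frac_kernel s z)"
      by (simp add: frac_diff_def power_mult_distrib power2_commute[of "u x"] ennreal_mult' add.commute)
  qed
  also have "\<dots> = gagliardo s u" unfolding gagliardo_def increment_energy_def
    by (intro nn_integral_cong nn_integral_multc) measurable
  finally show ?thesis .
qed

lemma frac_diff_L2:
  fixes u :: "'a::euclidean_space \<Rightarrow> real"
  assumes [measurable]: "u \<in> borel_measurable borel" and "gagliardo s u < \<infinity>"
  shows "frac_diff s u \<in> L2 (lborel \<Otimes>\<^sub>M lborel)"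
proof -
  have [measurable]: "frac_diff s u \<in> borel_measurable (borel \<Otimes>\<^sub>M borel)"
    unfolding frac_diff_def by measurable
  show ?thesis unfolding L2_def using assms(2)
    by (auto simp: integrable_iff_bounded frac_diff_nn_integral[OF assms(1)] cong: nn_integral_cong)
qed

lemma frac_form_eq_ip:
  "frac_form s u v = frac_const DIM('a) s / 2 * ip (lborel \<Otimes>\<^sub>M lborel) (frac_diff s u) (frac_diff s v)"
  for u v :: "'a::euclidean_space \<Rightarrow> real"
proof -
  \<comment> \<open>True at r = 0 as well, where both sides are 0; hence the two integrands agree on
    the diagonal.\<close>
  have *: "r powr (- p / 2) * r powr (- p / 2) = 1 / r powr p" for r p :: real
    by (simp add: powr_add[symmetric] powr_minus_divide)
  have "frac_diff s u xy * frac_diff s v xy =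
    (case xy of (x, y) \<Rightarrow> (u x - u y) * (v x - v y) / norm (x - y) powr (real DIM('a) + 2 * s))" for xy
  proof (cases xy)
    case (Pair x y)
    let ?r = "norm (x - y) powr (- (real DIM('a) + 2 * s) / 2)"
    have "frac_diff s u xy * frac_diff s v xy = (u x - u y) * (v x - v y) * (?r * ?r)"
      by (simp add: Pair frac_diff_def mult_ac)
    then show ?thesis by (simp only: * Pair prod.case mult_1_right times_divide_eq_right)
  qed
  then show ?thesis unfolding frac_form_def ip_def by simp
qed

lemma frac_form_self:
  fixes u :: "'a::euclidean_space \<Rightarrow> real"
  assumes "u \<in> borel_measurable borel" "gagliardo s u = ennreal w" "0 \<le> w"
  shows "frac_form s u u = frac_const DIM('a) s / 2 * w"
proof -
  have "ip (lborel \<Otimes>\<^sub>M lborel) (frac_diff s u) (frac_diff s u) = w"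
  proof -
    have "frac_diff s u \<in> L2 (lborel \<Otimes>\<^sub>M lborel)" using assms by (intro frac_diff_L2) auto
    then have "integrable (lborel \<Otimes>\<^sub>M lborel) (\<lambda>x. (frac_diff s u x)\<^sup>2)" by (simp add: L2_def)
    then have "ennreal (ip (lborel \<Otimes>\<^sub>M lborel) (frac_diff s u) (frac_diff s u)) = gagliardo s u"
      unfolding ip_def power2_eq_square[symmetric] frac_diff_nn_integral[OF assms(1), symmetric]
      by (intro nn_integral_eq_integral[symmetric]) auto
    then show ?thesis using assms(2,3) by (simp add: ip_def)
  qed
  then show ?thesis by (simp add: frac_form_eq_ip)
qed

section \<open>Strengthened Cauchy-Schwarz inequality for increments\<close>

abbreviation l2_norm :: "('a::euclidean_space \<Rightarrow> real) \<Rightarrow> real" where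
  "l2_norm f \<equiv> semi_ip.nm (ip lborel) f"

definition increment :: "'a::euclidean_space \<Rightarrow> ('a \<Rightarrow> real) \<Rightarrow> 'a \<Rightarrow> real" where
  "increment z f = (\<lambda>x. f (x + z) - f x)"

lemma increment_L2: "f \<in> L2 lborel \<Longrightarrow> increment z f \<in> L2 lborel"
  unfolding increment_def by (intro L2.diff_mem L2_translate)

lemma l2_norm_translate: "f \<in> L2 lborel \<Longrightarrow> l2_norm (\<lambda>x. f (x + a)) = l2_norm f"
  by (simp add: L2.nm_def ip_translate)

lemma l2_norm_increment_le: "f \<in> L2 lborel \<Longrightarrow> l2_norm (increment z f) \<le> 2 * l2_norm f"
  unfolding increment_def using L2.nm_triangle_diff[OF L2_translate, of f f z] by (simp add: l2_norm_translate)

lemma increment_sum: "increment z (\<lambda>x. \<Sum>i\<in>I. f i x) = (\<lambda>x. \<Sum>i\<in>I. increment z (f i) x)"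
  by (simp add: increment_def sum_subtractf)

lemma increment_of_nat_scale: "increment (real N *\<^sub>R z) f = (\<lambda>x. \<Sum>i<N. increment z f (x + real i *\<^sub>R z))"
proof
  fix x
  have "(\<Sum>i<N. f (x + real (Suc i) *\<^sub>R z) - f (x + real i *\<^sub>R z)) = f (x + real N *\<^sub>R z) - f (x + real 0 *\<^sub>R z)"
    by (rule sum_lessThan_telescope)
  then show "increment (real N *\<^sub>R z) f x = (\<Sum>i<N. increment z f (x + real i *\<^sub>R z))"
    by (simp add: increment_def algebra_simps)
qed

lemma l2_norm_increment_of_nat_scale_le:
  assumes "f \<in> L2 lborel"
  shows "l2_norm (increment (real N *\<^sub>R z) f) \<le> real N * l2_norm (increment z f)"
proof -
  have "l2_norm (increment (real N *\<^sub>R z) f) \<le> (\<Sum>i<N. l2_norm (\<lambda>x. increment z f (x + real i *\<^sub>R z)))"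
    unfolding increment_of_nat_scale using assms by (intro L2.nm_sum L2_translate increment_L2) auto
  then show ?thesis using assms by (simp add: l2_norm_translate increment_L2)
qed

text \<open>Schur's test: the symmetric matrix whose entries are q to the power of the distance
  between j and k has row sums at most 2 / (1 - q), and each product of \<open>b j\<close> and
  \<open>b k\<close> is split into half the sum of their squares.\<close>

lemma schur_geometric:
  fixes b :: "nat \<Rightarrow> real" and q :: real
  assumes "finite I" "0 < q" "q < 1"
  shows "(\<Sum>j\<in>I. \<Sum>k\<in>I. q ^ (if j \<le> k then k - j else j - k) * (b j * b k)) \<le> 2 / (1 - q) * (\<Sum>j\<in>I. (b j)\<^sup>2)"
proof -
  define w where "w = (\<lambda>j k. q ^ (if j \<le> k then k - j else j - k :: nat))"
  have w0: "0 \<le> w j k" and wc: "w j k = w k j" for j k using assms by (auto simp: w_def)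
  have ws: "(\<Sum>k\<in>I. w j k) \<le> 2 / (1 - q)" for j
  proof -
    define m where "m = Suc (Max I)"
    have m: "k < m" if "k \<in> I" for k using that assms(1) by (simp add: m_def less_Suc_eq_le)
    have gp: "(\<Sum>i<n. q ^ i) \<le> 1 / (1 - q)" for n
    proof -
      have "(\<Sum>i<n. q ^ i) = (1 - q ^ n) / (1 - q)" using assms by (simp add: sum_gp_strict)
      also have "\<dots> \<le> 1 / (1 - q)" using assms by (intro divide_right_mono) auto
      finally show ?thesis .
    qed
    have "(\<Sum>k\<in>I. w j k) = (\<Sum>k\<in>I \<inter> {k. k < j}. w j k) + (\<Sum>k\<in>I \<inter> {k. \<not> k < j}. w j k)"
      using sum.Int_Diff[OF assms(1), of "w j" "{k. k < j}"] by (simp add: Diff_eq Collect_neg_eq)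
    also have "(\<Sum>k\<in>I \<inter> {k. k < j}. w j k) \<le> (\<Sum>k<j. w j k)"
      using w0 by (intro sum_mono2) auto
    also have "\<dots> = (\<Sum>i<j. q * q ^ i)"
      by (rule sum.reindex_bij_witness[of _ "\<lambda>k. j - Suc k" "\<lambda>k. j - Suc k"])
         (auto simp: w_def power_Suc[symmetric] Suc_diff_Suc simp del: power_Suc)
    also have "\<dots> \<le> 1 / (1 - q)"
    proof -
      have "(\<Sum>i<j. q * q ^ i) \<le> (\<Sum>i<j. 1 * q ^ i)" using assms by (intro sum_mono mult_right_mono) auto
      then show ?thesis using gp[of j] by simp
    qed
    also have "(\<Sum>k\<in>I \<inter> {k. \<not> k < j}. w j k) \<le> (\<Sum>k\<in>{j..<j+m}. w j k)"
      using w0 by (intro sum_mono2) (auto dest!: m)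
    also have "\<dots> = (\<Sum>i<m. q ^ i)"
      by (rule sum.reindex_bij_witness[of _ "\<lambda>k. j + k" "\<lambda>k. k - j"]) (auto simp: w_def)
    also have "\<dots> \<le> 1 / (1 - q)" by (rule gp)
    finally show ?thesis by (simp add: add_divide_distrib[symmetric])
  qed
  have "(\<Sum>j\<in>I. \<Sum>k\<in>I. w j k * (b j * b k)) \<le> (\<Sum>j\<in>I. \<Sum>k\<in>I. w j k * (((b j)\<^sup>2 + (b k)\<^sup>2) / 2))"
  proof (intro sum_mono mult_left_mono w0)
    fix j k
    have "0 \<le> (b j - b k)\<^sup>2" by simp
    then show "b j * b k \<le> ((b j)\<^sup>2 + (b k)\<^sup>2) / 2" by (simp add: power2_diff)
  qed
  also have "\<dots> = (\<Sum>j\<in>I. \<Sum>k\<in>I. w j k * (b j)\<^sup>2) / 2 + (\<Sum>j\<in>I. \<Sum>k\<in>I. w j k * (b k)\<^sup>2) / 2"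
    by (simp add: sum_divide_distrib sum.distrib[symmetric] add_divide_distrib distrib_left)
  also have "(\<Sum>j\<in>I. \<Sum>k\<in>I. w j k * (b k)\<^sup>2) = (\<Sum>j\<in>I. \<Sum>k\<in>I. w j k * (b j)\<^sup>2)"
    by (subst sum.swap) (simp add: wc)
  also have "(\<Sum>j\<in>I. \<Sum>k\<in>I. w j k * (b j)\<^sup>2) / 2 + (\<Sum>j\<in>I. \<Sum>k\<in>I. w j k * (b j)\<^sup>2) / 2
      = (\<Sum>j\<in>I. (\<Sum>k\<in>I. w j k) * (b j)\<^sup>2)"
    by (simp add: sum_distrib_right)
  also have "\<dots> \<le> (\<Sum>j\<in>I. (2 / (1 - q)) * (b j)\<^sup>2)"
    by (intro sum_mono mult_right_mono ws) auto
  finally show ?thesis by (simp only: w_def sum_distrib_left)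
qed

text \<open>Averaging \<open>increment z f\<close> over \<open>N\<close> consecutive translates replaces it by the quotient
  \<open>increment (N z) f / N\<close>, and a difference can be moved from \<open>g\<close> onto that quotient.\<close>

lemma ip_increment_increment_le:
  assumes f: "f \<in> L2 lborel" and g: "g \<in> L2 lborel" and N: "0 < N"
    and F: "\<And>i. i \<le> N \<Longrightarrow> l2_norm (increment (real i *\<^sub>R z) (increment z f)) \<le> F"
  shows "\<bar>ip lborel (increment z f) (increment z g)\<bar> \<le> F * l2_norm (increment z g) + F * l2_norm g / real N"
proof -
  define D where "D = increment z f"
  define A where "A = (\<lambda>x. (1 / real N) * increment (real N *\<^sub>R z) f x)"
  define y where "y = real N *\<^sub>R z"
  have DL: "D \<in> L2 lborel" and gL: "increment z g \<in> L2 lborel" and yL: "increment y f \<in> L2 lborel"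
    unfolding D_def using f g by (auto intro: increment_L2)
  have AL: "A \<in> L2 lborel" unfolding A_def by (intro L2.scale_mem increment_L2 f)
  have F0: "0 \<le> F" using order_trans[OF L2.nm_nonneg F[of 0]] f by (simp add: increment_L2)
  \<comment> \<open>D minus its average over N translates is, up to sign, an average of differences
    of D with steps i z, each bounded by F.\<close>
  have DA: "l2_norm (\<lambda>x. D x - A x) \<le> F"
  proof -
    have "(\<lambda>x. D x - A x) = (\<lambda>x. \<Sum>i<N. (- 1 / real N) * increment (real i *\<^sub>R z) D x)"
    proof
      fix x
      have "(\<Sum>i<N. (- 1 / real N) * increment (real i *\<^sub>R z) D x) = (- 1 / real N) * ((\<Sum>i<N. D (x + real i *\<^sub>R z)) - real N * D x)"
        by (simp only: increment_def sum_distrib_left[symmetric] sum_subtractf sum_constant card_lessThan)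
      also have "\<dots> = D x - (1 / real N) * (\<Sum>i<N. D (x + real i *\<^sub>R z))" using N by (simp add: field_simps)
      finally show "D x - A x = (\<Sum>i<N. (- 1 / real N) * increment (real i *\<^sub>R z) D x)"
        by (simp add: A_def increment_of_nat_scale D_def)
    qed
    then have "l2_norm (\<lambda>x. D x - A x) \<le> (\<Sum>i<N. l2_norm (\<lambda>x. (- 1 / real N) * increment (real i *\<^sub>R z) D x))"
      using DL by (simp only:) (intro L2.nm_sum L2.scale_mem increment_L2, auto)
    also have "\<dots> = (\<Sum>i<N. (1 / real N) * l2_norm (increment (real i *\<^sub>R z) D))"
      using DL by (intro sum.cong refl) (subst L2.nm_scale, auto intro: increment_L2)
    also have "\<dots> \<le> (\<Sum>i<N. (1 / real N) * F)"
      unfolding D_def using F by (intro sum_mono mult_left_mono) auto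
    finally show ?thesis using N by simp
  qed
  \<comment> \<open>Summation by parts: translation invariance moves the difference of step z from g
    onto \<open>increment y f\<close>, where the hypothesis at i = N bounds it; what is left is
    \<open>l2_norm g\<close> with the factor 1 / N.\<close>
  have "ip lborel A (increment z g) = (1 / real N) * ip lborel (increment y f) (increment z g)"
    unfolding A_def y_def[symmetric] by (rule L2.B_scale[OF yL gL])
  also have "ip lborel (increment y f) (increment z g) = ip lborel (increment y f) (\<lambda>x. g (x + z)) - ip lborel (increment y f) g"
    unfolding increment_def[of z] by (rule L2.B_diff_right) (use yL g L2_translate in auto)
  also have "ip lborel (increment y f) (\<lambda>x. g (x + z)) = ip lborel (\<lambda>x. increment y f (x - z)) g"
    using ip_translate[OF L2_translate[OF yL, of "- z"] g, of z] by simp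
  also have "\<dots> - ip lborel (increment y f) g = ip lborel (\<lambda>x. increment y f (x - z) - increment y f x) g"
    by (rule L2.B_diff[symmetric]) (use yL g L2_translate[OF yL, of "- z"] in auto)
  finally have eq: "ip lborel A (increment z g) = (1 / real N) * ip lborel (\<lambda>x. increment y f (x - z) - increment y f x) g" .
  have "l2_norm (\<lambda>x. increment y f (x - z) - increment y f x) = l2_norm (\<lambda>x. increment y f x - increment y f (x - z))"
    by (rule L2.nm_minus_commute) (use yL L2_translate[OF yL, of "- z"] in auto)
  also have "(\<lambda>x. increment y f x - increment y f (x - z)) = (\<lambda>x. increment y (increment z f) (x + - z))"
    by (auto simp: increment_def algebra_simps)
  also have "l2_norm \<dots> = l2_norm (increment y (increment z f))" by (rule l2_norm_translate) (intro increment_L2 f)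
  also have "\<dots> \<le> F" unfolding y_def by (rule F) simp
  finally have G: "l2_norm (\<lambda>x. increment y f (x - z) - increment y f x) \<le> F" .
  have GL: "(\<lambda>x. increment y f (x - z) - increment y f x) \<in> L2 lborel"
    by (rule L2.diff_mem) (use yL L2_translate[OF yL, of "- z"] in auto)
  have "ip lborel D (increment z g) = ip lborel (\<lambda>x. D x - A x) (increment z g) + ip lborel A (increment z g)"
    by (simp add: L2.B_diff DL AL gL)
  also have "\<bar>\<dots>\<bar> \<le> \<bar>ip lborel (\<lambda>x. D x - A x) (increment z g)\<bar> + \<bar>ip lborel A (increment z g)\<bar>" by simp
  also have "\<bar>ip lborel (\<lambda>x. D x - A x) (increment z g)\<bar> \<le> l2_norm (\<lambda>x. D x - A x) * l2_norm (increment z g)"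
    by (intro L2.Cauchy_Schwarz L2.diff_mem DL AL gL)
  also have "\<dots> \<le> F * l2_norm (increment z g)" by (intro mult_right_mono DA L2.nm_nonneg gL)
  also have "\<bar>ip lborel A (increment z g)\<bar> \<le> F * l2_norm g / real N"
  proof -
    have "\<bar>ip lborel (\<lambda>x. increment y f (x - z) - increment y f x) g\<bar> \<le> l2_norm (\<lambda>x. increment y f (x - z) - increment y f x) * l2_norm g"
      by (intro L2.Cauchy_Schwarz GL g)
    also have "\<dots> \<le> F * l2_norm g" by (intro mult_right_mono G L2.nm_nonneg g)
    finally show ?thesis unfolding eq using N by (simp add: abs_mult divide_right_mono)
  qed
  finally show ?thesis by (simp add: D_def)
qed

text \<open>The factor \<open>sqrt \<sigma>\<close> in the bound on second increments encodes half
  an order of smoothness beyond the gradient. The bound is asked for short steps z only, and for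
  \<sigma> bounded away from 0, because it will be obtained by absorbing a term of higher order in
  z. Short steps decide: an increment of step n \<zeta> has at most n times the norm of one of step
  \<zeta>. For levels j \<le> k the inner product of increments then decays like
  \<open>sqrt \<gamma> ^ (k - j)\<close>, and Schur's test sums over the levels.\<close>

lemma strengthened_Cauchy_Schwarz:
  fixes u :: "nat \<Rightarrow> 'a::euclidean_space \<Rightarrow> real" and \<gamma> C :: real
  assumes \<gamma>: "0 < \<gamma>" "\<gamma> < 1" and C: "0 \<le> C" and I: "finite I" and u: "\<And>j. j \<in> I \<Longrightarrow> u j \<in> L2 lborel"
    and D: "\<And>j r. j \<in> I \<Longrightarrow> 0 < r \<Longrightarrow> r \<le> 1 \<Longrightarrow> \<exists>\<tau>>0. \<forall>z. z \<noteq> 0 \<and> norm z \<le> \<tau> \<longrightarrow>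
        l2_norm (increment z (u j)) \<le> C * norm z / \<gamma> ^ j * l2_norm (u j) \<and>
        (\<forall>y \<sigma>. r \<le> \<sigma> \<and> \<sigma> \<le> 1 \<and> norm y \<le> \<sigma> * \<gamma> ^ j \<longrightarrow>
           l2_norm (increment y (increment z (u j))) \<le> C * norm z / \<gamma> ^ j * sqrt \<sigma> * l2_norm (u j))"
  shows "(l2_norm (increment z (\<lambda>x. \<Sum>j\<in>I. u j x)))\<^sup>2
    \<le> (C\<^sup>2 + 2 * C) * (2 / (1 - sqrt \<gamma>)) * (norm z)\<^sup>2 * (\<Sum>j\<in>I. (l2_norm (u j) / \<gamma> ^ j)\<^sup>2)"
proof (cases "z = 0 \<or> I = {}")
  case True
  have "0 \<le> (C\<^sup>2 + 2 * C) * (2 / (1 - sqrt \<gamma>)) * (norm z)\<^sup>2 * (\<Sum>j\<in>I. (l2_norm (u j) / \<gamma> ^ j)\<^sup>2)"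
    using C \<gamma> by (intro mult_nonneg_nonneg sum_nonneg) auto
  then show ?thesis using True by (auto simp: increment_def L2.nm_zero)
next
  case False
  then have z: "z \<noteq> 0" and I0: "I \<noteq> {}" by auto
  define m where "m = Max I"
  have m: "j \<le> m" if "j \<in> I" for j using that I by (simp add: m_def)
  \<comment> \<open>No ratio \<gamma> ^ (k - j) between two levels of \<open>I\<close> is smaller
    than this.\<close>
  define r where "r = \<gamma> ^ m"
  have r: "0 < r" "r \<le> 1" using \<gamma> by (auto simp: r_def power_le_one)
  define P where "P = (\<lambda>j z. l2_norm (increment z (u j)) \<le> C * norm z / \<gamma> ^ j * l2_norm (u j) \<and>
        (\<forall>y \<sigma>. r \<le> \<sigma> \<and> \<sigma> \<le> 1 \<and> norm y \<le> \<sigma> * \<gamma> ^ j \<longrightarrow>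
           l2_norm (increment y (increment z (u j))) \<le> C * norm z / \<gamma> ^ j * sqrt \<sigma> * l2_norm (u j)))"
  have "\<forall>j\<in>I. \<exists>\<tau>>0. \<forall>z. z \<noteq> 0 \<and> norm z \<le> \<tau> \<longrightarrow> P j z"
    unfolding P_def using D[OF _ r] by blast
  then obtain T where T: "\<And>j. j \<in> I \<Longrightarrow> 0 < T j" "\<And>j z. j \<in> I \<Longrightarrow> z \<noteq> 0 \<Longrightarrow> norm z \<le> T j \<Longrightarrow> P j z"
    by metis
  define \<tau> where "\<tau> = min r (Min (T ` I))"
  have \<tau>: "0 < \<tau>" "\<tau> \<le> r" "\<And>j. j \<in> I \<Longrightarrow> \<tau> \<le> T j"
    using r T(1) I I0 by (auto simp: \<tau>_def min_le_iff_disj)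
  obtain n where n: "norm z / \<tau> < real n" using reals_Archimedean2 by blast
  have n0: "0 < n" using n \<tau> z by (cases n) (auto simp: divide_less_0_iff not_less[symmetric])
  define \<zeta> where "\<zeta> = (1 / real n) *\<^sub>R z"
  have \<zeta>: "\<zeta> \<noteq> 0" "norm \<zeta> \<le> \<tau>" "z = real n *\<^sub>R \<zeta>" "norm \<zeta> = norm z / real n"
    using n n0 \<tau> z by (auto simp: \<zeta>_def field_simps)
  have PT: "P j \<zeta>" if "j \<in> I" for j using T(2)[OF that \<zeta>(1)] \<tau>(3)[OF that] \<zeta>(2) by linarith
  define b where "b = (\<lambda>j. l2_norm (u j) / \<gamma> ^ j)"
  have b0: "0 \<le> b j" if "j \<in> I" for j using \<gamma> u[OF that] by (simp add: b_def L2.nm_nonneg)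
  have dL: "increment \<zeta> (u j) \<in> L2 lborel" if "j \<in> I" for j using u[OF that] by (rule increment_L2)
  have cs: "\<bar>ip lborel (increment \<zeta> (u j)) (increment \<zeta> (u k))\<bar> \<le> (C\<^sup>2 + 2 * C) * (norm \<zeta>)\<^sup>2 * (sqrt \<gamma> ^ (k - j) * (b j * b k))"
    if j: "j \<in> I" and k: "k \<in> I" and jk: "j \<le> k" for j k
  proof -
    define \<sigma> where "\<sigma> = \<gamma> ^ (k - j)"
    \<comment> \<open>The step N \<zeta> is about as long as the finer mesh width \<gamma> ^ k and
      does not exceed it. For the coarser function that is the fraction \<sigma> of its own width,
      while 1 / N is at most 2 norm \<zeta> / \<gamma> ^ k.\<close>
    define N where "N = nat \<lfloor>\<gamma> ^ k / norm \<zeta>\<rfloor>"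
    have rk: "r \<le> \<gamma> ^ k" using m[OF k] \<gamma> by (auto simp: r_def intro: power_decreasing)
    have "1 \<le> \<gamma> ^ k / norm \<zeta>" using \<zeta>(1,2) \<tau>(2) rk by (simp add: le_divide_eq)
    then have N: "1 \<le> N" "real N \<le> \<gamma> ^ k / norm \<zeta>" "\<gamma> ^ k / norm \<zeta> < real N + 1" unfolding N_def by linarith+
    have N2: "1 / real N \<le> 2 * norm \<zeta> / \<gamma> ^ k"
    proof -
      have "\<gamma> ^ k / norm \<zeta> \<le> 2 * real N" using N by linarith
      then show ?thesis using N(1) \<gamma> \<zeta>(1) by (simp add: field_simps)
    qed
    have \<sigma>: "r \<le> \<sigma>" "\<sigma> \<le> 1" "\<sigma> * \<gamma> ^ j = \<gamma> ^ k"
      using m[OF k] \<gamma> jk by (auto simp: r_def \<sigma>_def power_le_one power_add[symmetric] intro: power_decreasing)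
    have s\<sigma>: "sqrt \<sigma> = sqrt \<gamma> ^ (k - j)" by (simp add: \<sigma>_def real_sqrt_power)
    define F where "F = C * norm \<zeta> * sqrt \<sigma> * b j"
    have F: "l2_norm (increment (real i *\<^sub>R \<zeta>) (increment \<zeta> (u j))) \<le> F" if "i \<le> N" for i
    proof -
      have "norm (real i *\<^sub>R \<zeta>) = real i * norm \<zeta>" by simp
      also have "\<dots> \<le> real N * norm \<zeta>" using that by (intro mult_right_mono) auto
      also have "\<dots> \<le> \<gamma> ^ k" using N(2) \<zeta>(1) by (simp add: pos_le_divide_eq)
      finally have "norm (real i *\<^sub>R \<zeta>) \<le> \<sigma> * \<gamma> ^ j" unfolding \<sigma>(3) .
      then have "l2_norm (increment (real i *\<^sub>R \<zeta>) (increment \<zeta> (u j))) \<le> C * norm \<zeta> / \<gamma> ^ j * sqrt \<sigma> * l2_norm (u j)"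
        using PT[OF j] \<sigma> unfolding P_def by blast
      then show ?thesis by (simp add: F_def b_def)
    qed
    have F0: "0 \<le> F" using C b0[OF j] r \<sigma> by (simp add: F_def)
    have "l2_norm (increment \<zeta> (u k)) \<le> C * norm \<zeta> * b k" using PT[OF k] by (simp add: P_def b_def)
    then have "F * l2_norm (increment \<zeta> (u k)) \<le> F * (C * norm \<zeta> * b k)" using F0 by (intro mult_left_mono)
    moreover have "F * l2_norm (u k) / real N \<le> F * (2 * norm \<zeta> * b k)"
    proof -
      have "F * l2_norm (u k) * (1 / real N) \<le> F * l2_norm (u k) * (2 * norm \<zeta> / \<gamma> ^ k)"
        using F0 u[OF k] by (intro mult_left_mono N2 mult_nonneg_nonneg L2.nm_nonneg)
      then show ?thesis by (simp add: b_def mult_ac)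
    qed
    moreover have "\<bar>ip lborel (increment \<zeta> (u j)) (increment \<zeta> (u k))\<bar> \<le> F * l2_norm (increment \<zeta> (u k)) + F * l2_norm (u k) / real N"
      by (rule ip_increment_increment_le) (use u j k N F in auto)
    ultimately have "\<bar>ip lborel (increment \<zeta> (u j)) (increment \<zeta> (u k))\<bar> \<le> F * (C * norm \<zeta> * b k) + F * (2 * norm \<zeta> * b k)"
      by linarith
    also have "\<dots> = (C\<^sup>2 + 2 * C) * (norm \<zeta>)\<^sup>2 * (sqrt \<gamma> ^ (k - j) * (b j * b k))"
      unfolding F_def s\<sigma> by (simp add: power2_eq_square algebra_simps)
    finally show ?thesis .
  qed
  have wL: "(\<lambda>x. \<Sum>j\<in>I. u j x) \<in> L2 lborel" using I u by (intro L2.sum_mem)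
  have "(l2_norm (increment \<zeta> (\<lambda>x. \<Sum>j\<in>I. u j x)))\<^sup>2 = (\<Sum>j\<in>I. \<Sum>k\<in>I. ip lborel (increment \<zeta> (u j)) (increment \<zeta> (u k)))"
  proof -
    have sL: "(\<lambda>x. \<Sum>j\<in>I. increment \<zeta> (u j) x) \<in> L2 lborel" using I dL by (intro L2.sum_mem)
    then show ?thesis using I dL unfolding increment_sum by (subst L2.nm_sq) (auto simp: L2.B_sum L2.B_sum_right)
  qed
  also have "\<dots> \<le> (\<Sum>j\<in>I. \<Sum>k\<in>I. (C\<^sup>2 + 2 * C) * (norm \<zeta>)\<^sup>2 * (sqrt \<gamma> ^ (if j \<le> k then k - j else j - k) * (b j * b k)))"
  proof (intro sum_mono)
    fix j k assume jk: "j \<in> I" "k \<in> I"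
    show "ip lborel (increment \<zeta> (u j)) (increment \<zeta> (u k)) \<le> (C\<^sup>2 + 2 * C) * (norm \<zeta>)\<^sup>2 * (sqrt \<gamma> ^ (if j \<le> k then k - j else j - k) * (b j * b k))"
    proof (cases "j \<le> k")
      case True
      with cs[OF jk] show ?thesis by simp
    next
      case False
      with cs[OF jk(2,1)] show ?thesis
        using L2.sym[OF dL dL, OF jk] by (simp add: mult.commute[of "b j"])
    qed
  qed
  also have "\<dots> = (C\<^sup>2 + 2 * C) * (norm \<zeta>)\<^sup>2 * (\<Sum>j\<in>I. \<Sum>k\<in>I. sqrt \<gamma> ^ (if j \<le> k then k - j else j - k) * (b j * b k))"
    by (simp only: sum_distrib_left)
  also have "\<dots> \<le> (C\<^sup>2 + 2 * C) * (norm \<zeta>)\<^sup>2 * (2 / (1 - sqrt \<gamma>) * (\<Sum>j\<in>I. (b j)\<^sup>2))"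
    using C \<gamma> I by (intro mult_left_mono schur_geometric) auto
  finally have 1: "(l2_norm (increment \<zeta> (\<lambda>x. \<Sum>j\<in>I. u j x)))\<^sup>2 \<le> (C\<^sup>2 + 2 * C) * (norm \<zeta>)\<^sup>2 * (2 / (1 - sqrt \<gamma>) * (\<Sum>j\<in>I. (b j)\<^sup>2))" .
  have "l2_norm (increment z (\<lambda>x. \<Sum>j\<in>I. u j x)) \<le> real n * l2_norm (increment \<zeta> (\<lambda>x. \<Sum>j\<in>I. u j x))"
    unfolding \<zeta>(3) by (rule l2_norm_increment_of_nat_scale_le[OF wL])
  then have "(l2_norm (increment z (\<lambda>x. \<Sum>j\<in>I. u j x)))\<^sup>2 \<le> (real n)\<^sup>2 * (l2_norm (increment \<zeta> (\<lambda>x. \<Sum>j\<in>I. u j x)))\<^sup>2"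
    by (simp add: power_mult_distrib[symmetric] power_mono L2.nm_nonneg increment_L2 wL)
  also have "\<dots> \<le> (real n)\<^sup>2 * ((C\<^sup>2 + 2 * C) * (norm \<zeta>)\<^sup>2 * (2 / (1 - sqrt \<gamma>) * (\<Sum>j\<in>I. (b j)\<^sup>2)))"
    by (intro mult_left_mono 1) auto
  also have "\<dots> = (C\<^sup>2 + 2 * C) * (2 / (1 - sqrt \<gamma>)) * ((real n)\<^sup>2 * (norm \<zeta>)\<^sup>2) * (\<Sum>j\<in>I. (b j)\<^sup>2)"
    by (simp add: mult_ac)
  also have "(real n)\<^sup>2 * (norm \<zeta>)\<^sup>2 = (norm z)\<^sup>2" using \<zeta>(4) n0 by (simp add: power_divide)
  finally show ?thesis by (simp add: b_def)
qed

section \<open>Finite element functions\<close>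

lemma bounded_support_integrable:
  fixes f :: "'a::euclidean_space \<Rightarrow> real"
  assumes "f \<in> borel_measurable borel" "\<And>x. \<bar>f x\<bar> \<le> M" "\<And>x. x \<notin> cball 0 R \<Longrightarrow> f x = 0"
  shows "integrable lborel f"
proof (rule integrableI_bounded_set[where A = "cball 0 R" and B = M])
  show "emeasure lborel (cball (0::'a) R) < \<infinity>" by (intro emeasure_bounded_finite) simp
qed (use assms in auto)

lemma bounded_support_L2:
  fixes f :: "'a::euclidean_space \<Rightarrow> real"
  assumes "f \<in> borel_measurable borel" "\<And>x. \<bar>f x\<bar> \<le> M" "\<And>x. x \<notin> cball 0 R \<Longrightarrow> f x = 0"
  shows "f \<in> L2 lborel"
proof -
  have "\<bar>(f x)\<^sup>2\<bar> \<le> M\<^sup>2" for x using assms(2)[of x] by (simp add: abs_le_square_iff power2_le_iff_abs_le)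
  with assms show ?thesis unfolding L2_def
    by (auto intro!: bounded_support_integrable[where R = R and M = "M\<^sup>2"] borel_measurable_power)
qed

locale fe_mesh =
  fixes \<Omega> :: "'a::euclidean_space set" and \<T> :: "'a set set"
  assumes open_dom: "open \<Omega>" and bdd_dom: "bounded \<Omega>" and mesh: "simplicial_mesh \<Omega> \<T>"
begin

abbreviation "V \<equiv> fe_space \<Omega> \<T>"

lemma finite_mesh: "finite \<T>"
  using mesh by (simp add: simplicial_mesh_def triangulation_def)

lemma cover: "\<Union>\<T> = closure \<Omega>"
  using mesh by (simp add: simplicial_mesh_def)

lemma simplexE:
  assumes "K \<in> \<T>"
  obtains C where "finite C" "\<not> affine_dependent C" "K = convex hull C"
proof -
  have "int DIM('a) simplex K" using mesh assms by (simp add: simplicial_mesh_def)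
  then obtain C where "\<not> affine_dependent C" "K = convex hull C" unfolding simplex_def by blast
  then show ?thesis using that aff_independent_finite by blast
qed

lemma cell_compact: "K \<in> \<T> \<Longrightarrow> compact K"
  by (metis simplexE finite_imp_compact compact_convex_hull)

lemma cell_convex: "K \<in> \<T> \<Longrightarrow> convex K"
  by (metis simplexE convex_convex_hull)

text \<open>A face that meets the interior of its cell is the whole cell; the common face of the two
  cells does so for both.\<close>

lemma cells_disjoint:
  assumes "K \<in> \<T>" "K' \<in> \<T>" "x \<in> interior K" "x \<in> interior K'"
  shows "K = K'"
proof -
  have f: "(K \<inter> K') face_of K" "(K' \<inter> K) face_of K'"
    using mesh assms(1,2) by (auto simp: simplicial_mesh_def triangulation_def)
  have "x \<in> K \<inter> K'" using assms(3,4) interior_subset by blast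
  then have "K \<inter> K' = K" "K' \<inter> K = K'"
    using face_of_disjoint_interior[OF f(1)] face_of_disjoint_interior[OF f(2)] assms(3,4) by blast+
  then show ?thesis by blast
qed

lemma fe_zero: "(\<lambda>x. 0) \<in> V"
  unfolding fe_space_def by (auto intro!: exI[of _ 0])

lemma fe_lin:
  assumes "u \<in> V" "v \<in> V"
  shows "(\<lambda>x. u x + r * v x) \<in> V"
proof -
  have "\<exists>g b. \<forall>x\<in>K. u x + r * v x = g \<bullet> x + b" if K: "K \<in> \<T>" for K
  proof -
    obtain g b where 1: "\<forall>x\<in>K. u x = g \<bullet> x + b" using assms(1) K unfolding fe_space_def by blast
    obtain g' b' where 2: "\<forall>x\<in>K. v x = g' \<bullet> x + b'" using assms(2) K unfolding fe_space_def by blast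
    have "\<forall>x\<in>K. u x + r * v x = (g + r *\<^sub>R g') \<bullet> x + (b + r * b')"
      using 1 2 by (simp add: inner_add_left algebra_simps)
    then show ?thesis by blast
  qed
  then show ?thesis using assms unfolding fe_space_def by (auto intro!: continuous_intros)
qed

lemma fe_outside: "v \<in> V \<Longrightarrow> x \<notin> \<Omega> \<Longrightarrow> v x = 0"
  by (simp add: fe_space_def)

lemma fe_continuous:
  assumes "v \<in> V"
  shows "continuous_on UNIV v"
proof -
  have "continuous_on (closure \<Omega>) v" using assms by (simp add: fe_space_def)
  moreover have "continuous_on (- \<Omega>) v"
    using fe_outside[OF assms] by (subst continuous_on_cong[of "- \<Omega>" "- \<Omega>" v "\<lambda>_. 0"]) auto
  ultimately have "continuous_on (closure \<Omega> \<union> - \<Omega>) v"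
    using open_dom by (intro continuous_on_closed_Un) auto
  moreover have "closure \<Omega> \<union> - \<Omega> = UNIV" using closure_subset[of \<Omega>] by auto
  ultimately show ?thesis by simp
qed

lemma fe_borel [measurable]: "v \<in> V \<Longrightarrow> v \<in> borel_measurable borel"
  using fe_continuous by (rule borel_measurable_continuous_onI)

text \<open>A segment may leave \<Omega> and cross many cells. Its intersections with the cells and
  with the complement of \<Omega> are finitely many closed sets that cover it, and v is Lipschitz on
  each, hence along the segment. The constant is crude and serves qualitative purposes only.\<close>

lemma fe_gradient:
  assumes "v \<in> V"
  obtains g b L where "\<And>K x. K \<in> \<T> \<Longrightarrow> x \<in> K \<Longrightarrow> v x = g K \<bullet> x + b K"
    "\<And>K. K \<in> \<T> \<Longrightarrow> norm (g K) \<le> L" "0 \<le> L" "\<And>x y. \<bar>v x - v y\<bar> \<le> L * norm (x - y)"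
proof -
  have "\<forall>K\<in>\<T>. \<exists>g b. \<forall>x\<in>K. v x = g \<bullet> x + b" using assms by (simp add: fe_space_def)
  then obtain g b where gb: "\<And>K x. K \<in> \<T> \<Longrightarrow> x \<in> K \<Longrightarrow> v x = g K \<bullet> x + b K" by metis
  define L where "L = (\<Sum>K\<in>\<T>. norm (g K))"
  have gL: "norm (g K) \<le> L" if "K \<in> \<T>" for K
    unfolding L_def using finite_mesh that by (intro member_le_sum) auto
  have L0: "0 \<le> L" by (simp add: L_def sum_nonneg)
  have "\<bar>v x - v y\<bar> \<le> L * norm (x - y)" for x y
  proof -
    define p where "p = (\<lambda>t::real. x + t *\<^sub>R (y - x))"
    have cont: "continuous_on UNIV p" unfolding p_def by (intro continuous_intros)
    let ?I = "insert (- \<Omega>) \<T>"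
    have "(L * norm (y - x))-lipschitz_on {0..1} (v \<circ> p)"
    proof (rule lipschitz_on_closed_Union[where I = ?I and U = "\<lambda>K. p -` K"])
      show "finite ?I" using finite_mesh by simp
      show "0 \<le> L * norm (y - x)" using L0 by simp
      show "closed (p -` K)" if "K \<in> ?I" for K
        using that open_dom cell_compact cont by (intro closed_vimage) (auto intro: compact_imp_closed)
      show "{0..1} \<subseteq> (\<Union>K\<in>?I. p -` K)"
        using cover closure_subset[of \<Omega>] by fastforce
      show "(L * norm (y - x))-lipschitz_on (p -` K) (v \<circ> p)" if K: "K \<in> ?I" for K
      proof (cases "K \<in> \<T>")
        case True
        show ?thesis
        proof (rule lipschitz_onI)
          fix t t' assume t: "t \<in> p -` K" "t' \<in> p -` K"
          have "dist ((v \<circ> p) t) ((v \<circ> p) t') = \<bar>g K \<bullet> (p t - p t')\<bar>"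
            using t gb[OF True] by (simp add: dist_real_def inner_diff_right)
          also have "\<dots> \<le> norm (g K) * norm (p t - p t')" by (rule Cauchy_Schwarz_ineq2)
          also have "p t - p t' = (t - t') *\<^sub>R (y - x)" by (simp add: p_def algebra_simps)
          also have "norm (g K) * norm ((t - t') *\<^sub>R (y - x)) \<le> L * norm (y - x) * dist t t'"
            using mult_right_mono[OF gL[OF True], of "\<bar>t - t'\<bar> * norm (y - x)"] by (simp add: dist_real_def mult_ac)
          finally show "dist ((v \<circ> p) t) ((v \<circ> p) t') \<le> L * norm (y - x) * dist t t'" .
        qed (use L0 in simp)
      next
        case False
        with K have "K = - \<Omega>" by simp
        then show ?thesis using L0 fe_outside[OF assms] by (intro lipschitz_onI) auto
      qed
    qed
    then have "dist ((v \<circ> p) 0) ((v \<circ> p) 1) \<le> L * norm (y - x) * dist (0::real) 1"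
      by (rule lipschitz_onD) auto
    then show ?thesis by (simp add: p_def dist_real_def norm_minus_commute)
  qed
  with gb gL L0 that show thesis by blast
qed

lemma fe_bounded:
  assumes "v \<in> V"
  obtains M where "\<And>x. \<bar>v x\<bar> \<le> M"
proof -
  have "compact (v ` closure \<Omega>)"
    using fe_continuous[OF assms] bdd_dom by (intro compact_continuous_image) (auto intro: continuous_on_subset)
  then obtain M where M: "\<And>x. x \<in> closure \<Omega> \<Longrightarrow> \<bar>v x\<bar> \<le> M"
    by (metis bounded_real compact_imp_bounded imageI)
  have "\<bar>v x\<bar> \<le> max M 0" for x
    using M[of x] fe_outside[OF assms, of x] closure_subset[of \<Omega>] by (cases "x \<in> \<Omega>") (auto simp: max_def)
  then show thesis using that by blast
qed

lemma fe_L2: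
  assumes "v \<in> V"
  shows "v \<in> L2 lborel"
proof -
  obtain M where M: "\<And>x. \<bar>v x\<bar> \<le> M" using fe_bounded[OF assms] by blast
  obtain R where "\<And>x. x \<in> \<Omega> \<Longrightarrow> norm x \<le> R" using bdd_dom by (auto simp: bounded_iff)
  then have "x \<notin> cball 0 R \<Longrightarrow> v x = 0" for x using fe_outside[OF assms, of x] by auto
  with M show ?thesis using assms by (intro bounded_support_L2) auto
qed

lemma l2_inner_eq_ip:
  assumes "u \<in> V"
  shows "l2_inner \<Omega> u w = ip lborel u w"
proof -
  have "indicator \<Omega> x *\<^sub>R (u x * w x) = u x * w x" for x
    using fe_outside[OF assms, of x] by (cases "x \<in> \<Omega>") auto
  then show ?thesis unfolding l2_inner_def ip_def set_lebesgue_integral_def by (simp only:)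
qed

lemma fe_ip_zero:
  assumes "v \<in> V" "ip lborel v v = 0"
  shows "v = (\<lambda>x. 0)"
proof (rule ccontr)
  assume "v \<noteq> (\<lambda>x. 0)"
  then obtain x where x: "v x \<noteq> 0" by auto
  define U where "U = {x. v x \<noteq> 0}"
  have "U = v -` (- {0})" by (auto simp: U_def)
  then have oU: "open U" using open_vimage[OF _ fe_continuous[OF assms(1)], of "- {0}"] by auto
  have "integrable lborel (\<lambda>x. (v x)\<^sup>2)" using fe_L2[OF assms(1)] by (simp add: L2_def)
  moreover have "(LINT x|lborel. (v x)\<^sup>2) = 0" using assms(2) by (simp add: ip_def power2_eq_square)
  ultimately have "AE x in lborel. (v x)\<^sup>2 = 0" by (subst (asm) integral_nonneg_eq_0_iff_AE) auto
  then have "AE x in lebesgue. x \<notin> U" by (auto simp: U_def intro: AE_completion)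
  then have "negligible U" unfolding negligible_iff_null_sets by (auto simp: AE_iff_null_sets oU)
  then show False using open_not_negligible[OF oU] x by (auto simp: U_def)
qed

text \<open>Vertex values determine a finite element function: if they vanish, the zero set of each
  affine piece is convex and contains the vertices of the cell, hence the cell.\<close>

lemma fe_separating: "\<exists>P. finite P \<and> (\<forall>v\<in>V. (\<forall>p\<in>P. v p = 0) \<longrightarrow> v = (\<lambda>x. 0))"
proof -
  have "\<forall>K\<in>\<T>. \<exists>C. finite C \<and> K = convex hull C" by (metis simplexE)
  then obtain C where C: "\<And>K. K \<in> \<T> \<Longrightarrow> finite (C K)" "\<And>K. K \<in> \<T> \<Longrightarrow> K = convex hull (C K)" by metis
  have "v x = 0" if v: "v \<in> V" and P: "\<forall>p\<in>\<Union>(C ` \<T>). v p = 0" for v x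
  proof (cases "x \<in> \<Omega>")
    case True
    then obtain K where K: "K \<in> \<T>" "x \<in> K" using cover closure_subset[of \<Omega>] by blast
    obtain g b where gb: "\<forall>x\<in>K. v x = g \<bullet> x + b" using v K unfolding fe_space_def by blast
    have "K \<subseteq> {x. g \<bullet> x = - b}"
    proof -
      have "p \<in> K" if "p \<in> C K" for p using C(2)[OF K(1)] hull_inc[OF that] by metis
      then have "C K \<subseteq> {x. g \<bullet> x = - b}" using P K(1) gb by fastforce
      then show ?thesis using C(2)[OF K(1)] hull_minimal[of "C K" "{x. g \<bullet> x = - b}" convex] convex_hyperplane[of g "- b"] by metis
    qed
    then show ?thesis using K gb by auto
  qed (use v fe_outside in blast)
  then show ?thesis using finite_mesh C(1) by (intro exI[of _ "\<Union>(C ` \<T>)"]) auto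
qed

lemma fin_ip_fe: "fin_ip V (ip lborel)"
proof
  show "(\<lambda>x. 0) \<in> V" by (rule fe_zero)
  show "(\<lambda>x. u x + r * v x) \<in> V" if "u \<in> V" "v \<in> V" for u v r by (rule fe_lin[OF that])
  show "ip lborel u v = ip lborel v u" if "u \<in> V" "v \<in> V" for u v by (intro L2.sym fe_L2 that)
  show "ip lborel (\<lambda>x. u x + r * v x) w = ip lborel u w + r * ip lborel v w"
    if "u \<in> V" "v \<in> V" "w \<in> V" for u v w r by (intro L2.lin fe_L2 that)
  show "0 \<le> ip lborel u u" if "u \<in> V" for u by (intro L2.nonneg fe_L2 that)
  show "u = (\<lambda>x. 0)" if "u \<in> V" "ip lborel u u = 0" for u by (rule fe_ip_zero[OF that])
  show "\<exists>P. finite P \<and> (\<forall>v\<in>V. (\<forall>p\<in>P. v p = 0) \<longrightarrow> v = (\<lambda>x. 0))" by (rule fe_separating)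
qed

end

section \<open>Boundary layers of cells, inverse estimates and differences of finite element
  functions\<close>

lemma bounded_fmeasurable: "A \<in> sets borel \<Longrightarrow> bounded A \<Longrightarrow> A \<in> fmeasurable lborel"
  for A :: "'a::euclidean_space set"
  using emeasure_bounded_finite[of A] by (simp add: fmeasurable_def top.not_eq_extremum)

text \<open>The points of K near its boundary, relative to its size. Removing a contracted copy,
  instead of a neighbourhood of the boundary, makes the measure explicit without any surface
  area.\<close>

definition layer :: "'a::euclidean_space set \<Rightarrow> 'a \<Rightarrow> real \<Rightarrow> 'a set" where
  "layer K a \<tau> = K - (\<lambda>x. (1 - \<tau>) *\<^sub>R x + \<tau> *\<^sub>R a) ` K"

text \<open>If x lay in the contracted copy, x = (1 - \<tau>) y + \<tau> a, then x + z would be the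
  same combination of y and a + z / \<tau>, which is interior to K; so x + z would be interior
  too.\<close>

lemma layer_escape:
  assumes K: "convex K" "cball a r \<subseteq> K" and \<tau>: "0 < \<tau>" "\<tau> \<le> 1"
    and x: "x \<in> K" "x + z \<notin> interior K" "norm z < \<tau> * r"
  shows "x \<in> layer K a \<tau>"
proof (rule ccontr)
  assume "x \<notin> layer K a \<tau>"
  with x(1) obtain y where y: "y \<in> K" "x = (1 - \<tau>) *\<^sub>R y + \<tau> *\<^sub>R a" by (auto simp: layer_def)
  define p where "p = a + (1 / \<tau>) *\<^sub>R z"
  have "p \<in> ball a r" using x(3) \<tau> by (simp add: p_def dist_norm field_simps)
  moreover have "ball a r \<subseteq> interior K" using K(2) ball_subset_cball[of a r] by (intro interior_maximal) auto
  ultimately have "p \<in> interior K" by blast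
  from mem_interior_convex_shrink[OF K(1) this y(1) \<tau>]
  have "y - \<tau> *\<^sub>R (y - p) \<in> interior K" .
  moreover have "y - \<tau> *\<^sub>R (y - p) = x + z" using \<tau> by (simp add: y(2) p_def algebra_simps)
  ultimately show False using x(2) by simp
qed

lemma layer_sets [measurable]: "compact K \<Longrightarrow> layer K a \<tau> \<in> sets borel"
  unfolding layer_def
  by (intro sets.Diff borel_compact compact_continuous_image continuous_intros) auto

text \<open>The complement of a copy scaled by 1 - \<tau> has the fraction 1 - (1 - \<tau>) ^ d of
  the volume, at most d \<tau> by Bernoulli.\<close>

lemma layer_measure:
  fixes K :: "'a::euclidean_space set"
  assumes K: "compact K" "convex K" "a \<in> K" and \<tau>: "0 \<le> \<tau>" "\<tau> \<le> 1"
  shows "measure lborel (layer K a \<tau>) \<le> real DIM('a) * \<tau> * measure lborel K"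
proof -
  let ?I = "(\<lambda>x. (1 - \<tau>) *\<^sub>R x + \<tau> *\<^sub>R a) ` K"
  have Ic: "compact ?I" by (intro compact_continuous_image continuous_intros K)
  have IK: "?I \<subseteq> K" using K \<tau> by (auto intro!: convexD)
  have "measure lborel (layer K a \<tau>) = measure lborel K - measure lborel ?I"
    unfolding layer_def using K(1) Ic IK emeasure_bounded_finite[OF compact_imp_bounded[OF K(1)]]
    by (intro measure_Diff) (auto intro: borel_compact)
  also have "measure lborel ?I = measure lebesgue ?I"
    using Ic by (simp add: measure_completion borel_compact)
  also have "\<dots> = \<bar>1 - \<tau>\<bar> ^ DIM('a) * measure lebesgue K" by (rule measure_lebesgue_affine)
  also have "measure lebesgue K = measure lborel K" using K(1) by (simp add: measure_completion borel_compact)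
  also have "measure lborel K - \<bar>1 - \<tau>\<bar> ^ DIM('a) * measure lborel K = (1 - (1 - \<tau>) ^ DIM('a)) * measure lborel K"
    using \<tau> by (simp add: algebra_simps)
  also have "\<dots> \<le> real DIM('a) * \<tau> * measure lborel K"
    using Bernoulli_inequality[of "- \<tau>" "DIM('a)"] \<tau> by (intro mult_right_mono) auto
  finally show ?thesis .
qed

text \<open>Half a radius away from the centre, in the direction along the gradient in which the
  absolute value of u grows, there is a ball of radius r / 4 on which that value is at least norm g
  * r / 4.\<close>

lemma affine_inverse_estimate:
  fixes u :: "'a::euclidean_space \<Rightarrow> real"
  assumes K: "cball a r \<subseteq> K" "0 < r" and u: "\<And>x. x \<in> K \<Longrightarrow> u x = g \<bullet> x + b"
    and int: "integrable lborel (\<lambda>x. indicator (interior K) x * (u x)\<^sup>2)"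
  shows "(norm g)\<^sup>2 * (r\<^sup>2 / 16 * (unit_ball_vol DIM('a) * (r / 4) ^ DIM('a))) \<le> (LINT x|lborel. indicator (interior K) x * (u x)\<^sup>2)"
proof (cases "g = 0")
  case True
  then show ?thesis by (auto intro!: integral_nonneg_AE)
next
  case False
  \<comment> \<open>The sign of u at the centre, so that moving along \<epsilon> g leads away from
    the zero set.\<close>
  define \<epsilon> :: real where "\<epsilon> = (if 0 \<le> u a then 1 else - 1)"
  define p where "p = a + (\<epsilon> * r / 2 / norm g) *\<^sub>R g"
  have \<epsilon>: "\<bar>\<epsilon>\<bar> = 1" "\<epsilon> * \<epsilon> = 1" "\<bar>u a\<bar> = \<epsilon> * u a" by (auto simp: \<epsilon>_def)
  have pa: "dist a p = r / 2" using False \<epsilon> K(2) by (simp add: p_def dist_norm abs_mult)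
  have aK: "a \<in> K" using K by auto
  have sub: "ball p (r / 4) \<subseteq> interior K"
  proof (rule interior_maximal)
    show "ball p (r / 4) \<subseteq> K"
    proof
      fix x assume "x \<in> ball p (r / 4)"
      then have "dist a x \<le> r" using dist_triangle[of a x p] pa K(2) by simp
      then show "x \<in> K" using K by auto
    qed
  qed simp
  have low: "(norm g * r / 4)\<^sup>2 \<le> (u x)\<^sup>2" if x: "x \<in> ball p (r / 4)" for x
  proof -
    have xK: "x \<in> K" using that sub interior_subset by blast
    have "\<bar>g \<bullet> (x - p)\<bar> \<le> norm g * norm (x - p)" by (rule Cauchy_Schwarz_ineq2)
    also have "\<dots> \<le> norm g * (r / 4)" using x by (intro mult_left_mono) (auto simp: dist_norm norm_minus_commute)
    finally have 1: "\<bar>\<epsilon> * (g \<bullet> (x - p))\<bar> \<le> norm g * (r / 4)" using \<epsilon> by (simp add: abs_mult)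
    have 2: "\<epsilon> * (g \<bullet> (p - a)) = norm g * r / 2"
    proof -
      have "g \<bullet> (p - a) = \<epsilon> * r / 2 / norm g * (norm g)\<^sup>2" by (simp add: p_def power2_norm_eq_inner)
      also have "\<epsilon> * \<dots> = (\<epsilon> * \<epsilon>) * (r / 2 * norm g)" using False by (simp add: power2_eq_square)
      finally show ?thesis using \<epsilon> by simp
    qed
    have "\<epsilon> * u x = \<epsilon> * u a + \<epsilon> * (g \<bullet> (p - a)) + \<epsilon> * (g \<bullet> (x - p))"
      using u[OF xK] u[OF aK] by (simp add: inner_diff_right algebra_simps)
    then have "norm g * r / 4 \<le> \<epsilon> * u x" using 1 2 \<epsilon>(3) by (simp add: field_simps)
    also have "\<dots> \<le> \<bar>u x\<bar>" using \<epsilon>(1) by (metis abs_ge_self abs_mult mult_1)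
    finally have "norm g * r / 4 \<le> \<bar>u x\<bar>" .
    then show ?thesis using K(2) by (simp add: abs_le_square_iff[symmetric])
  qed
  have "(norm g)\<^sup>2 * (r\<^sup>2 / 16 * (unit_ball_vol DIM('a) * (r / 4) ^ DIM('a))) = (norm g * r / 4)\<^sup>2 * measure lborel (ball p (r / 4))"
    using K(2) by (simp add: content_ball power_mult_distrib power_divide)
  also have "\<dots> = (LINT x|lborel. (norm g * r / 4)\<^sup>2 * indicator (ball p (r / 4)) x)" by simp
  also have "\<dots> \<le> (LINT x|lborel. indicator (interior K) x * (u x)\<^sup>2)"
  proof (rule integral_mono[OF _ int])
    show "integrable lborel (\<lambda>x. (norm g * r / 4)\<^sup>2 * indicator (ball p (r / 4)) x)"
      using emeasure_bounded_finite[of "ball p (r / 4)"] by auto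
    show "(norm g * r / 4)\<^sup>2 * indicator (ball p (r / 4)) x \<le> indicator (interior K) x * (u x)\<^sup>2" for x
      using low[of x] sub by (auto simp: indicator_def)
  qed
  finally show ?thesis .
qed

text \<open>The constant of the inverse inequality: \<open>16 / \<rho>\<^sup>2\<close> undoes the
  factor \<open>r\<^sup>2 / 16\<close> of the cell estimate, and the power compares the volume of a
  cell with that of a ball of radius \<open>\<rho> * t / 4\<close>.\<close>

definition inverse_const :: "nat \<Rightarrow> real \<Rightarrow> real \<Rightarrow> real" where
  "inverse_const d \<rho> c = 16 / \<rho>\<^sup>2 * (4 * c / \<rho>) ^ d"

text \<open>The level is measured by a reference length \<open>t\<close>, later \<gamma> ^ k, in
  terms of which inscribed balls and diameters of all cells are bounded.\<close>

locale fe_level = fe_mesh +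
  fixes t \<rho> c :: real
  assumes t: "0 < t" and \<rho>: "0 < \<rho>" and c: "0 \<le> c"
    and inball: "\<And>K. K \<in> \<T> \<Longrightarrow> \<exists>a. cball a (\<rho> * t) \<subseteq> K"
    and diam: "\<And>K. K \<in> \<T> \<Longrightarrow> diameter K \<le> c * t"
begin

lemma inv_const_nonneg: "0 \<le> inverse_const DIM('a) \<rho> c"
  using \<rho> c by (simp add: inverse_const_def)

lemma cell_measure_le: "K \<in> \<T> \<Longrightarrow> measure lborel K \<le> unit_ball_vol DIM('a) * (c * t) ^ DIM('a)"
proof -
  assume K: "K \<in> \<T>"
  show ?thesis
  proof (cases "K = {}")
    case False
    then obtain x where x: "x \<in> K" by blast
    have "K \<subseteq> cball x (c * t)"
      using diameter_bounded_bound[OF compact_imp_bounded[OF cell_compact[OF K]] x] diam[OF K] by force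
    then have "measure lborel K \<le> measure lborel (cball x (c * t))"
      using cell_compact[OF K] by (intro measure_mono_fmeasurable bounded_fmeasurable) (auto intro: borel_compact)
    then show ?thesis using c t by (simp add: content_cball)
  qed (use c t in simp)
qed

lemma sum_indicator_cell:
  assumes "K \<in> \<T>" "x \<in> interior K"
  shows "(\<Sum>K'\<in>\<T>. f K' * indicat_real (interior K') x) = f K"
proof -
  have "indicat_real (interior K') x = 0" if "K' \<in> \<T> - {K}" for K'
    using cells_disjoint[OF _ assms(1) _ assms(2), of K'] that by (auto simp: indicator_def)
  then have "(\<Sum>K'\<in>\<T>. f K' * indicat_real (interior K') x) = (\<Sum>K'\<in>{K}. f K' * indicat_real (interior K') x)"
    using assms(1) finite_mesh by (intro sum.mono_neutral_right) auto
  then show ?thesis using assms(2) by simp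
qed

text \<open>The inverse inequality: the left side is the Dirichlet energy of v. The cell estimates
  add up because the interiors of cells are disjoint.\<close>

lemma gradient_energy_le:
  assumes v: "v \<in> V" and g: "\<And>K x. K \<in> \<T> \<Longrightarrow> x \<in> K \<Longrightarrow> v x = g K \<bullet> x + b K"
  shows "(\<Sum>K\<in>\<T>. (norm (g K))\<^sup>2 * measure lborel K) \<le> inverse_const DIM('a) \<rho> c / t\<^sup>2 * ip lborel v v"
proof -
  let ?d = "DIM('a)" and ?w = "unit_ball_vol (real DIM('a))"
  have w: "0 < ?w" by (rule unit_ball_vol_pos) simp
  have L2v: "integrable lborel (\<lambda>x. (v x)\<^sup>2)" using fe_L2[OF v] by (simp add: L2_def)
  have int: "integrable lborel (\<lambda>x. indicator (interior K) x * (v x)\<^sup>2)" for K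
    using integrable_mult_indicator[OF _ L2v, of "interior K"] by simp
  have cell: "(norm (g K))\<^sup>2 * measure lborel K \<le> inverse_const DIM('a) \<rho> c / t\<^sup>2 * (LINT x|lborel. indicator (interior K) x * (v x)\<^sup>2)"
    if K: "K \<in> \<T>" for K
  proof -
    obtain a where a: "cball a (\<rho> * t) \<subseteq> K" using inball[OF K] by blast
    let ?r = "\<rho> * t"
    have r: "0 < ?r" using \<rho> t by simp
    have "(norm (g K))\<^sup>2 * measure lborel K \<le> (norm (g K))\<^sup>2 * (?w * (c * t) ^ ?d)"
      by (intro mult_left_mono cell_measure_le K) auto
    also have "\<dots> = inverse_const DIM('a) \<rho> c / t\<^sup>2 * ((norm (g K))\<^sup>2 * (?r\<^sup>2 / 16 * (?w * (?r / 4) ^ ?d)))"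
    proof -
      have "inverse_const DIM('a) \<rho> c / t\<^sup>2 * (?r\<^sup>2 / 16 * (?w * (?r / 4) ^ ?d)) = ?w * ((4 * c / \<rho>) * (?r / 4)) ^ ?d"
        using \<rho> t by (simp add: inverse_const_def power_mult_distrib field_simps)
      also have "(4 * c / \<rho>) * (?r / 4) = c * t" using \<rho> by simp
      finally have "inverse_const DIM('a) \<rho> c / t\<^sup>2 * (?r\<^sup>2 / 16 * (?w * (?r / 4) ^ ?d)) = ?w * (c * t) ^ ?d" .
      then show ?thesis by (simp only: mult.left_commute[of _ "(norm (g K))\<^sup>2"])
    qed
    also have "\<dots> \<le> inverse_const DIM('a) \<rho> c / t\<^sup>2 * (LINT x|lborel. indicator (interior K) x * (v x)\<^sup>2)"
      using inv_const_nonneg affine_inverse_estimate[OF a r g[OF K] int] by (intro mult_left_mono) auto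
    finally show ?thesis .
  qed
  have "(\<Sum>K\<in>\<T>. (norm (g K))\<^sup>2 * measure lborel K) \<le> (\<Sum>K\<in>\<T>. inverse_const DIM('a) \<rho> c / t\<^sup>2 * (LINT x|lborel. indicator (interior K) x * (v x)\<^sup>2))"
    by (intro sum_mono cell)
  also have "\<dots> = inverse_const DIM('a) \<rho> c / t\<^sup>2 * (LINT x|lborel. (\<Sum>K\<in>\<T>. indicator (interior K) x * (v x)\<^sup>2))"
    using int by (subst Bochner_Integration.integral_sum) (auto simp only: sum_distrib_left)
  also have "\<dots> \<le> inverse_const DIM('a) \<rho> c / t\<^sup>2 * (LINT x|lborel. (v x)\<^sup>2)"
  proof (intro mult_left_mono integral_mono)
    fix x
    show "(\<Sum>K\<in>\<T>. indicator (interior K) x * (v x)\<^sup>2) \<le> (v x)\<^sup>2"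
    proof (cases "\<exists>K\<in>\<T>. x \<in> interior K")
      case True
      then obtain K where K: "K \<in> \<T>" "x \<in> interior K" by blast
      show ?thesis using sum_indicator_cell[OF K, of "\<lambda>_. (v x)\<^sup>2"] by (simp add: mult.commute)
    next
      case False
      then have "(\<Sum>K\<in>\<T>. indicator (interior K) x * (v x)\<^sup>2) = 0" by (intro sum.neutral) auto
      then show ?thesis by simp
    qed
  qed (use int L2v inv_const_nonneg in auto)
  finally show ?thesis by (simp add: ip_def power2_eq_square)
qed

text \<open>Supplies the hypothesis of \<open>strengthened_Cauchy_Schwarz\<close>. Split
  \<open>increment z v\<close> into \<open>G z\<close>, the piecewise constant derivative of v in
  direction z, and an error \<open>E z\<close>. The error is at most of order norm z and lives on a
  set of measure proportional to norm z, so its norm is of order \<open>norm z powr (3/2)\<close>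
  and can be absorbed for short steps. \<open>G z\<close> jumps only across faces: its increment of
  step y lives on layers of relative thickness proportional to \<sigma>, whose volume contributes
  \<open>sqrt \<sigma>\<close>, and the inverse inequality bounds the gradient.\<close>

lemma difference_estimates_ex:
  assumes v: "v \<in> V" and r: "0 < r"
  shows "\<exists>\<tau>0>0. \<forall>z. z \<noteq> 0 \<and> norm z \<le> \<tau>0 \<longrightarrow>
    l2_norm (increment z v) \<le> ((1 + sqrt (8 * real DIM('a) / \<rho>)) * sqrt (inverse_const DIM('a) \<rho> c) + 2) * norm z / t * l2_norm v \<and>
    (\<forall>y \<sigma>. r \<le> \<sigma> \<and> \<sigma> \<le> 1 \<and> norm y \<le> \<sigma> * t \<longrightarrow>
      l2_norm (increment y (increment z v)) \<le> ((1 + sqrt (8 * real DIM('a) / \<rho>)) * sqrt (inverse_const DIM('a) \<rho> c) + 2) * norm z / t * sqrt \<sigma> * l2_norm v)"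
proof (cases "l2_norm v = 0")
  case True
  then have "v = (\<lambda>x. 0)" using fe_ip_zero[OF v] L2.nm_sq[OF fe_L2[OF v]] by simp
  then have "increment z v = (\<lambda>x. 0)" "increment y (\<lambda>x. 0) = (\<lambda>x. 0)" for z y :: 'a by (auto simp: increment_def)
  then show ?thesis using True by (intro exI[of _ 1]) (simp add: L2.nm_zero)
next
  case False
  have vL: "v \<in> L2 lborel" by (rule fe_L2[OF v])
  have nv: "0 < l2_norm v" using False L2.nm_nonneg[OF vL] by simp
  let ?d = "real DIM('a)"
  obtain g b L where gb: "\<And>K x. K \<in> \<T> \<Longrightarrow> x \<in> K \<Longrightarrow> v x = g K \<bullet> x + b K"
    and gL: "\<And>K. K \<in> \<T> \<Longrightarrow> norm (g K) \<le> L" and L0: "0 \<le> L" and Lip: "\<And>x y. \<bar>v x - v y\<bar> \<le> L * norm (x - y)"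
    using fe_gradient[OF v] by blast
  define \<Gamma> where "\<Gamma> = (\<Sum>K\<in>\<T>. (norm (g K))\<^sup>2 * measure lborel K)"
  have \<Gamma>0: "0 \<le> \<Gamma>" unfolding \<Gamma>_def by (intro sum_nonneg) auto
  have "\<Gamma> \<le> inverse_const DIM('a) \<rho> c / t\<^sup>2 * (l2_norm v)\<^sup>2" unfolding \<Gamma>_def L2.nm_sq[OF vL] by (rule gradient_energy_le[OF v gb])
  then have "sqrt \<Gamma> \<le> sqrt (inverse_const DIM('a) \<rho> c / t\<^sup>2 * (l2_norm v)\<^sup>2)" by (rule real_sqrt_le_mono)
  then have s\<Gamma>: "sqrt \<Gamma> \<le> sqrt (inverse_const DIM('a) \<rho> c) / t * l2_norm v" using t nv by (simp add: real_sqrt_mult real_sqrt_divide)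
  obtain a where a: "\<And>K. K \<in> \<T> \<Longrightarrow> cball (a K) (\<rho> * t) \<subseteq> K" using inball by metis
  have rt: "0 < \<rho> * t" using \<rho> t by simp
  have aK: "a K \<in> K" if "K \<in> \<T>" for K using a[OF that] rt by auto
  \<comment> \<open>Counts the layers containing x. Where it vanishes at both x and x + z, the error
    \<open>E z\<close> vanishes at x.\<close>
  define lam where "lam = (\<lambda>\<tau> x. \<Sum>K\<in>\<T>. indicat_real (layer K (a K) \<tau>) x)"
  define G where "G = (\<lambda>z x. \<Sum>K\<in>\<T>. (g K \<bullet> z) * indicat_real (interior K) x)"
  have Gin: "G z x = g K \<bullet> z" if "K \<in> \<T>" "x \<in> interior K" for K z x
    unfolding G_def by (rule sum_indicator_cell[OF that])
  have Gout: "G z x = 0" if "\<And>K. K \<in> \<T> \<Longrightarrow> x \<notin> interior K" for z x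
    unfolding G_def using that by (intro sum.neutral) auto
  have indL2: "indicat_real A \<in> L2 lborel" if A: "A \<in> sets borel" "bounded A" for A :: "'a set"
  proof -
    obtain R where "A \<subseteq> cball 0 R" using A(2) by (force simp: bounded_iff)
    then show ?thesis using A by (intro bounded_support_L2[where R = R and M = 1]) (auto simp: indicator_def)
  qed
  have bK: "bounded K" if "K \<in> \<T>" for K using cell_compact[OF that] by (rule compact_imp_bounded)
  have layL2: "indicat_real (layer K (a K) \<tau>) \<in> L2 lborel" if "K \<in> \<T>" for K \<tau>
    using layer_sets[OF cell_compact[OF that]] bounded_subset[OF bK[OF that], of "layer K (a K) \<tau>"]
    by (intro indL2) (auto simp: layer_def)
  have intL2: "indicat_real (interior K) \<in> L2 lborel" if "K \<in> \<T>" for K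
    using bounded_subset[OF bK[OF that] interior_subset] by (intro indL2) auto
  have lamL2: "lam \<tau> \<in> L2 lborel" for \<tau> unfolding lam_def by (intro L2.sum_mem finite_mesh layL2)
  have GL2: "G z \<in> L2 lborel" for z unfolding G_def by (intro L2.sum_mem finite_mesh L2.scale_mem intL2)
  have ind_int: "(LINT x|lborel. indicat_real (layer K (a K) \<tau>) x) \<le> ?d * \<tau> * measure lborel K"
    if "K \<in> \<T>" "0 \<le> \<tau>" "\<tau> \<le> 1" for K \<tau>
    using layer_measure[OF cell_compact[OF that(1)] cell_convex[OF that(1)] aK[OF that(1)] that(2,3)] by simp
  have ind_integrable: "integrable lborel (indicat_real (layer K (a K) \<tau>))" if "K \<in> \<T>" for K \<tau>
  proof -
    have "(\<lambda>x. (indicat_real (layer K (a K) \<tau>) x)\<^sup>2) = indicat_real (layer K (a K) \<tau>)" by (auto simp: indicator_def)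
    then show ?thesis using layL2[OF that, of \<tau>] by (simp add: L2_def)
  qed
  define N where "N = real (card \<T>)"
  define M where "M = (\<Sum>K\<in>\<T>. measure lborel K)"
  have NM: "0 \<le> N" "0 \<le> M" by (auto simp: N_def M_def intro!: sum_nonneg)
  \<comment> \<open>The count is bounded by the number of cells, which depends on the mesh. Only the
    linear factor \<tau> matters, since this bound enters an error that will be absorbed.\<close>
  have lam_n2: "(l2_norm (lam \<tau>))\<^sup>2 \<le> N * (?d * \<tau> * M)" if "0 \<le> \<tau>" "\<tau> \<le> 1" for \<tau>
  proof -
    have lam: "0 \<le> lam \<tau> x" "lam \<tau> x \<le> N" for x
      unfolding lam_def N_def using sum_bounded_above[of \<T> "\<lambda>K. indicat_real (layer K (a K) \<tau>) x" 1]
      by (auto intro!: sum_nonneg simp: indicator_def)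
    have lint: "integrable lborel (lam \<tau>)" unfolding lam_def using ind_integrable by (intro Bochner_Integration.integrable_sum)
    have "(l2_norm (lam \<tau>))\<^sup>2 = (LINT x|lborel. (lam \<tau> x)\<^sup>2)" unfolding L2.nm_sq[OF lamL2] by (simp add: ip_def power2_eq_square)
    also have "\<dots> \<le> (LINT x|lborel. N * lam \<tau> x)"
      using lamL2[of \<tau>] lint lam by (intro integral_mono) (auto simp: L2_def power2_eq_square intro: mult_right_mono)
    also have "\<dots> = N * (\<Sum>K\<in>\<T>. LINT x|lborel. indicat_real (layer K (a K) \<tau>) x)"
      unfolding lam_def using ind_integrable by simp
    also have "\<dots> \<le> N * (\<Sum>K\<in>\<T>. ?d * \<tau> * measure lborel K)"
      using that ind_int NM by (intro mult_left_mono sum_mono) auto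
    finally show ?thesis by (simp add: M_def sum_distrib_left)
  qed
  have lam_ge: "1 \<le> lam \<tau> x" if "K \<in> \<T>" "x \<in> layer K (a K) \<tau>" for K \<tau> x
  proof -
    have "indicat_real (layer K (a K) \<tau>) x \<le> lam \<tau> x"
      unfolding lam_def using finite_mesh that by (intro member_le_sum) auto
    then show ?thesis using that by simp
  qed
  have lam0: "0 \<le> lam \<tau> x" for \<tau> x unfolding lam_def by (intro sum_nonneg) auto
  have esc: "x \<in> layer K (a K) \<tau>" if "K \<in> \<T>" "0 < \<tau>" "\<tau> \<le> 1" "x \<in> K" "x + z \<notin> interior K" "norm z < \<tau> * (\<rho> * t)" for K \<tau> x z
    using layer_escape[OF cell_convex a] that by blast
  define E where "E = (\<lambda>z x. increment z v x - G z x)"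
  have EL2: "E z \<in> L2 lborel" for z unfolding E_def by (intro L2.diff_mem increment_L2 vL GL2)
  have E: "\<bar>E z x\<bar> \<le> 2 * L * norm z * (lam \<tau> x + lam \<tau> (x + z))"
    if \<tau>: "0 < \<tau>" "\<tau> \<le> 1" "norm z < \<tau> * (\<rho> * t)" for z \<tau> x
  proof -
    have "\<bar>G z x\<bar> \<le> L * norm z"
    proof (cases "\<exists>K\<in>\<T>. x \<in> interior K")
      case True
      then obtain K where K: "K \<in> \<T>" "x \<in> interior K" by blast
      have "\<bar>g K \<bullet> z\<bar> \<le> norm (g K) * norm z" by (rule Cauchy_Schwarz_ineq2)
      also have "\<dots> \<le> L * norm z" by (intro mult_right_mono gL K) auto
      finally show ?thesis using Gin[OF K] by simp
    qed (use Gout L0 in auto)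
    moreover have "\<bar>increment z v x\<bar> \<le> L * norm z" using Lip[of "x + z" x] by (simp add: increment_def)
    ultimately have triv: "\<bar>E z x\<bar> \<le> 2 * L * norm z" unfolding E_def by linarith
    have fin: ?thesis if "1 \<le> lam \<tau> x + lam \<tau> (x + z)"
    proof -
      have "2 * L * norm z * 1 \<le> 2 * L * norm z * (lam \<tau> x + lam \<tau> (x + z))"
        using that L0 by (intro mult_left_mono) auto
      with triv show ?thesis by simp
    qed
    have z0: "norm (0::'a) < \<tau> * (\<rho> * t)" using \<tau>(1) rt by simp
    show ?thesis
    proof (cases "\<exists>K\<in>\<T>. x \<in> K")
      case True
      then obtain K where K: "K \<in> \<T>" "x \<in> K" by blast
      show ?thesis
      proof (cases "x \<in> interior K \<and> x + z \<in> interior K")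
        case True
        then have "x + z \<in> K" using interior_subset by blast
        then have "increment z v x = g K \<bullet> z" using gb[OF K] gb[OF K(1)] by (simp add: increment_def inner_add_right)
        then have "E z x = 0" using Gin[OF K(1)] True by (simp add: E_def)
        then show ?thesis using L0 lam0[of \<tau>] by simp
      next
        case False
        \<comment> \<open>If x itself is not interior to K, \<open>esc\<close> is applied with the
          zero step.\<close>
        then have "x \<in> layer K (a K) \<tau>"
          using esc[OF K(1) \<tau>(1,2) K(2) _ z0] esc[OF K(1) \<tau>(1,2) K(2) _ \<tau>(3)] by auto
        then show ?thesis using lam_ge[OF K(1)] lam0[of \<tau> "x + z"] by (intro fin) (smt (verit))
      qed
    next
      case False
      then have Gz: "G z x = 0" using interior_subset by (intro Gout) blast
      have vx: "v x = 0" using False cover closure_subset[of \<Omega>] fe_outside[OF v, of x] by blast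
      show ?thesis
      proof (cases "\<exists>K\<in>\<T>. x + z \<in> K")
        case True
        then obtain K where K: "K \<in> \<T>" "x + z \<in> K" by blast
        have "(x + z) + (- z) \<notin> interior K" using False K interior_subset by fastforce
        then have "x + z \<in> layer K (a K) \<tau>"
          using esc[OF K(1) \<tau>(1,2) K(2), of "- z"] \<tau>(3) by simp
        then show ?thesis using lam_ge[OF K(1)] lam0[of \<tau> x] by (intro fin) (smt (verit))
      next
        case False
        then have "v (x + z) = 0" using cover closure_subset[of \<Omega>] fe_outside[OF v, of "x + z"] by blast
        then have "E z x = 0" using vx Gz by (simp add: E_def increment_def)
        then show ?thesis using L0 lam0[of \<tau>] by simp
      qed
    qed
  qed
  \<comment> \<open>This constant depends on v and on the mesh. It does no harm, because the
    threshold \<open>\<tau>0\<close> below is chosen after it.\<close>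
  define A where "A = 32 * L\<^sup>2 * (N * (?d * M)) / (\<rho> * t)"
  have A0: "0 \<le> A" using NM rt by (simp add: A_def)
  have En: "(l2_norm (E z))\<^sup>2 \<le> A * norm z * (norm z)\<^sup>2" if z: "z \<noteq> 0" "norm z \<le> \<rho> * t / 2" for z
  proof -
    define \<tau> where "\<tau> = 2 * norm z / (\<rho> * t)"
    have \<tau>: "0 < \<tau>" "\<tau> \<le> 1" "norm z < \<tau> * (\<rho> * t)" using z \<rho> t by (auto simp: \<tau>_def field_simps)
    let ?h = "\<lambda>x. lam \<tau> x + lam \<tau> (x + z)"
    have hL: "?h \<in> L2 lborel" by (intro L2.add_mem lamL2 L2_translate)
    have n: "l2_norm (E z) \<le> l2_norm (\<lambda>x. (2 * L * norm z) * ?h x)"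
    proof -
      have "ip lborel (E z) (E z) \<le> ip lborel (\<lambda>x. (2 * L * norm z) * ?h x) (\<lambda>x. (2 * L * norm z) * ?h x)"
        unfolding ip_def
      proof (rule integral_mono)
        fix x
        have "(E z x)\<^sup>2 \<le> ((2 * L * norm z) * ?h x)\<^sup>2"
          using E[OF \<tau>, of x] by (simp add: abs_le_square_iff[symmetric])
        then show "E z x * E z x \<le> 2 * L * norm z * (lam \<tau> x + lam \<tau> (x + z)) * (2 * L * norm z * (lam \<tau> x + lam \<tau> (x + z)))"
          by (simp only: power2_eq_square)
      qed (intro L2_mult_integrable EL2 L2.scale_mem hL)+
      then show ?thesis by (simp add: L2.nm_def)
    qed
    also have "\<dots> = (2 * L * norm z) * l2_norm ?h" using L0 hL by (simp add: L2.nm_scale)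
    also have "l2_norm ?h \<le> 2 * l2_norm (lam \<tau>)"
      using L2.nm_triangle[OF lamL2 L2_translate[OF lamL2], of \<tau> \<tau> z] l2_norm_translate[OF lamL2] by simp
    finally have "l2_norm (E z) \<le> (2 * L * norm z) * (2 * l2_norm (lam \<tau>))" using L0 by (simp add: mult_left_mono)
    then have "(l2_norm (E z))\<^sup>2 \<le> ((2 * L * norm z) * (2 * l2_norm (lam \<tau>)))\<^sup>2"
      using L2.nm_nonneg[OF EL2] by (intro power_mono)
    also have "\<dots> = 16 * L\<^sup>2 * (norm z)\<^sup>2 * (l2_norm (lam \<tau>))\<^sup>2" by (simp add: power_mult_distrib)
    also have "\<dots> \<le> 16 * L\<^sup>2 * (norm z)\<^sup>2 * (N * (?d * \<tau> * M))"
      using \<tau> by (intro mult_left_mono lam_n2) auto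
    also have "\<dots> = A * norm z * (norm z)\<^sup>2" using rt by (simp add: A_def \<tau>_def field_simps)
    finally show ?thesis .
  qed
  have Gn: "l2_norm (G z) \<le> norm z * sqrt \<Gamma>" for z
  proof -
    have sq: "(G z x)\<^sup>2 = (\<Sum>K\<in>\<T>. (g K \<bullet> z)\<^sup>2 * indicat_real (interior K) x)" for x
    proof (cases "\<exists>K\<in>\<T>. x \<in> interior K")
      case True
      then obtain K where K: "K \<in> \<T>" "x \<in> interior K" by blast
      show ?thesis using sum_indicator_cell[OF K, of "\<lambda>K. (g K \<bullet> z)\<^sup>2"] Gin[OF K] by simp
    next
      case False
      then have "(\<Sum>K\<in>\<T>. (g K \<bullet> z)\<^sup>2 * indicat_real (interior K) x) = 0" by (intro sum.neutral) auto
      then show ?thesis using False Gout by simp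
    qed
    have ii: "integrable lborel (indicat_real (interior K))" if "K \<in> \<T>" for K
      using emeasure_bounded_finite[OF bounded_subset[OF bK[OF that] interior_subset]] by simp
    have "(l2_norm (G z))\<^sup>2 = (LINT x|lborel. (\<Sum>K\<in>\<T>. (g K \<bullet> z)\<^sup>2 * indicat_real (interior K) x))"
      unfolding L2.nm_sq[OF GL2] by (simp add: ip_def power2_eq_square[symmetric] sq)
    also have "\<dots> = (\<Sum>K\<in>\<T>. (g K \<bullet> z)\<^sup>2 * measure lborel (interior K))"
      using ii by (subst Bochner_Integration.integral_sum) auto
    also have "\<dots> \<le> (\<Sum>K\<in>\<T>. (norm z)\<^sup>2 * ((norm (g K))\<^sup>2 * measure lborel K))"
    proof (intro sum_mono)
      fix K assume K: "K \<in> \<T>"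
      have "\<bar>g K \<bullet> z\<bar> \<le> norm (g K) * norm z" by (rule Cauchy_Schwarz_ineq2)
      then have "(g K \<bullet> z)\<^sup>2 \<le> (norm (g K) * norm z)\<^sup>2" by (simp add: abs_le_square_iff[symmetric])
      moreover have "measure lborel (interior K) \<le> measure lborel K"
        using cell_compact[OF K] interior_subset by (intro measure_mono_fmeasurable bounded_fmeasurable) (auto intro: borel_compact compact_imp_bounded)
      ultimately have "(g K \<bullet> z)\<^sup>2 * measure lborel (interior K) \<le> (norm (g K) * norm z)\<^sup>2 * measure lborel K"
        by (intro mult_mono) auto
      then show "(g K \<bullet> z)\<^sup>2 * measure lborel (interior K) \<le> (norm z)\<^sup>2 * ((norm (g K))\<^sup>2 * measure lborel K)"
        by (simp add: power_mult_distrib mult_ac)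
    qed
    also have "\<dots> = (norm z * sqrt \<Gamma>)\<^sup>2" using \<Gamma>0 by (simp add: \<Gamma>_def sum_distrib_left power_mult_distrib)
    finally show ?thesis using \<Gamma>0 by (auto intro: power2_le_imp_le)
  qed
  have Gd1: "(l2_norm (increment y (G z)))\<^sup>2 \<le> 4 * ?d * \<tau> * ((norm z)\<^sup>2 * \<Gamma>)"
    if \<tau>: "0 < \<tau>" "\<tau> \<le> 1" "norm y < \<tau> * (\<rho> * t)" for y z \<tau>
  proof -
    define S where "S = (\<lambda>x. \<Sum>K\<in>\<T>. (g K \<bullet> z)\<^sup>2 * indicat_real (layer K (a K) \<tau>) x)"
    have S0: "0 \<le> S x" for x unfolding S_def by (intro sum_nonneg) auto
    have Sge: "(g K \<bullet> z)\<^sup>2 \<le> S x" if "K \<in> \<T>" "x \<in> layer K (a K) \<tau>" for K x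
    proof -
      have "(g K \<bullet> z)\<^sup>2 * indicat_real (layer K (a K) \<tau>) x \<le> S x"
        unfolding S_def by (rule member_le_sum[OF that(1) _ finite_mesh]) auto
      then show ?thesis using that by simp
    qed
    \<comment> \<open>If x and x + y' are not interior to a common cell, the value of
      \<open>G z\<close> at x is charged to a layer that contains x.\<close>
    have half: "(G z x)\<^sup>2 \<le> S x" if ny: "norm y' < \<tau> * (\<rho> * t)" and no: "\<not> (\<exists>K\<in>\<T>. x \<in> interior K \<and> x + y' \<in> interior K)" for x y'
    proof (cases "\<exists>K\<in>\<T>. x \<in> interior K")
      case True
      then obtain K where K: "K \<in> \<T>" "x \<in> interior K" by blast
      then have "x \<in> K" "x + y' \<notin> interior K" using no interior_subset by blast+
      then have "x \<in> layer K (a K) \<tau>" using esc[OF K(1) \<tau>(1,2) _ _ ny] by blast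
      then show ?thesis using Sge[OF K(1)] Gin[OF K] by simp
    qed (use Gout S0 in auto)
    have pt: "(increment y (G z) x)\<^sup>2 \<le> 2 * S x + 2 * S (x + y)" for x
    proof (cases "\<exists>K\<in>\<T>. x \<in> interior K \<and> x + y \<in> interior K")
      case True
      then have "increment y (G z) x = 0" using Gin by (auto simp: increment_def)
      then show ?thesis using S0 by simp
    next
      case False
      then have "\<not> (\<exists>K\<in>\<T>. (x + y) \<in> interior K \<and> (x + y) + (- y) \<in> interior K)" by auto
      then have "(G z (x + y))\<^sup>2 \<le> S (x + y)" using half[of "- y" "x + y"] \<tau>(3) by simp
      moreover have "(G z x)\<^sup>2 \<le> S x" using half[OF \<tau>(3) False] .
      moreover have "0 \<le> (G z (x + y) + G z x)\<^sup>2" by simp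
      ultimately show ?thesis by (simp add: increment_def power2_diff power2_sum)
    qed
    have Sint: "integrable lborel S" unfolding S_def using ind_integrable by (intro Bochner_Integration.integrable_sum) auto
    have Sm [measurable]: "S \<in> borel_measurable borel" using borel_measurable_integrable[OF Sint] by simp
    have "(l2_norm (increment y (G z)))\<^sup>2 = (LINT x|lborel. (increment y (G z) x)\<^sup>2)"
      unfolding L2.nm_sq[OF increment_L2[OF GL2]] by (simp add: ip_def power2_eq_square)
    also have "\<dots> \<le> (LINT x|lborel. 2 * S x + 2 * S (x + y))"
      using increment_L2[OF GL2, of y z] Sint integrable_translate[OF Sint, of y] pt by (intro integral_mono) (auto simp: L2_def)
    also have "\<dots> = 4 * (LINT x|lborel. S x)"
      using Sint integrable_translate[OF Sint, of y] integral_translate[of S y] by simp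
    also have "(LINT x|lborel. S x) = (\<Sum>K\<in>\<T>. (g K \<bullet> z)\<^sup>2 * (LINT x|lborel. indicat_real (layer K (a K) \<tau>) x))"
      unfolding S_def using ind_integrable by (subst Bochner_Integration.integral_sum) auto
    also have "\<dots> \<le> (\<Sum>K\<in>\<T>. ((norm (g K))\<^sup>2 * (norm z)\<^sup>2) * (?d * \<tau> * measure lborel K))"
    proof (intro sum_mono mult_mono)
      fix K assume K: "K \<in> \<T>"
      have "\<bar>g K \<bullet> z\<bar> \<le> norm (g K) * norm z" by (rule Cauchy_Schwarz_ineq2)
      then have "(g K \<bullet> z)\<^sup>2 \<le> (norm (g K) * norm z)\<^sup>2" by (simp add: abs_le_square_iff[symmetric])
      then show "(g K \<bullet> z)\<^sup>2 \<le> (norm (g K))\<^sup>2 * (norm z)\<^sup>2" by (simp add: power_mult_distrib)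
      show "(LINT x|lborel. indicat_real (layer K (a K) \<tau>) x) \<le> ?d * \<tau> * measure lborel K"
        using \<tau> by (intro ind_int K) auto
    qed auto
    also have "\<dots> = ?d * \<tau> * ((norm z)\<^sup>2 * \<Gamma>)" by (simp add: \<Gamma>_def sum_distrib_left mult_ac)
    finally show ?thesis by simp
  qed
  have Gd: "l2_norm (increment y (G z)) \<le> sqrt (8 * ?d / \<rho>) * sqrt \<sigma> * (norm z * sqrt \<Gamma>)" if \<sigma>: "0 < \<sigma>" "norm y \<le> \<sigma> * t" for y z \<sigma>
  \<comment> \<open>Layers of relative thickness 2 \<sigma> / \<rho> catch every step up to \<sigma>
    t. When that thickness exceeds 1, the trivial factor 2 is already below
    \<open>sqrt (8 * ?d / \<rho> * \<sigma>)\<close>.\<close>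
  proof (cases "2 * \<sigma> / \<rho> \<le> 1")
    case True
    have "0 < \<sigma> * t" using \<sigma>(1) t by simp
    then have "norm y < 2 * (\<sigma> * t)" using \<sigma>(2) by linarith
    then have "norm y < 2 * \<sigma> / \<rho> * (\<rho> * t)" using \<rho> by (simp add: mult.assoc)
    then have "(l2_norm (increment y (G z)))\<^sup>2 \<le> 4 * ?d * (2 * \<sigma> / \<rho>) * ((norm z)\<^sup>2 * \<Gamma>)"
      using True \<sigma> \<rho> by (intro Gd1) auto
    also have "\<dots> = (sqrt (8 * ?d / \<rho>) * sqrt \<sigma> * (norm z * sqrt \<Gamma>))\<^sup>2"
      using \<sigma> \<rho> \<Gamma>0 by (simp add: power_mult_distrib)
    finally show ?thesis using \<sigma> \<rho> \<Gamma>0 by (auto intro: power2_le_imp_le)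
  next
    case False
    have "l2_norm (increment y (G z)) \<le> 2 * l2_norm (G z)" by (rule l2_norm_increment_le[OF GL2])
    also have "\<dots> \<le> 2 * (norm z * sqrt \<Gamma>)" using Gn by simp
    also have "\<dots> \<le> sqrt (8 * ?d / \<rho> * \<sigma>) * (norm z * sqrt \<Gamma>)"
    proof (rule mult_right_mono)
      have "4 \<le> 4 * (2 * \<sigma> / \<rho>)" using False by simp
      also have "\<dots> \<le> 8 * ?d / \<rho> * \<sigma>"
        using \<sigma> \<rho> mult_right_mono[of 1 ?d "8 * \<sigma> / \<rho>"] DIM_ge_Suc0[where 'a='a] by (simp add: field_simps)
      finally have "sqrt (2\<^sup>2) \<le> sqrt (8 * ?d / \<rho> * \<sigma>)" by (intro real_sqrt_le_mono) simp
      then show "2 \<le> sqrt (8 * ?d / \<rho> * \<sigma>)" by simp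
    qed (use \<Gamma>0 in auto)
    finally show ?thesis by (simp only: real_sqrt_mult)
  qed
  define C where "C = (1 + sqrt (8 * ?d / \<rho>)) * sqrt (inverse_const DIM('a) \<rho> c) + 2"
  \<comment> \<open>The tolerance for \<open>E z\<close>: the factor \<open>sqrt (min r 1)\<close>
    is at most 1, as the first estimate requires, and at most \<open>sqrt \<sigma>\<close> for every
    admissible \<sigma>, as the second does.\<close>
  define \<epsilon> where "\<epsilon> = sqrt (min r 1) / t * l2_norm v"
  have \<epsilon>0: "0 < \<epsilon>" using r t nv by (simp add: \<epsilon>_def)
  define \<tau>0 where "\<tau>0 = min (\<rho> * t / 2) (\<epsilon>\<^sup>2 / (A + 1))"
  have \<tau>0: "0 < \<tau>0" using rt \<epsilon>0 A0 by (simp add: \<tau>0_def)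
  have main: "l2_norm (increment z v) \<le> C * norm z / t * l2_norm v \<and>
    (\<forall>y \<sigma>. r \<le> \<sigma> \<and> \<sigma> \<le> 1 \<and> norm y \<le> \<sigma> * t \<longrightarrow> l2_norm (increment y (increment z v)) \<le> C * norm z / t * sqrt \<sigma> * l2_norm v)"
    if "z \<noteq> 0" "norm z \<le> \<tau>0" for z
  proof -
    from that have z: "z \<noteq> 0" "norm z \<le> \<rho> * t / 2" "norm z \<le> \<epsilon>\<^sup>2 / (A + 1)" by (auto simp: \<tau>0_def)
    have dec: "increment z v = (\<lambda>x. G z x + E z x)" by (simp add: E_def)
    have Ez: "l2_norm (E z) \<le> norm z * \<epsilon>"
    proof -
      have "A * norm z \<le> (A + 1) * norm z" by (intro mult_right_mono) auto
      also have "\<dots> \<le> \<epsilon>\<^sup>2" using z(3) A0 by (simp add: field_simps)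
      finally have "A * norm z * (norm z)\<^sup>2 \<le> \<epsilon>\<^sup>2 * (norm z)\<^sup>2" by (intro mult_right_mono) auto
      then have "(l2_norm (E z))\<^sup>2 \<le> (norm z * \<epsilon>)\<^sup>2" using En[OF z(1,2)] by (simp add: power_mult_distrib mult_ac)
      then show ?thesis using \<epsilon>0 by (auto intro: power2_le_imp_le)
    qed
    have Gz: "norm z * sqrt \<Gamma> \<le> sqrt (inverse_const DIM('a) \<rho> c) * (norm z / t * l2_norm v)"
      using mult_left_mono[OF s\<Gamma>, of "norm z"] by (simp add: mult_ac)
    have q0: "0 \<le> norm z / t * l2_norm v" using t nv by simp
    have "l2_norm (increment z v) \<le> l2_norm (G z) + l2_norm (E z)" unfolding dec by (intro L2.nm_triangle GL2 EL2)
      also have "\<dots> \<le> sqrt (inverse_const DIM('a) \<rho> c) * (norm z / t * l2_norm v) + 1 * (norm z / t * l2_norm v)"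
      proof (rule add_mono)
        show "l2_norm (G z) \<le> sqrt (inverse_const DIM('a) \<rho> c) * (norm z / t * l2_norm v)" using Gn[of z] Gz by linarith
        have "sqrt (min r 1) * (norm z / t * l2_norm v) \<le> 1 * (norm z / t * l2_norm v)" by (intro mult_right_mono q0) auto
        then show "l2_norm (E z) \<le> 1 * (norm z / t * l2_norm v)" using Ez by (simp add: \<epsilon>_def mult_ac)
      qed
      also have "\<dots> = (sqrt (inverse_const DIM('a) \<rho> c) + 1) * (norm z / t * l2_norm v)" by (simp only: distrib_right)
      also have "\<dots> \<le> C * (norm z / t * l2_norm v)"
      proof (intro mult_right_mono q0)
        have "0 \<le> sqrt (8 * ?d / \<rho>) * sqrt (inverse_const DIM('a) \<rho> c)" using \<rho> inv_const_nonneg by simp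
        then show "sqrt (inverse_const DIM('a) \<rho> c) + 1 \<le> C" by (simp add: C_def distrib_right)
      qed
      finally have first: "l2_norm (increment z v) \<le> C * norm z / t * l2_norm v" by simp
    have second: "l2_norm (increment y (increment z v)) \<le> C * norm z / t * sqrt \<sigma> * l2_norm v"
      if \<sigma>: "r \<le> \<sigma>" "\<sigma> \<le> 1" "norm y \<le> \<sigma> * t" for y \<sigma>
    proof -
    have \<sigma>0: "0 < \<sigma>" using r \<sigma> by simp
    have "increment y (increment z v) = (\<lambda>x. increment y (G z) x + increment y (E z) x)" unfolding dec by (simp add: increment_def fun_eq_iff)
    then have "l2_norm (increment y (increment z v)) \<le> l2_norm (increment y (G z)) + l2_norm (increment y (E z))"
      by (simp only:) (intro L2.nm_triangle increment_L2 GL2 EL2)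
    also have "\<dots> \<le> sqrt (8 * ?d / \<rho>) * sqrt (inverse_const DIM('a) \<rho> c) * (norm z / t * sqrt \<sigma> * l2_norm v) + 2 * (norm z / t * sqrt \<sigma> * l2_norm v)"
    proof (rule add_mono)
      have "sqrt (8 * ?d / \<rho>) * sqrt \<sigma> * (norm z * sqrt \<Gamma>) \<le> sqrt (8 * ?d / \<rho>) * sqrt \<sigma> * (sqrt (inverse_const DIM('a) \<rho> c) * (norm z / t * l2_norm v))"
        using \<rho> \<sigma>0 by (intro mult_left_mono Gz) auto
      then show "l2_norm (increment y (G z)) \<le> sqrt (8 * ?d / \<rho>) * sqrt (inverse_const DIM('a) \<rho> c) * (norm z / t * sqrt \<sigma> * l2_norm v)"
        using Gd[OF \<sigma>0 \<sigma>(3), of z] by (simp add: mult_ac)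
      have "sqrt (min r 1) * (norm z / t * l2_norm v) \<le> sqrt \<sigma> * (norm z / t * l2_norm v)"
        using \<sigma> by (intro mult_right_mono q0) auto
      then have "l2_norm (E z) \<le> norm z / t * sqrt \<sigma> * l2_norm v" using Ez by (simp add: \<epsilon>_def mult_ac)
      then show "l2_norm (increment y (E z)) \<le> 2 * (norm z / t * sqrt \<sigma> * l2_norm v)" using l2_norm_increment_le[OF EL2, of y z] by linarith
    qed
    also have "\<dots> = (sqrt (8 * ?d / \<rho>) * sqrt (inverse_const DIM('a) \<rho> c) + 2) * (norm z / t * sqrt \<sigma> * l2_norm v)" by (simp only: distrib_right)
    also have "\<dots> \<le> C * (norm z / t * sqrt \<sigma> * l2_norm v)"
    proof (rule mult_right_mono)
      show "sqrt (8 * ?d / \<rho>) * sqrt (inverse_const DIM('a) \<rho> c) + 2 \<le> C" using inv_const_nonneg by (simp add: C_def distrib_right)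
      show "0 \<le> norm z / t * sqrt \<sigma> * l2_norm v" using t nv \<sigma>0 by simp
    qed
    finally show ?thesis by simp
    qed
    show ?thesis using first second by blast
  qed
  show ?thesis unfolding C_def[symmetric]
    by (rule exI[of _ \<tau>0], rule conjI[OF \<tau>0], rule allI, rule impI, elim conjE, rule main)
qed

end

section \<open>Approximation by finite element functions\<close>

text \<open>A maximum principle on a segment. If f exceeded its chord, take the leftmost point at
  which the excess is maximal; the midpoint inequality with a short step would make the excess
  maximal further left as well. Hence steps of length at most \<delta> suffice.\<close>

lemma local_midpoint_convex:
  fixes f :: "'a::euclidean_space \<Rightarrow> real"
  assumes K: "convex K" and f: "continuous_on K f" and \<delta>: "0 < \<delta>"
    and mid: "\<And>y z. y + z \<in> K \<Longrightarrow> y - z \<in> K \<Longrightarrow> norm z \<le> \<delta> \<Longrightarrow> 2 * f y \<le> f (y + z) + f (y - z)"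
  shows "convex_on K f"
proof (rule convex_onI)
  fix t :: real and x y assume t: "0 < t" "t < 1" and xy: "x \<in> K" "y \<in> K"
  define p where "p = (\<lambda>s::real. x + s *\<^sub>R (y - x))"
  define h where "h = (\<lambda>s. f (p s) - ((1 - s) * f x + s * f y))"
  have pK: "p s \<in> K" if "s \<in> {0..1}" for s
    using convexD_alt[OF K xy, of s] that by (simp add: p_def algebra_simps)
  have hc: "continuous_on {0..1} h"
    unfolding h_def
  proof (intro continuous_intros continuous_on_compose2[OF f])
    show "continuous_on {0..1} p" unfolding p_def by (intro continuous_intros)
  qed (use pK in auto)
  have h01: "h 0 = 0" "h 1 = 0" by (auto simp: h_def p_def)
  have "h s \<le> 0" if s: "s \<in> {0..1}" for s
  proof (rule ccontr)
    assume "\<not> h s \<le> 0"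
    obtain a where a: "a \<in> {0..1}" "\<And>r. r \<in> {0..1} \<Longrightarrow> h r \<le> h a"
      using continuous_attains_sup[OF _ _ hc] by auto
    with s \<open>\<not> h s \<le> 0\<close> have ma: "0 < h a" by fastforce
    define A where "A = {r \<in> {0..1}. h r = h a}"
    have Ac: "compact A"
    proof -
      have "closed A" unfolding A_def using continuous_closed_preimage[OF hc, of "{h a}"] by (simp add: vimage_def Int_def)
      moreover have "bounded A" unfolding A_def by (rule bounded_subset[of "{0..1}"]) auto
      ultimately show ?thesis by (simp add: compact_eq_bounded_closed)
    qed
    obtain c where c: "c \<in> A" "\<And>r. r \<in> A \<Longrightarrow> c \<le> r"
      using compact_attains_inf[OF Ac] a(1) by (auto simp: A_def)
    have c1: "c \<in> {0..1}" "h c = h a" using c(1) by (auto simp: A_def)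
    then have c01: "0 < c" "c < 1" using h01 ma by (auto simp: less_le)
    define e where "e = min (min c (1 - c)) (\<delta> / (norm (y - x) + 1))"
    have n1: "0 < norm (y - x) + 1" by (simp add: add_nonneg_pos)
    have e: "0 < e" "e \<le> c" "e \<le> 1 - c" using c01 \<delta> n1 by (auto simp: e_def)
    have "e * norm (y - x) \<le> e * (norm (y - x) + 1)" using e by (intro mult_left_mono) auto
    also have "\<dots> \<le> \<delta>" using n1 by (simp add: e_def min_le_iff_disj pos_le_divide_eq[symmetric])
    finally have en: "norm (e *\<^sub>R (y - x)) \<le> \<delta>" using e by simp
    have pp: "p (c + e) = p c + e *\<^sub>R (y - x)" "p (c - e) = p c - e *\<^sub>R (y - x)" by (auto simp: p_def algebra_simps)
    have cI: "c + e \<in> {0..1}" "c - e \<in> {0..1}" using e c01 by auto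
    have "2 * f (p c) \<le> f (p (c + e)) + f (p (c - e))"
      unfolding pp by (rule mid) (use pK[OF cI(1)] pK[OF cI(2)] en pp in auto)
    then have "2 * h c \<le> h (c + e) + h (c - e)" by (simp add: h_def algebra_simps)
    moreover have "h (c + e) \<le> h a" using a(2) cI by blast
    moreover have "h (c - e) < h a"
    proof -
      have "c - e \<notin> A" using c(2)[of "c - e"] e by auto
      then show ?thesis using a(2)[OF cI(2)] cI(2) by (auto simp: A_def)
    qed
    ultimately show False using c1 by simp
  qed
  from this[of t] t show "f ((1 - t) *\<^sub>R x + t *\<^sub>R y) \<le> (1 - t) * f x + t * f y"
    by (simp add: h_def p_def algebra_simps)
qed (rule K)

text \<open>A bound \<open>M (norm z)\<^sup>2\<close> on second differences makes \<open>g\<close> plus or minus \<open>M / 2 (norm x)\<^sup>2\<close> convex, so that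
  Jensen's inequality bounds the interpolation error.\<close>

lemma interpolation_error:
  fixes g :: "'a::euclidean_space \<Rightarrow> real"
  assumes C: "finite C" and g: "continuous_on (convex hull C) g" and \<delta>: "0 < \<delta>"
    and second_diff: "\<And>y z. y \<in> convex hull C \<Longrightarrow> norm z \<le> \<delta> \<Longrightarrow> \<bar>g (y + z) - 2 * g y + g (y - z)\<bar> \<le> M * (norm z)\<^sup>2"
    and l: "\<And>p. p \<in> C \<Longrightarrow> 0 \<le> l p" "sum l C = 1" and x: "x = (\<Sum>p\<in>C. l p *\<^sub>R p)"
    and h: "\<And>p. p \<in> C \<Longrightarrow> norm (p - x) \<le> h" and M: "0 \<le> M"
  shows "\<bar>g x - (\<Sum>p\<in>C. l p * g p)\<bar> \<le> M / 2 * h\<^sup>2"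
proof -
  have C0: "C \<noteq> {}" using l(2) by auto
  have quad: "(norm (y + z))\<^sup>2 + (norm (y - z))\<^sup>2 = 2 * (norm y)\<^sup>2 + 2 * (norm z)\<^sup>2" for y z :: 'a
    by (simp add: power2_norm_eq_inner inner_add_left inner_add_right inner_diff_left inner_diff_right inner_commute)
  \<comment> \<open>The variance of the vertices under the weights l: the difference is the mean of
    their squared distances to x.\<close>
  have gap: "(\<Sum>p\<in>C. l p * (norm p)\<^sup>2) - (norm x)\<^sup>2 \<le> h\<^sup>2"
  proof -
    have "(\<Sum>p\<in>C. l p * (norm (p - x))\<^sup>2) = (\<Sum>p\<in>C. l p * (norm p)\<^sup>2 - 2 * (l p * (p \<bullet> x)) + l p * (norm x)\<^sup>2)"
      by (intro sum.cong refl) (simp add: power2_norm_eq_inner inner_diff_left inner_diff_right inner_commute algebra_simps)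
    also have "\<dots> = (\<Sum>p\<in>C. l p * (norm p)\<^sup>2) - 2 * (\<Sum>p\<in>C. l p * (p \<bullet> x)) + sum l C * (norm x)\<^sup>2"
      by (simp add: sum.distrib sum_subtractf sum_distrib_left sum_distrib_right)
    also have "(\<Sum>p\<in>C. l p * (p \<bullet> x)) = x \<bullet> x"
      by (subst (2) x) (simp add: inner_sum_left)
    finally have "(\<Sum>p\<in>C. l p * (norm p)\<^sup>2) - (norm x)\<^sup>2 = (\<Sum>p\<in>C. l p * (norm (p - x))\<^sup>2)"
      using l(2) by (simp add: power2_norm_eq_inner)
    also have "\<dots> \<le> (\<Sum>p\<in>C. l p * h\<^sup>2)" using l h by (intro sum_mono mult_left_mono power_mono) auto
    also have "\<dots> = h\<^sup>2" using l by (simp add: sum_distrib_right[symmetric])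
    finally show ?thesis .
  qed
  \<comment> \<open>The sign \<epsilon> treats both one-sided estimates by the same convexity
    argument.\<close>
  have one: "\<epsilon> * g x - (\<Sum>p\<in>C. l p * (\<epsilon> * g p)) \<le> M / 2 * h\<^sup>2" if \<epsilon>: "\<bar>\<epsilon>\<bar> = 1" for \<epsilon> :: real
  proof -
    let ?f = "\<lambda>y. \<epsilon> * g y + M / 2 * (norm y)\<^sup>2"
    have "convex_on (convex hull C) ?f"
    proof (rule local_midpoint_convex[OF _ _ \<delta>])
      show "continuous_on (convex hull C) ?f" by (intro continuous_intros g)
      fix y z assume yz: "y + z \<in> convex hull C" "y - z \<in> convex hull C" "norm z \<le> \<delta>"
      have "y = (1 / 2) *\<^sub>R (y + z) + (1 / 2) *\<^sub>R (y - z)" by (simp add: algebra_simps flip: scaleR_add_left)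
      then have y: "y \<in> convex hull C" using yz(1,2) convexD[OF convex_convex_hull, of "y + z" C "y - z" "1/2" "1/2"] by simp
      have "\<bar>\<epsilon> * (g (y + z) - 2 * g y + g (y - z))\<bar> \<le> M * (norm z)\<^sup>2"
        using second_diff[OF y yz(3)] \<epsilon> by (simp add: abs_mult)
      moreover have "M / 2 * (norm (y + z))\<^sup>2 + M / 2 * (norm (y - z))\<^sup>2 = M * (norm y)\<^sup>2 + M * (norm z)\<^sup>2"
        using arg_cong[OF quad[of y z], of "\<lambda>a. M / 2 * a"] by (simp add: algebra_simps)
      ultimately show "2 * ?f y \<le> ?f (y + z) + ?f (y - z)" by (simp add: algebra_simps abs_le_iff)
    qed simp
    then have "?f (\<Sum>p\<in>C. l p *\<^sub>R p) \<le> (\<Sum>p\<in>C. l p * ?f p)"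
      using C C0 l convex_on_sum[of C "convex hull C" ?f l "\<lambda>p. p"] by (simp add: hull_inc)
    then have "\<epsilon> * g x + M / 2 * (norm x)\<^sup>2 \<le> (\<Sum>p\<in>C. l p * (\<epsilon> * g p)) + M / 2 * (\<Sum>p\<in>C. l p * (norm p)\<^sup>2)"
      by (simp add: x[symmetric] distrib_left sum.distrib sum_distrib_left mult_ac)
    then have "\<epsilon> * g x - (\<Sum>p\<in>C. l p * (\<epsilon> * g p)) \<le> M / 2 * ((\<Sum>p\<in>C. l p * (norm p)\<^sup>2) - (norm x)\<^sup>2)"
      by (simp add: algebra_simps)
    also have "\<dots> \<le> M / 2 * h\<^sup>2" using M by (intro mult_left_mono gap) auto
    finally show ?thesis .
  qed
  from one[of 1] one[of "-1"] show ?thesis by (simp add: sum_negf abs_if)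
qed

text \<open>For \<open>z\<close> in such a ball the second difference at \<open>y + z\<close> of a function vanishing outside \<open>\<Omega>\<close> is its value at \<open>y\<close>.\<close>

lemma exterior_balls:
  fixes \<Omega> :: "'a::euclidean_space set"
  assumes \<Omega>: "bounded_lipschitz_domain \<Omega>" and C0: "0 \<le> C0"
  shows "\<exists>R>0. \<forall>t y x0. 0 < t \<and> t \<le> 1 \<and> y \<in> \<Omega> \<and> x0 \<notin> \<Omega> \<and> dist y x0 \<le> C0 * t \<longrightarrow>
    (\<exists>z0. cball z0 t \<subseteq> cball 0 (R * t) \<and> (\<forall>z\<in>cball z0 t. y + z \<notin> \<Omega> \<and> y + 2 *\<^sub>R z \<notin> \<Omega>))"
proof -
  have op: "open \<Omega>" and bd: "bounded \<Omega>" using \<Omega> by (auto simp: bounded_lipschitz_domain_def)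
  define Q where "Q = (\<lambda>p r n L \<phi>. 0 < r \<and> norm n = 1 \<and> L-lipschitz_on {y. y \<bullet> n = 0} \<phi> \<and>
        \<Omega> \<inter> ball p r = {x \<in> ball p r. \<phi> (x - (x \<bullet> n) *\<^sub>R n) < x \<bullet> n})"
  have "\<forall>p\<in>frontier \<Omega>. \<exists>r n L \<phi>. Q p r n L \<phi>"
    using \<Omega> unfolding bounded_lipschitz_domain_def Q_def by blast
  then obtain r n L \<phi> where "\<And>p. p \<in> frontier \<Omega> \<Longrightarrow> Q p (r p) (n p) (L p) (\<phi> p)" by metis
  then have loc: "\<And>p. p \<in> frontier \<Omega> \<Longrightarrow> 0 < r p" "\<And>p. p \<in> frontier \<Omega> \<Longrightarrow> norm (n p) = 1"
    "\<And>p. p \<in> frontier \<Omega> \<Longrightarrow> (L p)-lipschitz_on {y. y \<bullet> n p = 0} (\<phi> p)"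
    "\<And>p. p \<in> frontier \<Omega> \<Longrightarrow> \<Omega> \<inter> ball p (r p) = {x \<in> ball p (r p). \<phi> p (x - (x \<bullet> n p) *\<^sub>R n p) < x \<bullet> n p}"
    unfolding Q_def by simp_all
  have "compact (frontier \<Omega>)" using bd by (rule compact_frontier_bounded)
  moreover have "frontier \<Omega> \<subseteq> (\<Union>p\<in>frontier \<Omega>. ball p (r p / 2))" using loc(1) by force
  ultimately obtain F where F: "F \<subseteq> frontier \<Omega>" "finite F" "frontier \<Omega> \<subseteq> (\<Union>p\<in>F. ball p (r p / 2))"
    using compactE_image[of "frontier \<Omega>" "frontier \<Omega>" "\<lambda>p. ball p (r p / 2)"] open_ball by metis
  define Lm where "Lm = (\<Sum>p\<in>F. L p)"
  have Lnn: "0 \<le> L p" if "p \<in> F" for p using loc(3)[of p] F(1) that lipschitz_on_nonneg by blast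
  have Lm: "L p \<le> Lm" if "p \<in> F" for p unfolding Lm_def using Lnn that F(2) by (intro member_le_sum) auto
  have Lm0: "0 \<le> Lm" unfolding Lm_def using Lnn by (intro sum_nonneg)
  \<comment> \<open>The depth, in units of t, to which the ball is pushed below the graph. It has to
    beat the distance C0 to the boundary, the radius 1, and the change of the graph, with slope at
    most Lm, over a displacement of at most C0 + 2.\<close>
  define A where "A = C0 + 1 + Lm * (C0 + 2)"
  have A1: "1 \<le> A" using C0 Lm0 by (simp add: A_def)
  define rm where "rm = Min (insert 1 (r ` F))"
  have rm: "0 < rm" "\<And>p. p \<in> F \<Longrightarrow> rm \<le> r p"
    using F(1,2) loc(1) by (auto simp: rm_def)
  \<comment> \<open>Below this scale both y + z and y + 2 z stay within one chart.\<close>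
  define t0 where "t0 = rm / (2 * (C0 + 2 * A + 3))"
  have den: "0 < 2 * (C0 + 2 * A + 3)" using C0 A1 by simp
  have t0: "0 < t0" using rm(1) den by (simp add: t0_def)
  obtain Rb where Rb: "0 < Rb" "\<And>x. x \<in> \<Omega> \<Longrightarrow> norm x < Rb"
    using bd by (meson bounded_pos_less)
  define R where "R = max (A + 1) ((2 * Rb + 2) / t0)"
  have R: "0 < R" using A1 by (simp add: R_def)
  show ?thesis
  proof (intro exI[of _ R] conjI R allI impI)
    fix t y x0 assume "0 < t \<and> t \<le> 1 \<and> y \<in> \<Omega> \<and> x0 \<notin> \<Omega> \<and> dist y x0 \<le> C0 * t"
    then have t: "0 < t" "t \<le> 1" and y: "y \<in> \<Omega>" and x0: "x0 \<notin> \<Omega>" "dist y x0 \<le> C0 * t" by auto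
    show "\<exists>z0. cball z0 t \<subseteq> cball 0 (R * t) \<and> (\<forall>z\<in>cball z0 t. y + z \<notin> \<Omega> \<and> y + 2 *\<^sub>R z \<notin> \<Omega>)"
    proof (cases "t < t0")
      case True
      \<comment> \<open>Charts are centred at boundary points, so x0 is replaced by a boundary point
        no farther from y.\<close>
      have "closed_segment y x0 \<inter> frontier \<Omega> \<noteq> {}"
        using y x0(1) by (intro connected_Int_frontier) auto
      then obtain x1 where x1: "x1 \<in> closed_segment y x0" "x1 \<in> frontier \<Omega>" by blast
      have dx1: "norm (y - x1) \<le> C0 * t"
        using dist_in_closed_segment[OF x1(1)] x0(2) by (simp add: dist_norm norm_minus_commute)
      obtain p where p: "p \<in> F" "dist p x1 < r p / 2" using F(3) x1(2) by auto
      have pf: "p \<in> frontier \<Omega>" using p F by blast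
      define m where "m = n p"
      have m: "norm m = 1" "m \<bullet> m = 1" using loc(2)[OF pf] by (auto simp: m_def norm_eq_1)
      define P where "P = (\<lambda>x. x - (x \<bullet> m) *\<^sub>R m)"
      have Pm: "P x \<bullet> m = 0" for x using m by (simp add: P_def inner_diff_left)
      have Pn: "norm (P x) \<le> norm x" for x
      proof -
        have "(norm (P x))\<^sup>2 = (norm x)\<^sup>2 - (x \<bullet> m)\<^sup>2"
          unfolding P_def power2_norm_eq_inner
            using m(2) by (simp add: inner_diff_left inner_diff_right inner_commute power2_eq_square)
        then have "(norm (P x))\<^sup>2 \<le> (norm x)\<^sup>2" by simp
        then show ?thesis by (rule power2_le_imp_le) simp
      qed
      have Padd: "P (x + x') = P x + P x'" and Pscale: "P (a *\<^sub>R x) = a *\<^sub>R P x" and Pmm: "P m = 0" for x x' a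
        using m(2) by (auto simp: P_def inner_add_left algebra_simps)
      have locP: "\<Omega> \<inter> ball p (r p) = {x \<in> ball p (r p). \<phi> p (P x) < x \<bullet> m}"
        unfolding P_def m_def by (rule loc(4)[OF pf])
      have x1\<phi>: "x1 \<bullet> m \<le> \<phi> p (P x1)"
      proof -
        have "x1 \<notin> \<Omega>" using x1(2) op by (simp add: frontier_def interior_open)
        moreover have "x1 \<in> ball p (r p)" using p(2) loc(1)[OF pf] by simp
        ultimately have "\<not> \<phi> p (P x1) < x1 \<bullet> m" using locP by blast
        then show ?thesis by simp
      qed
      \<comment> \<open>The parameter j treats y + z and y + 2 z at once.\<close>
      have out: "y + j *\<^sub>R z \<notin> \<Omega>" if z: "z \<in> cball ((- A * t) *\<^sub>R m) t" and j: "1 \<le> j" "j \<le> 2" for j z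
      proof
        assume w: "y + j *\<^sub>R z \<in> \<Omega>"
        define e where "e = z + (A * t) *\<^sub>R m"
        define w where "w = y + j *\<^sub>R z"
        have e: "norm e \<le> t" using z by (simp add: e_def dist_norm norm_minus_commute)
        have ze: "z = e - (A * t) *\<^sub>R m" by (simp add: e_def)
        have zn: "norm z \<le> t + A * t"
          using norm_triangle_ineq4[of e "(A * t) *\<^sub>R m"] e m(1) A1 t by (simp add: ze)
        have "dist p w \<le> dist p x1 + norm (x1 - y) + norm (j *\<^sub>R z)"
        proof -
          have pw: "p - w = (p - x1) + (x1 - y) - j *\<^sub>R z" by (simp add: w_def)
          show ?thesis unfolding dist_norm pw
            using norm_triangle_ineq4[of "(p - x1) + (x1 - y)" "j *\<^sub>R z"] norm_triangle_ineq[of "p - x1" "x1 - y"]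
            by linarith
        qed
        also have "\<dots> < r p"
        proof -
          have "norm (j *\<^sub>R z) \<le> 2 * (t + A * t)" using j mult_mono[OF j(2) zn] by simp
          then have "norm (x1 - y) + norm (j *\<^sub>R z) \<le> (C0 + 2 * A + 3) * t"
            using dx1 t by (simp add: norm_minus_commute algebra_simps)
          also have "\<dots> \<le> (C0 + 2 * A + 3) * t0" using True den by (intro mult_left_mono) auto
          also have "\<dots> = rm / 2" using den by (simp add: t0_def field_simps)
          also have "\<dots> \<le> r p / 2" using rm(2)[OF p(1)] by simp
          finally show ?thesis using p(2) by linarith
        qed
        finally have wb: "w \<in> ball p (r p)" by simp
        moreover have "w \<in> \<Omega>" using w by (simp add: w_def)
        ultimately have lt: "\<phi> p (P w) < w \<bullet> m" using locP by blast
        have wx: "w = x1 + ((y - x1) + j *\<^sub>R e) + (- j * (A * t)) *\<^sub>R m" by (simp add: w_def ze algebra_simps)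
        have Pw: "P w = P x1 + P ((y - x1) + j *\<^sub>R e)" unfolding wx Padd Pscale Pmm by simp
        have "\<bar>\<phi> p (P w) - \<phi> p (P x1)\<bar> \<le> L p * dist (P w) (P x1)"
          using lipschitz_onD[OF loc(3)[OF pf], of "P w" "P x1"] Pm by (simp add: dist_real_def m_def)
        also have "\<dots> = L p * norm (P ((y - x1) + j *\<^sub>R e))" by (simp add: Pw dist_norm)
        also have "\<dots> \<le> Lm * ((C0 + 2) * t)"
        proof (rule mult_mono[OF Lm[OF p(1)] _ Lm0])
          have "norm (P ((y - x1) + j *\<^sub>R e)) \<le> norm ((y - x1) + j *\<^sub>R e)" by (rule Pn)
          also have "\<dots> \<le> norm (y - x1) + norm (j *\<^sub>R e)" by (rule norm_triangle_ineq)
          also have "norm (j *\<^sub>R e) \<le> 2 * t" using j mult_mono[OF j(2) e] by simp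
          finally show "norm (P ((y - x1) + j *\<^sub>R e)) \<le> (C0 + 2) * t" using dx1 by (simp add: algebra_simps)
        qed simp
        finally have "\<bar>\<phi> p (P w) - \<phi> p (P x1)\<bar> \<le> Lm * ((C0 + 2) * t)" .
        then have "x1 \<bullet> m - Lm * ((C0 + 2) * t) \<le> \<phi> p (P w)" using x1\<phi> by linarith
        moreover have "w \<bullet> m \<le> x1 \<bullet> m + C0 * t + (j * t - j * (A * t))"
        proof -
          have "w \<bullet> m = x1 \<bullet> m + (y - x1) \<bullet> m + j * (e \<bullet> m) - j * (A * t)"
            unfolding wx using m(2) by (simp add: inner_add_left inner_diff_left)
          moreover have "(y - x1) \<bullet> m \<le> C0 * t" using norm_cauchy_schwarz[of "y - x1" m] m(1) dx1 by simp
          moreover have "j * (e \<bullet> m) \<le> j * t" using norm_cauchy_schwarz[of e m] m(1) e j by (intro mult_left_mono) auto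
          ultimately show ?thesis by linarith
        qed
        moreover have "j * t - j * (A * t) \<le> t - A * t"
        proof -
          have "0 \<le> (j - 1) * ((A - 1) * t)" using j A1 t by simp
          then show ?thesis by (simp add: algebra_simps)
        qed
        moreover have "A * t = C0 * t + t + Lm * ((C0 + 2) * t)" by (simp add: A_def algebra_simps)
        ultimately show False using lt by linarith
      qed
      have "cball ((- A * t) *\<^sub>R m) t \<subseteq> cball 0 (R * t)"
      proof
        fix z assume "z \<in> cball ((- A * t) *\<^sub>R m) t"
        then have "norm ((- A * t) *\<^sub>R m - z) \<le> t" by (simp add: dist_norm)
        moreover have "norm ((- A * t) *\<^sub>R m) = A * t" using m(1) A1 t by simp
        ultimately have "norm z \<le> (A + 1) * t"
          using norm_triangle_ineq4[of "(- A * t) *\<^sub>R m" "(- A * t) *\<^sub>R m - z"] by (simp add: algebra_simps)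
        also have "\<dots> \<le> R * t" using t by (intro mult_right_mono) (auto simp: R_def)
        finally show "z \<in> cball 0 (R * t)" by simp
      qed
      then show ?thesis using out[where j = 1] out[where j = 2] by (intro exI[of _ "(- A * t) *\<^sub>R m"]) auto
    next
      \<comment> \<open>For t \<ge> t0 the shape of the boundary is irrelevant: a step of length at
        least \<open>2 * Rb\<close> leaves \<Omega>, and R may depend on t0.\<close>
      case False
      obtain b :: 'a where b: "b \<in> Basis" using nonempty_Basis by blast
      define z0 where "z0 = (2 * Rb + 1) *\<^sub>R b"
      have nz0: "norm z0 = 2 * Rb + 1" using b Rb(1) by (simp add: z0_def)
      have z: "2 * Rb \<le> norm z" "norm z \<le> 2 * Rb + 2" if "z \<in> cball z0 t" for z
      proof -
        have "norm (z0 - z) \<le> 1" using that t by (simp add: dist_norm)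
        then show "2 * Rb \<le> norm z" "norm z \<le> 2 * Rb + 2"
          using norm_triangle_ineq2[of z0 z] norm_triangle_ineq2[of z z0] nz0 norm_minus_commute[of z z0] by linarith+
      qed
      have out: "y + j *\<^sub>R z \<notin> \<Omega>" if "z \<in> cball z0 t" "1 \<le> j" for z j
      proof
        assume "y + j *\<^sub>R z \<in> \<Omega>"
        then have "norm (y + j *\<^sub>R z) < Rb" by (rule Rb(2))
        moreover have "norm (j *\<^sub>R z) \<le> norm (y + j *\<^sub>R z) + norm y"
          using norm_triangle_ineq4[of "y + j *\<^sub>R z" y] by simp
        moreover have "1 * norm z \<le> j * norm z" using that(2) by (intro mult_right_mono) auto
        ultimately show False using Rb(2)[OF y] z(1)[OF that(1)] that(2) by simp
      qed
      have "cball z0 t \<subseteq> cball 0 (R * t)"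
      proof
        fix z assume "z \<in> cball z0 t"
        then have "norm z \<le> 2 * Rb + 2" by (rule z)
        also have "\<dots> = (2 * Rb + 2) / t0 * t0" using t0 by simp
        also have "\<dots> \<le> R * t" using False t0 less_imp_le[OF R] by (intro mult_mono) (auto simp: R_def le_max_iff_disj)
        finally show "z \<in> cball 0 (R * t)" by simp
      qed
      then show ?thesis using out[where j = 1] out[where j = 2] by (intro exI[of _ z0]) auto
    qed
  qed
qed

section \<open>Averages over balls and their second differences\<close>

definition average :: "('a::euclidean_space \<Rightarrow> real) \<Rightarrow> ('a \<Rightarrow> real) \<Rightarrow> 'a \<Rightarrow> real" where
  "average k f x = (LINT u|lborel. k u * f (x + u))"

definition second_diff :: "('a::euclidean_space \<Rightarrow> real) \<Rightarrow> 'a \<Rightarrow> 'a \<Rightarrow> real" where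
  "second_diff f x z = f (x + z) - 2 * f x + f (x - z)"

lemma second_diff_measurable [measurable]:
  assumes [measurable]: "f \<in> borel_measurable borel"
  shows "(\<lambda>p. second_diff f (fst p) (snd p)) \<in> borel_measurable (borel \<Otimes>\<^sub>M borel)" "second_diff f x \<in> borel_measurable borel"
  unfolding second_diff_def[abs_def] by measurable

text \<open>Evenness lets the deviation of an average from f be expressed by symmetric second
  differences. Bounding k by 1, instead of normalizing its mass, keeps the kernel out of the
  estimates.\<close>

locale even_kernel =
  fixes k :: "'a::euclidean_space \<Rightarrow> real" and r :: real
  assumes k_meas [measurable]: "k \<in> borel_measurable borel" and k0: "\<And>u. 0 \<le> k u" and k1: "\<And>u. k u \<le> 1"
    and k_even: "\<And>u. k (- u) = k u" and k_supp: "\<And>u. u \<notin> cball 0 r \<Longrightarrow> k u = 0"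
begin

lemma average_integrable:
  assumes [measurable]: "f \<in> borel_measurable borel" and M: "\<And>x. \<bar>f x\<bar> \<le> M"
  shows "integrable lborel (\<lambda>u. k u * f (x + u))"
proof (rule bounded_support_integrable[where M = M and R = r])
  show "\<bar>k u * f (x + u)\<bar> \<le> M" for u
    using mult_mono[OF k1[of u] M[of "x + u"]] k0[of u] by (simp add: abs_mult)
qed (use k_supp in auto)

lemma k_integrable: "integrable lborel k"
  by (rule bounded_support_integrable[where M = 1 and R = r]) (use k0 k1 k_supp in auto)

lemma average_le:
  assumes "f \<in> borel_measurable borel" "\<And>x. \<bar>f x\<bar> \<le> M"
  shows "ennreal \<bar>average k f x\<bar> \<le> (\<integral>\<^sup>+u. indicator (cball 0 r) u * ennreal \<bar>f (x + u)\<bar> \<partial>lborel)"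
proof -
  have "ennreal \<bar>average k f x\<bar> \<le> (\<integral>\<^sup>+u. norm (k u * f (x + u)) \<partial>lborel)"
    unfolding average_def using integral_norm_bound_ennreal[OF average_integrable[OF assms]] by simp
  also have "\<dots> \<le> (\<integral>\<^sup>+u. indicator (cball 0 r) u * ennreal \<bar>f (x + u)\<bar> \<partial>lborel)"
  proof (rule nn_integral_mono)
    fix u
    show "ennreal (norm (k u * f (x + u))) \<le> indicator (cball 0 r) u * ennreal \<bar>f (x + u)\<bar>"
    proof (cases "u \<in> cball 0 r")
      case True
      have "\<bar>k u * f (x + u)\<bar> \<le> 1 * \<bar>f (x + u)\<bar>"
        unfolding abs_mult using k0[of u] k1[of u] by (intro mult_right_mono) auto
      with True show ?thesis by (simp add: ennreal_leI)
    qed (simp add: k_supp)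
  qed
  finally show ?thesis .
qed

lemma average_lipschitz:
  assumes f: "f \<in> borel_measurable borel" "\<And>x. \<bar>f x\<bar> \<le> M" and L: "\<And>x y. \<bar>f x - f y\<bar> \<le> L * norm (x - y)"
  shows "\<bar>average k f x - average k f y\<bar> \<le> (LINT u|lborel. k u) * L * norm (x - y)"
proof -
  have "average k f x - average k f y = (LINT u|lborel. k u * (f (x + u) - f (y + u)))"
    unfolding average_def using average_integrable[OF f] by (simp add: right_diff_distrib)
  also have "\<bar>\<dots>\<bar> \<le> (LINT u|lborel. \<bar>k u * (f (x + u) - f (y + u))\<bar>)" by (rule integral_abs_bound)
  also have "\<dots> \<le> (LINT u|lborel. k u * (L * norm (x - y)))"
  proof (rule integral_mono)
    show "integrable lborel (\<lambda>u. \<bar>k u * (f (x + u) - f (y + u))\<bar>)"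
      using average_integrable[OF f] by (simp add: right_diff_distrib)
    show "integrable lborel (\<lambda>u. k u * (L * norm (x - y)))" using k_integrable by simp
    show "\<bar>k u * (f (x + u) - f (y + u))\<bar> \<le> k u * (L * norm (x - y))" for u
      using mult_left_mono[OF L[of "x + u" "y + u"] k0[of u]] k0[of u] by (simp add: abs_mult)
  qed
  finally show ?thesis by simp
qed

lemma average_bounded:
  assumes f: "f \<in> borel_measurable borel" "\<And>x. \<bar>f x\<bar> \<le> M"
  shows "\<bar>average k f x\<bar> \<le> (LINT u|lborel. k u) * M"
proof -
  have "\<bar>average k f x\<bar> \<le> (LINT u|lborel. \<bar>k u * f (x + u)\<bar>)" unfolding average_def by (rule integral_abs_bound)
  also have "\<dots> \<le> (LINT u|lborel. k u * M)"
  proof (rule integral_mono)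
    show "integrable lborel (\<lambda>u. \<bar>k u * f (x + u)\<bar>)" using average_integrable[OF f] by simp
    show "integrable lborel (\<lambda>u. k u * M)" using k_integrable by simp
    show "\<bar>k u * f (x + u)\<bar> \<le> k u * M" for u
      using mult_left_mono[OF f(2)[of "x + u"] k0[of u]] k0[of u] by (simp add: abs_mult)
  qed
  finally show ?thesis by simp
qed

text \<open>Reflecting the integral shows that twice the deviation is the integral of k against
  \<open>second_diff f x\<close>; the factor 2 is given away.\<close>

lemma average_diff_le:
  assumes [measurable]: "f \<in> borel_measurable borel" and M: "\<And>x. \<bar>f x\<bar> \<le> M"
  shows "ennreal \<bar>average k f x - (LINT u|lborel. k u) * f x\<bar> \<le> (\<integral>\<^sup>+u. indicator (cball 0 r) u * ennreal \<bar>second_diff f x u\<bar> \<partial>lborel)"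
proof -
  note int = average_integrable[OF assms]
  have refl: "average k f x = (LINT u|lborel. k u * f (x - u))" "integrable lborel (\<lambda>u. k u * f (x - u))"
    unfolding average_def using integral_reflect[of "\<lambda>u. k u * f (x + u)"] integrable_reflect[OF int[of x]]
    by (simp_all add: k_even)
  have "2 * (average k f x - (LINT u|lborel. k u) * f x) = average k f x + (LINT u|lborel. k u * f (x - u)) - (LINT u|lborel. 2 * f x * k u)"
    using refl by simp
  also have "\<dots> = (LINT u|lborel. k u * f (x + u) + k u * f (x - u) - 2 * f x * k u)"
    unfolding average_def using int[of x] refl(2) k_integrable by simp
  also have "\<dots> = (LINT u|lborel. k u * second_diff f x u)"
    by (intro Bochner_Integration.integral_cong) (auto simp: second_diff_def algebra_simps)
  finally have eq: "2 * (average k f x - (LINT u|lborel. k u) * f x) = (LINT u|lborel. k u * second_diff f x u)" .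
  have "integrable lborel (\<lambda>u. k u * f (x + u) + k u * f (x - u) - 2 * f x * k u)"
    using int[of x] refl(2) k_integrable by simp
  moreover have "(\<lambda>u. k u * f (x + u) + k u * f (x - u) - 2 * f x * k u) = (\<lambda>u. k u * second_diff f x u)"
    by (auto simp: second_diff_def algebra_simps)
  ultimately have ki: "integrable lborel (\<lambda>u. k u * second_diff f x u)" by simp
  have "ennreal \<bar>average k f x - (LINT u|lborel. k u) * f x\<bar> \<le> ennreal (norm (LINT u|lborel. k u * second_diff f x u))"
    unfolding eq[symmetric] by (intro ennreal_leI) simp
  also have "\<dots> \<le> (\<integral>\<^sup>+u. norm (k u * second_diff f x u) \<partial>lborel)" by (rule integral_norm_bound_ennreal[OF ki])
  also have "\<dots> \<le> (\<integral>\<^sup>+u. indicator (cball 0 r) u * ennreal \<bar>second_diff f x u\<bar> \<partial>lborel)"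
  proof (rule nn_integral_mono)
    fix u
    show "ennreal (norm (k u * second_diff f x u)) \<le> indicator (cball 0 r) u * ennreal \<bar>second_diff f x u\<bar>"
    proof (cases "u \<in> cball 0 r")
      case True
      have "\<bar>k u * second_diff f x u\<bar> \<le> 1 * \<bar>second_diff f x u\<bar>"
        unfolding abs_mult using k0[of u] k1[of u] by (intro mult_right_mono) auto
      with True show ?thesis by (simp add: ennreal_leI)
    qed (simp add: k_supp)
  qed
  finally show ?thesis .
qed

lemma second_diff_average:
  assumes f: "f \<in> borel_measurable borel" "\<And>x. \<bar>f x\<bar> \<le> M"
  shows "second_diff (average k f) x z = average k (\<lambda>x. second_diff f x z) x"
proof -
  have "average k (\<lambda>x. second_diff f x z) x = (LINT u|lborel. k u * f ((x + z) + u) - 2 * (k u * f (x + u)) + k u * f ((x - z) + u))"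
    unfolding average_def second_diff_def by (intro Bochner_Integration.integral_cong) (auto simp: algebra_simps)
  then show ?thesis
    unfolding second_diff_def average_def using average_integrable[OF f] by simp
qed

end

text \<open>The square of the truncated paraboloid has a Lipschitz gradient, so its second
  differences are quadratic in the step, with explicit elementary bounds.\<close>

definition bump :: "real \<Rightarrow> 'a::euclidean_space \<Rightarrow> real" where
  "bump t u = (max 0 (1 - (norm u / t)\<^sup>2))\<^sup>2"

lemma bump_le_one: "bump t u \<le> 1"
  unfolding bump_def by (intro power_le_one) auto

lemma bump_supp: "0 < t \<Longrightarrow> u \<notin> cball 0 t \<Longrightarrow> bump t u = 0"
proof -
  assume t: "0 < t" and u: "u \<notin> cball 0 t"
  then have "1 \<le> norm u / t" by simp
  then have "1 \<le> (norm u / t)\<^sup>2" by (simp add: one_le_power)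
  then show ?thesis by (simp add: bump_def)
qed

lemma bump_even_kernel: "0 < t \<Longrightarrow> even_kernel (bump t) t"
  by unfold_locales (auto simp: bump_le_one bump_supp, auto simp: bump_def[abs_def])

text \<open>First-order Taylor expansion of the squared positive part, whose derivative
  \<open>2 * max 0 a\<close> is Lipschitz with constant 2.\<close>

lemma max_sq_taylor:
  fixes a b :: real
  shows "\<bar>(max 0 b)\<^sup>2 - (max 0 a)\<^sup>2 - 2 * max 0 a * (b - a)\<bar> \<le> (b - a)\<^sup>2"
proof -
  have 1: "b\<^sup>2 - a\<^sup>2 - 2 * a * (b - a) = (b - a)\<^sup>2" by (simp add: power2_eq_square algebra_simps)
  have 2: "b\<^sup>2 \<le> (b - a)\<^sup>2" if "0 \<le> b" "a \<le> 0" using that by (intro power_mono) auto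
  have 3: "\<bar>- a\<^sup>2 - 2 * a * (b - a)\<bar> \<le> (b - a)\<^sup>2" if "b \<le> 0" "0 \<le> a"
  proof -
    have X: "- a\<^sup>2 - 2 * a * (b - a) = a\<^sup>2 - 2 * a * b" "(b - a)\<^sup>2 = a\<^sup>2 - 2 * a * b + b\<^sup>2"
      by (simp_all add: power2_eq_square algebra_simps)
    have "0 \<le> - (2 * a * b)" using that by (simp add: mult_nonneg_nonpos)
    then show ?thesis unfolding X using zero_le_power2[of a] zero_le_power2[of b] by linarith
  qed
  show ?thesis
    using 1 2 3 by (cases "0 \<le> a"; cases "0 \<le> b") (auto simp: max_def)
qed

lemma bump_second_difference:
  fixes u z :: "'a::euclidean_space"
  assumes t: "0 < t" and z: "norm z \<le> t"
  shows "\<bar>second_diff (bump t) u z\<bar> \<le> 38 * (norm z / t)\<^sup>2 * indicator (cball 0 (2 * t)) u"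
proof (cases "u \<in> cball 0 (2 * t)")
  case False
  have "t < norm (u + z)" "t < norm (u - z)"
    using False z norm_triangle_ineq4[of "u + z" z] norm_triangle_ineq[of "u - z" z] by auto
  then have "bump t (u + z) = 0" "bump t (u - z) = 0" "bump t u = 0"
    using False t by (auto intro!: bump_supp)
  then show ?thesis using False by (simp add: second_diff_def)
next
  case True
  define \<nu> where "\<nu> = norm z / t"
  define a where "a = 1 - (norm u / t)\<^sup>2"
  define \<mu> where "\<mu> = 2 * (u \<bullet> z) / t\<^sup>2"
  have \<nu>: "0 \<le> \<nu>" "\<nu> \<le> 1" using z t by (auto simp: \<nu>_def)
  have nu: "norm u / t \<le> 2" using True t by (simp add: divide_le_eq mult.commute)
  have a1: "max 0 a \<le> 1" by (simp add: a_def)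
  have \<mu>: "\<bar>\<mu>\<bar> \<le> 4 * \<nu>"
  proof -
    have "\<bar>\<mu>\<bar> = 2 * \<bar>u \<bullet> z\<bar> / t\<^sup>2" by (simp add: \<mu>_def abs_mult)
    also have "\<dots> \<le> 2 * (norm u * norm z) / t\<^sup>2" by (intro divide_right_mono mult_left_mono Cauchy_Schwarz_ineq2) auto
    also have "\<dots> = 2 * (norm u / t) * \<nu>" by (simp add: \<nu>_def power2_eq_square)
    also have "\<dots> \<le> 2 * 2 * \<nu>" using nu \<nu> by (intro mult_right_mono mult_left_mono) auto
    finally show ?thesis by simp
  qed
  have ap: "1 - (norm (u + z) / t)\<^sup>2 = a - \<mu> - \<nu>\<^sup>2" "1 - (norm (u - z) / t)\<^sup>2 = a + \<mu> - \<nu>\<^sup>2"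
    using t by (simp_all add: a_def \<mu>_def \<nu>_def power_divide power2_norm_eq_inner inner_add_left inner_add_right
        inner_diff_left inner_diff_right inner_commute field_simps)
  \<comment> \<open>The terms linear in \<mu> cancel in the second difference. The two Taylor
    remainders sum to at most 34 \<open>\<nu>\<^sup>2\<close>, and the common shift by
    \<open>\<nu>\<^sup>2\<close> adds 4 more, which makes 38.\<close>
  have b: "(\<mu> + \<nu>\<^sup>2)\<^sup>2 + (\<mu> - \<nu>\<^sup>2)\<^sup>2 \<le> 34 * \<nu>\<^sup>2"
  proof -
    have "\<nu>\<^sup>2 * \<nu>\<^sup>2 \<le> \<nu>\<^sup>2 * 1" using \<nu> by (intro mult_left_mono) (auto simp: power_le_one)
    moreover have "\<mu>\<^sup>2 \<le> (4 * \<nu>)\<^sup>2" using power_mono[OF \<mu>, of 2] by simp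
    ultimately show ?thesis by (simp add: power2_sum power2_diff power_mult_distrib power2_eq_square[of "\<nu>\<^sup>2"])
  qed
  have abs3: "s = x + y - w \<Longrightarrow> \<bar>x\<bar> \<le> p \<Longrightarrow> \<bar>y\<bar> \<le> q \<Longrightarrow> \<bar>w\<bar> \<le> r \<Longrightarrow> \<bar>s\<bar> \<le> p + q + r"
    for s x y w p q r :: real by linarith
  have "second_diff (bump t) u z = ((max 0 (a - \<mu> - \<nu>\<^sup>2))\<^sup>2 - (max 0 a)\<^sup>2 - 2 * max 0 a * (a - \<mu> - \<nu>\<^sup>2 - a))
     + ((max 0 (a + \<mu> - \<nu>\<^sup>2))\<^sup>2 - (max 0 a)\<^sup>2 - 2 * max 0 a * (a + \<mu> - \<nu>\<^sup>2 - a)) - 4 * max 0 a * \<nu>\<^sup>2"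
    by (simp add: second_diff_def bump_def ap a_def[symmetric] algebra_simps)
  moreover have "\<bar>(max 0 (a - \<mu> - \<nu>\<^sup>2))\<^sup>2 - (max 0 a)\<^sup>2 - 2 * max 0 a * (a - \<mu> - \<nu>\<^sup>2 - a)\<bar> \<le> (\<mu> + \<nu>\<^sup>2)\<^sup>2"
    using max_sq_taylor[of "a - \<mu> - \<nu>\<^sup>2" a] power2_minus[of "\<mu> + \<nu>\<^sup>2"] by simp
  moreover have "\<bar>(max 0 (a + \<mu> - \<nu>\<^sup>2))\<^sup>2 - (max 0 a)\<^sup>2 - 2 * max 0 a * (a + \<mu> - \<nu>\<^sup>2 - a)\<bar> \<le> (\<mu> - \<nu>\<^sup>2)\<^sup>2"
    using max_sq_taylor[of "a + \<mu> - \<nu>\<^sup>2" a] by simp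
  moreover have "\<bar>4 * max 0 a * \<nu>\<^sup>2\<bar> \<le> 4 * \<nu>\<^sup>2" using mult_right_mono[OF a1, of "\<nu>\<^sup>2"] by (simp add: abs_mult)
  ultimately have "\<bar>second_diff (bump t) u z\<bar> \<le> (\<mu> + \<nu>\<^sup>2)\<^sup>2 + (\<mu> - \<nu>\<^sup>2)\<^sup>2 + 4 * \<nu>\<^sup>2" by (rule abs3)
  also have "\<dots> \<le> 38 * \<nu>\<^sup>2" using b by simp
  finally have "\<bar>second_diff (bump t) u z\<bar> \<le> 38 * \<nu>\<^sup>2" .
  then show ?thesis using True by (simp add: \<nu>_def)
qed

text \<open>The difference falls on the kernel, whose second difference is even and has mean zero,
  so the second difference of \<open>f\<close> may be inserted under the integral.\<close>

lemma second_diff_average_bump_le: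
  fixes f :: "'a::euclidean_space \<Rightarrow> real"
  assumes [measurable]: "f \<in> borel_measurable borel" and M: "\<And>x. \<bar>f x\<bar> \<le> M" and t: "0 < t" and z: "norm z \<le> t"
  shows "ennreal \<bar>second_diff (average (bump t) f) x z\<bar> \<le> ennreal (38 * (norm z / t)\<^sup>2) *
    (\<integral>\<^sup>+u. indicator (cball 0 (2 * t)) u * ennreal \<bar>second_diff f x u\<bar> \<partial>lborel)"
proof -
  interpret even_kernel "bump t" t by (rule bump_even_kernel[OF t])
  define \<psi> where "\<psi> = (\<lambda>u. second_diff (bump t) u z)"
  have \<psi>m [measurable]: "\<psi> \<in> borel_measurable borel" unfolding \<psi>_def second_diff_def by measurable
  have \<psi>b: "\<bar>\<psi> u\<bar> \<le> 38 * (norm z / t)\<^sup>2 * indicator (cball 0 (2 * t)) u" for u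
    unfolding \<psi>_def by (rule bump_second_difference[OF t z])
  have \<psi>e: "\<psi> (- u) = \<psi> u" for u
    using k_even[of "u + z"] k_even[of "u - z"] k_even[of u] by (simp add: \<psi>_def second_diff_def algebra_simps)
  have int: "integrable lborel (\<lambda>u. bump t (u + a) * f (y + u))" for a y
    using integrable_translate[OF average_integrable[OF assms(1) M, of "y - a"], of a] by (simp add: algebra_simps)
  have tr: "average (bump t) f (y - a) = (LINT u|lborel. bump t (u + a) * f (y + u))" for a y
    unfolding average_def using integral_translate[of "\<lambda>u. bump t u * f (y - a + u)" a] by (simp add: algebra_simps)
  have eq1: "second_diff (average (bump t) f) x z = (LINT u|lborel. \<psi> u * f (x + u))"
  proof -
    have "second_diff (average (bump t) f) x z = (LINT u|lborel. bump t (u + - z) * f (x + u)) - 2 * (LINT u|lborel. bump t (u + 0) * f (x + u))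
        + (LINT u|lborel. bump t (u + z) * f (x + u))"
      using tr[of x "- z"] tr[of x z] tr[of x 0] by (simp add: second_diff_def)
    also have "\<dots> = (LINT u|lborel. bump t (u + - z) * f (x + u) - 2 * (bump t (u + 0) * f (x + u)) + bump t (u + z) * f (x + u))"
      using int[of "- z" x] int[of 0 x] int[of z x] by simp
    also have "\<dots> = (LINT u|lborel. \<psi> u * f (x + u))"
      by (intro Bochner_Integration.integral_cong) (auto simp: \<psi>_def second_diff_def algebra_simps)
    finally show ?thesis .
  qed
  have supp: "\<psi> u * c = 0" if "u \<notin> cball 0 (2 * t)" for u c using \<psi>b[of u] that by simp
  have \<psi>i: "integrable lborel (\<lambda>u. \<psi> u * g u)" if [measurable]: "g \<in> borel_measurable borel" and "\<And>u. \<bar>g u\<bar> \<le> N" for g N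
  proof (rule bounded_support_integrable[where R = "2 * t" and M = "38 * (norm z / t)\<^sup>2 * N"])
    show "\<bar>\<psi> u * g u\<bar> \<le> 38 * (norm z / t)\<^sup>2 * N" for u
    proof -
      have "\<bar>\<psi> u\<bar> \<le> 38 * (norm z / t)\<^sup>2" using \<psi>b[of u] by (auto simp: indicator_def split: if_splits intro: order_trans)
      then show ?thesis unfolding abs_mult using that(2)[of u] by (intro mult_mono) auto
    qed
  qed (use supp in auto)
  have i1: "integrable lborel (\<lambda>u. \<psi> u * f (x + u))" "integrable lborel (\<lambda>u. \<psi> u * f (x - u))" "integrable lborel \<psi>"
    using \<psi>i[of "\<lambda>u. f (x + u)" M] \<psi>i[of "\<lambda>u. f (x - u)" M] \<psi>i[of "\<lambda>u. 1" 1] M by auto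
  have zero: "(LINT u|lborel. \<psi> u) = 0"
  proof -
    have kt: "integrable lborel (\<lambda>u. bump t (u + a))" "(LINT u|lborel. bump t (u + a)) = (LINT u::'a|lborel. bump t u)" for a :: 'a
      using integrable_translate[OF k_integrable] integral_translate[OF k_meas] by auto
    have "(LINT u|lborel. \<psi> u) = (LINT u|lborel. bump t (u + z) - 2 * bump t (u + 0) + bump t (u + - z))"
      by (intro Bochner_Integration.integral_cong) (auto simp: \<psi>_def second_diff_def)
    also have "\<dots> = (LINT u|lborel. bump t (u + z)) - 2 * (LINT u::'a|lborel. bump t (u + 0)) + (LINT u|lborel. bump t (u + - z))"
      using kt(1)[of z] kt(1)[of 0] kt(1)[of "- z"] by simp
    finally show ?thesis using kt(2)[of z] kt(2)[of 0] kt(2)[of "- z"] by simp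
  qed
  have "(LINT u|lborel. \<psi> u * f (x + u)) = (LINT u|lborel. \<psi> u * f (x - u))"
    using integral_reflect[of "\<lambda>u. \<psi> u * f (x + u)"] by (simp add: \<psi>e)
  then have "2 * second_diff (average (bump t) f) x z = (LINT u|lborel. \<psi> u * f (x + u)) + (LINT u|lborel. \<psi> u * f (x - u)) - 2 * f x * (LINT u|lborel. \<psi> u)"
    using eq1 zero by simp
  also have "\<dots> = (LINT u|lborel. \<psi> u * f (x + u) + \<psi> u * f (x - u) - 2 * f x * \<psi> u)" using i1 by simp
  also have "(\<lambda>u. \<psi> u * f (x + u) + \<psi> u * f (x - u) - 2 * f x * \<psi> u) = (\<lambda>u. \<psi> u * second_diff f x u)"
    by (auto simp: second_diff_def algebra_simps)
  finally have eq2: "2 * second_diff (average (bump t) f) x z = (LINT u|lborel. \<psi> u * second_diff f x u)" .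
  have "integrable lborel (\<lambda>u. \<psi> u * f (x + u) + \<psi> u * f (x - u) - 2 * f x * \<psi> u)" using i1 by simp
  moreover have "(\<lambda>u. \<psi> u * f (x + u) + \<psi> u * f (x - u) - 2 * f x * \<psi> u) = (\<lambda>u. \<psi> u * second_diff f x u)"
    by (auto simp: second_diff_def algebra_simps)
  ultimately have ii: "integrable lborel (\<lambda>u. \<psi> u * second_diff f x u)" by simp
  have "ennreal \<bar>second_diff (average (bump t) f) x z\<bar> \<le> ennreal (norm (LINT u|lborel. \<psi> u * second_diff f x u))"
    unfolding eq2[symmetric] by (intro ennreal_leI) simp
  also have "\<dots> \<le> (\<integral>\<^sup>+u. norm (\<psi> u * second_diff f x u) \<partial>lborel)" by (rule integral_norm_bound_ennreal[OF ii])
  also have "\<dots> \<le> (\<integral>\<^sup>+u. ennreal (38 * (norm z / t)\<^sup>2) * (indicator (cball 0 (2 * t)) u * ennreal \<bar>second_diff f x u\<bar>) \<partial>lborel)"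
  proof (rule nn_integral_mono)
    fix u
    show "ennreal (norm (\<psi> u * second_diff f x u)) \<le> ennreal (38 * (norm z / t)\<^sup>2) * (indicator (cball 0 (2 * t)) u * ennreal \<bar>second_diff f x u\<bar>)"
    proof (cases "u \<in> cball 0 (2 * t)")
      case True
      have "\<bar>\<psi> u * second_diff f x u\<bar> \<le> (38 * (norm z / t)\<^sup>2) * \<bar>second_diff f x u\<bar>"
        unfolding abs_mult using \<psi>b[of u] True by (intro mult_right_mono) auto
      then have "ennreal \<bar>\<psi> u * second_diff f x u\<bar> \<le> ennreal ((38 * (norm z / t)\<^sup>2) * \<bar>second_diff f x u\<bar>)" by (rule ennreal_leI)
      with True show ?thesis by (simp add: ennreal_mult)
    qed (use supp in simp)
  qed
  also have "\<dots> = ennreal (38 * (norm z / t)\<^sup>2) * (\<integral>\<^sup>+u. indicator (cball 0 (2 * t)) u * ennreal \<bar>second_diff f x u\<bar> \<partial>lborel)"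
  proof -
    have [measurable]: "cball (0::'a) (2 * t) \<in> sets borel" by simp
    show ?thesis unfolding second_diff_def by (rule nn_integral_cmult) measurable
  qed
  finally show ?thesis .
qed

section \<open>Oscillation by second differences, and the mollifier\<close>

lemma nn_cball_square_le:
  fixes h :: "'a::euclidean_space \<Rightarrow> ennreal"
  assumes [measurable]: "h \<in> borel_measurable borel" and r: "0 \<le> r"
  shows "(\<integral>\<^sup>+z. indicator (cball 0 r) z * h z \<partial>lborel)\<^sup>2 \<le>
    ennreal (unit_ball_vol DIM('a) * r ^ DIM('a)) * (\<integral>\<^sup>+z. indicator (cball 0 r) z * (h z)\<^sup>2 \<partial>lborel)"
proof -
  have cb [measurable]: "cball (0::'a) r \<in> sets borel" by simp
  have "(\<integral>\<^sup>+z. indicator (cball 0 r) z * (indicator (cball 0 r) z * h z) \<partial>lborel)\<^sup>2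
    \<le> (\<integral>\<^sup>+z. (indicator (cball 0 r) (z::'a))\<^sup>2 \<partial>lborel) * (\<integral>\<^sup>+z. (indicator (cball 0 r) z * h z)\<^sup>2 \<partial>lborel)"
    by (rule Cauchy_Schwarz_nn_integral) measurable
  also have "(\<integral>\<^sup>+z. (indicator (cball 0 r) (z::'a))\<^sup>2 \<partial>lborel) = (\<integral>\<^sup>+z. indicator (cball 0 r) (z::'a) \<partial>lborel)"
    by (intro nn_integral_cong) (simp add: indicator_def)
  also have "\<dots> = ennreal (unit_ball_vol DIM('a) * r ^ DIM('a))" using emeasure_cball_le[OF r] by simp
  also have "(\<integral>\<^sup>+z. (indicator (cball 0 r) z * h z)\<^sup>2 \<partial>lborel) = (\<integral>\<^sup>+z. indicator (cball 0 r) z * (h z)\<^sup>2 \<partial>lborel)"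
    by (intro nn_integral_cong) (simp add: indicator_def)
  also have "(\<integral>\<^sup>+z. indicator (cball 0 r) z * (indicator (cball 0 r) z * h z) \<partial>lborel) = (\<integral>\<^sup>+z. indicator (cball 0 r) z * h z \<partial>lborel)"
    by (intro nn_integral_cong) (simp add: indicator_def)
  finally show ?thesis .
qed

definition ball_int :: "real \<Rightarrow> ('a::euclidean_space \<Rightarrow> ennreal) \<Rightarrow> ennreal" where
  "ball_int r h = (\<integral>\<^sup>+z. indicator (cball 0 r) z * h z \<partial>lborel)"

text \<open>The first term, centred at x, controls averages around x. The second, centred at x + z,
  recovers the value at x near the boundary, where x + z and x + 2 z can be chosen outside
  \<Omega>.\<close>

definition oscillation :: "real \<Rightarrow> ('a::euclidean_space \<Rightarrow> real) \<Rightarrow> 'a \<Rightarrow> ennreal" where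
  "oscillation r f x = ball_int r (\<lambda>z. ennreal \<bar>second_diff f x z\<bar> + ennreal \<bar>second_diff f (x + z) z\<bar>)"

text \<open>The centre is averaged as well, so that one value at x dominates the oscillation
  averaged near any point of the cell of x.\<close>

definition mean_oscillation :: "real \<Rightarrow> ('a::euclidean_space \<Rightarrow> real) \<Rightarrow> 'a \<Rightarrow> ennreal" where
  "mean_oscillation r f x = ball_int r (\<lambda>w. oscillation r f (x + w))"

lemma ball_int_mono: "r \<le> r' \<Longrightarrow> (\<And>z. z \<in> cball 0 r \<Longrightarrow> h z \<le> h' z) \<Longrightarrow> ball_int r h \<le> ball_int r' h'"
  unfolding ball_int_def by (intro nn_integral_mono) (auto simp: indicator_def)

lemma ball_int_cmult:
  fixes h :: "'a::euclidean_space \<Rightarrow> ennreal"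
  assumes [measurable]: "h \<in> borel_measurable borel"
  shows "ball_int r (\<lambda>z. c * h z) = c * ball_int r h"
proof -
  have cb [measurable]: "cball (0::'a) r \<in> sets borel" by simp
  have "ball_int r (\<lambda>z. c * h z) = (\<integral>\<^sup>+z. c * (indicator (cball 0 r) z * h z) \<partial>lborel)"
    unfolding ball_int_def by (intro nn_integral_cong) (simp add: mult_ac)
  also have "\<dots> = c * ball_int r h" unfolding ball_int_def by (rule nn_integral_cmult) measurable
  finally show ?thesis .
qed

lemma ball_int_const: "0 \<le> r \<Longrightarrow> ball_int r (\<lambda>z::'a::euclidean_space. c) = c * ennreal (unit_ball_vol DIM('a) * r ^ DIM('a))"
  unfolding ball_int_def using emeasure_cball_le[of r "0::'a"]
  by (simp add: mult.commute[of _ c] nn_integral_cmult_indicator)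

lemma ball_int_shift:
  fixes h :: "'a::euclidean_space \<Rightarrow> ennreal"
  assumes [measurable]: "h \<in> borel_measurable borel" and le: "norm a + r \<le> r'"
  shows "ball_int r (\<lambda>u. h (u + a)) \<le> ball_int r' h"
proof -
  have cb [measurable]: "cball (0::'a) r \<in> sets borel" by simp
  have "ball_int r (\<lambda>u. h (u + a)) = (\<integral>\<^sup>+u. indicator (cball 0 r) (u + a - a) * h (u + a) \<partial>lborel)"
    by (simp add: ball_int_def)
  also have "\<dots> = (\<integral>\<^sup>+u. indicator (cball 0 r) (u - a) * h u \<partial>lborel)"
    by (rule nn_integral_translate[of "\<lambda>u. indicator (cball 0 r) (u - a) * h u"]) measurable
  also have "\<dots> \<le> ball_int r' h"
    unfolding ball_int_def
  proof (intro nn_integral_mono)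
    fix u
    show "indicator (cball 0 r) (u - a) * h u \<le> indicator (cball 0 r') u * h u"
      using le norm_triangle_sub[of u a] by (auto simp: indicator_def)
  qed
  finally show ?thesis .
qed

lemma ball_int_measurable:
  fixes h :: "'a::euclidean_space \<Rightarrow> 'a \<Rightarrow> ennreal"
  assumes [measurable]: "case_prod h \<in> borel_measurable (borel \<Otimes>\<^sub>M borel)"
  shows "(\<lambda>x. ball_int r (h x)) \<in> borel_measurable borel"
proof -
  have cb [measurable]: "cball (0::'a) r \<in> sets borel" by simp
  show ?thesis unfolding ball_int_def by measurable
qed

lemma ball_int_swap:
  fixes h :: "'a::euclidean_space \<Rightarrow> 'a \<Rightarrow> ennreal"
  assumes [measurable]: "case_prod h \<in> borel_measurable (borel \<Otimes>\<^sub>M borel)"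
  shows "(\<integral>\<^sup>+x. ball_int r (h x) \<partial>lborel) = ball_int r (\<lambda>z. \<integral>\<^sup>+x. h x z \<partial>lborel)"
proof -
  have cb [measurable]: "cball (0::'a) r \<in> sets borel" by simp
  have "(\<integral>\<^sup>+x. ball_int r (h x) \<partial>lborel) = (\<integral>\<^sup>+z. \<integral>\<^sup>+x. indicator (cball 0 r) z * h x z \<partial>lborel \<partial>lborel)"
    unfolding ball_int_def by (rule lborel_pair.Fubini'[symmetric]) measurable
  also have "\<dots> = ball_int r (\<lambda>z. \<integral>\<^sup>+x. h x z \<partial>lborel)"
    unfolding ball_int_def by (intro nn_integral_cong nn_integral_cmult) measurable
  finally show ?thesis .
qed

lemma oscillation_measurable [measurable]:
  assumes [measurable]: "f \<in> borel_measurable borel"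
  shows "oscillation r f \<in> borel_measurable borel"
  unfolding oscillation_def[abs_def] second_diff_def by (rule ball_int_measurable) measurable

lemma mean_oscillation_measurable [measurable]:
  assumes [measurable]: "f \<in> borel_measurable borel"
  shows "mean_oscillation r f \<in> borel_measurable borel"
  unfolding mean_oscillation_def[abs_def] by (rule ball_int_measurable) measurable

text \<open>Cauchy-Schwarz in z and Tonelli; by translation invariance the terms centred at x and at
  x + z contribute alike, 2 each.\<close>

lemma oscillation_sq_integral:
  fixes f :: "'a::euclidean_space \<Rightarrow> real"
  assumes [measurable]: "f \<in> borel_measurable borel" and r: "0 \<le> r"
  shows "(\<integral>\<^sup>+x. (oscillation r f x)\<^sup>2 \<partial>lborel) \<le> ennreal (4 * (unit_ball_vol DIM('a) * r ^ DIM('a))) * ball_int r (second_diff_energy f)"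
proof -
  let ?w = "unit_ball_vol DIM('a) * r ^ DIM('a)"
  have w0: "0 \<le> ?w" using r by simp
  have sq: "(a + b)\<^sup>2 \<le> 2 * a\<^sup>2 + 2 * b\<^sup>2" for a b :: real
    using zero_le_power2[of "a - b"] by (simp add: power2_sum power2_diff)
  have increment_energy: "(\<integral>\<^sup>+x. ennreal ((second_diff f x z)\<^sup>2) \<partial>lborel) = second_diff_energy f z" for z
    by (simp add: second_diff_energy_def second_diff_def)
  have om': "(\<integral>\<^sup>+x. ennreal ((second_diff f (x + z) z)\<^sup>2) \<partial>lborel) = second_diff_energy f z" for z
    unfolding increment_energy[symmetric] by (rule nn_integral_translate[of "\<lambda>x. ennreal ((second_diff f x z)\<^sup>2)"]) (simp add: second_diff_def)
  have "(\<integral>\<^sup>+x. (oscillation r f x)\<^sup>2 \<partial>lborel) \<le> (\<integral>\<^sup>+x. ennreal ?w * ball_int r (\<lambda>z. 2 * ennreal ((second_diff f x z)\<^sup>2) + 2 * ennreal ((second_diff f (x + z) z)\<^sup>2)) \<partial>lborel)"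
  proof (rule nn_integral_mono)
    fix x
    have "(oscillation r f x)\<^sup>2 \<le> ennreal ?w * ball_int r (\<lambda>z. (ennreal \<bar>second_diff f x z\<bar> + ennreal \<bar>second_diff f (x + z) z\<bar>)\<^sup>2)"
      unfolding oscillation_def ball_int_def by (rule nn_cball_square_le[OF _ r]) (simp add: second_diff_def)
    also have "\<dots> \<le> ennreal ?w * ball_int r (\<lambda>z. 2 * ennreal ((second_diff f x z)\<^sup>2) + 2 * ennreal ((second_diff f (x + z) z)\<^sup>2))"
    proof (intro mult_left_mono ball_int_mono order_refl)
      fix z
      have "(ennreal \<bar>second_diff f x z\<bar> + ennreal \<bar>second_diff f (x + z) z\<bar>)\<^sup>2 = ennreal ((\<bar>second_diff f x z\<bar> + \<bar>second_diff f (x + z) z\<bar>)\<^sup>2)"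
        by (simp add: ennreal_power flip: ennreal_plus)
      also have "\<dots> \<le> ennreal (2 * (second_diff f x z)\<^sup>2 + 2 * (second_diff f (x + z) z)\<^sup>2)"
        using sq[of "\<bar>second_diff f x z\<bar>" "\<bar>second_diff f (x + z) z\<bar>"] by (intro ennreal_leI) simp
      also have "\<dots> = 2 * ennreal ((second_diff f x z)\<^sup>2) + 2 * ennreal ((second_diff f (x + z) z)\<^sup>2)"
        by (simp add: ennreal_plus ennreal_mult')
      finally show "(ennreal \<bar>second_diff f x z\<bar> + ennreal \<bar>second_diff f (x + z) z\<bar>)\<^sup>2 \<le> 2 * ennreal ((second_diff f x z)\<^sup>2) + 2 * ennreal ((second_diff f (x + z) z)\<^sup>2)" .
    qed auto
    finally show "(oscillation r f x)\<^sup>2 \<le> ennreal ?w * ball_int r (\<lambda>z. 2 * ennreal ((second_diff f x z)\<^sup>2) + 2 * ennreal ((second_diff f (x + z) z)\<^sup>2))" .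
  qed
  also have "\<dots> = ennreal ?w * (\<integral>\<^sup>+x. ball_int r (\<lambda>z. 2 * ennreal ((second_diff f x z)\<^sup>2) + 2 * ennreal ((second_diff f (x + z) z)\<^sup>2)) \<partial>lborel)"
    unfolding second_diff_def by (intro nn_integral_cmult, simp, rule ball_int_measurable) measurable
  also have "(\<integral>\<^sup>+x. ball_int r (\<lambda>z. 2 * ennreal ((second_diff f x z)\<^sup>2) + 2 * ennreal ((second_diff f (x + z) z)\<^sup>2)) \<partial>lborel)
    = ball_int r (\<lambda>z. \<integral>\<^sup>+x. 2 * ennreal ((second_diff f x z)\<^sup>2) + 2 * ennreal ((second_diff f (x + z) z)\<^sup>2) \<partial>lborel)"
    unfolding second_diff_def by (rule ball_int_swap) measurable
  also have "(\<lambda>z. \<integral>\<^sup>+x. 2 * ennreal ((second_diff f x z)\<^sup>2) + 2 * ennreal ((second_diff f (x + z) z)\<^sup>2) \<partial>lborel) = (\<lambda>z. 4 * second_diff_energy f z)"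
  proof
    fix z
    have m: "(\<lambda>x. ennreal ((second_diff f x z)\<^sup>2)) \<in> borel_measurable lborel" "(\<lambda>x. ennreal ((second_diff f (x + z) z)\<^sup>2)) \<in> borel_measurable lborel"
      unfolding second_diff_def by measurable
    have "(\<integral>\<^sup>+x. 2 * ennreal ((second_diff f x z)\<^sup>2) + 2 * ennreal ((second_diff f (x + z) z)\<^sup>2) \<partial>lborel) = 2 * second_diff_energy f z + 2 * second_diff_energy f z"
      using m by (simp add: nn_integral_add nn_integral_cmult increment_energy om')
    then show "(\<integral>\<^sup>+x. 2 * ennreal ((second_diff f x z)\<^sup>2) + 2 * ennreal ((second_diff f (x + z) z)\<^sup>2) \<partial>lborel) = 4 * second_diff_energy f z"
      by (simp add: distrib_right[symmetric])
  qed
  also have "ball_int r (\<lambda>z. 4 * second_diff_energy f z) = 4 * ball_int r (second_diff_energy f)" by (intro ball_int_cmult) measurable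
  also have "ennreal ?w * (4 * ball_int r (second_diff_energy f)) = ennreal (4 * ?w) * ball_int r (second_diff_energy f)"
    using w0 by (subst ennreal_mult) (auto simp: mult_ac)
  finally show ?thesis .
qed

lemma mean_oscillation_sq_integral:
  fixes f :: "'a::euclidean_space \<Rightarrow> real"
  assumes [measurable]: "f \<in> borel_measurable borel" and r: "0 \<le> r"
  shows "(\<integral>\<^sup>+x. (mean_oscillation r f x)\<^sup>2 \<partial>lborel) \<le> ennreal ((unit_ball_vol DIM('a) * r ^ DIM('a))\<^sup>2) * (\<integral>\<^sup>+x. (oscillation r f x)\<^sup>2 \<partial>lborel)"
proof -
  let ?w = "unit_ball_vol DIM('a) * r ^ DIM('a)"
  have w0: "0 \<le> ?w" using r by simp
  have "(\<integral>\<^sup>+x. (mean_oscillation r f x)\<^sup>2 \<partial>lborel) \<le> (\<integral>\<^sup>+x. ennreal ?w * ball_int r (\<lambda>w. (oscillation r f (x + w))\<^sup>2) \<partial>lborel)"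
    unfolding mean_oscillation_def ball_int_def by (intro nn_integral_mono nn_cball_square_le r) measurable
  also have "\<dots> = ennreal ?w * (\<integral>\<^sup>+x. ball_int r (\<lambda>w. (oscillation r f (x + w))\<^sup>2) \<partial>lborel)"
    by (intro nn_integral_cmult, simp, rule ball_int_measurable) measurable
  also have "(\<integral>\<^sup>+x. ball_int r (\<lambda>w. (oscillation r f (x + w))\<^sup>2) \<partial>lborel) = ball_int r (\<lambda>w. \<integral>\<^sup>+x. (oscillation r f (x + w))\<^sup>2 \<partial>lborel)"
    by (rule ball_int_swap) measurable
  also have "(\<lambda>w. \<integral>\<^sup>+x. (oscillation r f (x + w))\<^sup>2 \<partial>lborel) = (\<lambda>w. \<integral>\<^sup>+x. (oscillation r f x)\<^sup>2 \<partial>lborel)"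
    by (intro ext nn_integral_translate) measurable
  also have "ball_int r (\<lambda>w::'a. \<integral>\<^sup>+x. (oscillation r f x)\<^sup>2 \<partial>lborel) = (\<integral>\<^sup>+x. (oscillation r f x)\<^sup>2 \<partial>lborel) * ennreal ?w"
    by (rule ball_int_const[OF r])
  also have "ennreal ?w * ((\<integral>\<^sup>+x. (oscillation r f x)\<^sup>2 \<partial>lborel) * ennreal ?w) = ennreal (?w\<^sup>2) * (\<integral>\<^sup>+x. (oscillation r f x)\<^sup>2 \<partial>lborel)"
  proof -
    have "ennreal (?w\<^sup>2) = ennreal ?w * ennreal ?w" unfolding power2_eq_square by (rule ennreal_mult[OF w0 w0])
    then show ?thesis by (simp only: mult_ac)
  qed
  finally show ?thesis .
qed

lemma lipschitz_continuous: "(\<And>x y. \<bar>g x - g y\<bar> \<le> A * norm (x - y)) \<Longrightarrow> continuous_on S g"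
  for g :: "'b::real_normed_vector \<Rightarrow> real"
proof -
  assume g: "\<And>x y. \<bar>g x - g y\<bar> \<le> A * norm (x - y)"
  have "\<bar>A\<bar>-lipschitz_on S g"
  proof (rule lipschitz_onI)
    fix x y
    have "\<bar>g x - g y\<bar> \<le> A * norm (x - y)" by (rule g)
    also have "\<dots> \<le> \<bar>A\<bar> * norm (x - y)" by (intro mult_right_mono) auto
    finally show "dist (g x) (g y) \<le> \<bar>A\<bar> * dist x y" by (simp add: dist_real_def dist_norm)
  qed simp
  then show ?thesis by (rule lipschitz_on_continuous_on)
qed

text \<open>The two averages have different duties: the bump makes second differences quadratic in
  the step, and the ball replaces pointwise oscillation by averaged oscillation, so that bounds at
  different points of one cell become comparable.\<close>

definition smooth :: "real \<Rightarrow> ('a::euclidean_space \<Rightarrow> real) \<Rightarrow> 'a \<Rightarrow> real" where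
  "smooth t f = average (indicat_real (cball 0 t)) (average (bump t) f)"

lemma cball_even_kernel: "even_kernel (indicat_real (cball (0::'a::euclidean_space) t)) t"
proof
  show "indicat_real (cball (0::'a) t) \<in> borel_measurable borel" by (rule borel_measurable_indicator) simp
qed (auto simp: indicator_def)

context
  fixes f :: "'a::euclidean_space \<Rightarrow> real" and M L t :: real
  assumes f_lip: "\<And>x y. \<bar>f x - f y\<bar> \<le> L * norm (x - y)" and f_bd: "\<And>x. \<bar>f x\<bar> \<le> M" and f_meas: "f \<in> borel_measurable borel"
    and t: "0 < t"
begin

interpretation b: even_kernel "bump t :: 'a \<Rightarrow> real" t by (rule bump_even_kernel[OF t])
interpretation x: even_kernel "indicat_real (cball (0::'a) t)" t by (rule cball_even_kernel)

private lemma bump_mass: "0 \<le> (LINT u::'a|lborel. bump t u)" using b.k0 by (intro integral_nonneg_AE) auto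

private lemma cball_mass: "(LINT u::'a|lborel. indicat_real (cball 0 t) u) = unit_ball_vol DIM('a) * t ^ DIM('a)"
  using t by (simp add: content_cball)

private lemma Q_bd: "\<bar>average (bump t) f x\<bar> \<le> (LINT u::'a|lborel. bump t u) * M" by (rule b.average_bounded[OF f_meas f_bd])

private lemma Q_lip: "\<bar>average (bump t) f x - average (bump t) f y\<bar> \<le> (LINT u::'a|lborel. bump t u) * L * norm (x - y)"
  by (rule b.average_lipschitz[OF f_meas f_bd f_lip])

private lemma Q_meas [measurable]: "average (bump t) f \<in> borel_measurable borel"
  by (rule borel_measurable_continuous_onI, rule lipschitz_continuous, rule Q_lip)

lemma smooth_continuous: "continuous_on S (smooth t f)"
  unfolding smooth_def by (rule lipschitz_continuous, rule x.average_lipschitz[OF Q_meas Q_bd Q_lip])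

lemma smooth_diff_le:
  assumes r: "2 * t \<le> r"
  shows "ennreal \<bar>(LINT u::'a|lborel. bump t u) * (unit_ball_vol DIM('a) * t ^ DIM('a)) * f x - smooth t f x\<bar>
    \<le> ennreal (LINT u::'a|lborel. bump t u) * oscillation r f x + mean_oscillation r f x"
proof -
  let ?m = "LINT u::'a|lborel. bump t u" and ?w = "unit_ball_vol DIM('a) * t ^ DIM('a)"
  note f_meas [measurable]
  have osc1: "ball_int t (\<lambda>u. ennreal \<bar>second_diff f y u\<bar>) \<le> oscillation r f y" for y
    unfolding oscillation_def using r t by (intro ball_int_mono) auto
  have dm: "(\<lambda>y. average (bump t) f y - ?m * f y) \<in> borel_measurable borel" by measurable
  have db: "\<bar>average (bump t) f y - ?m * f y\<bar> \<le> ?m * M + ?m * M" for y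
  proof -
    have "\<bar>?m * f y\<bar> \<le> ?m * M" using mult_left_mono[OF f_bd[of y] bump_mass] bump_mass by (simp add: abs_mult)
    then show ?thesis using Q_bd[of y] abs_triangle_ineq4[of "average (bump t) f y" "?m * f y"] by linarith
  qed
  \<comment> \<open>The error of the double average is that of the outer average applied to f, and
    the outer average of the error of the inner one.\<close>
  have split: "?m * ?w * f x - smooth t f x = ?m * (?w * f x - average (indicat_real (cball 0 t)) f x)
      - average (indicat_real (cball 0 t)) (\<lambda>y. average (bump t) f y - ?m * f y) x"
  proof -
    have "average (indicat_real (cball 0 t)) (\<lambda>y. average (bump t) f y - ?m * f y) x
      = (LINT u|lborel. indicat_real (cball 0 t) u * average (bump t) f (x + u) - ?m * (indicat_real (cball 0 t) u * f (x + u)))"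
      unfolding average_def[of "indicat_real (cball 0 t)"] by (intro Bochner_Integration.integral_cong) (auto simp: algebra_simps)
    also have "\<dots> = smooth t f x - ?m * average (indicat_real (cball 0 t)) f x"
      unfolding smooth_def average_def[of "indicat_real (cball 0 t)"]
      using x.average_integrable[OF Q_meas Q_bd, of x] x.average_integrable[OF f_meas f_bd, of x] by simp
    finally show ?thesis by (simp add: algebra_simps)
  qed
  have "ennreal \<bar>?m * ?w * f x - smooth t f x\<bar> \<le> ennreal (?m * \<bar>average (indicat_real (cball 0 t)) f x - ?w * f x\<bar> +
      \<bar>average (indicat_real (cball 0 t)) (\<lambda>y. average (bump t) f y - ?m * f y) x\<bar>)"
  proof (rule ennreal_leI)
    have "\<bar>?m * (?w * f x - average (indicat_real (cball 0 t)) f x)\<bar> = ?m * \<bar>average (indicat_real (cball 0 t)) f x - ?w * f x\<bar>"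
      using bump_mass by (simp add: abs_mult abs_minus_commute)
    then show "\<bar>?m * ?w * f x - smooth t f x\<bar> \<le> ?m * \<bar>average (indicat_real (cball 0 t)) f x - ?w * f x\<bar> +
      \<bar>average (indicat_real (cball 0 t)) (\<lambda>y. average (bump t) f y - ?m * f y) x\<bar>" unfolding split by linarith
  qed
  also have "\<dots> = ennreal ?m * ennreal \<bar>average (indicat_real (cball 0 t)) f x - ?w * f x\<bar> +
      ennreal \<bar>average (indicat_real (cball 0 t)) (\<lambda>y. average (bump t) f y - ?m * f y) x\<bar>"
    using bump_mass by (simp add: ennreal_plus ennreal_mult)
  also have "\<dots> \<le> ennreal ?m * oscillation r f x + mean_oscillation r f x"
  proof (intro add_mono mult_left_mono)
    have "ennreal \<bar>average (indicat_real (cball 0 t)) f x - ?w * f x\<bar> \<le> ball_int t (\<lambda>u. ennreal \<bar>second_diff f x u\<bar>)"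
      using x.average_diff_le[OF f_meas f_bd, of x] unfolding cball_mass ball_int_def by simp
    then show "ennreal \<bar>average (indicat_real (cball 0 t)) f x - ?w * f x\<bar> \<le> oscillation r f x" using osc1 order_trans by blast
    have "ennreal \<bar>average (indicat_real (cball 0 t)) (\<lambda>y. average (bump t) f y - ?m * f y) x\<bar>
      \<le> ball_int t (\<lambda>u. ennreal \<bar>average (bump t) f (x + u) - ?m * f (x + u)\<bar>)"
      unfolding ball_int_def by (rule x.average_le[OF dm db])
    also have "\<dots> \<le> mean_oscillation r f x" unfolding mean_oscillation_def
    proof (rule ball_int_mono)
      fix u
      show "ennreal \<bar>average (bump t) f (x + u) - ?m * f (x + u)\<bar> \<le> oscillation r f (x + u)"
        using b.average_diff_le[OF f_meas f_bd, of "x + u"] osc1[of "x + u"] unfolding ball_int_def by (rule order_trans)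
    qed (use r t in simp)
    finally show "ennreal \<bar>average (indicat_real (cball 0 t)) (\<lambda>y. average (bump t) f y - ?m * f y) x\<bar> \<le> mean_oscillation r f x" .
  qed auto
  finally show ?thesis .
qed

text \<open>The point x is kept apart from y because interpolation at x requires second differences
  at all points y of the cell in terms of a single quantity at x.\<close>

lemma smooth_second_diff_le:
  assumes z: "norm z \<le> t" and r: "2 * t \<le> r" "norm (y - x) + t \<le> r"
  shows "ennreal \<bar>second_diff (smooth t f) y z\<bar> \<le> ennreal (38 * (norm z / t)\<^sup>2) * mean_oscillation r f x"
proof -
  note f_meas [measurable]
  have sm: "(\<lambda>x. second_diff (average (bump t) f) x z) \<in> borel_measurable borel" unfolding second_diff_def by measurable
  have sb: "\<bar>second_diff (average (bump t) f) x z\<bar> \<le> 4 * ((LINT u::'a|lborel. bump t u) * M)" for x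
    unfolding second_diff_def using Q_bd[of "x + z"] Q_bd[of x] Q_bd[of "x - z"] by linarith
  have "ennreal \<bar>second_diff (smooth t f) y z\<bar> \<le> ball_int t (\<lambda>w. ennreal \<bar>second_diff (average (bump t) f) (y + w) z\<bar>)"
    unfolding smooth_def x.second_diff_average[OF Q_meas Q_bd] ball_int_def by (rule x.average_le[OF sm sb])
  also have "\<dots> \<le> ball_int t (\<lambda>w. ennreal (38 * (norm z / t)\<^sup>2) * oscillation r f (y + w))"
  proof (intro ball_int_mono order_refl)
    fix w
    have "ennreal \<bar>second_diff (average (bump t) f) (y + w) z\<bar> \<le> ennreal (38 * (norm z / t)\<^sup>2) * ball_int (2 * t) (\<lambda>u. ennreal \<bar>second_diff f (y + w) u\<bar>)"
      unfolding ball_int_def by (rule second_diff_average_bump_le[OF f_meas f_bd t z])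
    also have "\<dots> \<le> ennreal (38 * (norm z / t)\<^sup>2) * oscillation r f (y + w)"
      unfolding oscillation_def using r by (intro mult_left_mono ball_int_mono) auto
    finally show "ennreal \<bar>second_diff (average (bump t) f) (y + w) z\<bar> \<le> ennreal (38 * (norm z / t)\<^sup>2) * oscillation r f (y + w)" .
  qed
  also have "\<dots> = ennreal (38 * (norm z / t)\<^sup>2) * ball_int t (\<lambda>w. oscillation r f (y + w))" by (intro ball_int_cmult) measurable
  also have "ball_int t (\<lambda>w. oscillation r f (y + w)) = ball_int t (\<lambda>w. oscillation r f (x + (w + (y - x))))" by (simp add: algebra_simps)
  also have "\<dots> \<le> mean_oscillation r f x" unfolding mean_oscillation_def by (rule ball_int_shift[OF _ r(2)]) measurable
  finally show ?thesis by (simp add: mult_left_mono)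
qed

text \<open>For cells close to the complement, where nodal values are bounded by nearby values of f
  instead of being compared with them.\<close>

lemma smooth_abs_le:
  assumes r: "norm (p - x) + 2 * t \<le> r"
  shows "ennreal \<bar>smooth t f p\<bar> \<le> ennreal (unit_ball_vol DIM('a) * t ^ DIM('a)) * ball_int r (\<lambda>u. ennreal \<bar>f (x + u)\<bar>)"
proof -
  note f_meas [measurable]
  have "ennreal \<bar>smooth t f p\<bar> \<le> ball_int t (\<lambda>w. ennreal \<bar>average (bump t) f (p + w)\<bar>)"
    unfolding smooth_def ball_int_def by (rule x.average_le[OF Q_meas Q_bd])
  also have "\<dots> \<le> ball_int t (\<lambda>w::'a. ball_int r (\<lambda>u. ennreal \<bar>f (x + u)\<bar>))"
  proof (rule ball_int_mono[OF order_refl])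
    fix w :: 'a assume w: "w \<in> cball 0 t"
    have "ennreal \<bar>average (bump t) f (p + w)\<bar> \<le> ball_int t (\<lambda>u. ennreal \<bar>f (p + w + u)\<bar>)"
      unfolding ball_int_def by (rule b.average_le[OF f_meas f_bd])
    also have "\<dots> = ball_int t (\<lambda>u. ennreal \<bar>f (x + (u + (p + w - x)))\<bar>)" by (simp add: algebra_simps)
    also have "\<dots> \<le> ball_int r (\<lambda>u. ennreal \<bar>f (x + u)\<bar>)"
    proof (rule ball_int_shift)
      show "norm (p + w - x) + t \<le> r" using w r norm_triangle_ineq[of "p - x" w] by (simp add: algebra_simps)
    qed measurable
    finally show "ennreal \<bar>average (bump t) f (p + w)\<bar> \<le> ball_int r (\<lambda>u. ennreal \<bar>f (x + u)\<bar>)" .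
  qed
  also have "\<dots> = ball_int r (\<lambda>u. ennreal \<bar>f (x + u)\<bar>) * ennreal (unit_ball_vol DIM('a) * t ^ DIM('a))"
    using t by (intro ball_int_const) simp
  finally show ?thesis by (simp add: mult.commute)
qed

end

lemma bump_mass_eq:
  assumes "0 < t"
  shows "(LINT u::'a::euclidean_space|lborel. bump t u) = t ^ DIM('a) * (LINT u::'a|lborel. bump 1 u)"
    "0 < (LINT u::'a|lborel. bump 1 u)"
proof -
  show "0 < (LINT u::'a|lborel. bump 1 u)"
  proof -
    interpret even_kernel "bump 1 :: 'a \<Rightarrow> real" 1 by (rule bump_even_kernel) simp
    have "0 < measure lborel (cball (0::'a) (1/2)) * (9/16)" using content_cball_gt_0_iff[of "0::'a" "1/2"] by simp
    also have "\<dots> = (LINT u::'a|lborel. indicator (cball 0 (1/2)) u * (9/16))" by simp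
    also have "\<dots> \<le> (LINT u::'a|lborel. bump 1 u)"
    proof (rule integral_mono)
      show "integrable lborel (\<lambda>u::'a. indicator (cball 0 (1/2)) u * (9/16 :: real))"
        using emeasure_bounded_finite[of "cball (0::'a) (1/2)"] by simp
      show "indicator (cball 0 (1/2)) u * (9/16) \<le> (bump 1 u :: real)" for u :: 'a
      proof (cases "u \<in> cball 0 (1/2)")
        case True
        then have "(norm u)\<^sup>2 \<le> (1/2)\<^sup>2" by (intro power_mono) auto
        then have "(norm u)\<^sup>2 \<le> 1/4" by (simp add: power_divide)
        then have "3/4 \<le> 1 - (norm u)\<^sup>2" by linarith
        then have "3/4 \<le> max 0 (1 - (norm u)\<^sup>2)" by (rule max.coboundedI2)
        then have "(3/4)\<^sup>2 \<le> (max 0 (1 - (norm u)\<^sup>2))\<^sup>2" by (rule power_mono) simp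
        moreover have "indicator (cball 0 (1/2)) u * (9/16) = (3/4 :: real)\<^sup>2" using True by (simp add: power2_eq_square)
        ultimately show ?thesis by (simp only: bump_def div_by_1)
      qed (simp add: k0)
    qed (rule k_integrable)
    finally show ?thesis .
  qed
  show "(LINT u::'a|lborel. bump t u) = t ^ DIM('a) * (LINT u::'a|lborel. bump 1 u)"
  proof -
    have [measurable]: "(bump t :: 'a \<Rightarrow> real) \<in> borel_measurable borel" by (simp add: bump_def[abs_def])
    have "(LINT u::'a|lborel. bump t u) = (LINT u::'a|density (distr lborel borel (\<lambda>x. 0 + t *\<^sub>R x)) (\<lambda>_. ennreal (\<bar>t\<bar> ^ DIM('a))). bump t u)"
      using lborel_affine[of t "0::'a"] assms by simp
    also have "\<dots> = t ^ DIM('a) * (LINT u::'a|lborel. bump t (t *\<^sub>R u))"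
      using assms by (simp add: integral_density integral_distr)
    also have "(\<lambda>u::'a. bump t (t *\<^sub>R u)) = bump 1" using assms by (auto simp: bump_def)
    finally show ?thesis .
  qed
qed

text \<open>Subtracting one vertex turns affine into linear independence; the linear extension is
  represented by its adjoint at 1.\<close>

lemma affine_interpolation:
  fixes C :: "'a::euclidean_space set" and W :: "'a \<Rightarrow> real"
  assumes "\<not> affine_dependent C"
  shows "\<exists>g b. \<forall>p\<in>C. g \<bullet> p + b = W p"
proof (cases "C = {}")
  case False
  then obtain a where a: "a \<in> C" by blast
  let ?B = "(\<lambda>x. - a + x) ` (C - {a})"
  have "independent ?B" using assms affine_dependent_iff_dependent2[OF a] by simp
  then obtain f :: "'a \<Rightarrow> real" where f: "linear f" "\<And>x. x \<in> ?B \<Longrightarrow> f x = W (a + x) - W a"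
    using linear_independent_extend[of ?B "\<lambda>x. W (a + x) - W a"] by blast
  have ad: "adjoint f 1 \<bullet> x = f x" for x using adjoint_works[OF f(1), of x 1] by (simp add: inner_commute)
  have "adjoint f 1 \<bullet> p + (W a - adjoint f 1 \<bullet> a) = W p" if "p \<in> C" for p
  proof (cases "p = a")
    case False
    then have "f (- a + p) = W p - W a" using f(2)[of "- a + p"] that by simp
    then show ?thesis using ad[of "- a + p"] by (simp add: inner_diff_right)
  qed simp
  then show ?thesis by blast
qed simp

text \<open>Describes the value a at x of an affine interpolant of W on the simplex K. The spanning
  points stay existential, since later steps exploit only that the weights are convex.\<close>

definition barycentric_value :: "('a::euclidean_space \<Rightarrow> real) \<Rightarrow> 'a set \<Rightarrow> 'a \<Rightarrow> real \<Rightarrow> bool" where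
  "barycentric_value W K x a \<longleftrightarrow> (\<exists>C l. finite C \<and> K = convex hull C \<and> (\<forall>p\<in>C. 0 \<le> l p) \<and> sum l C = 1 \<and>
    x = (\<Sum>p\<in>C. l p *\<^sub>R p) \<and> a = (\<Sum>p\<in>C. l p * W p))"

text \<open>The affine pieces agree on the intersection of two cells because it is spanned by common
  vertices. The hypothesis makes W vanish on every cell that touches the complement, which enforces
  the boundary condition without singling out boundary faces.\<close>

lemma (in fe_mesh) fe_interpolant:
  fixes W :: "'a \<Rightarrow> real"
  assumes W: "\<And>K x p. K \<in> \<T> \<Longrightarrow> x \<in> K \<Longrightarrow> x \<notin> \<Omega> \<Longrightarrow> p \<in> K \<Longrightarrow> W p = 0"
  shows "\<exists>w\<in>V. \<forall>K\<in>\<T>. \<forall>x\<in>K. barycentric_value W K x (w x)"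
proof -
  have "\<forall>K\<in>\<T>. \<exists>C. \<not> affine_dependent C \<and> K = convex hull C" by (metis simplexE)
  then obtain C where C: "\<And>K. K \<in> \<T> \<Longrightarrow> \<not> affine_dependent (C K)" "\<And>K. K \<in> \<T> \<Longrightarrow> K = convex hull (C K)" by metis
  have Cfin: "finite (C K)" if "K \<in> \<T>" for K using C(1)[OF that] by (rule aff_independent_finite)
  have CK: "p \<in> K" if "K \<in> \<T>" "p \<in> C K" for K p using C(2)[OF that(1)] hull_inc[OF that(2)] by metis
  have "\<forall>K\<in>\<T>. \<exists>g b. \<forall>p\<in>C K. g \<bullet> p + b = W p" using C(1) affine_interpolation by blast
  then obtain g b where gb: "\<And>K p. K \<in> \<T> \<Longrightarrow> p \<in> C K \<Longrightarrow> g K \<bullet> p + b K = W p" by metis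
  have agree: "g K \<bullet> x + b K = g K' \<bullet> x + b K'" if K: "K \<in> \<T>" "K' \<in> \<T>" "x \<in> K" "x \<in> K'" for K K' x
  proof -
    have f: "(K \<inter> K') face_of K" "(K' \<inter> K) face_of K'"
      using mesh K(1,2) by (auto simp: simplicial_mesh_def triangulation_def)
    obtain S where S: "S \<subseteq> C K" "K \<inter> K' = convex hull S"
      using f(1) C[OF K(1)] face_of_convex_hull_affine_independent[of "C K" "K \<inter> K'"] by metis
    obtain S' where S': "S' \<subseteq> C K'" "K' \<inter> K = convex hull S'"
      using f(2) C[OF K(2)] face_of_convex_hull_affine_independent[of "C K'" "K' \<inter> K"] by metis
    have "\<not> affine_dependent S" "\<not> affine_dependent S'"
      using S S' C(1) K affine_independent_subset by blast+
    \<comment> \<open>Both hulls are the same set, and the extreme points of a simplex are its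
      vertices.\<close>
    then have "p \<in> S \<longleftrightarrow> p \<in> S'" for p
      using extreme_point_of_convex_hull_affine_independent[of S p] extreme_point_of_convex_hull_affine_independent[of S' p]
        S(2) S'(2) by (metis Int_commute)
    then have "S \<subseteq> {x. (g K - g K') \<bullet> x = b K' - b K}"
      using gb[OF K(1)] gb[OF K(2)] S(1) S'(1) by (fastforce simp: inner_diff_left)
    then have "convex hull S \<subseteq> {x. (g K - g K') \<bullet> x = b K' - b K}"
      by (rule hull_minimal) (rule convex_hyperplane)
    then have "(g K - g K') \<bullet> x = b K' - b K" using K(3,4) S(2) by blast
    then show ?thesis by (simp add: inner_diff_left)
  qed
  define sel where "sel = (\<lambda>x. SOME K. K \<in> \<T> \<and> x \<in> K)"
  define w where "w = (\<lambda>x. if \<exists>K\<in>\<T>. x \<in> K then g (sel x) \<bullet> x + b (sel x) else 0)"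
  have wK: "w x = g K \<bullet> x + b K" if "K \<in> \<T>" "x \<in> K" for K x
  proof -
    have "sel x \<in> \<T> \<and> x \<in> sel x" unfolding sel_def by (rule someI[of _ K]) (use that in blast)
    then show ?thesis using agree[of "sel x" K x] that by (auto simp: w_def)
  qed
  have bary: "barycentric_value W K x (w x)" if K: "K \<in> \<T>" "x \<in> K" for K x
  proof -
    have "x \<in> convex hull (C K)" using K C(2) by metis
    then obtain l where l: "\<forall>p\<in>C K. 0 \<le> l p" "sum l (C K) = 1" "(\<Sum>p\<in>C K. l p *\<^sub>R p) = x"
      using convex_hull_finite[OF Cfin[OF K(1)]] by auto
    have "w x = g K \<bullet> (\<Sum>p\<in>C K. l p *\<^sub>R p) + b K * sum l (C K)" using wK[OF K] l by simp
    also have "\<dots> = (\<Sum>p\<in>C K. l p * (g K \<bullet> p + b K))"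
      by (simp add: inner_sum_right sum_distrib_left sum.distrib distrib_left mult.commute)
    also have "\<dots> = (\<Sum>p\<in>C K. l p * W p)" using gb[OF K(1)] by (intro sum.cong) auto
    finally show ?thesis unfolding barycentric_value_def
      using l Cfin[OF K(1)] C(2)[OF K(1)] by (intro exI[of _ "C K"] exI[of _ l]) auto
  qed
  have "w \<in> V" unfolding fe_space_def
  proof (intro CollectI conjI allI impI ballI)
    have "continuous_on (\<Union>K\<in>\<T>. K) w"
    proof (rule continuous_on_closed_Union[OF finite_mesh])
      fix K assume K: "K \<in> \<T>"
      show "closed K" using cell_compact[OF K] by (rule compact_imp_closed)
      show "continuous_on K w"
        by (subst continuous_on_cong[OF refl wK[OF K]]) (auto intro!: continuous_intros)
    qed
    then show "continuous_on (closure \<Omega>) w" using cover by simp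
    fix x assume x: "x \<notin> \<Omega>"
    show "w x = 0"
    proof (cases "\<exists>K\<in>\<T>. x \<in> K")
      case True
      then obtain K where K: "K \<in> \<T>" "x \<in> K" by blast
      from bary[OF K] obtain C l where Cl: "K = convex hull C" "w x = (\<Sum>p\<in>C. l p * W p)"
        unfolding barycentric_value_def by blast
      have "W p = 0" if "p \<in> C" for p using W[OF K x] hull_inc[OF that] Cl(1) by blast
      then show ?thesis using Cl(2) by simp
    qed (simp add: w_def)
  next
    fix K assume "K \<in> \<T>"
    then show "\<exists>g b. \<forall>x\<in>K. w x = g \<bullet> x + b" using wK by blast
  qed
  then show ?thesis using bary by blast
qed

section \<open>The approximation estimate\<close>

lemma ennreal_square_add_le: "(a + b)\<^sup>2 \<le> 2 * a\<^sup>2 + 2 * b\<^sup>2" for a b :: ennreal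
proof (cases "a = top \<or> b = top")
  case True
  then show ?thesis by (auto simp: ennreal_top_mult power2_eq_square ennreal_mult_top)
next
  case False
  then obtain x y where xy: "a = ennreal x" "0 \<le> x" "b = ennreal y" "0 \<le> y" by (cases a; cases b) auto
  have "(x + y)\<^sup>2 \<le> 2 * x\<^sup>2 + 2 * y\<^sup>2" using zero_le_power2[of "x - y"] by (simp add: power2_sum power2_diff)
  then have "ennreal ((x + y)\<^sup>2) \<le> ennreal (2 * x\<^sup>2 + 2 * y\<^sup>2)" by (rule ennreal_leI)
  moreover have "ennreal (2 * x\<^sup>2 + 2 * y\<^sup>2) = 2 * a\<^sup>2 + 2 * b\<^sup>2"
    using xy by (simp add: ennreal_plus ennreal_mult' ennreal_power)
  moreover have "ennreal ((x + y)\<^sup>2) = (a + b)\<^sup>2" using xy by (simp add: ennreal_power flip: ennreal_plus)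
  ultimately show ?thesis by simp
qed

lemma convex_combination_ennreal_le:
  assumes "finite C" "\<And>p. p \<in> C \<Longrightarrow> 0 \<le> l p" "sum l C = 1" "\<And>p. p \<in> C \<Longrightarrow> ennreal \<bar>a p\<bar> \<le> X"
  shows "ennreal \<bar>\<Sum>p\<in>C. l p * a p\<bar> \<le> X"
proof (cases X)
  case (real \<xi>)
  have ap: "\<bar>a p\<bar> \<le> \<xi>" if "p \<in> C" for p using assms(4)[OF that] real by simp
  have "\<bar>\<Sum>p\<in>C. l p * a p\<bar> \<le> (\<Sum>p\<in>C. \<bar>l p * a p\<bar>)" by (rule sum_abs)
  also have "\<dots> \<le> (\<Sum>p\<in>C. l p * \<xi>)" using assms(2) ap by (intro sum_mono) (auto simp: abs_mult intro: mult_left_mono)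
  also have "\<dots> = \<xi>" using assms(3) by (simp add: sum_distrib_right[symmetric])
  finally show ?thesis using real by (simp add: ennreal_leI)
qed simp

text \<open>The approximant interpolates a mollification of \<open>v\<close>, reset to zero at the vertices close to the
  complement of \<open>\<Omega>\<close>. There \<open>v\<close> itself is controlled by the exterior balls.\<close>

theorem jackson_estimate:
  fixes \<Omega> :: "'a::euclidean_space set"
  assumes \<Omega>: "bounded_lipschitz_domain \<Omega>" and c: "0 \<le> c"
  shows "\<exists>R A. 0 < R \<and> 0 \<le> A \<and> (\<forall>\<T> t v L M. simplicial_mesh \<Omega> \<T> \<and> 0 < t \<and> t \<le> 1 \<and> (\<forall>K\<in>\<T>. diameter K \<le> c * t) \<and>
    (\<forall>x y. \<bar>v x - v y\<bar> \<le> L * norm (x - y)) \<and> (\<forall>x. \<bar>v x\<bar> \<le> M) \<and> (\<forall>x. x \<notin> \<Omega> \<longrightarrow> v x = 0) \<longrightarrow>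
    (\<exists>w\<in>fe_space \<Omega> \<T>. (\<integral>\<^sup>+x. ennreal ((v x - w x)\<^sup>2) \<partial>lborel) \<le> ennreal (A / t ^ DIM('a)) * ball_int (R * t) (second_diff_energy v)))"
proof -
  let ?d = "DIM('a)"
  define \<omega> where "\<omega> = unit_ball_vol ?d"
  define m1 where "m1 = (LINT u::'a|lborel. bump 1 u)"
  have \<omega>: "0 < \<omega>" unfolding \<omega>_def by (rule unit_ball_vol_pos) simp
  have m1: "0 < m1" unfolding m1_def by (rule bump_mass_eq(2)[of 1]) simp
  \<comment> \<open>The estimates visit points within (2 + c) t of x, while x is within c t of a
    vertex and that vertex within c t of the complement: in all (2 + 3 c) t.\<close>
  have c0: "0 \<le> 2 + 3 * c" using c by simp
  obtain R1 where R1: "0 < R1" and ext0: "\<forall>t y x0. 0 < t \<and> t \<le> 1 \<and> y \<in> \<Omega> \<and> x0 \<notin> \<Omega> \<and> dist y x0 \<le> (2 + 3 * c) * t \<longrightarrow>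
      (\<exists>z0. cball z0 t \<subseteq> cball 0 (R1 * t) \<and> (\<forall>z\<in>cball z0 t. y + z \<notin> \<Omega> \<and> y + 2 *\<^sub>R z \<notin> \<Omega>))"
    using exterior_balls[OF \<Omega> c0] by (elim exE conjE)
  have ext: "\<exists>z0. cball z0 t \<subseteq> cball 0 (R1 * t) \<and> (\<forall>z\<in>cball z0 t. y + z \<notin> \<Omega> \<and> y + 2 *\<^sub>R z \<notin> \<Omega>)"
    if "0 < t" "t \<le> 1" "y \<in> \<Omega>" "x0 \<notin> \<Omega>" "dist y x0 \<le> (2 + 3 * c) * t" for t y x0
    by (rule ext0[rule_format, of t y x0]) (intro conjI that)
  \<comment> \<open>Room for the exterior balls and for the averaging windows around x.\<close>
  define R where "R = max R1 (3 + 2 * c)"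
  \<comment> \<open>One unit for the error of smoothing, and 38 / 2 times \<open>c\<^sup>2\<close>
    for interpolation on a cell of diameter at most c t.\<close>
  define \<kappa> where "\<kappa> = 1 + 19 * c\<^sup>2"
  define A where "A = (2 * m1\<^sup>2 + 2 * \<kappa>\<^sup>2 * (\<omega> * R ^ ?d)\<^sup>2) * (4 * (\<omega> * R ^ ?d)) / (m1 * \<omega>)\<^sup>2"
  have R: "0 < R" "R1 \<le> R" "3 + 2 * c \<le> R" using R1 by (auto simp: R_def)
  have A0: "0 \<le> A" using \<omega> R by (simp add: A_def)
  have \<kappa>: "1 \<le> \<kappa>" by (simp add: \<kappa>_def)
  show ?thesis
  proof (rule exI[of _ R], rule exI[of _ A], intro conjI R(1) A0 allI impI)
    fix \<T> t v L M
    assume asm: "simplicial_mesh \<Omega> \<T> \<and> 0 < t \<and> t \<le> 1 \<and> (\<forall>K\<in>\<T>. diameter K \<le> c * t) \<and>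
      (\<forall>x y. \<bar>v x - v y\<bar> \<le> L * norm (x - y)) \<and> (\<forall>x. \<bar>v x\<bar> \<le> M) \<and> (\<forall>x. x \<notin> \<Omega> \<longrightarrow> v x = 0)"
    then have mesh: "simplicial_mesh \<Omega> \<T>" and t: "0 < t" "t \<le> 1" and diam: "\<And>K. K \<in> \<T> \<Longrightarrow> diameter K \<le> c * t"
      and Lip: "\<And>x y. \<bar>v x - v y\<bar> \<le> L * norm (x - y)" and bd: "\<And>x. \<bar>v x\<bar> \<le> M" and out: "\<And>x. x \<notin> \<Omega> \<Longrightarrow> v x = 0" by auto
    interpret fe_mesh \<Omega> \<T>
      using \<Omega> mesh by unfold_locales (auto simp: bounded_lipschitz_domain_def)
    have vm [measurable]: "v \<in> borel_measurable borel"
      by (rule borel_measurable_continuous_onI, rule lipschitz_continuous, rule Lip)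
    define r where "r = R * t"
    have r: "0 \<le> r" "R1 * t \<le> r" "(3 + 2 * c) * t \<le> r" using R t by (auto simp: r_def intro: mult_right_mono)
    define m where "m = (LINT u::'a|lborel. bump t u)"
    define W0 where "W0 = \<omega> * t ^ ?d"
    have m_eq: "m = t ^ ?d * m1" unfolding m_def m1_def by (rule bump_mass_eq(1)[OF t(1)])
    have m: "0 < m" and W0: "0 < W0" using m1 t \<omega> by (auto simp: m_eq W0_def)
    have ct: "0 \<le> c * t" using c t by simp
    have t2: "2 * t \<le> r" "t + c * t \<le> r" "2 * t + c * t \<le> r" using r(3) t(1) ct by (auto simp: algebra_simps)
    have near: "ennreal W0 * ennreal \<bar>v y\<bar> \<le> oscillation r v y" if "x0 \<notin> \<Omega>" "dist y x0 \<le> (2 + 3 * c) * t" for y x0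
    proof (cases "y \<in> \<Omega>")
      case True
      from ext[OF t True that] obtain z0 where z0: "cball z0 t \<subseteq> cball 0 (R1 * t)"
        "\<And>z. z \<in> cball z0 t \<Longrightarrow> y + z \<notin> \<Omega> \<and> y + 2 *\<^sub>R z \<notin> \<Omega>" by blast
      have "ennreal W0 * ennreal \<bar>v y\<bar> = ennreal \<bar>v y\<bar> * emeasure lborel (cball z0 t)"
        using emeasure_cball_le[of t z0] t by (simp add: W0_def \<omega>_def mult.commute)
      also have "\<dots> = (\<integral>\<^sup>+z. ennreal \<bar>v y\<bar> * indicator (cball z0 t) z \<partial>lborel)"
        by (rule nn_integral_cmult_indicator[symmetric]) simp
      also have "\<dots> \<le> oscillation r v y" unfolding oscillation_def ball_int_def
      proof (rule nn_integral_mono)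
        fix z
        show "ennreal \<bar>v y\<bar> * indicator (cball z0 t) z \<le> indicator (cball 0 r) z * (ennreal \<bar>second_diff v y z\<bar> + ennreal \<bar>second_diff v (y + z) z\<bar>)"
        proof (cases "z \<in> cball z0 t")
          case True
          have "v (y + z) = 0" "v (y + 2 *\<^sub>R z) = 0" using z0(2)[OF True] out by blast+
          then have "second_diff v (y + z) z = v y" by (simp add: second_diff_def scaleR_2 add.assoc)
          moreover have "z \<in> cball 0 r" using True z0(1) r(2) by fastforce
          ultimately show ?thesis using True by (simp add: add_increasing)
        qed simp
      qed
      finally show ?thesis .
    qed (simp add: out)
    \<comment> \<open>The points farther than c t from the complement. A cell of diameter at most c
      t that touches the complement contains none, so W satisfies the hypothesis of
      \<open>fe_interpolant\<close>.\<close>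
    define inner where "inner = (\<lambda>p. \<forall>x0. x0 \<notin> \<Omega> \<longrightarrow> c * t < dist p x0)"
    define W where "W = (\<lambda>p. if inner p then smooth t v p / (m * W0) else 0)"
    have dK: "dist p x \<le> c * t" if "K \<in> \<T>" "p \<in> K" "x \<in> K" for K p x
      using diameter_bounded_bound[OF compact_imp_bounded[OF cell_compact[OF that(1)]] that(2,3)] diam[OF that(1)] by simp
    have "\<exists>w\<in>V. \<forall>K\<in>\<T>. \<forall>x\<in>K. barycentric_value W K x (w x)"
    proof (rule fe_interpolant)
      fix K x p assume "K \<in> \<T>" "x \<in> K" "x \<notin> \<Omega>" "p \<in> K"
      then have "\<not> inner p" using dK[of K p x] by (force simp: inner_def)
      then show "W p = 0" by (simp add: W_def)
    qed
    then obtain w where wV: "w \<in> V" and w: "\<And>K x. K \<in> \<T> \<Longrightarrow> x \<in> K \<Longrightarrow> barycentric_value W K x (w x)" by blast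
    \<comment> \<open>Scaled by the masses of both kernels, so that no division takes place among
      extended reals.\<close>
    have pointwise: "ennreal (m * W0 * \<bar>v x - w x\<bar>) \<le> ennreal m * oscillation r v x + ennreal \<kappa> * mean_oscillation r v x" for x
    proof (cases "x \<in> \<Omega>")
      case False
      then show ?thesis using out fe_outside[OF wV] by simp
    next
      case True
      then obtain K where K: "K \<in> \<T>" "x \<in> K" using cover closure_subset[of \<Omega>] by blast
      from w[OF K] obtain C l where C: "finite C" "K = convex hull C" and l: "\<And>p. p \<in> C \<Longrightarrow> 0 \<le> l p" "sum l C = 1"
        and x: "x = (\<Sum>p\<in>C. l p *\<^sub>R p)" and wx: "w x = (\<Sum>p\<in>C. l p * W p)"
        unfolding barycentric_value_def by blast
      have am: "m * W0 * \<bar>a\<bar> = \<bar>m * W0 * a\<bar>" for a using m W0 by (simp add: abs_mult)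
      have CK: "p \<in> K" if "p \<in> C" for p using hull_inc[OF that] C(2) by blast
      have mW: "0 < m * W0" using m W0 by simp
      let ?G = "smooth t v"
      show ?thesis
      proof (cases "\<forall>p\<in>C. inner p")
        case True
        have wx': "m * W0 * w x = (\<Sum>p\<in>C. l p * ?G p)"
          unfolding wx sum_distrib_left using True mW by (intro sum.cong) (auto simp: W_def)
        have gap: "ennreal \<bar>?G x - (\<Sum>p\<in>C. l p * ?G p)\<bar> \<le> ennreal (19 * c\<^sup>2) * mean_oscillation r v x"
        proof (cases "mean_oscillation r v x")
          case (real \<mu>)
          have "\<bar>?G x - (\<Sum>p\<in>C. l p * ?G p)\<bar> \<le> 38 * \<mu> / t\<^sup>2 / 2 * (c * t)\<^sup>2"
          proof (rule interpolation_error[OF C(1) _ t(1) _ l x])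
            show "continuous_on (convex hull C) ?G" by (rule smooth_continuous[OF Lip bd vm t(1)])
            show "norm (p - x) \<le> c * t" if "p \<in> C" for p using dK[OF K(1) CK[OF that] K(2)] by (simp add: dist_norm)
            show "0 \<le> 38 * \<mu> / t\<^sup>2" using real by simp
            fix y z :: 'a assume y: "y \<in> convex hull C" and z: "norm z \<le> t"
            have "norm (y - x) \<le> c * t" using dK[OF K(1) _ K(2), of y] y C(2) by (simp add: dist_norm)
            then have "ennreal \<bar>second_diff ?G y z\<bar> \<le> ennreal (38 * (norm z / t)\<^sup>2) * mean_oscillation r v x"
              using t2 by (intro smooth_second_diff_le[OF Lip bd vm t(1) z]) auto
            also have "\<dots> = ennreal (38 * (norm z / t)\<^sup>2 * \<mu>)" using real by (simp add: ennreal_mult)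
            finally have "\<bar>second_diff ?G y z\<bar> \<le> 38 * (norm z / t)\<^sup>2 * \<mu>" using real by simp
            then show "\<bar>?G (y + z) - 2 * ?G y + ?G (y - z)\<bar> \<le> 38 * \<mu> / t\<^sup>2 * (norm z)\<^sup>2"
              by (simp add: second_diff_def power_divide mult_ac)
          qed
          also have "38 * \<mu> / t\<^sup>2 / 2 * (c * t)\<^sup>2 = 19 * c\<^sup>2 * \<mu>" using t by (simp add: power_mult_distrib)
          finally show ?thesis using real by (simp add: ennreal_mult'[symmetric] ennreal_leI)
        next
          case top
          show ?thesis
          \<comment> \<open>An infinite mean oscillation makes the bound trivial unless its
            coefficient is 0, since 0 times infinity is 0 in \<open>ennreal\<close>. For c = 0 the
            vertices coincide with x.\<close>
          proof (cases "c = 0")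
            case True
            have "p = x" if "p \<in> C" for p using dK[OF K(1) CK[OF that] K(2)] True by simp
            then have "(\<Sum>p\<in>C. l p * ?G p) = (\<Sum>p\<in>C. l p * ?G x)" by (intro sum.cong) auto
            also have "\<dots> = ?G x" using l by (simp add: sum_distrib_right[symmetric])
            finally show ?thesis by simp
          qed (simp add: top ennreal_mult_top)
        qed
        have "m * W0 * \<bar>v x - w x\<bar> = \<bar>(m * W0 * v x - ?G x) + (?G x - (\<Sum>p\<in>C. l p * ?G p))\<bar>"
          unfolding am using wx' by (simp add: right_diff_distrib)
        also have "ennreal \<dots> \<le> ennreal (\<bar>m * W0 * v x - ?G x\<bar> + \<bar>?G x - (\<Sum>p\<in>C. l p * ?G p)\<bar>)"
          by (intro ennreal_leI abs_triangle_ineq)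
        also have "\<dots> = ennreal \<bar>m * W0 * v x - ?G x\<bar> + ennreal \<bar>?G x - (\<Sum>p\<in>C. l p * ?G p)\<bar>" by simp
        also have "\<dots> \<le> (ennreal m * oscillation r v x + mean_oscillation r v x) + ennreal (19 * c\<^sup>2) * mean_oscillation r v x"
          using smooth_diff_le[OF Lip bd vm t(1) t2(1), of x] gap unfolding m_def W0_def \<omega>_def by (rule add_mono)
        also have "\<dots> = ennreal m * oscillation r v x + ennreal \<kappa> * mean_oscillation r v x"
          by (simp add: \<kappa>_def ennreal_plus distrib_right add.assoc)
        finally show ?thesis .
      next
        \<comment> \<open>With a vertex near the complement v and w are not compared: each is
          bounded on its own by oscillations, through the exterior balls.\<close>
        case False
        then obtain p0 x0 where p0: "p0 \<in> C" "x0 \<notin> \<Omega>" "dist p0 x0 \<le> c * t" by (auto simp: inner_def not_less)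
        have close: "dist y x0 \<le> (2 + 3 * c) * t" if "norm (y - x) \<le> (2 + c) * t" for y
        proof -
          have "dist y x0 \<le> dist y x + dist x p0 + dist p0 x0"
            using dist_triangle[of y x0 x] dist_triangle[of x x0 p0] by linarith
          also have "\<dots> \<le> (2 + c) * t + c * t + c * t"
            using that p0(3) dK[OF K(1,2) CK[OF p0(1)]] by (intro add_mono) (auto simp: dist_norm)
          finally show ?thesis by (simp add: algebra_simps)
        qed
        have v1: "ennreal (m * W0 * \<bar>v x\<bar>) \<le> ennreal m * oscillation r v x"
        proof -
          have "ennreal (m * W0 * \<bar>v x\<bar>) = ennreal m * (ennreal W0 * ennreal \<bar>v x\<bar>)"
            using m W0 by (simp add: ennreal_mult' mult.assoc)
          also have "\<dots> \<le> ennreal m * oscillation r v x"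
            using near[OF p0(2) close, of x] c t by (intro mult_left_mono) auto
          finally show ?thesis .
        qed
        have v2: "ennreal (m * W0 * \<bar>w x\<bar>) \<le> mean_oscillation r v x"
        proof -
          have Wp: "ennreal \<bar>m * W0 * W p\<bar> \<le> mean_oscillation r v x" if p: "p \<in> C" for p
          proof (cases "inner p")
            case True
            have "ennreal \<bar>m * W0 * W p\<bar> = ennreal \<bar>?G p\<bar>" using True m W0 by (simp add: W_def)
            also have "\<dots> \<le> ennreal W0 * ball_int ((2 + c) * t) (\<lambda>u. ennreal \<bar>v (x + u)\<bar>)"
              unfolding W0_def \<omega>_def
            proof (rule smooth_abs_le[OF Lip bd vm t(1)])
              show "norm (p - x) + 2 * t \<le> (2 + c) * t" using dK[OF K(1) CK[OF p] K(2)] by (simp add: dist_norm algebra_simps)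
            qed
            also have "\<dots> = ball_int ((2 + c) * t) (\<lambda>u. ennreal W0 * ennreal \<bar>v (x + u)\<bar>)"
              by (rule ball_int_cmult[symmetric]) measurable
            also have "\<dots> \<le> mean_oscillation r v x" unfolding mean_oscillation_def
            proof (rule ball_int_mono)
              show "(2 + c) * t \<le> r" using t2(3) by (simp add: algebra_simps)
              fix u :: 'a assume "u \<in> cball 0 ((2 + c) * t)"
              then show "ennreal W0 * ennreal \<bar>v (x + u)\<bar> \<le> oscillation r v (x + u)" by (intro near[OF p0(2) close]) simp
            qed
            finally show ?thesis .
          qed (simp add: W_def)
          have "m * W0 * \<bar>w x\<bar> = \<bar>\<Sum>p\<in>C. l p * (m * W0 * W p)\<bar>"
            unfolding am wx by (simp add: sum_distrib_left mult_ac)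
          then show ?thesis using convex_combination_ennreal_le[OF C(1) l Wp] by simp
        qed
        have "ennreal (m * W0 * \<bar>v x - w x\<bar>) \<le> ennreal (m * W0 * \<bar>v x\<bar> + m * W0 * \<bar>w x\<bar>)"
          using mult_left_mono[OF abs_triangle_ineq4[of "v x" "w x"], of "m * W0"] mW by (intro ennreal_leI) (simp add: distrib_left)
        also have "\<dots> = ennreal (m * W0 * \<bar>v x\<bar>) + ennreal (m * W0 * \<bar>w x\<bar>)" using mW by (intro ennreal_plus) auto
        also have "\<dots> \<le> ennreal m * oscillation r v x + mean_oscillation r v x" by (rule add_mono[OF v1 v2])
        also have "mean_oscillation r v x \<le> ennreal \<kappa> * mean_oscillation r v x"
          using mult_right_mono[of 1 "ennreal \<kappa>" "mean_oscillation r v x"] \<kappa> by simp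
        finally show ?thesis by (simp add: add_left_mono)
      qed
    qed
    define B where "B = (2 * m\<^sup>2 + 2 * \<kappa>\<^sup>2 * (\<omega> * r ^ ?d)\<^sup>2) * (4 * (\<omega> * r ^ ?d))"
    have wm [measurable]: "w \<in> borel_measurable borel" by (rule fe_borel[OF wV])
    define N2 where "N2 = (\<integral>\<^sup>+x. ennreal ((v x - w x)\<^sup>2) \<partial>lborel)"
    define O2 where "O2 = (\<integral>\<^sup>+x. (oscillation r v x)\<^sup>2 \<partial>lborel)"
    have mW: "0 < m * W0" using m W0 by simp
    have "ennreal ((m * W0)\<^sup>2) * N2 = (\<integral>\<^sup>+x. (ennreal (m * W0 * \<bar>v x - w x\<bar>))\<^sup>2 \<partial>lborel)"
    proof -
      have "ennreal ((m * W0)\<^sup>2) * N2 = (\<integral>\<^sup>+x. ennreal ((m * W0)\<^sup>2) * ennreal ((v x - w x)\<^sup>2) \<partial>lborel)"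
        unfolding N2_def by (rule nn_integral_cmult[symmetric]) measurable
      also have "\<dots> = (\<integral>\<^sup>+x. (ennreal (m * W0 * \<bar>v x - w x\<bar>))\<^sup>2 \<partial>lborel)"
      proof (rule nn_integral_cong)
        fix x
        have "ennreal ((m * W0)\<^sup>2) * ennreal ((v x - w x)\<^sup>2) = ennreal ((m * W0)\<^sup>2 * (v x - w x)\<^sup>2)"
          by (rule ennreal_mult[symmetric]) auto
        also have "(m * W0)\<^sup>2 * (v x - w x)\<^sup>2 = (m * W0 * \<bar>v x - w x\<bar>)\<^sup>2" by (simp add: power_mult_distrib)
        also have "ennreal \<dots> = (ennreal (m * W0 * \<bar>v x - w x\<bar>))\<^sup>2" using mW by (intro ennreal_power[symmetric]) simp
        finally show "ennreal ((m * W0)\<^sup>2) * ennreal ((v x - w x)\<^sup>2) = (ennreal (m * W0 * \<bar>v x - w x\<bar>))\<^sup>2" .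
      qed
      finally show ?thesis .
    qed
    also have "\<dots> \<le> (\<integral>\<^sup>+x. ennreal (2 * m\<^sup>2) * (oscillation r v x)\<^sup>2 + ennreal (2 * \<kappa>\<^sup>2) * (mean_oscillation r v x)\<^sup>2 \<partial>lborel)"
    proof (rule nn_integral_mono)
      fix x
      have "(ennreal (m * W0 * \<bar>v x - w x\<bar>))\<^sup>2 \<le> (ennreal m * oscillation r v x + ennreal \<kappa> * mean_oscillation r v x)\<^sup>2"
        by (intro power_mono pointwise) auto
      also have "\<dots> \<le> 2 * (ennreal m * oscillation r v x)\<^sup>2 + 2 * (ennreal \<kappa> * mean_oscillation r v x)\<^sup>2" by (rule ennreal_square_add_le)
      also have "\<dots> = ennreal (2 * m\<^sup>2) * (oscillation r v x)\<^sup>2 + ennreal (2 * \<kappa>\<^sup>2) * (mean_oscillation r v x)\<^sup>2"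
        using m \<kappa> by (simp add: power_mult_distrib ennreal_mult' ennreal_power mult.assoc)
      finally show "(ennreal (m * W0 * \<bar>v x - w x\<bar>))\<^sup>2 \<le> ennreal (2 * m\<^sup>2) * (oscillation r v x)\<^sup>2 + ennreal (2 * \<kappa>\<^sup>2) * (mean_oscillation r v x)\<^sup>2" .
    qed
    also have "\<dots> = ennreal (2 * m\<^sup>2) * O2 + ennreal (2 * \<kappa>\<^sup>2) * (\<integral>\<^sup>+x. (mean_oscillation r v x)\<^sup>2 \<partial>lborel)"
      unfolding O2_def by (simp add: nn_integral_add nn_integral_cmult)
    also have "\<dots> \<le> ennreal (2 * m\<^sup>2) * O2 + ennreal (2 * \<kappa>\<^sup>2) * (ennreal ((\<omega> * r ^ ?d)\<^sup>2) * O2)"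
      unfolding O2_def \<omega>_def by (intro add_left_mono mult_left_mono mean_oscillation_sq_integral vm r) auto
    also have "\<dots> = ennreal (2 * m\<^sup>2 + 2 * \<kappa>\<^sup>2 * (\<omega> * r ^ ?d)\<^sup>2) * O2"
      by (simp add: ennreal_plus ennreal_mult' distrib_right mult.assoc)
    also have "\<dots> \<le> ennreal (2 * m\<^sup>2 + 2 * \<kappa>\<^sup>2 * (\<omega> * r ^ ?d)\<^sup>2) * (ennreal (4 * (\<omega> * r ^ ?d)) * ball_int r (second_diff_energy v))"
      unfolding O2_def \<omega>_def by (intro mult_left_mono oscillation_sq_integral vm r) auto
    also have "\<dots> = ennreal B * ball_int r (second_diff_energy v)"
      unfolding B_def using \<omega> r(1) by (subst ennreal_mult) (auto simp: mult.assoc)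
    finally have fin: "ennreal ((m * W0)\<^sup>2) * N2 \<le> ennreal B * ball_int r (second_diff_energy v)" .
    have "N2 = ennreal (1 / (m * W0)\<^sup>2) * (ennreal ((m * W0)\<^sup>2) * N2)"
      using m W0 by (simp add: mult.assoc[symmetric] ennreal_mult'[symmetric])
    also have "\<dots> \<le> ennreal (1 / (m * W0)\<^sup>2) * (ennreal B * ball_int r (second_diff_energy v))" by (intro mult_left_mono fin) simp
    also have "\<dots> = ennreal (B / (m * W0)\<^sup>2) * ball_int r (second_diff_energy v)"
      by (simp add: mult.assoc[symmetric] ennreal_mult'[symmetric])
    also have "B / (m * W0)\<^sup>2 = A / t ^ ?d"
    proof -
      define T where "T = t ^ ?d"
      have T: "0 < T" using t by (simp add: T_def)
      have rd: "r ^ ?d = R ^ ?d * T" by (simp add: r_def T_def power_mult_distrib)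
      have "B = T\<^sup>2 * (2 * m1\<^sup>2 + 2 * \<kappa>\<^sup>2 * (\<omega> * R ^ ?d)\<^sup>2) * (T * (4 * (\<omega> * R ^ ?d)))"
        unfolding B_def m_eq rd T_def[symmetric] by (simp add: power_mult_distrib algebra_simps)
      also have "\<dots> = T\<^sup>2 * T * ((2 * m1\<^sup>2 + 2 * \<kappa>\<^sup>2 * (\<omega> * R ^ ?d)\<^sup>2) * (4 * (\<omega> * R ^ ?d)))" by (simp only: mult_ac)
      finally have BB: "B = T\<^sup>2 * T * ((2 * m1\<^sup>2 + 2 * \<kappa>\<^sup>2 * (\<omega> * R ^ ?d)\<^sup>2) * (4 * (\<omega> * R ^ ?d)))" .
      have mm: "(m * W0)\<^sup>2 = T\<^sup>2 * T\<^sup>2 * (m1 * \<omega>)\<^sup>2" by (simp add: m_eq W0_def T_def[symmetric] power_mult_distrib mult_ac)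
      show ?thesis unfolding BB mm A_def T_def[symmetric] using T by (simp add: power2_eq_square)
    qed
    finally show "\<exists>w\<in>V. (\<integral>\<^sup>+x. ennreal ((v x - w x)\<^sup>2) \<partial>lborel) \<le> ennreal (A / t ^ ?d) * ball_int (R * t) (second_diff_energy v)"
      using wV unfolding N2_def r_def by blast
  qed
qed

section \<open>Multilevel norm equivalence\<close>

lemma mesh_refines_fe_space: "mesh_refines \<T>' \<T> \<Longrightarrow> fe_space \<Omega> \<T> \<subseteq> fe_space \<Omega> \<T>'"
  unfolding mesh_refines_def fe_space_def by (safe; meson subsetD)

text \<open>The supremum in \<open>inball_diameter\<close> is not shown to be attained; a ball with
  more than half the supremal diameter is taken, whence 4 instead of 2.\<close>

lemma inball_diameter_witness:
  fixes K :: "'a::euclidean_space set"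
  assumes K: "bounded K" and d: "0 < diameter K" "diameter K \<le> \<kappa> * inball_diameter K"
  shows "0 < \<kappa>" "\<exists>x r. diameter K / (4 * \<kappa>) \<le> r \<and> cball x r \<subseteq> K"
proof -
  define S where "S = {2 * r |r x. 0 \<le> r \<and> cball x r \<subseteq> K}"
  have "K \<noteq> {}" using d(1) by auto
  then obtain a where a: "a \<in> K" by blast
  then have "2 * 0 \<in> S" unfolding S_def by (auto intro!: exI[of _ "0::real"] exI[of _ a])
  then have S0: "0 \<in> S" by simp
  have ub: "s \<le> diameter K" if "s \<in> S" for s
  proof -
    from that obtain r x where r: "s = 2 * r" "0 \<le> r" "cball x r \<subseteq> K" by (auto simp: S_def)
    then show ?thesis using diameter_subset[OF r(3) K] by (simp add: diameter_cball)
  qed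
  then have bdd: "bdd_above S" by (rule bdd_aboveI)
  have I: "inball_diameter K = Sup S" by (simp add: inball_diameter_def S_def)
  have I0: "0 \<le> inball_diameter K" unfolding I by (rule cSup_upper[OF S0 bdd])
  have "0 < \<kappa> * inball_diameter K" using d by linarith
  then have pos: "0 < \<kappa>" "0 < inball_diameter K" using I0 by (auto simp: zero_less_mult_iff)
  show "0 < \<kappa>" by fact
  have "inball_diameter K / 2 < Sup S" using pos I by simp
  then obtain s where s: "s \<in> S" "inball_diameter K / 2 < s" using less_cSup_iff[of S] S0 bdd by blast
  then obtain r x where r: "s = 2 * r" "0 \<le> r" "cball x r \<subseteq> K" by (auto simp: S_def)
  have "diameter K / (4 * \<kappa>) \<le> inball_diameter K / 4" using d pos by (simp add: field_simps)
  also have "\<dots> \<le> r" using s r by simp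
  finally show "\<exists>x r. diameter K / (4 * \<kappa>) \<le> r \<and> cball x r \<subseteq> K" using r by blast
qed

text \<open>In \<open>1 / (4 * \<kappa> * q * c)\<close> the factor 4 \<kappa> comes from the
  inscribed ball, q from quasi-uniformity, and c from replacing the mesh size by \<gamma> ^ k. The
  parameters are arbitrary reals: their signs follow from the hierarchy, and c \<ge> 1 from
  combining both comparisons of the mesh size.\<close>

lemma grid_level:
  fixes \<Omega> :: "'a::euclidean_space set"
  assumes \<Omega>: "bounded_lipschitz_domain \<Omega>" and \<gamma>: "0 < \<gamma>" and H: "grid_hierarchy \<Omega> \<kappa> q c \<gamma> J \<T>" and k: "k \<le> J"
  shows "fe_level \<Omega> (\<T> k) (\<gamma> ^ k) (1 / (4 * \<kappa> * q * c)) c" "1 \<le> c" "0 < mesh_size (\<T> k)"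
proof -
  have op: "open \<Omega>" and bd: "bounded \<Omega>" and ne: "\<Omega> \<noteq> {}" using \<Omega> by (auto simp: bounded_lipschitz_domain_def)
  have mesh: "simplicial_mesh \<Omega> (\<T> k)" and sr: "shape_regular \<kappa> (\<T> k)" and qu: "quasi_uniform q (\<T> k)"
    and h: "mesh_size (\<T> k) \<le> c * \<gamma> ^ k" "\<gamma> ^ k \<le> c * mesh_size (\<T> k)"
    using H k by (auto simp: grid_hierarchy_def)
  interpret fe_mesh \<Omega> "\<T> k" by unfold_locales (fact op bd mesh)+
  define h where "h = mesh_size (\<T> k)"
  have Tne: "\<T> k \<noteq> {}" using cover ne closure_subset[of \<Omega>] by auto
  have diam: "diameter K \<le> h" if "K \<in> \<T> k" for K
    unfolding h_def mesh_size_def using finite_mesh that by (intro Max_ge) auto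
  have gk: "0 < \<gamma> ^ k" using \<gamma> by simp
  have h0: "0 \<le> h"
  proof -
    obtain K where K: "K \<in> \<T> k" using Tne by blast
    show ?thesis using diam[OF K] diameter_ge_0[OF compact_imp_bounded[OF cell_compact[OF K]]] by linarith
  qed
  have "0 < c * h" using h gk by (simp add: h_def)
  then have c0: "0 < c" and hp: "0 < h" using h0 by (auto simp: zero_less_mult_iff)
  show "0 < mesh_size (\<T> k)" using hp by (simp add: h_def)
  show c1: "1 \<le> c"
  proof (rule ccontr)
    assume "\<not> 1 \<le> c"
    then have "c * c < 1 * 1" using c0 by (intro mult_strict_mono) auto
    then have "c * c * \<gamma> ^ k < 1 * \<gamma> ^ k" using gk by (intro mult_strict_right_mono) auto
    moreover have "\<gamma> ^ k \<le> c * (c * \<gamma> ^ k)"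
      using h c0 order_trans[OF h(2) mult_left_mono[OF h(1), of c]] by simp
    ultimately show False by simp
  qed
  have ball: "\<exists>a. cball a (1 / (4 * \<kappa> * q * c) * \<gamma> ^ k) \<subseteq> K \<and> 0 < \<kappa> \<and> 0 < q" if K: "K \<in> \<T> k" for K
  proof -
    have hq: "h \<le> q * diameter K" using qu K by (simp add: quasi_uniform_def h_def)
    have bK: "bounded K" using cell_compact[OF K] by (rule compact_imp_bounded)
    have "0 < q * diameter K" using hp hq by linarith
    then have q: "0 < q" "0 < diameter K" using diameter_ge_0[OF bK] by (auto simp: zero_less_mult_iff)
    have "diameter K \<le> \<kappa> * inball_diameter K" using sr K by (simp add: shape_regular_def)
    from inball_diameter_witness[OF bK q(2) this]
    obtain x r where \<kappa>: "0 < \<kappa>" and r: "diameter K / (4 * \<kappa>) \<le> r" "cball x r \<subseteq> K" by blast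
    have "\<gamma> ^ k \<le> c * (q * diameter K)"
      using order_trans[OF h(2)[folded h_def] mult_left_mono[OF hq, of c]] c0 by simp
    then have "1 / (4 * \<kappa> * q * c) * \<gamma> ^ k \<le> diameter K / (4 * \<kappa>)"
      using \<kappa> q(1) c0 by (simp add: field_simps)
    then have "cball x (1 / (4 * \<kappa> * q * c) * \<gamma> ^ k) \<subseteq> cball x r" using r(1) by (intro subset_cball) linarith
    then show ?thesis using r(2) \<kappa> q(1) by blast
  qed
  obtain K where "K \<in> \<T> k" using Tne by blast
  from ball[OF this] have \<kappa>q: "0 < \<kappa>" "0 < q" by auto
  show "fe_level \<Omega> (\<T> k) (\<gamma> ^ k) (1 / (4 * \<kappa> * q * c)) c"
  proof unfold_locales
    show "0 < \<gamma> ^ k" by fact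
    show "0 < 1 / (4 * \<kappa> * q * c)" using \<kappa>q c0 by simp
    show "0 \<le> c" using c0 by simp
    show "\<exists>a. cball a (1 / (4 * \<kappa> * q * c) * \<gamma> ^ k) \<subseteq> K" if "K \<in> \<T> k" for K using ball[OF that] by blast
    show "diameter K \<le> c * \<gamma> ^ k" if "K \<in> \<T> k" for K using diam[OF that] h(1) by (simp add: h_def)
  qed
qed

lemma grid_nested:
  assumes H: "grid_hierarchy \<Omega> \<kappa> q c \<gamma> J \<T>" and "j \<le> k" "k \<le> J"
  shows "fe_space \<Omega> (\<T> j) \<subseteq> fe_space \<Omega> (\<T> k)"
  using assms(2,3)
proof (induction k rule: dec_induct)
  case (step n)
  have "mesh_refines (\<T> (Suc n)) (\<T> n)" using H step by (simp add: grid_hierarchy_def)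
  then show ?case using mesh_refines_fe_space step by (metis Suc_leD order_trans)
qed simp

lemma increment_energy_eq_l2_norm: "v \<in> L2 lborel \<Longrightarrow> increment_energy v z = ennreal ((l2_norm (increment z v))\<^sup>2)"
proof -
  assume v: "v \<in> L2 lborel"
  have i: "integrable lborel (\<lambda>x. (increment z v x)\<^sup>2)" using increment_L2[OF v, of z] by (simp add: L2_def)
  have "increment_energy v z = (\<integral>\<^sup>+x. ennreal ((increment z v x)\<^sup>2) \<partial>lborel)" by (simp add: increment_energy_def increment_def)
  also have "\<dots> = ennreal (LINT x|lborel. (increment z v x)\<^sup>2)" by (rule nn_integral_eq_integral[OF i]) simp
  also have "(LINT x|lborel. (increment z v x)\<^sup>2) = (l2_norm (increment z v))\<^sup>2"
    unfolding L2.nm_sq[OF increment_L2[OF v]] by (simp add: ip_def power2_eq_square)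
  finally show ?thesis .
qed

lemma l2_norm_sq_sum_orthogonal:
  assumes "finite I" "\<And>i. i \<in> I \<Longrightarrow> u i \<in> L2 lborel" "\<And>i j. i \<in> I \<Longrightarrow> j \<in> I \<Longrightarrow> i \<noteq> j \<Longrightarrow> ip lborel (u i) (u j) = 0"
  shows "(l2_norm (\<lambda>x. \<Sum>i\<in>I. u i x))\<^sup>2 = (\<Sum>i\<in>I. (l2_norm (u i))\<^sup>2)"
proof -
  have L: "(\<lambda>x. \<Sum>i\<in>I. u i x) \<in> L2 lborel" using assms by (intro L2.sum_mem)
  have "(l2_norm (\<lambda>x. \<Sum>i\<in>I. u i x))\<^sup>2 = (\<Sum>i\<in>I. \<Sum>j\<in>I. ip lborel (u i) (u j))"
    unfolding L2.nm_sq[OF L] using assms(1,2) L by (simp add: L2.B_sum L2.B_sum_right)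
  also have "\<dots> = (\<Sum>i\<in>I. ip lborel (u i) (u i))"
  proof (rule sum.cong[OF refl])
    fix i assume i: "i \<in> I"
    have "(\<Sum>j\<in>I. ip lborel (u i) (u j)) = (\<Sum>j\<in>{i}. ip lborel (u i) (u j))"
      using assms(1,3) i by (intro sum.mono_neutral_right) auto
    then show "(\<Sum>j\<in>I. ip lborel (u i) (u j)) = ip lborel (u i) (u i)" by simp
  qed
  finally show ?thesis using assms(2) by (simp add: L2.nm_sq)
qed

definition diff_const :: "nat \<Rightarrow> real \<Rightarrow> real \<Rightarrow> real" where
  "diff_const d \<rho> c = (1 + sqrt (8 * real d / \<rho>)) * sqrt (inverse_const d \<rho> c) + 2"

text \<open>For each step z the levels are split. Where norm z \<le> \<gamma> ^ j, the strengthened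
  Cauchy-Schwarz inequality gives the squared factor norm z / \<gamma> ^ j. On finer levels
  increments gain nothing, and orthogonality of the \<open>u j\<close> keeps the number of levels
  out of the bound. Integrating against the kernel inside and outside the ball of radius \<gamma> ^
  j gives 1 / (1 - s) and 1 / s.\<close>

lemma gagliardo_le_level_sum:
  fixes \<Omega> :: "'a::euclidean_space set"
  assumes \<Omega>: "bounded_lipschitz_domain \<Omega>" and \<gamma>: "0 < \<gamma>" "\<gamma> < 1"
  shows "\<exists>C\<ge>0. \<forall>J (s::real) \<T> u. 0 < s \<and> s < 1 \<and> grid_hierarchy \<Omega> \<kappa> q c \<gamma> J \<T> \<and> (\<forall>j\<le>J. u j \<in> fe_space \<Omega> (\<T> j)) \<and>
    (\<forall>i\<le>J. \<forall>j\<le>J. i \<noteq> j \<longrightarrow> ip lborel (u i) (u j) = 0) \<longrightarrow>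
    gagliardo s (\<lambda>x. \<Sum>j\<le>J. u j x) \<le> ennreal (C / (s * (1 - s)) * (\<Sum>j\<le>J. (\<gamma> ^ j) powr (- 2 * s) * (l2_norm (u j))\<^sup>2))"
proof -
  let ?d = "DIM('a)"
  define \<rho> where "\<rho> = 1 / (4 * \<kappa> * q * c)"
  define D where "D = diff_const ?d \<rho> c"
  define C1 where "C1 = (D\<^sup>2 + 2 * D) * (2 / (1 - sqrt \<gamma>))"
  define \<omega> where "\<omega> = unit_ball_vol (real ?d)"
  \<comment> \<open>The absolute value keeps this nonnegative before a hierarchy, and with it the
    signs of the parameters, is given.\<close>
  define C where "C = 2 * \<bar>C1\<bar> * (\<omega> * 2 ^ (?d + 3)) + 8 * (\<omega> * 2 ^ (?d + 1))"
  have \<omega>: "0 \<le> \<omega>" by (simp add: \<omega>_def)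
  have C0: "0 \<le> C" using \<omega> by (simp add: C_def)
  show ?thesis
  proof (intro exI[of _ C] conjI C0 allI impI)
    fix J and s :: real and \<T> u
    assume asm: "0 < s \<and> s < 1 \<and> grid_hierarchy \<Omega> \<kappa> q c \<gamma> J \<T> \<and> (\<forall>j\<le>J. u j \<in> fe_space \<Omega> (\<T> j)) \<and>
      (\<forall>i\<le>J. \<forall>j\<le>J. i \<noteq> j \<longrightarrow> ip lborel (u i) (u j) = 0)"
    then have s: "0 < s" "s < 1" and H: "grid_hierarchy \<Omega> \<kappa> q c \<gamma> J \<T>" and uV: "\<And>j. j \<le> J \<Longrightarrow> u j \<in> fe_space \<Omega> (\<T> j)"
      and orth: "\<And>i j. i \<le> J \<Longrightarrow> j \<le> J \<Longrightarrow> i \<noteq> j \<Longrightarrow> ip lborel (u i) (u j) = 0" by auto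
    note lev = grid_level[OF \<Omega> \<gamma>(1) H, folded \<rho>_def]
    have uL: "u j \<in> L2 lborel" if "j \<le> J" for j
    proof -
      interpret fe_level \<Omega> "\<T> j" "\<gamma> ^ j" \<rho> c using lev(1)[OF that] .
      show ?thesis by (rule fe_L2[OF uV[OF that]])
    qed
    have D0: "0 \<le> D" and C10: "0 \<le> C1"
    proof -
      interpret fe_level \<Omega> "\<T> J" "\<gamma> ^ J" \<rho> c using lev(1)[of J] by simp
      show "0 \<le> D" using \<rho> inv_const_nonneg by (simp add: D_def diff_const_def)
      then show "0 \<le> C1" using \<gamma> by (simp add: C1_def)
    qed
    define v where "v = (\<lambda>x. \<Sum>j\<le>J. u j x)"
    define a where "a = (\<lambda>j. (l2_norm (u j))\<^sup>2)"
    have a0: "0 \<le> a j" for j by (simp add: a_def)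
    have vL: "v \<in> L2 lborel" unfolding v_def by (intro L2.sum_mem uL) auto
    have omv: "increment_energy v z \<le> (\<Sum>j\<le>J. ennreal (a j) * (ennreal (2 * C1 / (\<gamma> ^ j)\<^sup>2) * (indicator {z. norm z \<le> \<gamma> ^ j} z * ennreal ((norm z)\<^sup>2))
        + 8 * indicator {z. \<gamma> ^ j < norm z} z))" for z
    proof -
      define I1 where "I1 = {j. j \<le> J \<and> norm z \<le> \<gamma> ^ j}"
      define I2 where "I2 = {j. j \<le> J \<and> \<gamma> ^ j < norm z}"
      have I: "finite I1" "finite I2" "I1 \<union> I2 = {..J}" "I1 \<inter> I2 = {}" "\<And>j. j \<in> I1 \<Longrightarrow> j \<le> J" "\<And>j. j \<in> I2 \<Longrightarrow> j \<le> J"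
        by (auto simp: I1_def I2_def)
      define v1 where "v1 = (\<lambda>x. \<Sum>j\<in>I1. u j x)"
      define v2 where "v2 = (\<lambda>x. \<Sum>j\<in>I2. u j x)"
      have L12: "v1 \<in> L2 lborel" "v2 \<in> L2 lborel" unfolding v1_def v2_def using I uL by (auto intro!: L2.sum_mem)
      have "v = (\<lambda>x. v1 x + v2 x)" unfolding v_def v1_def v2_def using I by (simp add: sum.union_disjoint[symmetric])
      then have "increment z v = (\<lambda>x. increment z v1 x + increment z v2 x)" by (auto simp: increment_def)
      then have "(l2_norm (increment z v))\<^sup>2 \<le> 2 * (l2_norm (increment z v1))\<^sup>2 + 2 * (l2_norm (increment z v2))\<^sup>2"
        using L2.nm_sq_add_le[OF increment_L2[OF L12(1)] increment_L2[OF L12(2)]] L12 vL by (simp add: L2.nm_sq increment_L2 L2.add_mem)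
      moreover have "(l2_norm (increment z v1))\<^sup>2 \<le> C1 * (norm z)\<^sup>2 * (\<Sum>j\<in>I1. (l2_norm (u j) / \<gamma> ^ j)\<^sup>2)"
        unfolding v1_def C1_def
      proof (rule strengthened_Cauchy_Schwarz[OF \<gamma> D0 I(1)])
        show "u j \<in> L2 lborel" if "j \<in> I1" for j using uL I that by blast
        fix j r assume j: "j \<in> I1" and r: "0 < (r::real)" "r \<le> 1"
        interpret fe_level \<Omega> "\<T> j" "\<gamma> ^ j" \<rho> c using lev(1)[OF I(5)[OF j]] .
        show "\<exists>\<tau>>0. \<forall>z. z \<noteq> 0 \<and> norm z \<le> \<tau> \<longrightarrow>
          l2_norm (increment z (u j)) \<le> D * norm z / \<gamma> ^ j * l2_norm (u j) \<and>
          (\<forall>y \<sigma>. r \<le> \<sigma> \<and> \<sigma> \<le> 1 \<and> norm y \<le> \<sigma> * \<gamma> ^ j \<longrightarrow> l2_norm (increment y (increment z (u j))) \<le> D * norm z / \<gamma> ^ j * sqrt \<sigma> * l2_norm (u j))"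
          unfolding D_def diff_const_def by (rule difference_estimates_ex[OF uV[OF I(5)[OF j]] r(1)])
      qed
      moreover have "(l2_norm (increment z v2))\<^sup>2 \<le> 4 * (\<Sum>j\<in>I2. a j)"
      proof -
        have "(l2_norm (increment z v2))\<^sup>2 \<le> (2 * l2_norm v2)\<^sup>2"
          using l2_norm_increment_le[OF L12(2)] L2.nm_nonneg[OF increment_L2[OF L12(2)]] by (intro power_mono)
        also have "(2 * l2_norm v2)\<^sup>2 = 4 * (\<Sum>j\<in>I2. a j)"
          unfolding v2_def a_def power_mult_distrib
          using l2_norm_sq_sum_orthogonal[OF I(2), of u] uL orth I(6) by simp
        finally show ?thesis .
      qed
      ultimately have "(l2_norm (increment z v))\<^sup>2 \<le> 2 * (C1 * (norm z)\<^sup>2 * (\<Sum>j\<in>I1. (l2_norm (u j) / \<gamma> ^ j)\<^sup>2)) + 2 * (4 * (\<Sum>j\<in>I2. a j))"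
        by linarith
      also have "\<dots> = (\<Sum>j\<in>I1. a j * (2 * C1 / (\<gamma> ^ j)\<^sup>2 * (norm z)\<^sup>2)) + (\<Sum>j\<in>I2. a j * 8)"
        by (simp add: sum_distrib_left sum_distrib_right power_divide a_def mult_ac)
      also have "(\<Sum>j\<in>I1. a j * (2 * C1 / (\<gamma> ^ j)\<^sup>2 * (norm z)\<^sup>2)) + (\<Sum>j\<in>I2. a j * 8)
        = (\<Sum>j\<le>J. if norm z \<le> \<gamma> ^ j then a j * (2 * C1 / (\<gamma> ^ j)\<^sup>2 * (norm z)\<^sup>2) else a j * 8)"
        unfolding I(3)[symmetric] sum.union_disjoint[OF I(1,2,4)] by (intro arg_cong2[of _ _ _ _ "(+)"] sum.cong) (auto simp: I1_def I2_def)
      finally have "increment_energy v z \<le> ennreal (\<Sum>j\<le>J. if norm z \<le> \<gamma> ^ j then a j * (2 * C1 / (\<gamma> ^ j)\<^sup>2 * (norm z)\<^sup>2) else a j * 8)"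
        unfolding increment_energy_eq_l2_norm[OF vL] by (rule ennreal_leI)
      also have "\<dots> = (\<Sum>j\<le>J. ennreal (if norm z \<le> \<gamma> ^ j then a j * (2 * C1 / (\<gamma> ^ j)\<^sup>2 * (norm z)\<^sup>2) else a j * 8))"
        using a0 C10 by (intro sum_ennreal[symmetric]) auto
      also have "\<dots> = (\<Sum>j\<le>J. ennreal (a j) * (ennreal (2 * C1 / (\<gamma> ^ j)\<^sup>2) * (indicator {z. norm z \<le> \<gamma> ^ j} z * ennreal ((norm z)\<^sup>2))
        + 8 * indicator {z. \<gamma> ^ j < norm z} z))"
      proof (rule sum.cong[OF refl])
        fix j
        show "ennreal (if norm z \<le> \<gamma> ^ j then a j * (2 * C1 / (\<gamma> ^ j)\<^sup>2 * (norm z)\<^sup>2) else a j * 8)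
          = ennreal (a j) * (ennreal (2 * C1 / (\<gamma> ^ j)\<^sup>2) * (indicator {z. norm z \<le> \<gamma> ^ j} z * ennreal ((norm z)\<^sup>2)) + 8 * indicator {z. \<gamma> ^ j < norm z} z)"
        proof (cases "norm z \<le> \<gamma> ^ j")
          case True
          have "ennreal (a j * (2 * C1 / (\<gamma> ^ j)\<^sup>2 * (norm z)\<^sup>2)) = ennreal (a j) * (ennreal (2 * C1 / (\<gamma> ^ j)\<^sup>2) * ennreal ((norm z)\<^sup>2))"
            using a0 C10 by (simp only: ennreal_mult' ennreal_mult'' zero_le_power2)
          with True show ?thesis by simp
        next
          case False
          then show ?thesis using a0[of j] by (simp add: ennreal_mult')
        qed
      qed
      finally show ?thesis .
    qed
    let ?p = "real ?d + 2 * s"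
    have sets [measurable]: "{z::'a. norm z \<le> r} \<in> sets borel" "{z::'a. r < norm z} \<in> sets borel" for r :: real by auto
    have "gagliardo s v \<le> (\<integral>\<^sup>+z. (\<Sum>j\<le>J. ennreal (a j) * (ennreal (2 * C1 / (\<gamma> ^ j)\<^sup>2) * (indicator {z. norm z \<le> \<gamma> ^ j} z * ennreal ((norm z)\<^sup>2 * norm z powr - ?p))
        + 8 * (indicator {z. \<gamma> ^ j < norm z} z * ennreal (norm z powr - ?p)))) \<partial>(lborel :: 'a measure))"
      unfolding gagliardo_def
    proof (rule nn_integral_mono)
      fix z :: 'a
      have "increment_energy v z * ennreal (frac_kernel s z) \<le> (\<Sum>j\<le>J. ennreal (a j) * (ennreal (2 * C1 / (\<gamma> ^ j)\<^sup>2) * (indicator {z. norm z \<le> \<gamma> ^ j} z * ennreal ((norm z)\<^sup>2))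
        + 8 * indicator {z. \<gamma> ^ j < norm z} z)) * ennreal (frac_kernel s z)"
        by (intro mult_right_mono omv) auto
      also have "\<dots> = (\<Sum>j\<le>J. ennreal (a j) * (ennreal (2 * C1 / (\<gamma> ^ j)\<^sup>2) * (indicator {z. norm z \<le> \<gamma> ^ j} z * ennreal ((norm z)\<^sup>2 * norm z powr - ?p))
        + 8 * (indicator {z. \<gamma> ^ j < norm z} z * ennreal (norm z powr - ?p))))"
        unfolding sum_distrib_right frac_kernel_def
        by (intro sum.cong refl) (simp only: distrib_right distrib_left ennreal_mult' zero_le_power2 mult.assoc)
      finally show "increment_energy v z * ennreal (frac_kernel s z) \<le> (\<Sum>j\<le>J. ennreal (a j) * (ennreal (2 * C1 / (\<gamma> ^ j)\<^sup>2) * (indicator {z. norm z \<le> \<gamma> ^ j} z * ennreal ((norm z)\<^sup>2 * norm z powr - ?p))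
        + 8 * (indicator {z. \<gamma> ^ j < norm z} z * ennreal (norm z powr - ?p))))" .
    qed
    also have "\<dots> = (\<Sum>j\<le>J. ennreal (a j) * (ennreal (2 * C1 / (\<gamma> ^ j)\<^sup>2) * (\<integral>\<^sup>+z. indicator {z. norm z \<le> \<gamma> ^ j} z * ennreal ((norm z)\<^sup>2 * norm z powr - ?p) \<partial>(lborel :: 'a measure))
        + 8 * (\<integral>\<^sup>+z. indicator {z. \<gamma> ^ j < norm z} z * ennreal (norm z powr - ?p) \<partial>(lborel :: 'a measure))))"
      by (simp add: nn_integral_sum nn_integral_cmult nn_integral_add)
    also have "\<dots> \<le> (\<Sum>j\<le>J. ennreal (C / (s * (1 - s)) * ((\<gamma> ^ j) powr (- 2 * s) * a j)))"
    proof (rule sum_mono)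
      fix j
      define t where "t = \<gamma> ^ j"
      have t: "0 < t" using \<gamma> by (simp add: t_def)
      have "ennreal (2 * C1 / t\<^sup>2) * (\<integral>\<^sup>+z. indicator {z. norm z \<le> t} z * ennreal ((norm z)\<^sup>2 * norm z powr - ?p) \<partial>(lborel :: 'a measure))
        + 8 * (\<integral>\<^sup>+z. indicator {z. t < norm z} z * ennreal (norm z powr - ?p) \<partial>(lborel :: 'a measure))
        \<le> ennreal (2 * C1 / t\<^sup>2) * ennreal (\<omega> * 2 ^ (?d + 3) * t powr (2 - 2 * s) / (1 - s)) + 8 * ennreal (\<omega> * 2 ^ (?d + 1) * t powr (- 2 * s) / s)"
        unfolding \<omega>_def by (intro add_mono mult_left_mono kernel_inner_le kernel_outer_le s t) auto
      also have "\<dots> = ennreal (2 * C1 / t\<^sup>2 * (\<omega> * 2 ^ (?d + 3) * t powr (2 - 2 * s) / (1 - s)) + 8 * (\<omega> * 2 ^ (?d + 1) * t powr (- 2 * s) / s))"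
      proof -
        have gen: "ennreal p * ennreal x + 8 * ennreal y = ennreal (p * x + 8 * y)" if "0 \<le> p" "0 \<le> x" "0 \<le> y" for p x y
          using that by (simp add: ennreal_mult ennreal_plus)
        show ?thesis by (rule gen) (use \<omega> s C10 in auto)
      qed
      also have "\<dots> \<le> ennreal (C / (s * (1 - s)) * t powr (- 2 * s))"
      proof (rule ennreal_leI)
        have "t powr (2 - 2 * s) = t powr (- 2 * s) * t\<^sup>2"
          using t powr_add[of t "- 2 * s" 2] by (simp add: powr_numeral)
        then have "2 * C1 / t\<^sup>2 * (\<omega> * 2 ^ (?d + 3) * t powr (2 - 2 * s) / (1 - s)) = 2 * \<bar>C1\<bar> * (\<omega> * 2 ^ (?d + 3)) * t powr (- 2 * s) * (1 / (1 - s))"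
          using t C10 by simp
        also have "\<dots> \<le> 2 * \<bar>C1\<bar> * (\<omega> * 2 ^ (?d + 3)) * t powr (- 2 * s) * (1 / (s * (1 - s)))"
          using s \<omega> by (intro mult_left_mono frac_le mult_nonneg_nonneg) auto
        finally have 1: "2 * C1 / t\<^sup>2 * (\<omega> * 2 ^ (?d + 3) * t powr (2 - 2 * s) / (1 - s)) \<le> 2 * \<bar>C1\<bar> * (\<omega> * 2 ^ (?d + 3)) * t powr (- 2 * s) * (1 / (s * (1 - s)))" .
        have 2: "8 * (\<omega> * 2 ^ (?d + 1) * t powr (- 2 * s) / s) \<le> 8 * (\<omega> * 2 ^ (?d + 1)) * t powr (- 2 * s) * (1 / (s * (1 - s)))"
        proof -
          have "8 * (\<omega> * 2 ^ (?d + 1)) * t powr (- 2 * s) * (1 / s) \<le> 8 * (\<omega> * 2 ^ (?d + 1)) * t powr (- 2 * s) * (1 / (s * (1 - s)))"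
            using s \<omega> by (intro mult_left_mono frac_le mult_nonneg_nonneg) auto
          then show ?thesis by simp
        qed
        have "C / (s * (1 - s)) * t powr (- 2 * s) = 2 * \<bar>C1\<bar> * (\<omega> * 2 ^ (?d + 3)) * t powr (- 2 * s) * (1 / (s * (1 - s)))
          + 8 * (\<omega> * 2 ^ (?d + 1)) * t powr (- 2 * s) * (1 / (s * (1 - s)))"
          unfolding C_def by (simp add: add_divide_distrib distrib_right)
        with 1 2 show "2 * C1 / t\<^sup>2 * (\<omega> * 2 ^ (?d + 3) * t powr (2 - 2 * s) / (1 - s)) + 8 * (\<omega> * 2 ^ (?d + 1) * t powr (- 2 * s) / s)
          \<le> C / (s * (1 - s)) * t powr (- 2 * s)" by linarith
      qed
      finally have "ennreal (a j) * (ennreal (2 * C1 / t\<^sup>2) * (\<integral>\<^sup>+z. indicator {z. norm z \<le> t} z * ennreal ((norm z)\<^sup>2 * norm z powr - ?p) \<partial>(lborel :: 'a measure))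
        + 8 * (\<integral>\<^sup>+z. indicator {z. t < norm z} z * ennreal (norm z powr - ?p) \<partial>(lborel :: 'a measure)))
        \<le> ennreal (a j) * ennreal (C / (s * (1 - s)) * t powr (- 2 * s))" by (rule mult_left_mono) simp
      also have "\<dots> = ennreal (C / (s * (1 - s)) * (t powr (- 2 * s) * a j))"
        using a0[of j] by (simp add: ennreal_mult'[symmetric] mult_ac)
      finally show "ennreal (a j) * (ennreal (2 * C1 / (\<gamma> ^ j)\<^sup>2) * (\<integral>\<^sup>+z. indicator {z. norm z \<le> \<gamma> ^ j} z * ennreal ((norm z)\<^sup>2 * norm z powr - ?p) \<partial>(lborel :: 'a measure))
        + 8 * (\<integral>\<^sup>+z. indicator {z. \<gamma> ^ j < norm z} z * ennreal (norm z powr - ?p) \<partial>(lborel :: 'a measure)))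
        \<le> ennreal (C / (s * (1 - s)) * ((\<gamma> ^ j) powr (- 2 * s) * a j))" unfolding t_def .
    qed
    also have "\<dots> = ennreal (\<Sum>j\<le>J. C / (s * (1 - s)) * ((\<gamma> ^ j) powr (- 2 * s) * a j))"
      using C0 s a0 by (intro sum_ennreal) auto
    finally show "gagliardo s (\<lambda>x. \<Sum>j\<le>J. u j x) \<le> ennreal (C / (s * (1 - s)) * (\<Sum>j\<le>J. (\<gamma> ^ j) powr (- 2 * s) * (l2_norm (u j))\<^sup>2))"
      by (simp only: v_def a_def sum_distrib_left)
  qed
qed

text \<open>\<open>E k\<close> bounds the squared distance from v to level k from below. The
  second-difference energy \<open>w2\<close> carries the factor 1 - s, and each summand on the left
  gains a factor s: the first by a Poincare inequality, as the kernel has mass of order 1 / s far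
  out, the second through its Abel weight.\<close>

lemma level_sum_le_gagliardo:
  fixes \<Omega> :: "'a::euclidean_space set"
  assumes \<Omega>: "bounded_lipschitz_domain \<Omega>" and \<gamma>: "0 < \<gamma>" "\<gamma> < 1"
  shows "\<exists>C\<ge>0. \<forall>J (s::real) \<T> v w E. 0 < s \<and> s < 1 \<and> grid_hierarchy \<Omega> \<kappa> q c \<gamma> J \<T> \<and> v \<in> fe_space \<Omega> (\<T> J) \<and>
    gagliardo s v = ennreal w \<and> 0 \<le> w \<and> (\<forall>k<J. 0 \<le> E k \<and> (\<forall>w'\<in>fe_space \<Omega> (\<T> k). E k \<le> (l2_norm (\<lambda>x. v x - w' x))\<^sup>2)) \<longrightarrow>
    (l2_norm v)\<^sup>2 + (\<gamma> powr (- 2 * s) - 1) * (\<Sum>k<J. (\<gamma> ^ k) powr (- 2 * s) * E k) \<le> C * (s * (1 - s)) * w"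
proof -
  let ?d = "DIM('a)"
  \<comment> \<open>Without a hierarchy at hand the sign of c is unknown.\<close>
  define c' where "c' = max c 0"
  have c'0: "0 \<le> c'" by (simp add: c'_def)
  obtain R A where R: "0 < R" and A: "0 \<le> A" and jack0: "\<forall>\<T> t v L M. simplicial_mesh \<Omega> \<T> \<and> 0 < t \<and> t \<le> 1 \<and> (\<forall>K\<in>\<T>. diameter K \<le> c' * t) \<and>
    (\<forall>x y. \<bar>v x - v y\<bar> \<le> L * norm (x - y)) \<and> (\<forall>x. \<bar>v x\<bar> \<le> M) \<and> (\<forall>x. x \<notin> \<Omega> \<longrightarrow> v x = 0) \<longrightarrow>
    (\<exists>w\<in>fe_space \<Omega> \<T>. (\<integral>\<^sup>+x. ennreal ((v x - w x)\<^sup>2) \<partial>lborel) \<le> ennreal (A / t ^ ?d) * ball_int (R * t) (second_diff_energy v))"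
    using jackson_estimate[OF \<Omega> c'0] by (elim exE conjE)
  obtain Rb where Rb: "0 < Rb" "\<And>x. x \<in> \<Omega> \<Longrightarrow> norm x < Rb"
    using \<Omega> bounded_pos_less[of \<Omega>] by (auto simp: bounded_lipschitz_domain_def)
  define \<omega> where "\<omega> = unit_ball_vol (real ?d)"
  have \<omega>: "0 < \<omega>" unfolding \<omega>_def by (rule unit_ball_vol_pos) simp
  \<comment> \<open>A lower bound for (2 Rb) powr (- 2 s) that holds for all s in (0, 1).\<close>
  define \<delta> where "\<delta> = (max 1 (2 * Rb)) powr (- 2)"
  have \<delta>: "0 < \<delta>" by (simp add: \<delta>_def)
  define B where "B = (2::real) ^ (2 * ?d + 2) * ln 4"
  have B: "0 < B" by (simp add: B_def)
  define CP where "CP = B / (4 * \<omega> * \<delta>)"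
  define Kc where "Kc = (max 1 R) ^ (?d + 2) / (1 - \<gamma>)"
  define Cg where "Cg = \<gamma> powr (- 2) * (- ln \<gamma> * 2)"
  define C where "C = (CP + Cg * (A * Kc)) * (4 * ln 4)"
  have pos: "0 \<le> CP" "0 \<le> Kc" "0 \<le> Cg" using B \<omega> \<delta> \<gamma> by (auto simp: CP_def Kc_def Cg_def ln_less_zero less_imp_le mult_nonneg_nonpos2 mult_nonneg_nonpos)
  have C0: "0 \<le> C" using pos A by (simp add: C_def)
  show ?thesis
  proof (intro exI[of _ C] conjI C0 allI impI)
    fix J and s :: real and \<T> v w E
    assume asm: "0 < s \<and> s < 1 \<and> grid_hierarchy \<Omega> \<kappa> q c \<gamma> J \<T> \<and> v \<in> fe_space \<Omega> (\<T> J) \<and>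
      gagliardo s v = ennreal w \<and> 0 \<le> w \<and> (\<forall>k<J. 0 \<le> E k \<and> (\<forall>w'\<in>fe_space \<Omega> (\<T> k). E k \<le> (l2_norm (\<lambda>x. v x - w' x))\<^sup>2))"
    then have s: "0 < s" "s < 1" and H: "grid_hierarchy \<Omega> \<kappa> q c \<gamma> J \<T>" and vV: "v \<in> fe_space \<Omega> (\<T> J)"
      and w: "gagliardo s v = ennreal w" "0 \<le> w" and E0: "\<And>k. k < J \<Longrightarrow> 0 \<le> E k"
      and E: "\<And>k w'. k < J \<Longrightarrow> w' \<in> fe_space \<Omega> (\<T> k) \<Longrightarrow> E k \<le> (l2_norm (\<lambda>x. v x - w' x))\<^sup>2" by auto
    let ?p = "real ?d + 2 * s"
    interpret F: fe_level \<Omega> "\<T> J" "\<gamma> ^ J" "1 / (4 * \<kappa> * q * c)" c using grid_level(1)[OF \<Omega> \<gamma>(1) H order_refl] .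
    have vL: "v \<in> L2 lborel" by (rule F.fe_L2[OF vV])
    have vm [measurable]: "v \<in> borel_measurable borel" by (rule F.fe_borel[OF vV])
    define w2 where "w2 = (4 - 4 powr s) * w"
    have second_diff_energy: "(\<integral>\<^sup>+z. second_diff_energy v z * ennreal (frac_kernel s z) \<partial>lborel) = ennreal w2"
      unfolding w2_def by (rule gagliardo_second_difference[OF vm w s])
    have "4 powr s \<le> (4::real) powr 1" using s by (intro powr_mono) auto
    then have w20: "0 \<le> w2" using w(2) by (simp add: w2_def)
    have w2le: "w2 \<le> 4 * ln 4 * (1 - s) * w"
    proof -
      have "(4::real) powr s = 4 * 4 powr - (1 - s)" using powr_add[of 4 1 "- (1 - s)"] by simp
      moreover have "1 - 4 powr - (1 - s) \<le> ln 4 * (1 - s)"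
        using one_minus_powr_le[of "1/4" "1 - s"] unfolding quarter_powr by (simp add: ln_div)
      ultimately have "4 - 4 powr s \<le> 4 * ln 4 * (1 - s)" by simp
      then show ?thesis unfolding w2_def using w(2) by (intro mult_right_mono)
    qed
    \<comment> \<open>For steps longer than 2 Rb both translates of \<Omega> miss \<Omega>, so the
      second difference equals -2 v on \<Omega>, and its energy is at least 4 times the squared norm
      of v.\<close>
    have poincare: "(l2_norm v)\<^sup>2 \<le> CP * s * w2"
    proof -
      let ?D = "2 * Rb"
      have far: "ennreal (4 * (l2_norm v)\<^sup>2) \<le> second_diff_energy v z" if z: "?D < norm z" for z
      proof -
        have i: "integrable lborel (\<lambda>x. 4 * (v x)\<^sup>2)" using vL by (simp add: L2_def)
        have "4 * (l2_norm v)\<^sup>2 = (LINT x|lborel. 4 * (v x)\<^sup>2)" unfolding L2.nm_sq[OF vL] by (simp add: ip_def power2_eq_square)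
        then have "ennreal (4 * (l2_norm v)\<^sup>2) = (\<integral>\<^sup>+x. ennreal (4 * (v x)\<^sup>2) \<partial>lborel)"
          using nn_integral_eq_integral[OF i] by simp
        also have "\<dots> \<le> second_diff_energy v z" unfolding second_diff_energy_def
        proof (rule nn_integral_mono)
          fix x
          show "ennreal (4 * (v x)\<^sup>2) \<le> ennreal ((v (x + z) - 2 * v x + v (x - z))\<^sup>2)"
          proof (cases "x \<in> \<Omega>")
            case True
            have "\<not> norm (x + z) < Rb" "\<not> norm (x - z) < Rb"
              using Rb(2)[OF True] z norm_triangle_ineq4[of "x + z" x] norm_triangle_ineq4[of x "x - z"] by auto
            then have "x + z \<notin> \<Omega>" "x - z \<notin> \<Omega>" using Rb(2) by blast+
            then show ?thesis using F.fe_outside[OF vV] by simp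
          next
            case False
            then show ?thesis using F.fe_outside[OF vV] by simp
          qed
        qed
        finally show ?thesis .
      qed
      have [measurable]: "{z::'a. ?D < norm z} \<in> sets borel" by auto
      have "ennreal (4 * (l2_norm v)\<^sup>2 * (\<omega> * \<delta> / (B * s))) \<le> ennreal (4 * (l2_norm v)\<^sup>2) * ennreal (\<omega> * ?D powr (- 2 * s) / (B * s))"
      proof -
        have "\<delta> \<le> (max 1 ?D) powr (- 2 * s)" unfolding \<delta>_def using s by (intro powr_mono) auto
        also have "\<dots> \<le> ?D powr (- 2 * s)" using s Rb(1) by (intro powr_mono2') auto
        finally have "\<omega> * \<delta> / (B * s) \<le> \<omega> * ?D powr (- 2 * s) / (B * s)"
          using \<omega> B s by (intro divide_right_mono mult_left_mono) auto
        then have "4 * (l2_norm v)\<^sup>2 * (\<omega> * \<delta> / (B * s)) \<le> 4 * (l2_norm v)\<^sup>2 * (\<omega> * ?D powr (- 2 * s) / (B * s))"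
          by (intro mult_left_mono) auto
        then show ?thesis by (subst ennreal_mult'[symmetric]) (auto intro: ennreal_leI)
      qed
      also have "\<dots> \<le> ennreal (4 * (l2_norm v)\<^sup>2) * (\<integral>\<^sup>+z. indicator {z. ?D < norm z} z * ennreal (norm z powr - ?p) \<partial>(lborel :: 'a measure))"
        using kernel_outer_ge[OF s, of ?D, where 'a='a] Rb(1) by (intro mult_left_mono) (auto simp: \<omega>_def B_def)
      also have "\<dots> = (\<integral>\<^sup>+z. ennreal (4 * (l2_norm v)\<^sup>2) * (indicator {z. ?D < norm z} z * ennreal (norm z powr - ?p)) \<partial>(lborel :: 'a measure))"
        by (rule nn_integral_cmult[symmetric]) measurable
      also have "\<dots> \<le> (\<integral>\<^sup>+z. second_diff_energy v z * ennreal (frac_kernel s z) \<partial>lborel)"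
      proof (rule nn_integral_mono)
        fix z :: 'a
        show "ennreal (4 * (l2_norm v)\<^sup>2) * (indicator {z. ?D < norm z} z * ennreal (norm z powr - ?p)) \<le> second_diff_energy v z * ennreal (frac_kernel s z)"
        proof (cases "?D < norm z")
          case True
          then show ?thesis using mult_right_mono[OF far[OF True], of "ennreal (frac_kernel s z)"] by (simp add: frac_kernel_def)
        qed simp
      qed
      also have "\<dots> = ennreal w2" by (rule second_diff_energy)
      finally have "4 * (l2_norm v)\<^sup>2 * (\<omega> * \<delta> / (B * s)) \<le> w2" using w20 by simp
      then show ?thesis using \<omega> \<delta> B s by (simp add: CP_def field_simps)
    qed
    \<comment> \<open>The levels whose window of radius R \<gamma> ^ k contains z contribute a
      geometric sum dominated by the finest of them, hence by a multiple of the kernel at z. Thus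
      the approximation estimates of all levels add up without a factor J.\<close>
    have kersum: "(\<Sum>k<J. ennreal ((\<gamma> ^ k) powr - ?p) * indicator (cball 0 (R * \<gamma> ^ k)) z) * second_diff_energy v z \<le> ennreal Kc * (second_diff_energy v z * ennreal (frac_kernel s z))" for z :: 'a
    proof (cases "z = 0")
      case True
      \<comment> \<open>The kernel is 0 at the origin, so the left side has to vanish there
        too.\<close>
      have "second_diff_energy v 0 = 0" by (simp add: second_diff_energy_def)
      with True show ?thesis by simp
    next
      case False
      define q0 where "q0 = \<gamma> powr ?p"
      define S where "S = {k. k < J \<and> norm z \<le> R * \<gamma> ^ k}"
      have p1: "1 \<le> ?p" using s DIM_ge_Suc0[where 'a='a] by linarith
      \<comment> \<open>As the exponent is at least 1, 1 - q0 is bounded below by 1 - \<gamma>,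
        independently of s.\<close>
      have q0: "0 < q0" "q0 \<le> \<gamma>" using \<gamma> p1 powr_mono'[of 1 ?p \<gamma>] by (auto simp: q0_def)
      have qk: "(\<gamma> ^ k) powr ?p = q0 ^ k" for k
        using \<gamma> by (simp add: q0_def powr_realpow[symmetric] powr_powr mult.commute)
      have "(\<Sum>k\<in>S. 1 / q0 ^ k) \<le> 1 / ((norm z / R) powr ?p * (1 - q0))"
      proof (rule geometric_sum_inverse_le)
        show "0 < q0" "q0 < 1" using q0 \<gamma> by auto
        show "finite S" by (simp add: S_def)
        show "0 < (norm z / R) powr ?p" using False R by simp
        fix k assume "k \<in> S"
        then have "norm z / R \<le> \<gamma> ^ k" using R by (simp add: S_def divide_le_eq mult.commute)
        then have "(norm z / R) powr ?p \<le> (\<gamma> ^ k) powr ?p" using R s by (intro powr_mono2) auto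
        then show "(norm z / R) powr ?p \<le> q0 ^ k" by (simp add: qk)
      qed
      also have "\<dots> = R powr ?p / (1 - q0) * norm z powr - ?p"
        unfolding powr_divide powr_minus[of _ ?p] by (simp add: divide_inverse mult_ac)
      also have "\<dots> \<le> Kc * norm z powr - ?p"
        unfolding Kc_def
      proof (intro mult_right_mono frac_le)
        have "R powr ?p \<le> (max 1 R) powr ?p" using R s by (intro powr_mono2) auto
        also have "\<dots> \<le> (max 1 R) powr real (?d + 2)" using s by (intro powr_mono) auto
        also have "\<dots> = (max 1 R) ^ (?d + 2)" by (subst powr_realpow) auto
        finally show "R powr ?p \<le> (max 1 R) ^ (?d + 2)" .
      qed (use \<gamma> q0 in auto)
      finally have le: "(\<Sum>k\<in>S. 1 / q0 ^ k) \<le> Kc * frac_kernel s z" by (simp add: frac_kernel_def)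
      have "(\<Sum>k<J. ennreal ((\<gamma> ^ k) powr - ?p) * indicator (cball 0 (R * \<gamma> ^ k)) z) = (\<Sum>k\<in>S. ennreal ((\<gamma> ^ k) powr - ?p) * indicator (cball 0 (R * \<gamma> ^ k)) z)"
        unfolding S_def by (rule sum.mono_neutral_right) auto
      also have "\<dots> = (\<Sum>k\<in>S. ennreal (1 / q0 ^ k))"
      proof (rule sum.cong[OF refl])
        fix k assume k: "k \<in> S"
        have "(\<gamma> ^ k) powr - ?p = 1 / q0 ^ k" by (simp only: powr_minus qk inverse_eq_divide)
        then show "ennreal ((\<gamma> ^ k) powr - ?p) * indicator (cball 0 (R * \<gamma> ^ k)) z = ennreal (1 / q0 ^ k)"
          using k by (simp only: S_def) simp
      qed
      also have "\<dots> = ennreal (\<Sum>k\<in>S. 1 / q0 ^ k)" using q0 by (intro sum_ennreal) auto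
      also have "\<dots> \<le> ennreal (Kc * frac_kernel s z)" by (rule ennreal_leI[OF le])
      finally have "(\<Sum>k<J. ennreal ((\<gamma> ^ k) powr - ?p) * indicator (cball 0 (R * \<gamma> ^ k)) z) * second_diff_energy v z \<le> ennreal (Kc * frac_kernel s z) * second_diff_energy v z"
        by (rule mult_right_mono) simp
      then show ?thesis using pos by (simp add: ennreal_mult mult_ac)
    qed
    have approx: "(\<Sum>k<J. (\<gamma> ^ k) powr (- 2 * s) * E k) \<le> A * Kc * w2"
    proof -
      have Ek: "ennreal ((\<gamma> ^ k) powr (- 2 * s) * E k) \<le> ennreal A * (ennreal ((\<gamma> ^ k) powr - ?p) * ball_int (R * \<gamma> ^ k) (second_diff_energy v))" if k: "k < J" for k
      proof -
        interpret G: fe_level \<Omega> "\<T> k" "\<gamma> ^ k" "1 / (4 * \<kappa> * q * c)" c using grid_level(1)[OF \<Omega> \<gamma>(1) H] k by simp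
        obtain g b L where L: "\<And>x y. \<bar>v x - v y\<bar> \<le> L * norm (x - y)" using F.fe_gradient[OF vV] by metis
        obtain M where M: "\<And>x. \<bar>v x\<bar> \<le> M" using F.fe_bounded[OF vV] by metis
        have "diameter K \<le> c' * \<gamma> ^ k" if "K \<in> \<T> k" for K
          using G.diam[OF that] G.c by (simp add: c'_def)
        then have "\<exists>w\<in>fe_space \<Omega> (\<T> k). (\<integral>\<^sup>+x. ennreal ((v x - w x)\<^sup>2) \<partial>lborel) \<le> ennreal (A / (\<gamma> ^ k) ^ ?d) * ball_int (R * \<gamma> ^ k) (second_diff_energy v)"
          using jack0[rule_format, of "\<T> k" "\<gamma> ^ k" v L M] G.mesh \<gamma> L M F.fe_outside[OF vV] by (simp add: power_le_one)
        then obtain w' where w': "w' \<in> fe_space \<Omega> (\<T> k)" "(\<integral>\<^sup>+x. ennreal ((v x - w' x)\<^sup>2) \<partial>lborel) \<le> ennreal (A / (\<gamma> ^ k) ^ ?d) * ball_int (R * \<gamma> ^ k) (second_diff_energy v)" by blast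
        have dL: "(\<lambda>x. v x - w' x) \<in> L2 lborel" by (intro L2.diff_mem vL G.fe_L2 w')
        have di: "integrable lborel (\<lambda>x. (v x - w' x)\<^sup>2)" using dL by (simp add: L2_def)
        have "ennreal (E k) \<le> ennreal ((l2_norm (\<lambda>x. v x - w' x))\<^sup>2)" by (intro ennreal_leI E k w')
        also have "(l2_norm (\<lambda>x. v x - w' x))\<^sup>2 = (LINT x|lborel. (v x - w' x)\<^sup>2)" unfolding L2.nm_sq[OF dL] by (simp add: ip_def power2_eq_square)
        also have "ennreal \<dots> = (\<integral>\<^sup>+x. ennreal ((v x - w' x)\<^sup>2) \<partial>lborel)" by (rule nn_integral_eq_integral[OF di, symmetric]) simp
        also have "\<dots> \<le> ennreal (A / (\<gamma> ^ k) ^ ?d) * ball_int (R * \<gamma> ^ k) (second_diff_energy v)" by (rule w')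
        finally have "ennreal ((\<gamma> ^ k) powr (- 2 * s)) * ennreal (E k) \<le> ennreal ((\<gamma> ^ k) powr (- 2 * s)) * (ennreal (A / (\<gamma> ^ k) ^ ?d) * ball_int (R * \<gamma> ^ k) (second_diff_energy v))"
          by (rule mult_left_mono) simp
        also have "\<dots> = ennreal ((\<gamma> ^ k) powr (- 2 * s) * (A / (\<gamma> ^ k) ^ ?d)) * ball_int (R * \<gamma> ^ k) (second_diff_energy v)"
          by (simp only: mult.assoc[symmetric] ennreal_mult'[symmetric] powr_ge_zero)
        also have "(\<gamma> ^ k) powr (- 2 * s) * (A / (\<gamma> ^ k) ^ ?d) = A * (\<gamma> ^ k) powr - ?p"
        proof -
          have g: "0 < \<gamma> ^ k" using \<gamma> by simp
          have "- ?p = - 2 * s + - real ?d" by simp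
          then have "(\<gamma> ^ k) powr - ?p = (\<gamma> ^ k) powr (- 2 * s) * (\<gamma> ^ k) powr - real ?d" by (simp only: powr_add)
          also have "(\<gamma> ^ k) powr - real ?d = 1 / (\<gamma> ^ k) ^ ?d" using powr_realpow[OF g, of ?d] by (simp only: powr_minus inverse_eq_divide)
          finally show ?thesis by simp
        qed
        also have "ennreal (A * (\<gamma> ^ k) powr - ?p) * ball_int (R * \<gamma> ^ k) (second_diff_energy v) = ennreal A * (ennreal ((\<gamma> ^ k) powr - ?p) * ball_int (R * \<gamma> ^ k) (second_diff_energy v))"
          using A by (simp add: ennreal_mult mult.assoc)
        finally show ?thesis using E0[OF k] by (simp add: ennreal_mult'')
      qed
      have cbm: "(\<lambda>z. indicator (cball (0::'a) r) z * second_diff_energy v z) \<in> borel_measurable lborel" for r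
      proof -
        have [measurable]: "cball (0::'a) r \<in> sets borel" by simp
        show ?thesis by measurable
      qed
      have "ennreal (\<Sum>k<J. (\<gamma> ^ k) powr (- 2 * s) * E k) = (\<Sum>k<J. ennreal ((\<gamma> ^ k) powr (- 2 * s) * E k))"
        using E0 by (intro sum_ennreal[symmetric]) auto
      also have "\<dots> \<le> (\<Sum>k<J. ennreal A * (ennreal ((\<gamma> ^ k) powr - ?p) * ball_int (R * \<gamma> ^ k) (second_diff_energy v)))"
        by (intro sum_mono Ek) auto
      also have "\<dots> = ennreal A * (\<Sum>k<J. \<integral>\<^sup>+z. ennreal ((\<gamma> ^ k) powr - ?p) * (indicator (cball 0 (R * \<gamma> ^ k)) z * second_diff_energy v z) \<partial>lborel)"
        unfolding ball_int_def sum_distrib_left[symmetric] using cbm by (simp only: nn_integral_cmult)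
      also have "(\<Sum>k<J. \<integral>\<^sup>+z. ennreal ((\<gamma> ^ k) powr - ?p) * (indicator (cball 0 (R * \<gamma> ^ k)) z * second_diff_energy v z) \<partial>lborel)
        = (\<integral>\<^sup>+z. (\<Sum>k<J. ennreal ((\<gamma> ^ k) powr - ?p) * (indicator (cball 0 (R * \<gamma> ^ k)) z * second_diff_energy v z)) \<partial>lborel)"
        by (rule nn_integral_sum[symmetric]) (intro borel_measurable_times_ennreal borel_measurable_const cbm)
      also have "\<dots> \<le> (\<integral>\<^sup>+z. ennreal Kc * (second_diff_energy v z * ennreal (frac_kernel s z)) \<partial>lborel)"
        using kersum by (intro nn_integral_mono) (simp only: sum_distrib_right mult.assoc)
      also have "\<dots> = ennreal Kc * ennreal w2" unfolding second_diff_energy[symmetric] by (rule nn_integral_cmult) measurable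
      also have "ennreal A * (ennreal Kc * ennreal w2) = ennreal (A * Kc * w2)"
        using A pos w20 by (simp add: ennreal_mult mult.assoc)
      finally have "ennreal (\<Sum>k<J. (\<gamma> ^ k) powr (- 2 * s) * E k) \<le> ennreal (A * Kc * w2)" by (simp add: mult_left_mono)
      moreover have "0 \<le> A * Kc * w2" using A pos w20 by simp
      ultimately show ?thesis by simp
    qed
    have g: "0 \<le> \<gamma> powr (- 2 * s) - 1" "\<gamma> powr (- 2 * s) - 1 \<le> Cg * s"
    proof -
      have e: "\<gamma> powr (- 2 * s) - 1 = \<gamma> powr (- 2 * s) * (1 - \<gamma> powr (2 * s))"
        using \<gamma> powr_add[of \<gamma> "- 2 * s" "2 * s"] by (simp add: right_diff_distrib)
      have u: "\<gamma> powr (2 * s) \<le> 1" using \<gamma> s by (simp add: powr_le1)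
      show "0 \<le> \<gamma> powr (- 2 * s) - 1" unfolding e using u by simp
      have "\<gamma> powr (- 2 * s) \<le> \<gamma> powr (- 2)" using \<gamma> s by (intro powr_mono') auto
      moreover have "1 - \<gamma> powr (2 * s) \<le> - ln \<gamma> * (2 * s)" by (rule one_minus_powr_le[OF \<gamma>(1)])
      ultimately have "\<gamma> powr (- 2 * s) * (1 - \<gamma> powr (2 * s)) \<le> \<gamma> powr (- 2) * (- ln \<gamma> * (2 * s))"
        using u by (intro mult_mono) auto
      then show "\<gamma> powr (- 2 * s) - 1 \<le> Cg * s" unfolding e by (simp add: Cg_def mult_ac)
    qed
    have "(\<gamma> powr (- 2 * s) - 1) * (\<Sum>k<J. (\<gamma> ^ k) powr (- 2 * s) * E k) \<le> (\<gamma> powr (- 2 * s) - 1) * (A * Kc * w2)"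
      by (rule mult_left_mono[OF approx g(1)])
    also have "\<dots> \<le> Cg * s * (A * Kc * w2)" using A pos w20 by (intro mult_right_mono g) auto
    finally have "(l2_norm v)\<^sup>2 + (\<gamma> powr (- 2 * s) - 1) * (\<Sum>k<J. (\<gamma> ^ k) powr (- 2 * s) * E k) \<le> CP * s * w2 + Cg * s * (A * Kc * w2)"
      using poincare by (rule add_mono[rotated])
    also have "\<dots> = (CP + Cg * (A * Kc)) * s * w2" by (simp add: algebra_simps)
    also have "\<dots> \<le> (CP + Cg * (A * Kc)) * s * (4 * ln 4 * (1 - s) * w)"
      using pos A s by (intro mult_left_mono w2le) auto
    also have "\<dots> = C * (s * (1 - s)) * w" by (simp only: C_def mult_ac)
    finally show "(l2_norm v)\<^sup>2 + (\<gamma> powr (- 2 * s) - 1) * (\<Sum>k<J. (\<gamma> ^ k) powr (- 2 * s) * E k) \<le> C * (s * (1 - s)) * w" .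
  qed
qed

section \<open>Spectrum of the preconditioned operator\<close>

lemma abel_summation:
  fixes x :: real
  shows "(\<Sum>j\<le>J. x ^ j * (case j of 0 \<Rightarrow> D 0 | Suc i \<Rightarrow> D (Suc i) - D i)) = x ^ J * D J + (1 - x) * (\<Sum>k<J. x ^ k * D k)"
  by (induction J) (simp_all add: algebra_simps)

locale nested_spaces =
  fixes V :: "nat \<Rightarrow> ('a::euclidean_space \<Rightarrow> real) set" and J :: nat
  assumes fin: "\<And>k. k \<le> J \<Longrightarrow> fin_ip (V k) (ip lborel)"
    and L2: "\<And>k v. k \<le> J \<Longrightarrow> v \<in> V k \<Longrightarrow> v \<in> L2 lborel"
    and nested: "\<And>j k. j \<le> k \<Longrightarrow> k \<le> J \<Longrightarrow> V j \<subseteq> V k"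
begin

text \<open>Agrees with \<open>l2_projection\<close> on these spaces, but is written with the inner
  product of the whole space, common to all levels.\<close>

definition level_proj :: "nat \<Rightarrow> ('a \<Rightarrow> real) \<Rightarrow> 'a \<Rightarrow> real" where
  "level_proj k v = (THE z. z \<in> V k \<and> (\<forall>w\<in>V k. ip lborel z w = ip lborel v w))"

text \<open>The difference R j of consecutive projections, with zero in place of a projection below
  level 0.\<close>

definition level_part :: "nat \<Rightarrow> ('a \<Rightarrow> real) \<Rightarrow> 'a \<Rightarrow> real" where
  "level_part j v = (case j of 0 \<Rightarrow> level_proj 0 v | Suc i \<Rightarrow> (\<lambda>x. level_proj (Suc i) v x - level_proj i v x))"

lemma level_proj_props:
  assumes k: "k \<le> J" and v: "v \<in> V J"
  shows "level_proj k v \<in> V k" "\<And>w. w \<in> V k \<Longrightarrow> ip lborel (level_proj k v) w = ip lborel v w"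
proof -
  interpret fin_ip "V k" "ip lborel" by (rule fin[OF k])
  have "\<exists>!z. z \<in> V k \<and> (\<forall>w\<in>V k. ip lborel z w = ip lborel v w)"
  proof (rule riesz)
    fix u w r assume uw: "u \<in> V k" "w \<in> V k"
    have L: "u \<in> L2 lborel" "w \<in> L2 lborel" "v \<in> L2 lborel" using L2 k uw v by auto
    show "ip lborel v (\<lambda>x. u x + r * w x) = ip lborel v u + r * ip lborel v w"
      using L2.sym[OF L(3) L2.lin_mem[OF L(1,2)]] L2.lin[OF L] L2.sym[OF L(3,1)] L2.sym[OF L(3,2)] by simp
  qed
  from theI'[OF this] show "level_proj k v \<in> V k" "\<And>w. w \<in> V k \<Longrightarrow> ip lborel (level_proj k v) w = ip lborel v w"
    unfolding level_proj_def by auto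
qed

lemma level_proj_top: "v \<in> V J \<Longrightarrow> level_proj J v = v"
proof -
  assume v: "v \<in> V J"
  interpret fin_ip "V J" "ip lborel" by (rule fin[OF order_refl])
  have level_proj: "level_proj J v \<in> V J" by (rule level_proj_props[OF order_refl v])
  let ?d = "\<lambda>x. level_proj J v x - v x"
  have d: "?d \<in> V J" by (rule diff_mem[OF level_proj v])
  have "ip lborel ?d ?d = 0" using B_diff[OF level_proj v d] level_proj_props(2)[OF order_refl v d] by simp
  then have "?d = (\<lambda>x. 0)" by (rule posdef[OF d])
  then show ?thesis by (intro ext) (metis eq_iff_diff_eq_0)
qed

lemma mem_top: "k \<le> J \<Longrightarrow> v \<in> V k \<Longrightarrow> v \<in> V J" using nested[of k J] by auto

lemma level_proj_L2: "k \<le> J \<Longrightarrow> v \<in> V J \<Longrightarrow> level_proj k v \<in> L2 lborel" using level_proj_props(1) L2 by blast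

lemma level_part_mem: "j \<le> J \<Longrightarrow> v \<in> V J \<Longrightarrow> level_part j v \<in> V j"
proof -
  assume j: "j \<le> J" and v: "v \<in> V J"
  interpret fin_ip "V j" "ip lborel" by (rule fin[OF j])
  show ?thesis
  proof (cases j)
    case (Suc i)
    have "level_proj i v \<in> V j" using level_proj_props(1)[of i v] nested[of i j] j v Suc by auto
    then show ?thesis using level_proj_props(1)[OF j v] diff_mem Suc by (auto simp: level_part_def)
  qed (use level_proj_props(1)[OF j v] in \<open>simp add: level_part_def\<close>)
qed

lemma level_part_L2: "j \<le> J \<Longrightarrow> v \<in> V J \<Longrightarrow> level_part j v \<in> L2 lborel" using level_part_mem L2 by blast

lemma level_part_orth_space: "i < j \<Longrightarrow> j \<le> J \<Longrightarrow> v \<in> V J \<Longrightarrow> w \<in> V i \<Longrightarrow> ip lborel (level_part j v) w = 0"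
proof -
  assume ij: "i < j" "j \<le> J" and v: "v \<in> V J" and w: "w \<in> V i"
  obtain m where m: "j = Suc m" "i \<le> m" using ij(1) by (cases j) auto
  have wm: "w \<in> V m" "w \<in> V j" using nested[of i m] nested[of i j] m ij w by auto
  have "ip lborel (level_part j v) w = ip lborel (level_proj j v) w - ip lborel (level_proj m v) w"
    unfolding m level_part_def nat.case using level_proj_L2[of "Suc m" v] level_proj_L2[of m v] L2[OF _ wm(2)] m ij v by (intro L2.B_diff) auto
  then show ?thesis using level_proj_props(2)[of j v w] level_proj_props(2)[of m v w] wm m ij v by simp
qed

lemma level_part_orth: "i \<le> J \<Longrightarrow> j \<le> J \<Longrightarrow> i \<noteq> j \<Longrightarrow> v \<in> V J \<Longrightarrow> w \<in> V J \<Longrightarrow> ip lborel (level_part i v) (level_part j w) = 0"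
proof (cases "i < j")
  case True
  assume *: "i \<le> J" "j \<le> J" "v \<in> V J" "w \<in> V J"
  have "ip lborel (level_part i v) (level_part j w) = ip lborel (level_part j w) (level_part i v)"
    by (rule L2.sym[OF level_part_L2[OF *(1,3)] level_part_L2[OF *(2,4)]])
  also have "\<dots> = 0" by (rule level_part_orth_space[OF True *(2,4) level_part_mem[OF *(1,3)]])
  finally show ?thesis .
next
  case False
  assume *: "i \<le> J" "j \<le> J" "i \<noteq> j" "v \<in> V J" "w \<in> V J"
  with False have "j < i" by simp
  then show ?thesis by (rule level_part_orth_space[OF _ *(1,4) level_part_mem[OF *(2,5)]])
qed

lemma level_part_sum: "v \<in> V J \<Longrightarrow> (\<Sum>j\<le>J. level_part j v x) = v x"
proof -
  assume v: "v \<in> V J"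
  have "(\<Sum>j\<le>n. level_part j v x) = level_proj n v x" for n
    by (induction n) (simp_all add: level_part_def)
  then show ?thesis using level_proj_top[OF v] by simp
qed

lemma ip_level_proj_self: "k \<le> J \<Longrightarrow> v \<in> V J \<Longrightarrow> ip lborel (level_proj k v) v = (l2_norm (level_proj k v))\<^sup>2"
proof -
  assume k: "k \<le> J" and v: "v \<in> V J"
  have "ip lborel (level_proj k v) v = ip lborel v (level_proj k v)" by (rule L2.sym[OF level_proj_L2[OF k v] L2[OF order_refl v]])
  also have "\<dots> = ip lborel (level_proj k v) (level_proj k v)" using level_proj_props[OF k v] by simp
  finally show ?thesis by (simp add: L2.nm_sq level_proj_L2[OF k v])
qed

lemma ip_level_part: "j \<le> J \<Longrightarrow> v \<in> V J \<Longrightarrow> w \<in> V J \<Longrightarrow> ip lborel v (level_part j w) = ip lborel (level_part j v) (level_part j w)"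
proof -
  assume j: "j \<le> J" and v: "v \<in> V J" and w: "w \<in> V J"
  have R: "level_part j w \<in> V j" by (rule level_part_mem[OF j w])
  have "ip lborel v (level_part j w) = ip lborel (level_proj j v) (level_part j w)" using level_proj_props(2)[OF j v R] by simp
  also have "\<dots> = ip lborel (level_part j v) (level_part j w)"
  proof (cases j)
    case (Suc i)
    have Qi: "level_proj i v \<in> V i" using level_proj_props(1)[of i v] j v Suc by simp
    have z: "ip lborel (level_proj i v) (level_part j w) = 0"
      using level_part_orth_space[of i j w "level_proj i v"] L2.sym[of "level_proj i v" lborel "level_part j w"] level_part_L2[OF j w] level_proj_L2[of i v] j v w Qi Suc by simp
    have "ip lborel (level_part j v) (level_part j w) = ip lborel (level_proj j v) (level_part j w) - ip lborel (level_proj i v) (level_part j w)"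
      using level_proj_L2[of "Suc i" v] level_proj_L2[of i v] level_part_L2[OF j w] j v Suc
      by (subst level_part_def) (simp add: L2.B_diff)
    then show ?thesis using z by simp
  qed (simp add: level_part_def)
  finally show ?thesis .
qed

lemma l2_norm_level_part_sq: "j \<le> J \<Longrightarrow> v \<in> V J \<Longrightarrow> (l2_norm (level_part j v))\<^sup>2 = (case j of 0 \<Rightarrow> (l2_norm (level_proj 0 v))\<^sup>2 | Suc i \<Rightarrow> (l2_norm (level_proj (Suc i) v))\<^sup>2 - (l2_norm (level_proj i v))\<^sup>2)"
proof (cases j)
  case (Suc i)
  assume j: "j \<le> J" and v: "v \<in> V J"
  have vL: "v \<in> L2 lborel" by (rule L2[OF order_refl v])
  have "(l2_norm (level_part j v))\<^sup>2 = ip lborel v (level_part j v)" using ip_level_part[OF j v v] by (simp add: L2.nm_sq level_part_L2[OF j v])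
  also have "\<dots> = ip lborel (level_part j v) v" by (rule L2.sym[OF vL level_part_L2[OF j v]])
  also have "\<dots> = ip lborel (level_proj (Suc i) v) v - ip lborel (level_proj i v) v"
    unfolding Suc level_part_def nat.case using level_proj_L2 j v vL Suc by (intro L2.B_diff) auto
  finally show ?thesis using ip_level_proj_self[of "Suc i" v] ip_level_proj_self[of i v] j v Suc by simp
qed (simp add: level_part_def)

text \<open>For x = \<gamma> powr (2 s) the right side is, up to constants, the quadratic form of
  the preconditioner.\<close>

lemma weighted_level_sum:
  "v \<in> V J \<Longrightarrow> (\<Sum>j\<le>J. x ^ j * (l2_norm (level_part j v))\<^sup>2) = x ^ J * (l2_norm v)\<^sup>2 + (1 - x) * (\<Sum>k<J. x ^ k * (l2_norm (level_proj k v))\<^sup>2)"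
proof -
  assume v: "v \<in> V J"
  have "(\<Sum>j\<le>J. x ^ j * (l2_norm (level_part j v))\<^sup>2)
    = (\<Sum>j\<le>J. x ^ j * (case j of 0 \<Rightarrow> (l2_norm (level_proj 0 v))\<^sup>2 | Suc i \<Rightarrow> (l2_norm (level_proj (Suc i) v))\<^sup>2 - (l2_norm (level_proj i v))\<^sup>2))"
    by (intro sum.cong refl arg_cong2[of _ _ _ _ "(*)"] l2_norm_level_part_sq v) simp
  then show ?thesis using abel_summation[of x "\<lambda>k. (l2_norm (level_proj k v))\<^sup>2" J] level_proj_top[OF v] by simp
qed

lemma l2_norm_minus_level_proj:
  assumes k: "k \<le> J" and v: "v \<in> V J"
  shows "(l2_norm (\<lambda>x. v x - level_proj k v x))\<^sup>2 = (l2_norm v)\<^sup>2 - (l2_norm (level_proj k v))\<^sup>2"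
    "\<And>w. w \<in> V k \<Longrightarrow> (l2_norm (\<lambda>x. v x - level_proj k v x))\<^sup>2 \<le> (l2_norm (\<lambda>x. v x - w x))\<^sup>2"
proof -
  have vL: "v \<in> L2 lborel" by (rule L2[OF order_refl v])
  note QL = level_proj_L2[OF k v]
  have vq: "ip lborel v (level_proj k v) = (l2_norm (level_proj k v))\<^sup>2" using ip_level_proj_self[OF k v] L2.sym[OF vL QL] by simp
  show 1: "(l2_norm (\<lambda>x. v x - level_proj k v x))\<^sup>2 = (l2_norm v)\<^sup>2 - (l2_norm (level_proj k v))\<^sup>2"
    using L2.B_diff_sq[OF vL QL] vq by (simp add: L2.nm_sq vL QL L2.diff_mem)
  fix w assume w: "w \<in> V k"
  have wL: "w \<in> L2 lborel" by (rule L2[OF k w])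
  have "(l2_norm (\<lambda>x. v x - w x))\<^sup>2 = (l2_norm v)\<^sup>2 - 2 * ip lborel (level_proj k v) w + (l2_norm w)\<^sup>2"
    using L2.B_diff_sq[OF vL wL] level_proj_props(2)[OF k v w] by (simp add: L2.nm_sq vL wL L2.diff_mem)
  moreover have "0 \<le> (l2_norm (level_proj k v))\<^sup>2 - 2 * ip lborel (level_proj k v) w + (l2_norm w)\<^sup>2"
    using L2.B_diff_sq[OF QL wL] L2.nonneg[OF L2.diff_mem[OF QL wL]] by (simp add: L2.nm_sq QL wL)
  ultimately show "(l2_norm (\<lambda>x. v x - level_proj k v x))\<^sup>2 \<le> (l2_norm (\<lambda>x. v x - w x))\<^sup>2" using 1 by linarith
qed

text \<open>The form suited to x > 1: Pythagoras trades squared norms of projections for squared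
  errors, so that both terms on the right are nonnegative and approximation estimates apply.\<close>

lemma weighted_level_sum_error:
  assumes v: "v \<in> V J"
  shows "(\<Sum>j\<le>J. x ^ j * (l2_norm (level_part j v))\<^sup>2) = (l2_norm v)\<^sup>2 + (x - 1) * (\<Sum>k<J. x ^ k * (l2_norm (\<lambda>y. v y - level_proj k v y))\<^sup>2)"
proof -
  have gp: "(x - 1) * (\<Sum>k<J. x ^ k) = x ^ J - 1" by (simp add: power_diff_1_eq)
  have "(\<Sum>k<J. x ^ k * (l2_norm (\<lambda>y. v y - level_proj k v y))\<^sup>2) = (\<Sum>k<J. x ^ k * ((l2_norm v)\<^sup>2 - (l2_norm (level_proj k v))\<^sup>2))"
    by (intro sum.cong refl) (simp add: l2_norm_minus_level_proj(1)[OF _ v])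
  also have "\<dots> = (\<Sum>k<J. x ^ k) * (l2_norm v)\<^sup>2 - (\<Sum>k<J. x ^ k * (l2_norm (level_proj k v))\<^sup>2)"
    by (simp add: right_diff_distrib sum_subtractf sum_distrib_right)
  finally have "(x - 1) * (\<Sum>k<J. x ^ k * (l2_norm (\<lambda>y. v y - level_proj k v y))\<^sup>2)
    = ((x - 1) * (\<Sum>k<J. x ^ k)) * (l2_norm v)\<^sup>2 - (x - 1) * (\<Sum>k<J. x ^ k * (l2_norm (level_proj k v))\<^sup>2)"
    by (simp only: right_diff_distrib mult.assoc)
  then show ?thesis unfolding weighted_level_sum[OF v] gp by (simp add: algebra_simps)
qed

lemma ip_decomp:
  assumes v: "v \<in> V J" and w: "w \<in> V J"
  shows "ip lborel v w = (\<Sum>j\<le>J. ip lborel (level_part j v) (level_part j w))"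
proof -
  have "ip lborel v w = ip lborel v (\<lambda>x. \<Sum>j\<le>J. level_part j w x)" using level_part_sum[OF w] by simp
  also have "\<dots> = (\<Sum>j\<le>J. ip lborel v (level_part j w))"
    using level_part_L2 w L2[OF order_refl v] by (intro L2.B_sum_right) auto
  also have "\<dots> = (\<Sum>j\<le>J. ip lborel (level_part j v) (level_part j w))" using ip_level_part v w by (intro sum.cong) auto
  finally show ?thesis .
qed

text \<open>Since level parts are mutually orthogonal, the level sums with weights x ^ j and (1 / x)
  ^ j are dual under the \<open>L2\<close> inner product.\<close>

lemma ip_dual_le:
  assumes v: "v \<in> V J" and w: "w \<in> V J" and x: "0 < x"
  shows "(ip lborel v w)\<^sup>2 \<le> (\<Sum>j\<le>J. x ^ j * (l2_norm (level_part j v))\<^sup>2) * (\<Sum>j\<le>J. (1 / x) ^ j * (l2_norm (level_part j w))\<^sup>2)"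
proof -
  have n: "0 \<le> l2_norm (level_part j v)" "0 \<le> l2_norm (level_part j w)" if "j \<le> J" for j
    using L2.nm_nonneg level_part_L2 that v w by blast+
  have "\<bar>ip lborel v w\<bar> \<le> (\<Sum>j\<le>J. \<bar>ip lborel (level_part j v) (level_part j w)\<bar>)" unfolding ip_decomp[OF v w] by (rule sum_abs)
  also have "\<dots> \<le> (\<Sum>j\<le>J. l2_norm (level_part j v) * l2_norm (level_part j w))"
    using v w by (intro sum_mono L2.Cauchy_Schwarz level_part_L2) auto
  also have "\<dots> = (\<Sum>j\<le>J. (sqrt (x ^ j) * l2_norm (level_part j v)) * (sqrt ((1 / x) ^ j) * l2_norm (level_part j w)))"
  proof (intro sum.cong refl)
    fix j
    have "sqrt (x ^ j) * sqrt ((1 / x) ^ j) = 1" using x by (simp add: real_sqrt_mult[symmetric] power_mult_distrib[symmetric])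
    moreover have "(sqrt (x ^ j) * l2_norm (level_part j v)) * (sqrt ((1 / x) ^ j) * l2_norm (level_part j w))
      = (sqrt (x ^ j) * sqrt ((1 / x) ^ j)) * (l2_norm (level_part j v) * l2_norm (level_part j w))" by (simp only: mult_ac)
    ultimately show "l2_norm (level_part j v) * l2_norm (level_part j w) = (sqrt (x ^ j) * l2_norm (level_part j v)) * (sqrt ((1 / x) ^ j) * l2_norm (level_part j w))"
      by simp
  qed
  finally have "\<bar>ip lborel v w\<bar>\<^sup>2 \<le> (\<Sum>j\<le>J. (sqrt (x ^ j) * l2_norm (level_part j v)) * (sqrt ((1 / x) ^ j) * l2_norm (level_part j w)))\<^sup>2"
    by (intro power_mono) auto
  also have "\<dots> \<le> (\<Sum>j\<le>J. (sqrt (x ^ j) * l2_norm (level_part j v))\<^sup>2) * (\<Sum>j\<le>J. (sqrt ((1 / x) ^ j) * l2_norm (level_part j w))\<^sup>2)"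
    by (rule Cauchy_Schwarz_ineq_sum)
  finally show ?thesis using x by (simp add: power_mult_distrib)
qed

end

text \<open>If the space is trivial there are no eigenvalues, and \<open>cond_on\<close> is the unspecified number \<open>Max {} / Min {}\<close>.\<close>

lemma eigenvalue_bounds_imp_cond_le:
  assumes m: "0 < m" and E: "\<And>\<mu>. \<mu> \<in> eigenvalues_on V F \<Longrightarrow> m \<le> \<mu> \<and> \<mu> \<le> M" and fin: "finite (eigenvalues_on V F)"
    and C: "M / m \<le> C" "Max {} / Min {} \<le> C"
  shows "(\<forall>\<mu>\<in>eigenvalues_on V F. 0 < \<mu>) \<and> cond_on V F \<le> C"
proof (cases "eigenvalues_on V F = {}")
  case True
  then show ?thesis using C by (simp add: cond_on_def)
next
  case False
  have "m \<le> Min (eigenvalues_on V F)" "Max (eigenvalues_on V F) \<le> M" using E False fin by auto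
  moreover have "0 < Max (eigenvalues_on V F)" using E False fin m by (metis Max_in less_le_trans)
  ultimately have "Max (eigenvalues_on V F) / Min (eigenvalues_on V F) \<le> M / m" using m by (intro frac_le) auto
  then show ?thesis using C E m by (force simp: cond_on_def)
qed

text \<open>The linear algebra of the theorem, separated from the particular form: F is the
  preconditioned operator and \<open>b k\<close> the weight of level k. On level J the projection is
  the identity.\<close>

locale preconditioned_form = nested_spaces +
  fixes a :: "('a \<Rightarrow> real) \<Rightarrow> ('a \<Rightarrow> real) \<Rightarrow> real" and b :: "nat \<Rightarrow> real" and A F :: "('a \<Rightarrow> real) \<Rightarrow> 'a \<Rightarrow> real"
  assumes form: "fin_ip (V J) a"
    and A_mem: "\<And>v. v \<in> V J \<Longrightarrow> A v \<in> V J"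
    and A_ip: "\<And>v w. v \<in> V J \<Longrightarrow> w \<in> V J \<Longrightarrow> ip lborel (A v) w = a v w"
    and F_eq: "\<And>v. v \<in> V J \<Longrightarrow> F v = (\<lambda>x. b J * A v x + (\<Sum>k<J. b k * level_proj k (A v) x))"
begin

sublocale a: fin_ip "V J" a by (rule form)

lemma ip_preconditioned:
  assumes v: "v \<in> V J" and w: "w \<in> V J"
  shows "ip lborel (F v) w = b J * ip lborel (A v) w + (\<Sum>k<J. b k * ip lborel (level_proj k (A v)) (level_proj k w))"
proof -
  have wL: "w \<in> L2 lborel" by (rule L2[OF order_refl w])
  have AL: "A v \<in> L2 lborel" by (rule L2[OF order_refl A_mem[OF v]])
  have QL: "level_proj k (A v) \<in> L2 lborel" if "k < J" for k using level_proj_L2[of k "A v"] A_mem[OF v] that by simp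
  have S: "(\<lambda>x. \<Sum>k<J. b k * level_proj k (A v) x) \<in> L2 lborel"
    by (intro L2.sum_mem L2.scale_mem QL) auto
  have "ip lborel (F v) w = ip lborel (\<lambda>x. b J * A v x) w + ip lborel (\<lambda>x. \<Sum>k<J. b k * level_proj k (A v) x) w"
    unfolding F_eq[OF v] by (intro L2.B_add L2.scale_mem AL S wL)
  also have "ip lborel (\<lambda>x. b J * A v x) w = b J * ip lborel (A v) w" by (rule L2.B_scale[OF AL wL])
  also have "ip lborel (\<lambda>x. \<Sum>k<J. b k * level_proj k (A v) x) w = (\<Sum>k<J. ip lborel (\<lambda>x. b k * level_proj k (A v) x) w)"
    by (intro L2.B_sum L2.scale_mem QL wL) auto
  also have "\<dots> = (\<Sum>k<J. b k * ip lborel (level_proj k (A v)) (level_proj k w))"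
  proof (intro sum.cong refl)
    fix k assume "k \<in> {..<J}"
    then have k: "k < J" "k \<le> J" by auto
    have q: "level_proj k (A v) \<in> V k" by (rule level_proj_props(1)[OF k(2) A_mem[OF v]])
    have "ip lborel (level_proj k (A v)) w = ip lborel w (level_proj k (A v))" by (rule L2.sym[OF QL[OF k(1)] wL])
    also have "\<dots> = ip lborel (level_proj k w) (level_proj k (A v))" by (rule level_proj_props(2)[OF k(2) w q, symmetric])
    also have "\<dots> = ip lborel (level_proj k (A v)) (level_proj k w)" by (rule L2.sym[OF level_proj_L2[OF k(2) w] QL[OF k(1)]])
    finally show "ip lborel (\<lambda>x. b k * level_proj k (A v) x) w = b k * ip lborel (level_proj k (A v)) (level_proj k w)"
      using L2.B_scale[OF QL[OF k(1)] wL] by simp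
  qed
  finally show ?thesis .
qed

text \<open>The two sides are a (F v) w and a (F w) v, so this is self-adjointness of F for the form
  a.\<close>

lemma ip_preconditioned_sym:
  assumes v: "v \<in> V J" and w: "w \<in> V J"
  shows "ip lborel (F v) (A w) = ip lborel (F w) (A v)"
proof -
  have 1: "ip lborel (A v) (A w) = ip lborel (A w) (A v)"
    by (rule L2.sym[OF L2[OF order_refl A_mem[OF v]] L2[OF order_refl A_mem[OF w]]])
  have 2: "ip lborel (level_proj k (A v)) (level_proj k (A w)) = ip lborel (level_proj k (A w)) (level_proj k (A v))" if "k \<in> {..<J}" for k
    using that by (intro L2.sym level_proj_L2 A_mem v w) auto
  have "(\<Sum>k<J. b k * ip lborel (level_proj k (A v)) (level_proj k (A w))) = (\<Sum>k<J. b k * ip lborel (level_proj k (A w)) (level_proj k (A v)))"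
    by (intro sum.cong refl arg_cong2[of _ _ _ _ "(*)"] 2)
  then show ?thesis unfolding ip_preconditioned[OF v A_mem[OF w]] ip_preconditioned[OF w A_mem[OF v]] 1 by simp
qed

lemma eigenvector_ip:
  assumes v: "v \<in> V J" and w: "w \<in> V J" and F: "F v = (\<lambda>x. \<mu> * v x)"
  shows "ip lborel (F v) (A w) = \<mu> * a v w"
proof -
  have vL: "v \<in> L2 lborel" by (rule L2[OF order_refl v])
  have AL: "A w \<in> L2 lborel" by (rule L2[OF order_refl A_mem[OF w]])
  have "ip lborel (F v) (A w) = \<mu> * ip lborel v (A w)" unfolding F by (rule L2.B_scale[OF vL AL])
  also have "ip lborel v (A w) = ip lborel (A w) v" by (rule L2.sym[OF vL AL])
  also have "\<dots> = a v w" unfolding A_ip[OF w v] by (rule a.sym[OF w v])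
  finally show ?thesis .
qed

text \<open>Eigenvectors of distinct eigenvalues are orthogonal for a, and the space is
  finite-dimensional.\<close>

lemma finite_eigenvalues: "finite (eigenvalues_on (V J) F)"
proof -
  define f where "f = (\<lambda>\<mu>. SOME v. v \<in> V J \<and> v \<noteq> (\<lambda>x. 0) \<and> F v = (\<lambda>x. \<mu> * v x))"
  have f: "f \<mu> \<in> V J \<and> f \<mu> \<noteq> (\<lambda>x. 0) \<and> F (f \<mu>) = (\<lambda>x. \<mu> * f \<mu> x)" if "\<mu> \<in> eigenvalues_on (V J) F" for \<mu>
  proof -
    have "\<exists>v. v \<in> V J \<and> v \<noteq> (\<lambda>x. 0) \<and> F v = (\<lambda>x. \<mu> * v x)"
      using that by (simp add: eigenvalues_on_def Bex_def)
    from someI_ex[OF this] show ?thesis unfolding f_def .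
  qed
  show ?thesis
  proof (rule a.finite_orthogonal_family)
    show "f \<mu> \<in> V J" if "\<mu> \<in> eigenvalues_on (V J) F" for \<mu> using f[OF that] by (rule conjunct1)
    show "f \<mu> \<noteq> (\<lambda>x. 0)" if "\<mu> \<in> eigenvalues_on (V J) F" for \<mu> using f[OF that] by (elim conjE)
    fix \<mu> \<nu> assume \<mu>: "\<mu> \<in> eigenvalues_on (V J) F" and \<nu>: "\<nu> \<in> eigenvalues_on (V J) F" and ne: "\<mu> \<noteq> \<nu>"
    note fm = f[OF \<mu>, THEN conjunct1] f[OF \<mu>, THEN conjunct2, THEN conjunct2]
    note fn = f[OF \<nu>, THEN conjunct1] f[OF \<nu>, THEN conjunct2, THEN conjunct2]
    have "\<mu> * a (f \<mu>) (f \<nu>) = \<nu> * a (f \<nu>) (f \<mu>)"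
      using eigenvector_ip[OF fm(1) fn(1) fm(2)] eigenvector_ip[OF fn(1) fm(1) fn(2)]
        ip_preconditioned_sym[OF fm(1) fn(1)] by linarith
    then have "\<mu> * a (f \<mu>) (f \<nu>) = \<nu> * a (f \<mu>) (f \<nu>)" using a.sym[OF fm(1) fn(1)] by simp
    then show "a (f \<mu>) (f \<nu>) = 0" using ne by simp
  qed
qed

text \<open>With w = A v and \<alpha> = a v v, the number \<mu> \<alpha> is the quadratic form of
  the preconditioner at w. The bounds on the weights place it between m \<beta> and M \<beta>, where
  \<beta> is the level sum of w, and it remains to compare \<alpha> with \<beta>.\<close>

lemma eigenvalue_bounds:
  assumes y: "0 < y" and L: "0 < L"
    and b: "\<And>k. k \<le> J \<Longrightarrow> m * (y ^ k * (if k = J then 1 else 1 - y)) \<le> b k"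
      "\<And>k. k \<le> J \<Longrightarrow> b k \<le> M * (y ^ k * (if k = J then 1 else 1 - y))" and m: "0 \<le> m" and M: "0 \<le> M"
    and lower: "\<And>v. v \<in> V J \<Longrightarrow> (\<Sum>j\<le>J. (1 / y) ^ j * (l2_norm (level_part j v))\<^sup>2) \<le> L * a v v"
    and upper: "\<And>w. w \<in> V J \<Longrightarrow> a (\<lambda>x. \<Sum>j\<le>J. y ^ j * level_part j w x) (\<lambda>x. \<Sum>j\<le>J. y ^ j * level_part j w x)
      \<le> U * (\<Sum>j\<le>J. y ^ j * (l2_norm (level_part j w))\<^sup>2)"
    and \<mu>: "\<mu> \<in> eigenvalues_on (V J) F"
  shows "m / L \<le> \<mu> \<and> \<mu> \<le> M * U"
proof -
  obtain v where v: "v \<in> V J" and v0: "v \<noteq> (\<lambda>x. 0)" and Fv: "F v = (\<lambda>x. \<mu> * v x)"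
    using \<mu> by (auto simp: eigenvalues_on_def)
  define \<alpha> where "\<alpha> = a v v"
  define w where "w = A v"
  define \<beta> where "\<beta> = (\<Sum>j\<le>J. y ^ j * (l2_norm (level_part j w))\<^sup>2)"
  have w: "w \<in> V J" unfolding w_def by (rule A_mem[OF v])
  have wL: "w \<in> L2 lborel" by (rule L2[OF order_refl w])
  have vL: "v \<in> L2 lborel" by (rule L2[OF order_refl v])
  have \<alpha>: "0 < \<alpha>" using a.nonneg[OF v] a.posdef[OF v] v0 unfolding \<alpha>_def by fastforce
  have \<beta>eq: "\<beta> = y ^ J * (l2_norm w)\<^sup>2 + (1 - y) * (\<Sum>k<J. y ^ k * (l2_norm (level_proj k w))\<^sup>2)"
    unfolding \<beta>_def by (rule weighted_level_sum[OF w])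
  have \<beta>0: "0 \<le> \<beta>" unfolding \<beta>_def using y by (intro sum_nonneg) simp
  have \<mu>\<alpha>: "\<mu> * \<alpha> = b J * (l2_norm w)\<^sup>2 + (\<Sum>k<J. b k * (l2_norm (level_proj k w))\<^sup>2)"
    using ip_preconditioned[OF v w] eigenvector_ip[OF v v Fv] level_proj_L2 w
    by (simp add: w_def[symmetric] \<alpha>_def L2.nm_sq wL)
  have mb: "m * \<beta> \<le> \<mu> * \<alpha>"
  proof -
    have "m * (y ^ J * (l2_norm w)\<^sup>2) \<le> b J * (l2_norm w)\<^sup>2"
      using mult_right_mono[OF b(1)[of J], of "(l2_norm w)\<^sup>2"] by (simp add: mult_ac)
    moreover have "m * ((1 - y) * (\<Sum>k<J. y ^ k * (l2_norm (level_proj k w))\<^sup>2)) \<le> (\<Sum>k<J. b k * (l2_norm (level_proj k w))\<^sup>2)"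
      unfolding sum_distrib_left
    proof (rule sum_mono)
      fix k assume "k \<in> {..<J}"
      then show "m * ((1 - y) * (y ^ k * (l2_norm (level_proj k w))\<^sup>2)) \<le> b k * (l2_norm (level_proj k w))\<^sup>2"
        using mult_right_mono[OF b(1)[of k], of "(l2_norm (level_proj k w))\<^sup>2"] by (simp add: mult_ac)
    qed
    ultimately show ?thesis unfolding \<mu>\<alpha> \<beta>eq by (simp add: distrib_left)
  qed
  have Mb: "\<mu> * \<alpha> \<le> M * \<beta>"
  proof -
    have "b J * (l2_norm w)\<^sup>2 \<le> M * (y ^ J * (l2_norm w)\<^sup>2)"
      using mult_right_mono[OF b(2)[of J], of "(l2_norm w)\<^sup>2"] by (simp add: mult_ac)
    moreover have "(\<Sum>k<J. b k * (l2_norm (level_proj k w))\<^sup>2) \<le> M * ((1 - y) * (\<Sum>k<J. y ^ k * (l2_norm (level_proj k w))\<^sup>2))"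
      unfolding sum_distrib_left
    proof (rule sum_mono)
      fix k assume "k \<in> {..<J}"
      then show "b k * (l2_norm (level_proj k w))\<^sup>2 \<le> M * ((1 - y) * (y ^ k * (l2_norm (level_proj k w))\<^sup>2))"
        using mult_right_mono[OF b(2)[of k], of "(l2_norm (level_proj k w))\<^sup>2"] by (simp add: mult_ac)
    qed
    ultimately show ?thesis unfolding \<mu>\<alpha> \<beta>eq by (simp add: distrib_left)
  qed
  have ipwv: "ip lborel v w = \<alpha>"
    using A_ip[OF v v] L2.sym[OF vL wL] by (simp add: \<alpha>_def w_def)
  \<comment> \<open>\<alpha> is the inner product of v and w; duality bounds its square by the level
    sum of v, at most L \<alpha>, times \<beta>.\<close>
  have lo: "\<alpha> \<le> L * \<beta>"
  proof -
    have "\<alpha>\<^sup>2 \<le> (\<Sum>j\<le>J. (1 / y) ^ j * (l2_norm (level_part j v))\<^sup>2) * (\<Sum>j\<le>J. (1 / (1 / y)) ^ j * (l2_norm (level_part j w))\<^sup>2)"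
      using ip_dual_le[OF v w, of "1 / y"] y unfolding ipwv by simp
    also have "\<dots> = (\<Sum>j\<le>J. (1 / y) ^ j * (l2_norm (level_part j v))\<^sup>2) * \<beta>" by (simp add: \<beta>_def)
    also have "\<dots> \<le> (L * \<alpha>) * \<beta>" using lower[OF v] \<beta>0 by (intro mult_right_mono) (simp add: \<alpha>_def)
    finally have "\<alpha> * \<alpha> \<le> \<alpha> * (L * \<beta>)" by (simp add: power2_eq_square mult_ac)
    then show ?thesis using \<alpha> by simp
  qed
  \<comment> \<open>The test function X satisfies a v X = \<beta> by orthogonality of the level
    parts, and \<open>upper\<close> gives a X X \<le> U \<beta>; Cauchy-Schwarz for a then allows
    \<beta> to be cancelled.\<close>
  have up: "\<beta> \<le> U * \<alpha>"
  proof -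
    define X where "X = (\<lambda>x. \<Sum>j\<le>J. y ^ j * level_part j w x)"
    have R: "level_part j w \<in> V J" if "j \<in> {..J}" for j using mem_top[OF _ level_part_mem[OF _ w]] that by simp
    have RL: "level_part j w \<in> L2 lborel" if "j \<in> {..J}" for j by (rule L2[OF order_refl R[OF that]])
    have X: "X \<in> V J" unfolding X_def by (intro a.sum_mem a.scale_mem R) auto
    have "a v X = ip lborel w X" unfolding w_def by (rule A_ip[OF v X, symmetric])
    also have "\<dots> = (\<Sum>j\<le>J. ip lborel w (\<lambda>x. y ^ j * level_part j w x))"
      unfolding X_def by (intro L2.B_sum_right L2.scale_mem RL wL) auto
    also have "\<dots> = \<beta>" unfolding \<beta>_def
    proof (intro sum.cong refl)
      fix j assume j: "j \<in> {..J}"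
      then show "ip lborel w (\<lambda>x. y ^ j * level_part j w x) = y ^ j * (l2_norm (level_part j w))\<^sup>2"
        using L2.B_scale_right[OF RL[OF j] wL] ip_level_part[OF _ w w, of j] by (simp add: L2.nm_sq RL[OF j])
    qed
    finally have "\<beta>\<^sup>2 \<le> \<alpha> * a X X" using a.Cauchy_Schwarz_sq[OF v X] by (simp add: \<alpha>_def)
    also have "\<dots> \<le> \<alpha> * (U * \<beta>)" using upper[OF w] \<alpha> by (intro mult_left_mono) (auto simp: X_def \<beta>_def)
    finally have "\<beta> * \<beta> \<le> \<beta> * (U * \<alpha>)" by (simp add: power2_eq_square mult_ac)
    moreover have "0 < \<beta>" using lo \<alpha> L \<beta>0 by (cases "\<beta> = 0") auto
    ultimately show ?thesis by simp
  qed
  have "m * \<alpha> \<le> m * (L * \<beta>)" using lo m by (rule mult_left_mono)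
  also have "\<dots> \<le> L * (\<mu> * \<alpha>)" using mult_left_mono[OF mb, of L] L by (simp add: mult_ac)
  finally have "m \<le> L * \<mu>" using \<alpha> by simp
  moreover have "\<mu> * \<alpha> \<le> (M * U) * \<alpha>" using Mb mult_left_mono[OF up M] by (simp add: mult_ac)
  ultimately show ?thesis using \<alpha> L by (simp add: divide_le_eq mult.commute)
qed

end

section \<open>The fractional form on the grid hierarchy\<close>

lemma fin_ip_frac_form:
  fixes \<Omega> :: "'a::euclidean_space set" and s :: real
  assumes mesh: "fe_mesh \<Omega> \<T>" and s: "0 < s" "s < 1"
    and gag_finite: "\<And>v. v \<in> fe_space \<Omega> \<T> \<Longrightarrow> gagliardo s v < \<infinity>"
    and gag_pos: "\<And>v. v \<in> fe_space \<Omega> \<T> \<Longrightarrow> gagliardo s v = 0 \<Longrightarrow> v = (\<lambda>x. 0)"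
  shows "fin_ip (fe_space \<Omega> \<T>) (frac_form s)"
proof -
  interpret fe_mesh \<Omega> \<T> by (rule mesh)
  define \<theta> where "\<theta> = frac_const DIM('a) s / 2"
  have \<theta>: "0 < \<theta>" unfolding \<theta>_def frac_const_def using s
    by (intro divide_pos_pos mult_pos_pos Gamma_real_pos) auto
  have ff: "frac_form s u v = \<theta> * ip (lborel \<Otimes>\<^sub>M lborel) (frac_diff s u) (frac_diff s v)" for u v :: "'a \<Rightarrow> real"
    unfolding \<theta>_def by (rule frac_form_eq_ip)
  have L: "frac_diff s u \<in> L2 (lborel \<Otimes>\<^sub>M lborel)" if "u \<in> V" for u
    by (rule frac_diff_L2[OF fe_borel[OF that] gag_finite[OF that]])
  show ?thesis
  proof
    show "(\<lambda>x. 0) \<in> V" by (rule fe_zero)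
    show "(\<lambda>x. u x + r * v x) \<in> V" if "u \<in> V" "v \<in> V" for u v r by (rule fe_lin[OF that])
    show "frac_form s u v = frac_form s v u" if "u \<in> V" "v \<in> V" for u v
      unfolding ff L2.sym[OF L[OF that(1)] L[OF that(2)]] ..
    show "frac_form s (\<lambda>x. u x + r * v x) w = frac_form s u w + r * frac_form s v w"
      if "u \<in> V" "v \<in> V" "w \<in> V" for u v w r
    proof -
      have "frac_diff s (\<lambda>x. u x + r * v x) = (\<lambda>p. frac_diff s u p + r * frac_diff s v p)"
        by (intro ext) (simp add: frac_diff_def split_beta algebra_simps)
      then show ?thesis unfolding ff using L2.lin[OF L[OF that(1)] L[OF that(2)] L[OF that(3)], of r]
        by (simp add: algebra_simps)
    qed
    show "0 \<le> frac_form s u u" if "u \<in> V" for u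
      unfolding ff using L2.nonneg[OF L[OF that]] \<theta> by simp
    show "u = (\<lambda>x. 0)" if u: "u \<in> V" "frac_form s u u = 0" for u
    proof (rule gag_pos[OF u(1)])
      define w where "w = enn2real (gagliardo s u)"
      have w: "gagliardo s u = ennreal w" "0 \<le> w" using gag_finite[OF u(1)] by (auto simp: w_def)
      have "\<theta> * w = 0" using frac_form_self[OF fe_borel[OF u(1)] w] u(2) by (simp add: \<theta>_def)
      then show "gagliardo s u = 0" using \<theta> w by simp
    qed
    show "\<exists>P. finite P \<and> (\<forall>v\<in>V. (\<forall>p\<in>P. v p = 0) \<longrightarrow> v = (\<lambda>x. 0))" by (rule fe_separating)
  qed
qed

lemma frac_operator_props:
  assumes mesh: "fe_mesh \<Omega> \<T>" and form: "fin_ip (fe_space \<Omega> \<T>) (frac_form s)" and v: "v \<in> fe_space \<Omega> \<T>"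
  shows "frac_operator s \<Omega> (fe_space \<Omega> \<T>) v \<in> fe_space \<Omega> \<T>"
    "\<And>w. w \<in> fe_space \<Omega> \<T> \<Longrightarrow> ip lborel (frac_operator s \<Omega> (fe_space \<Omega> \<T>) v) w = frac_form s v w"
proof -
  interpret fe_mesh \<Omega> \<T> by (rule mesh)
  interpret I: fin_ip V "ip lborel" by (rule fin_ip_fe)
  interpret a: fin_ip V "frac_form s" by (rule form)
  have "\<exists>!z. z \<in> V \<and> (\<forall>w\<in>V. ip lborel z w = frac_form s v w)"
  proof (rule I.riesz)
    fix u w r assume uw: "u \<in> V" "w \<in> V"
    show "frac_form s v (\<lambda>x. u x + r * w x) = frac_form s v u + r * frac_form s v w"
      using a.B_add_right[OF uw(1) a.scale_mem[OF uw(2)] v] a.B_scale_right[OF uw(2) v] by simp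
  qed
  from theI'[OF this]
  have 1: "(THE z. z \<in> V \<and> (\<forall>w\<in>V. ip lborel z w = frac_form s v w)) \<in> V \<and>
    (\<forall>w\<in>V. ip lborel (THE z. z \<in> V \<and> (\<forall>w\<in>V. ip lborel z w = frac_form s v w)) w = frac_form s v w)" .
  have "frac_operator s \<Omega> V v = (THE z. z \<in> V \<and> (\<forall>w\<in>V. ip lborel z w = frac_form s v w))"
    unfolding frac_operator_def
    by (intro arg_cong[where f = The] ext conj_cong refl ball_cong) (simp_all only: l2_inner_eq_ip)
  with 1 show "frac_operator s \<Omega> V v \<in> V" "\<And>w. w \<in> V \<Longrightarrow> ip lborel (frac_operator s \<Omega> V v) w = frac_form s v w"
    by simp_all
qed

text \<open>Mesh sizes are replaced by \<gamma> ^ k at the cost of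
  \<open>c powr (2 * s) \<le> c\<^sup>2\<close>. The factor formed with \<gamma>' is replaced by 1 -
  \<gamma> powr (2 s): both are comparable to s, so their ratio is bounded independently of
  s.\<close>

lemma preconditioner_weight_bounds:
  fixes \<gamma> \<gamma>' c s h :: real
  assumes \<gamma>: "0 < \<gamma>" "\<gamma> < 1" and \<gamma>': "0 < \<gamma>'" "\<gamma>' < 1" and s: "0 < s" "s < 1" and c: "1 \<le> c"
    and h: "0 < h" "h \<le> c * \<gamma> ^ k" "\<gamma> ^ k \<le> c * h"
  shows "1 / c\<^sup>2 * (\<gamma> powr (2 * s)) ^ k \<le> h powr (2 * s)" "h powr (2 * s) \<le> c\<^sup>2 * (\<gamma> powr (2 * s)) ^ k"
    "(1 - \<gamma>') / (- 2 * ln \<gamma>) * (1 - \<gamma> powr (2 * s)) \<le> 1 - \<gamma>' powr s"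
    "1 - \<gamma>' powr s \<le> - ln \<gamma>' / (1 - \<gamma>\<^sup>2) * (1 - \<gamma> powr (2 * s))"
proof -
  have y: "(\<gamma> powr (2 * s)) ^ k = (\<gamma> ^ k) powr (2 * s)"
    using \<gamma> by (simp add: powr_powr powr_realpow[symmetric] mult_ac)
  have c2: "c powr (2 * s) \<le> c\<^sup>2" using powr_mono[of "2 * s" 2 c] c s by (simp add: powr_numeral)
  have c0: "0 < c" using c by simp
  have "h powr (2 * s) \<le> (c * \<gamma> ^ k) powr (2 * s)" using h s by (intro powr_mono2) auto
  also have "\<dots> = c powr (2 * s) * (\<gamma> ^ k) powr (2 * s)" using c0 \<gamma> by (simp add: powr_mult)
  also have "\<dots> \<le> c\<^sup>2 * (\<gamma> ^ k) powr (2 * s)" using c2 by (rule mult_right_mono) simp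
  finally show "h powr (2 * s) \<le> c\<^sup>2 * (\<gamma> powr (2 * s)) ^ k" unfolding y .
  have "(\<gamma> ^ k) powr (2 * s) \<le> (c * h) powr (2 * s)" using h s \<gamma> by (intro powr_mono2) auto
  also have "\<dots> = c powr (2 * s) * h powr (2 * s)" using c0 h by (simp add: powr_mult)
  also have "\<dots> \<le> c\<^sup>2 * h powr (2 * s)" using c2 by (rule mult_right_mono) simp
  finally show "1 / c\<^sup>2 * (\<gamma> powr (2 * s)) ^ k \<le> h powr (2 * s)" unfolding y using c0 by (simp add: divide_le_eq mult.commute)
  have ln: "ln \<gamma> < 0" "ln \<gamma>' < 0" using \<gamma> \<gamma>' by auto
  have g2: "\<gamma>\<^sup>2 < 1" "0 < \<gamma>\<^sup>2" using \<gamma> by (auto simp: power_less_one_iff)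
  have "\<gamma> powr (2 * s) = (\<gamma>\<^sup>2) powr s"
    using \<gamma> by (simp add: powr_powr[symmetric] powr_numeral)
  then have ylo: "s * (1 - \<gamma>\<^sup>2) \<le> 1 - \<gamma> powr (2 * s)" using one_minus_powr_ge[of "\<gamma>\<^sup>2" s] g2 s by simp
  have yup: "1 - \<gamma> powr (2 * s) \<le> - ln \<gamma> * (2 * s)" by (rule one_minus_powr_le[OF \<gamma>(1)])
  have n: "0 \<le> (1 - \<gamma>') / (- 2 * ln \<gamma>)" "0 \<le> - ln \<gamma>' / (1 - \<gamma>\<^sup>2)"
    by (rule divide_nonneg_nonneg; use ln g2 \<gamma>' in linarith)+
  have "(1 - \<gamma>') / (- 2 * ln \<gamma>) * (1 - \<gamma> powr (2 * s)) \<le> (1 - \<gamma>') / (- 2 * ln \<gamma>) * (- ln \<gamma> * (2 * s))"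
    by (rule mult_left_mono[OF yup n(1)])
  also have "\<dots> = s * (1 - \<gamma>')" using ln by (simp add: field_simps)
  also have "\<dots> \<le> 1 - \<gamma>' powr s" using one_minus_powr_ge[of \<gamma>' s] \<gamma>' s by simp
  finally show "(1 - \<gamma>') / (- 2 * ln \<gamma>) * (1 - \<gamma> powr (2 * s)) \<le> 1 - \<gamma>' powr s" .
  have "1 - \<gamma>' powr s \<le> - ln \<gamma>' * s" by (rule one_minus_powr_le[OF \<gamma>'(1)])
  also have "\<dots> = - ln \<gamma>' / (1 - \<gamma>\<^sup>2) * (s * (1 - \<gamma>\<^sup>2))" using g2 by simp
  also have "\<dots> \<le> - ln \<gamma>' / (1 - \<gamma>\<^sup>2) * (1 - \<gamma> powr (2 * s))"
    by (rule mult_left_mono[OF ylo n(2)])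
  finally show "1 - \<gamma>' powr s \<le> - ln \<gamma>' / (1 - \<gamma>\<^sup>2) * (1 - \<gamma> powr (2 * s))" .
qed

theorem theorem4p1:
  fixes \<Omega> :: "'a::euclidean_space set" and \<kappa> q c \<gamma> \<gamma>' :: real
  assumes "bounded_lipschitz_domain \<Omega>"
    and "0 < \<gamma>" "\<gamma> < 1" "0 < \<gamma>'" "\<gamma>' < 1"
  shows "\<exists>C. \<forall>(J::nat) (s::real) (\<T>::nat \<Rightarrow> 'a set set).
           0 < s \<and> s < 1 \<and> grid_hierarchy \<Omega> \<kappa> q c \<gamma> J \<T> \<longrightarrow>
           (let V = fe_space \<Omega> (\<T> J);
                BA = bpx_preconditioner s \<gamma>' \<Omega> J \<T> \<circ> frac_operator s \<Omega> V
            in (\<forall>\<mu>\<in>eigenvalues_on V BA. 0 < \<mu>) \<and> cond_on V BA \<le> C)"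
proof -
  note \<Omega> = assms(1) and \<gamma> = assms(2,3) and \<gamma>' = assms(4,5)
  obtain CL0 where CL0: "0 \<le> CL0" and lower0: "\<forall>J (s::real) \<T> v w E. 0 < s \<and> s < 1 \<and> grid_hierarchy \<Omega> \<kappa> q c \<gamma> J \<T> \<and> v \<in> fe_space \<Omega> (\<T> J) \<and>
    gagliardo s v = ennreal w \<and> 0 \<le> w \<and> (\<forall>k<J. 0 \<le> E k \<and> (\<forall>w'\<in>fe_space \<Omega> (\<T> k). E k \<le> (l2_norm (\<lambda>x. v x - w' x))\<^sup>2)) \<longrightarrow>
    (l2_norm v)\<^sup>2 + (\<gamma> powr (- 2 * s) - 1) * (\<Sum>k<J. (\<gamma> ^ k) powr (- 2 * s) * E k) \<le> CL0 * (s * (1 - s)) * w"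
    using level_sum_le_gagliardo[OF \<Omega> \<gamma>, of \<kappa> q c] by (elim exE conjE)
  obtain CU0 where CU0: "0 \<le> CU0" and upper0: "\<forall>J (s::real) \<T> u. 0 < s \<and> s < 1 \<and> grid_hierarchy \<Omega> \<kappa> q c \<gamma> J \<T> \<and> (\<forall>j\<le>J. u j \<in> fe_space \<Omega> (\<T> j)) \<and>
    (\<forall>i\<le>J. \<forall>j\<le>J. i \<noteq> j \<longrightarrow> ip lborel (u i) (u j) = 0) \<longrightarrow>
    gagliardo s (\<lambda>x. \<Sum>j\<le>J. u j x) \<le> ennreal (CU0 / (s * (1 - s)) * (\<Sum>j\<le>J. (\<gamma> ^ j) powr (- 2 * s) * (l2_norm (u j))\<^sup>2))"
    using gagliardo_le_level_sum[OF \<Omega> \<gamma>, of \<kappa> q c] by (elim exE conjE)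
  define \<Lambda>1 where "\<Lambda>1 = min 1 ((1 - \<gamma>') / (- 2 * ln \<gamma>))"
  define \<Lambda>2 where "\<Lambda>2 = max 1 (- ln \<gamma>' / (1 - \<gamma>\<^sup>2))"
  \<comment> \<open>The ratio of the two eigenvalue bounds, in which s (1 - s) and
    \<open>frac_const\<close> have cancelled; the second entry covers a trivial space.\<close>
  define C where "C = max ((\<Lambda>2 * c\<^sup>2) * (CU0 + 1) * (CL0 + 1) / (\<Lambda>1 / c\<^sup>2)) (Max {} / Min {} :: real)"
  have \<Lambda>: "0 < \<Lambda>1" "0 < \<Lambda>2" using \<gamma> \<gamma>' by (auto simp: \<Lambda>1_def \<Lambda>2_def divide_pos_neg)
  have main: "(\<forall>\<mu>\<in>eigenvalues_on (fe_space \<Omega> (\<T> J)) (bpx_preconditioner s \<gamma>' \<Omega> J \<T> \<circ> frac_operator s \<Omega> (fe_space \<Omega> (\<T> J))). 0 < \<mu>) \<and>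
      cond_on (fe_space \<Omega> (\<T> J)) (bpx_preconditioner s \<gamma>' \<Omega> J \<T> \<circ> frac_operator s \<Omega> (fe_space \<Omega> (\<T> J))) \<le> C"
    if s: "0 < s" "s < 1" and H: "grid_hierarchy \<Omega> \<kappa> q c \<gamma> J \<T>" for J :: nat and s :: real and \<T> :: "nat \<Rightarrow> 'a set set"
  proof -
    let ?V = "\<lambda>k. fe_space \<Omega> (\<T> k)"
    let ?A = "frac_operator s \<Omega> (?V J)"
    let ?F = "bpx_preconditioner s \<gamma>' \<Omega> J \<T> \<circ> ?A"
    define y where "y = \<gamma> powr (2 * s)"
    define \<theta> where "\<theta> = frac_const DIM('a) s / 2"
    define b where "b = (\<lambda>k. (if k = J then 1 else 1 - \<gamma>' powr s) * mesh_size (\<T> k) powr (2 * s))"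
    have y: "0 < y" "y < 1" using \<gamma> s powr_less_mono2[of "2 * s" \<gamma> 1] by (simp_all add: y_def)
    have x1: "\<gamma> powr (- 2 * s) = 1 / y" by (simp add: y_def powr_minus_divide)
    have xk: "(\<gamma> ^ k) powr (- 2 * s) = (1 / y) ^ k" for k
    proof -
      have "(\<gamma> ^ k) powr (- 2 * s) = (\<gamma> powr (- 2 * s)) ^ k"
        using \<gamma> by (simp add: powr_powr powr_realpow[symmetric] mult_ac)
      then show ?thesis unfolding x1 .
    qed
    have \<theta>: "0 < \<theta>" unfolding \<theta>_def frac_const_def using s
      by (intro divide_pos_pos mult_pos_pos Gamma_real_pos) auto
    have ss: "0 < s * (1 - s)" using s by simp
    have c1: "1 \<le> c" using grid_level(2)[OF \<Omega> \<gamma>(1) H order_refl] .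
    have mesh: "fe_mesh \<Omega> (\<T> k)" if "k \<le> J" for k
      using grid_level(1)[OF \<Omega> \<gamma>(1) H that] by (rule fe_level.axioms)
    interpret nested_spaces ?V J
    proof (rule nested_spaces.intro)
      show "fin_ip (?V k) (ip lborel)" if "k \<le> J" for k by (rule fe_mesh.fin_ip_fe[OF mesh[OF that]])
      show "v \<in> L2 lborel" if "k \<le> J" "v \<in> ?V k" for k v by (rule fe_mesh.fe_L2[OF mesh[OF that(1)] that(2)])
      show "?V j \<subseteq> ?V k" if "j \<le> k" "k \<le> J" for j k by (rule grid_nested[OF H that])
    qed
    \<comment> \<open>The multilevel upper bound also proves finiteness of the energy: take v as the
      only nonzero member of the family.\<close>
    have gag_finite: "gagliardo s v < \<infinity>" if v: "v \<in> ?V J" for v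
    proof -
      define u where "u = (\<lambda>j. if j = J then v else (\<lambda>x. 0))"
      have "gagliardo s (\<lambda>x. \<Sum>j\<le>J. u j x) \<le> ennreal (CU0 / (s * (1 - s)) * (\<Sum>j\<le>J. (\<gamma> ^ j) powr (- 2 * s) * (l2_norm (u j))\<^sup>2))"
      proof (rule upper0[rule_format], intro conjI allI impI)
        show "u j \<in> ?V j" if "j \<le> J" for j using v fe_mesh.fe_zero[OF mesh[OF that]] by (simp add: u_def)
        show "ip lborel (u i) (u j) = 0" if "i \<noteq> j" for i j using that by (auto simp: u_def ip_def)
      qed (fact s H)+
      moreover have "(\<lambda>x. \<Sum>j\<le>J. u j x) = v"
      proof
        fix x
        have "(\<Sum>j\<le>J. u j x) = (\<Sum>j\<le>J. if j = J then v x else 0)" by (intro sum.cong) (auto simp: u_def)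
        then show "(\<Sum>j\<le>J. u j x) = v x" by simp
      qed
      ultimately show ?thesis by (simp add: le_less_trans)
    qed
    have lower: "(\<Sum>j\<le>J. (1 / y) ^ j * (l2_norm (level_part j v))\<^sup>2) \<le> (CL0 + 1) * (s * (1 - s)) * w"
      if v: "v \<in> ?V J" and w: "gagliardo s v = ennreal w" "0 \<le> w" for v w
    proof -
      have "(l2_norm v)\<^sup>2 + (\<gamma> powr (- 2 * s) - 1) * (\<Sum>k<J. (\<gamma> ^ k) powr (- 2 * s) * (l2_norm (\<lambda>x. v x - level_proj k v x))\<^sup>2) \<le> CL0 * (s * (1 - s)) * w"
      proof (rule lower0[rule_format], intro conjI allI impI ballI)
        show "(l2_norm (\<lambda>x. v x - level_proj k v x))\<^sup>2 \<le> (l2_norm (\<lambda>x. v x - w' x))\<^sup>2" if "k < J" "w' \<in> ?V k" for k w'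
          using l2_norm_minus_level_proj(2)[OF _ v that(2)] that(1) by simp
      qed (fact s H v w | simp)+
      also have "\<dots> \<le> (CL0 + 1) * (s * (1 - s)) * w" using ss w by (intro mult_right_mono) auto
      finally show ?thesis unfolding weighted_level_sum_error[OF v] xk x1 .
    qed
    \<comment> \<open>Definiteness of the form, from the lower bound with w = 0.\<close>
    have gag_pos: "v = (\<lambda>x. 0)" if v: "v \<in> ?V J" and g: "gagliardo s v = 0" for v
    proof -
      have "(l2_norm v)\<^sup>2 + (1 / y - 1) * (\<Sum>k<J. (1 / y) ^ k * (l2_norm (\<lambda>x. v x - level_proj k v x))\<^sup>2) \<le> 0"
        using lower[OF v, of 0] g unfolding weighted_level_sum_error[OF v] by simp
      moreover have "0 \<le> (1 / y - 1) * (\<Sum>k<J. (1 / y) ^ k * (l2_norm (\<lambda>x. v x - level_proj k v x))\<^sup>2)"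
        using y by (intro mult_nonneg_nonneg sum_nonneg) auto
      ultimately have "(l2_norm v)\<^sup>2 = 0" using zero_le_power2[of "l2_norm v"] by linarith
      then show ?thesis
        using fe_mesh.fe_ip_zero[OF mesh[OF order_refl] v] L2.nm_sq[OF L2[OF order_refl v]] by simp
    qed
    have form: "fin_ip (?V J) (frac_form s)"
      by (rule fin_ip_frac_form[OF mesh[OF order_refl] s gag_finite gag_pos])
    note A = frac_operator_props[OF mesh[OF order_refl] form]
    have proj: "l2_projection \<Omega> (?V k) v = level_proj k v" if "k \<le> J" and v: "v \<in> ?V J" for k v
      unfolding l2_projection_def level_proj_def
      by (intro arg_cong[where f = The] ext conj_cong refl ball_cong)
        (simp_all only: fe_mesh.l2_inner_eq_ip[OF mesh[OF that(1)]] fe_mesh.l2_inner_eq_ip[OF mesh[OF order_refl] v])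
    interpret preconditioned_form ?V J "frac_form s" b ?A ?F
    proof (rule preconditioned_form.intro[OF nested_spaces_axioms], rule preconditioned_form_axioms.intro)
      show "fin_ip (?V J) (frac_form s)" by (rule form)
      show "?A v \<in> ?V J" if "v \<in> ?V J" for v by (rule A(1)[OF that])
      show "ip lborel (?A v) w = frac_form s v w" if "v \<in> ?V J" "w \<in> ?V J" for v w by (rule A(2)[OF that])
      show "?F v = (\<lambda>x. b J * ?A v x + (\<Sum>k<J. b k * level_proj k (?A v) x))" if v: "v \<in> ?V J" for v
      proof
        fix x
        have "(\<Sum>k<J. mesh_size (\<T> k) powr (2 * s) * l2_projection \<Omega> (?V k) (?A v) x)
          = (\<Sum>k<J. mesh_size (\<T> k) powr (2 * s) * level_proj k (?A v) x)"
          using proj[OF less_imp_le A(1)[OF v]] by (intro sum.cong refl) simp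
        moreover have "(\<Sum>k<J. b k * level_proj k (?A v) x) = (1 - \<gamma>' powr s) * (\<Sum>k<J. mesh_size (\<T> k) powr (2 * s) * level_proj k (?A v) x)"
          unfolding sum_distrib_left by (intro sum.cong refl) (simp add: b_def)
        ultimately show "?F v x = b J * ?A v x + (\<Sum>k<J. b k * level_proj k (?A v) x)"
          using proj[OF order_refl A(1)[OF v]] level_proj_top[OF A(1)[OF v]] by (simp add: bpx_preconditioner_def b_def)
      qed
    qed
    \<comment> \<open>L and U are reciprocal up to constants, so U * L is free of \<theta> and s.
      The added 1 makes L positive even if \<open>CL0\<close> is 0.\<close>
    define L where "L = (CL0 + 1) * (s * (1 - s)) / \<theta>"
    define U where "U = \<theta> * ((CU0 + 1) / (s * (1 - s)))"
    have L: "0 < L" using CL0 ss \<theta> by (simp add: L_def)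
    \<comment> \<open>Level J carries the factor 1 in place of 1 - \<gamma>' powr s, which matches
      the top term of the Abel sum.\<close>
    have bb: "\<Lambda>1 / c\<^sup>2 * (y ^ k * (if k = J then 1 else 1 - y)) \<le> b k \<and>
        b k \<le> \<Lambda>2 * c\<^sup>2 * (y ^ k * (if k = J then 1 else 1 - y))" if k: "k \<le> J" for k
    proof -
      define f where "f = (if k = J then 1 else 1 - y)"
      define e where "e = (if k = J then 1 else 1 - \<gamma>' powr s)"
      have hk: "0 < mesh_size (\<T> k)" "mesh_size (\<T> k) \<le> c * \<gamma> ^ k" "\<gamma> ^ k \<le> c * mesh_size (\<T> k)"
        using grid_level(3)[OF \<Omega> \<gamma>(1) H k] H k by (auto simp: grid_hierarchy_def)
      note W = preconditioner_weight_bounds[OF \<gamma> \<gamma>' s c1 hk, folded y_def]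
      have f0: "0 \<le> f" using y by (simp add: f_def)
      have "\<Lambda>1 * (1 - y) \<le> (1 - \<gamma>') / (- 2 * ln \<gamma>) * (1 - y)" using y by (intro mult_right_mono) (auto simp: \<Lambda>1_def)
      then have e1: "\<Lambda>1 * f \<le> e" using W(3) by (auto simp: f_def e_def \<Lambda>1_def)
      have "- ln \<gamma>' / (1 - \<gamma>\<^sup>2) * (1 - y) \<le> \<Lambda>2 * (1 - y)" using y by (intro mult_right_mono) (auto simp: \<Lambda>2_def)
      then have e2: "e \<le> \<Lambda>2 * f" using W(4) by (auto simp: f_def e_def \<Lambda>2_def)
      have "(\<Lambda>1 * f) * (1 / c\<^sup>2 * y ^ k) \<le> e * mesh_size (\<T> k) powr (2 * s)"
        using e1 W(1) f0 \<Lambda> y c1 by (intro mult_mono) (auto intro: order_trans[OF _ e1])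
      moreover have "e * mesh_size (\<T> k) powr (2 * s) \<le> (\<Lambda>2 * f) * (c\<^sup>2 * y ^ k)"
        using e2 W(2) f0 \<Lambda> y by (intro mult_mono) auto
      ultimately show ?thesis unfolding b_def f_def[symmetric] e_def[symmetric] by (simp add: mult_ac)
    qed
    have bounds: "\<Lambda>1 / c\<^sup>2 / L \<le> \<mu> \<and> \<mu> \<le> \<Lambda>2 * c\<^sup>2 * U" if "\<mu> \<in> eigenvalues_on (?V J) ?F" for \<mu>
    proof (rule eigenvalue_bounds[OF y(1) L bb[THEN conjunct1] bb[THEN conjunct2] _ _ _ _ that])
      show "0 \<le> \<Lambda>1 / c\<^sup>2" "0 \<le> \<Lambda>2 * c\<^sup>2" using \<Lambda> by auto
      fix v assume v: "v \<in> ?V J"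
      define w where "w = enn2real (gagliardo s v)"
      have w: "gagliardo s v = ennreal w" "0 \<le> w" using gag_finite[OF v] by (auto simp: w_def)
      show "(\<Sum>j\<le>J. (1 / y) ^ j * (l2_norm (level_part j v))\<^sup>2) \<le> L * frac_form s v v"
        unfolding frac_form_self[OF fe_mesh.fe_borel[OF mesh[OF order_refl] v] w] \<theta>_def[symmetric]
        using lower[OF v w] \<theta> by (simp add: L_def)
      let ?X = "\<lambda>x. \<Sum>j\<le>J. y ^ j * level_part j v x"
      define \<beta> where "\<beta> = (\<Sum>j\<le>J. y ^ j * (l2_norm (level_part j v))\<^sup>2)"
      have \<beta>0: "0 \<le> \<beta>" unfolding \<beta>_def using y by (intro sum_nonneg) simp
      have R: "level_part j v \<in> L2 lborel" if "j \<le> J" for j by (rule level_part_L2[OF that v])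
      have "level_part j v \<in> ?V J" if "j \<in> {..J}" for j using mem_top[OF _ level_part_mem[OF _ v]] that by simp
      then have X: "?X \<in> ?V J" by (intro a.sum_mem a.scale_mem) auto
      define z where "z = enn2real (gagliardo s ?X)"
      have z: "gagliardo s ?X = ennreal z" "0 \<le> z" using gag_finite[OF X] by (auto simp: z_def)
      have "gagliardo s ?X \<le> ennreal (CU0 / (s * (1 - s)) * (\<Sum>j\<le>J. (\<gamma> ^ j) powr (- 2 * s) * (l2_norm (\<lambda>x. y ^ j * level_part j v x))\<^sup>2))"
      proof (rule upper0[rule_format], intro conjI allI impI)
        show "(\<lambda>x. y ^ j * level_part j v x) \<in> ?V j" if j: "j \<le> J" for j
          by (rule semi_ip.scale_mem[OF fin_ip.axioms(1)[OF fin[OF j]] level_part_mem[OF j v]])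
        show "ip lborel (\<lambda>x. y ^ i * level_part i v x) (\<lambda>x. y ^ j * level_part j v x) = 0" if "i \<le> J" "j \<le> J" "i \<noteq> j" for i j
          using level_part_orth[OF that v v] by (simp add: L2.B_scale L2.B_scale_right L2.scale_mem R that)
      qed (fact s H)+
      \<comment> \<open>The coefficient y ^ j enters squared and meets the weight (1 / y) ^ j, which
        leaves one power y ^ j.\<close>
      also have "(\<Sum>j\<le>J. (\<gamma> ^ j) powr (- 2 * s) * (l2_norm (\<lambda>x. y ^ j * level_part j v x))\<^sup>2) = \<beta>"
        unfolding \<beta>_def xk
      proof (intro sum.cong refl)
        fix j assume "j \<in> {..J}"
        then have n: "l2_norm (\<lambda>x. y ^ j * level_part j v x) = y ^ j * l2_norm (level_part j v)" using L2.nm_scale[OF R, of j "y ^ j"] y by simp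
        have "(1 / y) ^ j * y ^ j = 1" using y by (simp add: power_mult_distrib[symmetric])
        moreover have "(1 / y) ^ j * (y ^ j * l2_norm (level_part j v))\<^sup>2 = ((1 / y) ^ j * y ^ j) * (y ^ j * (l2_norm (level_part j v))\<^sup>2)"
          by (simp only: power2_eq_square mult_ac)
        ultimately show "(1 / y) ^ j * (l2_norm (\<lambda>x. y ^ j * level_part j v x))\<^sup>2 = y ^ j * (l2_norm (level_part j v))\<^sup>2"
          unfolding n by (simp only: mult_1_left)
      qed
      finally have "z \<le> CU0 / (s * (1 - s)) * \<beta>" unfolding z using CU0 ss \<beta>0 by (subst (asm) ennreal_le_iff) auto
      also have "\<dots> \<le> (CU0 + 1) / (s * (1 - s)) * \<beta>" using \<beta>0 ss by (intro mult_right_mono divide_right_mono) auto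
      finally have "\<theta> * z \<le> \<theta> * ((CU0 + 1) / (s * (1 - s)) * \<beta>)"
        using \<theta> by (intro mult_left_mono) auto
      then show "frac_form s ?X ?X \<le> U * (\<Sum>j\<le>J. y ^ j * (l2_norm (level_part j v))\<^sup>2)"
        unfolding \<beta>_def[symmetric] frac_form_self[OF fe_mesh.fe_borel[OF mesh[OF order_refl] X] z] \<theta>_def[symmetric] U_def
        by (simp only: mult.assoc)
    qed
    show ?thesis
    proof (rule eigenvalue_bounds_imp_cond_le[OF _ bounds finite_eigenvalues])
      show "0 < \<Lambda>1 / c\<^sup>2 / L" using \<Lambda> c1 L by simp
      have UL: "U * L = (CU0 + 1) * (CL0 + 1)" using \<theta> s by (simp add: U_def L_def)
      have "\<Lambda>2 * c\<^sup>2 * U / (\<Lambda>1 / c\<^sup>2 / L) = \<Lambda>2 * c\<^sup>2 * (U * L) / (\<Lambda>1 / c\<^sup>2)" using L by (simp add: mult.assoc)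
      also have "\<dots> = (\<Lambda>2 * c\<^sup>2) * (CU0 + 1) * (CL0 + 1) / (\<Lambda>1 / c\<^sup>2)" unfolding UL by (simp only: mult.assoc)
      also have "\<dots> \<le> C" unfolding C_def by (rule max.cobounded1)
      finally show "\<Lambda>2 * c\<^sup>2 * U / (\<Lambda>1 / c\<^sup>2 / L) \<le> C" .
      show "Max {} / Min {} \<le> C" by (simp add: C_def)
    qed
  qed
  show ?thesis
    unfolding Let_def by (rule exI[of _ C]) (intro allI impI, elim conjE, rule main)
qed

end
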